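(* Let $b\ge2$ and $l\ge0$ be integers, let $\varkappa=\ln b$ and $Q(t)=e^{-2\varkappa t}$. Let $q\in C^1(\mathbb R_+)$ satisfy $$q(t)=Q(t)(1+o(1)),\quad t\to\infty,$$ and, with some constants $c,C>0$, $cQ(t)\le q(t)\le CQ(t)$ and $|q'(t)|\le CQ(t)$ for all $t\in\mathbb R_+$. Let $\lambda\in\overline{\mathfrak l_l}$, with $\lambda\neq(\pi l)^2$ if $l\ge1$. Then $$\lim_{g\to\infty}\frac{M(\lambda;\mathbf A_{-gq})}{g^{1/2}\ln g}=\frac{1-b^{-1}}{2\pi\varkappa^2}.$$
   Context: Tree: $\Gamma=\Gamma_b$ is the rooted metric tree with root $o$, all edges of length $1$, exactly one edge emanating from $o$ and exactly $b$ edges emanating from each vertex $v\neq o$; $|x|$ is the distance from $x$ to $o$, $dx$ is Lebesgue measure on $\Gamma$. $\mathsf H^{1,0}(\Gamma)$: continuous $f$ with $f\in\mathsf H^1(e)$ on each edge, $\int_\Gamma(|f'|^2+|f|^2)dx<\infty$, $f(o)=0$. For bounded real measurable $V$ on $\mathbb R_+$, $\mathbf A_V$ is the self-adjoint operator in $L^2(\Gamma)$ with form $\int_\Gamma(|f'|^2+V(|x|)|f|^2)dx$ on $\mathsf H^{1,0}(\Gamma)$. Gaps: $R=\frac{b^{1/2}+b^{-1/2}}2$, $\theta=\arccos(1/R)$, $\mathfrak l_0=(-\infty,\theta^2)$, $\mathfrak l_l=((\pi l-\theta)^2,(\pi l+\theta)^2)$ for $l\ge1$. The points of $\mathfrak l_l$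 other than $(\pi l)^2$ (all points of $\mathfrak l_0$) lie outside the spectrum of $\mathbf A_0$. Counting function: $M(\lambda;\mathbf A_V)=\sum_{0<\alpha<1}\dim\ker(\mathbf A_0+\alpha V-\lambda)$ for $\lambda$ in a gap of the spectrum of $\mathbf A_0$; at an end of $\mathfrak l_l$ it is defined as the one-sided limit from inside $\mathfrak l_l$. (The orthogonal decomposition of $\mathbf A_V$ gives $M(\lambda;\mathbf A_V)=M(\lambda;A_V)+(1-b^{-1})\sum_{k\ge1}b^kM(\lambda;A_{V_k})$, $V_k(t)=V(t+k)$, where $A_V$ is the operator $-y''+Vy$ in $L^2(\mathbb R_+)$ with $y(0)=0$ and matching conditions $y(n+)=b^{1/2}y(n-)$, $y'(n+)=b^{-1/2}y'(n-)$, $n\in\mathbb N$.) *)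

theory Defs
  imports
    "HOL-Analysis.Analysis"
    "HOL-Library.Function_Algebras"
    "HOL-Library.Landau_Symbols"
    "HOL-Library.Sublist"
begin

section \<open>The rooted metric tree\<close>

text \<open>
  An edge is coded by the word of branching choices in \<open>{..<b}\<close> that leads to it; the edge with
  word \<open>w\<close> consists of the points at distance \<open>length w .. length w + 1\<close> from the root.  A point
  is a pair of an edge and its distance to the root.  A vertex other than the root is represented
  only once, as the upper end of the edge that leads to it, so edges are half-open here.  The
  empty word is the unique edge emanating from the root.
\<close>

type_synonym tpoint = "nat list \<times> real"

definition tree_root :: tpoint where
  "tree_root = ([], 0)"

definition tree :: "nat \<Rightarrow> tpoint set" where
  "tree b = insert tree_root
     {(w, t). set w \<subseteq> {..<b} \<and> real (length w) < t \<and> t \<le> real (length w) + 1}"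

text \<open>
  The geodesics from the root to \<open>(w, s)\<close> and \<open>(v, t)\<close> coincide up to height
  \<open>min (min s t) (m + 1)\<close>, where \<open>m\<close> is the length of the longest common prefix of \<open>w\<close> and \<open>v\<close>.
\<close>

fun tree_meet :: "tpoint \<Rightarrow> tpoint \<Rightarrow> real" where
  "tree_meet (w, s) (v, t) = min (min s t) (real (length (longest_common_prefix w v)) + 1)"

definition tree_dist :: "tpoint \<Rightarrow> tpoint \<Rightarrow> real" where
  "tree_dist x y = snd x + snd y - 2 * tree_meet x y"

definition height :: "tpoint \<Rightarrow> real" where
  "height x = tree_dist x tree_root"

lemma length_lcp_le:
  "length (longest_common_prefix w v) \<le> length w" "length (longest_common_prefix w v) \<le> length v"
  by (simp_all add: longest_common_prefix_prefix1 longest_common_prefix_prefix2 prefix_length_le)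

lemma lcp_commute: "longest_common_prefix w v = longest_common_prefix v w"
  by (induction w v rule: longest_common_prefix.induct) auto

lemma lcp_ultra:
  "min (length (longest_common_prefix w u)) (length (longest_common_prefix u v))
     \<le> length (longest_common_prefix w v)"
proof -
  let ?p = "longest_common_prefix w u" and ?q = "longest_common_prefix u v"
  have pu: "prefix ?p u" "prefix ?p w" "prefix ?q u" "prefix ?q v"
    by (simp_all add: longest_common_prefix_prefix1 longest_common_prefix_prefix2)
  then have "prefix ?p ?q \<or> prefix ?q ?p"
    using prefix_same_cases by blast
  then show ?thesis
    using pu by (meson longest_common_prefix_max_prefix min.coboundedI1 min.coboundedI2
        prefix_length_le prefix_order.trans)
qed

lemma tree_snd: "x \<in> tree b \<Longrightarrow> snd x \<ge> 0"
  by (auto simp: tree_def tree_root_def)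

lemma height_eq: "x \<in> tree b \<Longrightarrow> height x = snd x"
  using tree_snd[of x b] by (cases x) (simp add: height_def tree_dist_def tree_root_def min_def)

lemma Metric_space_tree: "Metric_space (tree b) tree_dist"
proof -
  have ultra: "min (tree_meet x y) (tree_meet y z) \<le> tree_meet x z" for x y z
    using lcp_ultra[of "fst x" "fst y" "fst z"] by (cases x; cases y; cases z) auto
  have le: "tree_meet x y \<le> snd x" "tree_meet x y \<le> snd y" for x y
    by (cases x; cases y; simp)+
  have lcp_refl: "longest_common_prefix w w = w" for w :: "nat list"
    by (induction w) auto
  show ?thesis
  proof
    fix x y
    show "0 \<le> tree_dist x y"
      using le[of x y] by (simp add: tree_dist_def)
    show "tree_dist x y = tree_dist y x"
      by (cases x; cases y) (auto simp: tree_dist_def lcp_commute min.commute)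
  next
    fix x y assume xy: "x \<in> tree b" "y \<in> tree b"
    obtain w s v t where eq: "x = (w, s)" "y = (v, t)" by fastforce
    show "tree_dist x y = 0 \<longleftrightarrow> x = y"
    proof
      assume "tree_dist x y = 0"
      then have st: "s = t" "s \<le> real (length (longest_common_prefix w v)) + 1"
        by (auto simp: eq tree_dist_def min_def split: if_splits)
      show "x = y"
      proof (cases "s = 0")
        case True
        then show ?thesis using xy st by (auto simp: eq tree_def tree_root_def)
      next
        case False
        then have "real (length w) < s" "real (length v) < s"
          using xy st by (auto simp: eq tree_def tree_root_def)
        with st length_lcp_le[of w v]
        have "length (longest_common_prefix w v) = length w"
             "length (longest_common_prefix w v) = length v" by linarith+
        then have "w = v"
          by (metis longest_common_prefix_prefix1 longest_common_prefix_prefix2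
              prefix_def append_self_conv length_append add_cancel_left_right length_0_conv)
        then show ?thesis using st eq by simp
      qed
    next
      assume "x = y"
      then show "tree_dist x y = 0"
        using xy by (auto simp: eq tree_dist_def tree_def tree_root_def lcp_refl)
    qed
  next
    fix x y z
    show "tree_dist x z \<le> tree_dist x y + tree_dist y z"
      using ultra[of x y z] le[of x y] le[of y z] unfolding tree_dist_def by linarith
  qed
qed

definition tree_measure :: "nat \<Rightarrow> tpoint measure" where
  "tree_measure b = restrict_space (count_space UNIV \<Otimes>\<^sub>M lborel) (tree b)"

section \<open>Sobolev spaces\<close>

definition square_integrable_on_interval :: "real \<Rightarrow> real \<Rightarrow> (real \<Rightarrow> complex) \<Rightarrow> bool" where
  "square_integrable_on_interval a c u \<longleftrightarrow>
     set_borel_measurable lborel {a<..<c} u \<and>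
     set_integrable lborel {a<..<c} (\<lambda>t. (cmod (u t))\<^sup>2)"

definition test_function :: "real \<Rightarrow> real \<Rightarrow> (real \<Rightarrow> real) \<Rightarrow> bool" where
  "test_function a c \<phi> \<longleftrightarrow>
     \<phi> C1_differentiable_on UNIV \<and> (\<exists>a' c'. a < a' \<and> c' < c \<and> (\<forall>t. t \<notin> {a'..c'} \<longrightarrow> \<phi> t = 0))"

definition has_weak_derivative ::
    "real \<Rightarrow> real \<Rightarrow> (real \<Rightarrow> complex) \<Rightarrow> (real \<Rightarrow> complex) \<Rightarrow> bool" where
  "has_weak_derivative a c u v \<longleftrightarrow>
     square_integrable_on_interval a c v \<and>
     (\<forall>\<phi>. test_function a c \<phi> \<longrightarrow>
        (LINT t:{a<..<c}|lborel. u t * of_real (deriv \<phi> t))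
          = - (LINT t:{a<..<c}|lborel. v t * of_real (\<phi> t)))"

definition H1_interval :: "real \<Rightarrow> real \<Rightarrow> (real \<Rightarrow> complex) set" where
  "H1_interval a c = {u. square_integrable_on_interval a c u \<and> (\<exists>v. has_weak_derivative a c u v)}"

text \<open>The weak derivative is determined up to a null set; a representative is chosen on each edge.\<close>

definition tree_deriv :: "(tpoint \<Rightarrow> complex) \<Rightarrow> tpoint \<Rightarrow> complex" where
  "tree_deriv f = (\<lambda>(w, t).
     (SOME v. has_weak_derivative (length w) (real (length w) + 1) (\<lambda>s. f (w, s)) v) t)"

text \<open>
  Functions on the tree are total functions that vanish off \<open>tree b\<close>, so that they are determined
  by their values on the tree and dimensions are computed correctly.
\<close>

definition tree_H10 :: "nat \<Rightarrow> (tpoint \<Rightarrow> complex) set" where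
  "tree_H10 b = {f.
     (\<forall>x. x \<notin> tree b \<longrightarrow> f x = 0) \<and>
     continuous_map (Metric_space.mtopology (tree b) tree_dist) euclidean f \<and>
     (\<forall>w. set w \<subseteq> {..<b} \<longrightarrow> (\<lambda>t. f (w, t)) \<in> H1_interval (length w) (real (length w) + 1)) \<and>
     integrable (tree_measure b) (\<lambda>x. (cmod (tree_deriv f x))\<^sup>2 + (cmod (f x))\<^sup>2) \<and>
     f tree_root = 0}"

definition tree_L2 :: "nat \<Rightarrow> (tpoint \<Rightarrow> complex) set" where
  "tree_L2 b = {h \<in> borel_measurable (tree_measure b).
     integrable (tree_measure b) (\<lambda>x. (cmod (h x))\<^sup>2)}"

section \<open>The Schroedinger operator\<close>

text \<open>The sesquilinear form that polarizes the quadratic form.\<close>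

definition schroedinger_form ::
    "nat \<Rightarrow> (real \<Rightarrow> real) \<Rightarrow> (tpoint \<Rightarrow> complex) \<Rightarrow> (tpoint \<Rightarrow> complex) \<Rightarrow> complex" where
  "schroedinger_form b V f h =
     (LINT x|tree_measure b. tree_deriv f x * cnj (tree_deriv h x)
        + of_real (V (height x)) * f x * cnj (h x))"

text \<open>
  The graph of the self-adjoint operator associated with the closed form by the representation
  theorem.  The second component of a pair is an \<open>L\<^sup>2\<close> function, determined up to a null set;
  the first one is the continuous representative.
\<close>

definition schroedinger_op ::
    "nat \<Rightarrow> (real \<Rightarrow> real) \<Rightarrow> ((tpoint \<Rightarrow> complex) \<times> (tpoint \<Rightarrow> complex)) set" where
  "schroedinger_op b V = {(u, h). u \<in> tree_H10 b \<and> h \<in> tree_L2 b \<and>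
     (\<forall>\<phi> \<in> tree_H10 b. schroedinger_form b V u \<phi> = (LINT x|tree_measure b. h x * cnj (\<phi> x)))}"

definition eigenspace :: "nat \<Rightarrow> (real \<Rightarrow> real) \<Rightarrow> real \<Rightarrow> (tpoint \<Rightarrow> complex) set" where
  "eigenspace b V \<mu> = {u. (u, \<lambda>x. of_real \<mu> * u x) \<in> schroedinger_op b V}"

definition cscale :: "complex \<Rightarrow> ('a \<Rightarrow> complex) \<Rightarrow> 'a \<Rightarrow> complex" where
  "cscale c f = (\<lambda>x. c * f x)"

lemma vector_space_cscale: "vector_space (cscale :: complex \<Rightarrow> ('a \<Rightarrow> complex) \<Rightarrow> _)"
  by unfold_locales (auto simp: cscale_def fun_eq_iff algebra_simps)

text \<open>The library's \<open>dim\<close> is \<open>0\<close> on infinite-dimensional spaces.\<close>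

definition cdim :: "('a \<Rightarrow> complex) set \<Rightarrow> enat" where
  "cdim S = (if \<exists>B. finite B \<and> S \<subseteq> module.span cscale B
     then enat (vector_space.dim cscale S) else \<infinity>)"

section \<open>Gaps and the counting function\<close>

definition gap_R :: "nat \<Rightarrow> real" where
  "gap_R b = (real b powr (1/2) + real b powr (-1/2)) / 2"

definition gap_theta :: "nat \<Rightarrow> real" where
  "gap_theta b = arccos (1 / gap_R b)"

definition gap :: "nat \<Rightarrow> nat \<Rightarrow> real set" where
  "gap b l = (if l = 0 then {..<(gap_theta b)\<^sup>2}
     else {(pi * real l - gap_theta b)\<^sup>2 <..< (pi * real l + gap_theta b)\<^sup>2})"

text \<open>
  For bounded \<open>V\<close> the operator \<open>A\<^sub>0 + \<alpha> V\<close> is the one with potential \<open>\<alpha> V\<close>.  The sum is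
  taken in the extended reals because it may be infinite for general \<open>V\<close>.
\<close>

definition interior_count :: "nat \<Rightarrow> (real \<Rightarrow> real) \<Rightarrow> real \<Rightarrow> ereal" where
  "interior_count b V \<mu> =
     (\<Sum>\<^sub>\<infinity>\<alpha>\<in>{0<..<1}. ereal_of_enat (cdim (eigenspace b (\<lambda>t. \<alpha> * V t) \<mu>)))"

definition counting_function :: "nat \<Rightarrow> nat \<Rightarrow> (real \<Rightarrow> real) \<Rightarrow> real \<Rightarrow> ereal" where
  "counting_function b l V \<mu> =
     (if \<mu> \<in> gap b l then interior_count b V \<mu>
      else Lim (at \<mu> within gap b l) (interior_count b V))"

end

theory Submission
  imports Defs
begin

text \<open>
  On the edges between heights \<open>n\<close> and \<open>n + 1\<close> an eigenfunction for the potential \<open>- s q\<close> and the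
  level \<open>\<mu>\<close> solves \<open>y'' + (\<mu> + s q) y = 0\<close>.  For \<open>\<mu>\<close> in a gap the transfer map of the free
  equation over one generation is hyperbolic, with an eigenvalue of modulus greater than \<open>sqrt b\<close>,
  so the radial solutions that are square integrable above a vertex of height \<open>k\<close> are the
  multiples of one solution \<open>v\<^sub>k(s, \<mu>)\<close>.  The Wronskian of an eigenfunction with it is
  additive over branches and tends to zero at infinity; hence an eigenfunction is on every edge a
  multiple of the decaying solution, and the multiples can change only at the vertices where that
  solution vanishes.  Such a height \<open>k\<close> contributes \<open>m\<^sub>k\<close> to the dimension of the eigenspace, where
  \<open>m\<^sub>0 = 1\<close> and \<open>m\<^sub>k = b\<^sup>k - b\<^sup>k\<^sup>-\<^sup>1\<close>.  With \<open>s = \<alpha> g\<close> the counting function is therefore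
  the sum over \<open>k\<close> of \<open>m\<^sub>k\<close> times the number of zeros of the value of \<open>v\<^sub>k(s, \<mu>)\<close> for
  \<open>0 < s < g\<close>.

  The zeros are crossings of multiples of \<open>pi\<close> by a Pruefer angle, which is strictly increasing in \<open>s\<close>
  and in \<open>\<mu>\<close> and grows over one edge by \<open>sqrt g\<close> times the integral of \<open>sqrt q\<close>, up to \<open>O(1)\<close>.  From the
  height \<open>T\<close> on where \<open>g q\<close> is small there are no zeros; \<open>b\<^sup>T\<close> is of the order of \<open>sqrt g\<close> and \<open>T\<close> is
  asymptotic to \<open>ln g / (2 \<kappa>)\<close>.  Since \<open>m\<^sub>0 + \<dots> + m\<^sub>n = b\<^sup>n\<close>, \<open>pi\<close> times the count is \<open>sqrt g\<close> times the sum
  over \<open>n < T\<close> of \<open>b\<^sup>n\<close> times the integral of \<open>sqrt q\<close> over the edge at height \<open>n\<close>, up to \<open>O(sqrt g)\<close>.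
  These terms tend to \<open>(1 - 1 / b) / \<kappa>\<close>.  All bounds are uniform in \<open>\<mu>\<close> up to the ends of the gap,
  where the one-sided limits exist by monotonicity.
\<close>

section \<open>Linear second-order equations on the unit interval\<close>

text \<open>The obstacle is uniformity up to the ends of a gap. There the two eigenvalues of the
  free transfer matrix over one generation merge at modulus \<open>sqrt b\<close> and the matrix is
  a Jordan block, so hyperbolicity is lost. The construction survives because \<open>q\<close> falls
  by the factor \<open>b^2 >= 4\<close> per generation, while the suitably normalised transfer maps
  expand by at most 2: the Floquet solution continued back from height \<open>n + j\<close>
  converges geometrically on the closed gap. The normalisation gives the Floquet vector first
  coordinate 1. This is impossible at \<open>(pi l)^2\<close>, where the free sine solution vanishes
  at both ends of an edge, and there the level is excluded. Levels strictly inside the gap are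
  needed for square integrability and for monotonicity. Monotonicity does not come from
  differentiating the limit that defines the solution: a continuous lift of the angle is combined
  with the sign of a Wronskian, which a series with ratio below 1 provides. The growth of the angle
  uses that \<open>|q'|\<close> is bounded by a multiple of \<open>q\<close>, uniformly in the
  height.\<close>

definition ode_sol :: "(real \<Rightarrow> real) \<Rightarrow> (real \<Rightarrow> real) \<Rightarrow> (real \<Rightarrow> real \<times> real) \<Rightarrow> bool" where
  "ode_sol P f z \<longleftrightarrow> (\<forall>x\<in>{0..1}.
     ((\<lambda>x. fst (z x)) has_real_derivative snd (z x)) (at x within {0..1}) \<and>
     ((\<lambda>x. snd (z x)) has_real_derivative (f x - P x * fst (z x))) (at x within {0..1}))"

lemma ode_solD:
  assumes "ode_sol P f z" "x \<in> {0..1}"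
  shows "((\<lambda>x. fst (z x)) has_real_derivative snd (z x)) (at x within {0..1})"
    "((\<lambda>x. snd (z x)) has_real_derivative (f x - P x * fst (z x))) (at x within {0..1})"
  using assms by (auto simp: ode_sol_def)

lemma ode_sol_add:
  assumes "ode_sol P f z" "ode_sol P h w"
  shows "ode_sol P (\<lambda>x. f x + h x) (\<lambda>x. z x + w x)"
  unfolding ode_sol_def
proof
  fix x :: real assume x: "x \<in> {0..1}"
  show "((\<lambda>x. fst (z x + w x)) has_real_derivative snd (z x + w x)) (at x within {0..1}) \<and>
     ((\<lambda>x. snd (z x + w x)) has_real_derivative (f x + h x - P x * fst (z x + w x))) (at x within {0..1})"
    using DERIV_add[OF ode_solD(1)[OF assms(1) x] ode_solD(1)[OF assms(2) x]]
      DERIV_add[OF ode_solD(2)[OF assms(1) x] ode_solD(2)[OF assms(2) x]]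
    by (simp add: algebra_simps)
qed

lemma ode_sol_scale:
  assumes "ode_sol P f z"
  shows "ode_sol P (\<lambda>x. c * f x) (\<lambda>x. c *\<^sub>R z x)"
  unfolding ode_sol_def
proof
  fix x :: real assume x: "x \<in> {0..1}"
  show "((\<lambda>x. fst (c *\<^sub>R z x)) has_real_derivative snd (c *\<^sub>R z x)) (at x within {0..1}) \<and>
     ((\<lambda>x. snd (c *\<^sub>R z x)) has_real_derivative (c * f x - P x * fst (c *\<^sub>R z x))) (at x within {0..1})"
    using DERIV_cmult[OF ode_solD(1)[OF assms(1) x], of c]
      DERIV_cmult[OF ode_solD(2)[OF assms(1) x], of c]
    by (simp add: algebra_simps)
qed

section \<open>Energy estimates and existence of solutions\<close>

lemma ode_energy_deriv:
  assumes "ode_sol P f z" "0 < x" "x < 1"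
  shows "((\<lambda>x. (fst (z x))\<^sup>2 + (snd (z x))\<^sup>2) has_real_derivative
     (2 * (1 - P x) * fst (z x) * snd (z x) + 2 * snd (z x) * f x)) (at x)"
proof -
  have x: "x \<in> {0..1}" using assms by auto
  have at: "at x within {0..1} = at x" using assms by (simp add: at_within_Icc_at)
  note d = ode_solD[OF assms(1) x, unfolded at]
  show ?thesis
    by (rule derivative_eq_intros d refl)+ (simp add: algebra_simps)
qed

lemma ode_sol_continuous: "ode_sol P f z \<Longrightarrow> continuous_on {0..1} z"
proof -
  assume "ode_sol P f z"
  then have "continuous_on {0..1} (\<lambda>x. (fst (z x), snd (z x)))"
    by (intro continuous_on_Pair DERIV_continuous_on) (auto simp: ode_sol_def)
  then show ?thesis by simp
qed

text \<open>Gronwall's inequality for \<open>y^2 + y'^2\<close>. The cross term costs at most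
  \<open>1 + B\<close> times the energy, and the forcing is split by
  \<open>2 y' f <= y'^2 + f^2\<close>; adding the constant \<open>F\<^sup>2\<close> to the energy
  absorbs it. This gives the rate \<open>B + 2\<close>.\<close>

lemma ode_energy_upper:
  assumes sol: "ode_sol P f z" and P: "\<And>x. x \<in> {0..1} \<Longrightarrow> \<bar>P x\<bar> \<le> B"
    and f: "\<And>x. x \<in> {0..1} \<Longrightarrow> \<bar>f x\<bar> \<le> F" and x: "x \<in> {0..1}"
  shows "(norm (z x))\<^sup>2 \<le> exp (B + 2) * ((norm (z 0))\<^sup>2 + F\<^sup>2)"
proof -
  define E where "E x = (fst (z x))\<^sup>2 + (snd (z x))\<^sup>2" for x
  have nE: "(norm (z x))\<^sup>2 = E x" for x
    by (cases "z x") (simp add: norm_Pair E_def)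
  have B0: "B \<ge> 0" using P[of 0] by auto
  \<comment> \<open>The energy is negated, so that the upper bound can be read off from a function
    with nonnegative derivative.\<close>
  have h: "exp (-(B+2)*0) * - (E 0 + F\<^sup>2) \<le> exp (-(B+2)*x) * - (E x + F\<^sup>2)"
  proof (rule DERIV_nonneg_imp_increasing_open[where f = "\<lambda>x. exp (-(B+2)*x) * - (E x + F\<^sup>2)"])
    show "0 \<le> x" using x by auto
    show "continuous_on {0..x} (\<lambda>x. exp (-(B+2)*x) * - (E x + F\<^sup>2))"
      unfolding E_def using continuous_on_subset[OF ode_sol_continuous[OF sol], of "{0..x}"] x
      by (intro continuous_intros) auto
    fix t assume t: "0 < t" "t < x"
    then have t1: "0 < t" "t < 1" using x by auto
    let ?a = "fst (z t)" and ?c = "snd (z t)"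
    let ?E' = "2 * (1 - P t) * ?a * ?c + 2 * ?c * f t"
    have d: "(E has_real_derivative ?E') (at t)"
      using ode_energy_deriv[OF sol t1] unfolding E_def .
    have "((\<lambda>x. exp (-(B+2)*x) * - (E x + F\<^sup>2)) has_real_derivative
        exp (-(B+2)*t) * ((B+2) * (E t + F\<^sup>2) - ?E')) (at t)"
      by (rule derivative_eq_intros d refl)+ (simp add: algebra_simps)
    moreover have "?E' \<le> (B+2) * (E t + F\<^sup>2)"
    proof -
      have "\<bar>1 - P t\<bar> \<le> 1 + B" using P[of t] t1 by auto
      moreover have ac: "\<bar>2 * ?a * ?c\<bar> \<le> E t"
        using sum_squares_bound[of ?a ?c] sum_squares_bound[of "-?a" ?c] by (auto simp: E_def abs_if)
      ultimately have "\<bar>1 - P t\<bar> * \<bar>2 * ?a * ?c\<bar> \<le> (1 + B) * E t"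
        by (intro mult_mono) auto
      then have 1: "2 * (1 - P t) * ?a * ?c \<le> (1 + B) * E t"
      proof -
        have "2 * (1 - P t) * ?a * ?c \<le> \<bar>(1 - P t) * (2 * ?a * ?c)\<bar>" by (simp add: algebra_simps)
        then show ?thesis using \<open>\<bar>1 - P t\<bar> * \<bar>2 * ?a * ?c\<bar> \<le> (1 + B) * E t\<close> by (simp only: abs_mult)
      qed
      have "2 * ?c * f t \<le> ?c\<^sup>2 + (f t)\<^sup>2" using sum_squares_bound[of ?c "f t"] .
      also have "(f t)\<^sup>2 \<le> F\<^sup>2" using f[of t] t1 by (simp add: abs_le_square_iff[symmetric])
      also have "?c\<^sup>2 \<le> E t" by (simp add: E_def)
      finally have 2: "2 * ?c * f t \<le> E t + F\<^sup>2" by simp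
      have "0 \<le> (B + 1) * F\<^sup>2" using B0 by simp
      then show ?thesis using 1 2 by (simp add: algebra_simps)
    qed
    ultimately show "\<exists>y. ((\<lambda>x. exp (-(B+2)*x) * - (E x + F\<^sup>2)) has_real_derivative y) (at t) \<and> y \<ge> 0"
      by (intro exI conjI) auto
  qed
  then have "exp ((B+2)*x) * (exp (-(B+2)*x) * (E x + F\<^sup>2)) \<le> exp ((B+2)*x) * (E 0 + F\<^sup>2)"
    by (intro mult_left_mono) (simp_all only: mult_minus_right mult_zero_right exp_zero neg_le_iff_le mult_1_left exp_ge_zero)
  then have "E x + F\<^sup>2 \<le> exp ((B+2)*x) * (E 0 + F\<^sup>2)"
    by (simp only: mult.assoc[symmetric] exp_add[symmetric] mult_minus_left add.right_inverse exp_zero mult_1_left)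
  also have "\<dots> \<le> exp (B+2) * (E 0 + F\<^sup>2)"
    using B0 x by (intro mult_right_mono) (auto simp: E_def mult_left_le)
  finally show ?thesis by (simp add: nE) (smt (verit) zero_le_power2)
qed

text \<open>The same argument in the other direction: a solution of the homogeneous equation shrinks
  at most exponentially, so nonzero data stay nonzero along an edge.\<close>

lemma ode_energy_lower:
  assumes sol: "ode_sol P (\<lambda>_. 0) z" and P: "\<And>x. x \<in> {0..1} \<Longrightarrow> \<bar>P x\<bar> \<le> B"
    and x: "x \<in> {0..1}"
  shows "(norm (z 0))\<^sup>2 \<le> exp (B + 1) * (norm (z x))\<^sup>2"
proof -
  define E where "E x = (fst (z x))\<^sup>2 + (snd (z x))\<^sup>2" for x
  have nE: "(norm (z x))\<^sup>2 = E x" for x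
    by (cases "z x") (simp add: norm_Pair E_def)
  have B0: "B \<ge> 0" using P[of 0] by auto
  have h: "exp ((B+1)*0) * E 0 \<le> exp ((B+1)*x) * E x"
  proof (rule DERIV_nonneg_imp_increasing_open[where f = "\<lambda>x. exp ((B+1)*x) * E x"])
    show "0 \<le> x" using x by auto
    show "continuous_on {0..x} (\<lambda>x. exp ((B+1)*x) * E x)"
      unfolding E_def using continuous_on_subset[OF ode_sol_continuous[OF sol], of "{0..x}"] x
      by (intro continuous_intros) auto
    fix t assume t: "0 < t" "t < x"
    then have t1: "0 < t" "t < 1" using x by auto
    let ?a = "fst (z t)" and ?c = "snd (z t)"
    let ?E' = "2 * (1 - P t) * ?a * ?c"
    have d: "(E has_real_derivative ?E') (at t)"
      using ode_energy_deriv[OF sol t1] unfolding E_def by simp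
    have "((\<lambda>x. exp ((B+1)*x) * E x) has_real_derivative
        exp ((B+1)*t) * ((B+1) * E t + ?E')) (at t)"
      by (rule derivative_eq_intros d refl)+ (simp add: algebra_simps)
    moreover have "0 \<le> (B+1) * E t + ?E'"
    proof -
      have "\<bar>1 - P t\<bar> \<le> 1 + B" using P[of t] t1 by auto
      moreover have ac: "\<bar>2 * ?a * ?c\<bar> \<le> E t"
        using sum_squares_bound[of ?a ?c] sum_squares_bound[of "-?a" ?c] by (auto simp: E_def abs_if)
      ultimately have "\<bar>1 - P t\<bar> * \<bar>2 * ?a * ?c\<bar> \<le> (1 + B) * E t"
        by (intro mult_mono) auto
      moreover have "\<bar>?E'\<bar> = \<bar>1 - P t\<bar> * \<bar>2 * ?a * ?c\<bar>"
        by (simp only: abs_mult[symmetric] mult.assoc mult.commute[of 2] mult.left_commute[of 2])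
      ultimately have "\<bar>?E'\<bar> \<le> (B+1) * E t" by (simp only: add.commute)
      then show ?thesis by (simp only: abs_le_iff) linarith
    qed
    ultimately show "\<exists>y. ((\<lambda>x. exp ((B+1)*x) * E x) has_real_derivative y) (at t) \<and> y \<ge> 0"
      using mult_nonneg_nonneg[OF exp_ge_zero] by fast
  qed
  also have "\<dots> \<le> exp (B+1) * E x"
    using B0 x by (intro mult_right_mono) (auto simp: E_def mult_left_le)
  finally show ?thesis by (simp add: nE)
qed

lemma ode_sol_unique:
  assumes "ode_sol P f z" "ode_sol P f w" "continuous_on {0..1} P" "z 0 = w 0" "x \<in> {0..1}"
  shows "z x = w x"
proof -
  obtain B where B: "\<And>x. x \<in> {0..1} \<Longrightarrow> \<bar>P x\<bar> \<le> B"
    using compact_imp_bounded[OF compact_continuous_image[OF assms(3)]]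
    by (force simp: bounded_iff)
  have "ode_sol P (\<lambda>_. 0) (\<lambda>x. z x - w x)"
    using ode_sol_add[OF assms(1) ode_sol_scale[OF assms(2), of "-1"]] by simp
  from ode_energy_upper[OF this B, of 0 x] show ?thesis using assms by simp
qed

text \<open>Picard iteration: the derivatives of the terms of the series for a solution of
  \<open>y'' = - P y\<close> satisfy \<open>|f\<^sub>k'| \<le> D B\<^sup>k x\<^sup>k / k!\<close>.\<close>

primrec picard :: "(real \<Rightarrow> real) \<Rightarrow> real \<Rightarrow> real \<Rightarrow> nat \<Rightarrow> real \<Rightarrow> real \<times> real" where
  "picard P u0 u1 0 = (\<lambda>x. (u0 + u1 * x, u1))"
| "picard P u0 u1 (Suc k) = (\<lambda>x.
     (integral {0..x} (\<lambda>t. integral {0..t} (\<lambda>r. - P r * fst (picard P u0 u1 k r))),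
      integral {0..x} (\<lambda>r. - P r * fst (picard P u0 u1 k r))))"

lemma picard_continuous:
  assumes P: "continuous_on {0..1} P"
  shows "continuous_on {0..1} (\<lambda>x. fst (picard P u0 u1 k x)) \<and> continuous_on {0..1} (\<lambda>x. snd (picard P u0 u1 k x))"
proof (induction k)
  case 0
  show ?case by (auto intro!: continuous_intros)
next
  case (Suc k)
  have 1: "continuous_on {0..1} (\<lambda>x. integral {0..x} (\<lambda>r. - P r * fst (picard P u0 u1 k r)))"
    using Suc P by (intro indefinite_integral_continuous_1 integrable_continuous_interval continuous_on_mult continuous_on_minus) auto
  then have "continuous_on {0..1} (\<lambda>x. integral {0..x} (\<lambda>t. integral {0..t} (\<lambda>r. - P r * fst (picard P u0 u1 k r))))"
    by (rule indefinite_integral_continuous_1[OF integrable_continuous_interval])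
  with 1 show ?case by simp
qed

lemma picard_deriv:
  assumes P: "continuous_on {0..1} P" and x: "x \<in> {0..1}"
  shows "((\<lambda>x. fst (picard P u0 u1 k x)) has_real_derivative snd (picard P u0 u1 k x)) (at x within {0..1})"
    "((\<lambda>x. snd (picard P u0 u1 k x)) has_real_derivative
       (case k of 0 \<Rightarrow> 0 | Suc j \<Rightarrow> - P x * fst (picard P u0 u1 j x))) (at x within {0..1})"
proof -
  have c: "continuous_on {0..1} (\<lambda>r. - P r * fst (picard P u0 u1 j r))" for j
    using picard_continuous[OF P, of u0 u1 j] P by (intro continuous_on_mult continuous_on_minus) auto
  show "((\<lambda>x. fst (picard P u0 u1 k x)) has_real_derivative snd (picard P u0 u1 k x)) (at x within {0..1})"
  proof (cases k)
    case 0
    then show ?thesis by (auto intro!: derivative_eq_intros)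
  next
    case (Suc j)
    have "continuous_on {0..1} (\<lambda>t. integral {0..t} (\<lambda>r. - P r * fst (picard P u0 u1 j r)))"
      using c by (intro indefinite_integral_continuous_1 integrable_continuous_interval)
    from integral_has_real_derivative[OF this x] Suc show ?thesis by simp
  qed
  show "((\<lambda>x. snd (picard P u0 u1 k x)) has_real_derivative
       (case k of 0 \<Rightarrow> 0 | Suc j \<Rightarrow> - P x * fst (picard P u0 u1 j x))) (at x within {0..1})"
    using integral_has_real_derivative[OF c x] by (cases k) auto
qed

lemma DERIV_cong_both:
  assumes "(f has_real_derivative D) (at x within S)" "f = g" "D = E"
  shows "(g has_real_derivative E) (at x within S)"
  using assms by simp

lemma picard_bound:
  assumes P: "continuous_on {0..1} P" and B: "\<And>x. x \<in> {0..1} \<Longrightarrow> \<bar>P x\<bar> \<le> B" and x: "x \<in> {0..1}"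
  shows "\<bar>fst (picard P u0 u1 k x)\<bar> \<le> (\<bar>u0\<bar> + \<bar>u1\<bar>) * (B * x) ^ k / fact k \<and>
         \<bar>snd (picard P u0 u1 k x)\<bar> \<le> (\<bar>u0\<bar> + \<bar>u1\<bar>) * (B * x) ^ k / fact k"
  using x
proof (induction k arbitrary: x)
  case 0
  have "\<bar>u0 + u1 * x\<bar> \<le> \<bar>u0\<bar> + \<bar>u1\<bar> * 1"
    using 0 by (intro order_trans[OF abs_triangle_ineq] add_mono) (auto simp: abs_mult mult_left_le)
  then show ?case by simp
next
  case (Suc k)
  define D where "D = \<bar>u0\<bar> + \<bar>u1\<bar>"
  have D0: "D \<ge> 0" by (simp add: D_def)
  have B0: "B \<ge> 0" using B[of 0] by auto
  have c: "continuous_on {0..1} (\<lambda>r. - P r * fst (picard P u0 u1 k r))"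
    using picard_continuous[OF P, of u0 u1 k] P by (intro continuous_on_mult continuous_on_minus) auto
  have sub: "{0..y} \<subseteq> {0..1}" if "y \<in> {0..1}" for y :: real using that by auto
  have I: "((\<lambda>r. D * B ^ Suc k * r ^ k / fact k) has_integral D * (B * y) ^ Suc k / fact (Suc k)) {0..y}"
    if "y \<in> {0..1}" for y
  proof -
    have "((\<lambda>r. D * B ^ Suc k * r ^ k / fact k) has_integral D * (B * y) ^ Suc k / fact (Suc k) - D * (B * 0) ^ Suc k / fact (Suc k)) {0..y}"
    proof (rule fundamental_theorem_of_calculus)
      fix r assume "r \<in> {0..y}"
      show "((\<lambda>r. D * (B * r) ^ Suc k / fact (Suc k)) has_vector_derivative D * B ^ Suc k * r ^ k / fact k) (at r within {0..y})"
        unfolding has_real_derivative_iff_has_vector_derivative[symmetric]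
        using DERIV_cmult[OF DERIV_power_Suc[OF DERIV_ident, where n=k], of "D * B ^ Suc k / fact (Suc k)"]
      proof (rule DERIV_cong_both)
        have "K \<noteq> 0 \<Longrightarrow> F \<noteq> 0 \<Longrightarrow> A / (K * F) * (K * (1 * y)) = A * y / F" for A K F y :: real
          by (simp add: field_simps)
        from this[of "1 + real k" "fact k" "D * B ^ Suc k" "r ^ k"]
        show "D * B ^ Suc k / fact (Suc k) * ((1 + real k) * (1 * r ^ k)) = D * B ^ Suc k * r ^ k / fact k"
          by (simp only: fact_Suc of_nat_Suc of_nat_1 add_nonneg_eq_0_iff) simp
      qed (simp add: fun_eq_iff power_mult_distrib)
    qed (use that in auto)
    then show ?thesis by simp
  qed
  have 1: "\<bar>integral {0..y} (\<lambda>r. - P r * fst (picard P u0 u1 k r))\<bar> \<le> D * (B * y) ^ Suc k / fact (Suc k)"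
    if y: "y \<in> {0..1}" for y
  proof -
    have "norm (integral {0..y} (\<lambda>r. - P r * fst (picard P u0 u1 k r)))
        \<le> integral {0..y} (\<lambda>r. D * B ^ Suc k * r ^ k / fact k)"
    proof (rule integral_norm_bound_integral)
      show "(\<lambda>r. - P r * fst (picard P u0 u1 k r)) integrable_on {0..y}"
        by (intro integrable_continuous_interval continuous_on_subset[OF c] sub y)
      show "(\<lambda>r. D * B ^ Suc k * r ^ k / fact k) integrable_on {0..y}"
        using I[OF y] by blast
      fix r assume r: "r \<in> {0..y}"
      then have r1: "r \<in> {0..1}" using y by auto
      have "\<bar>P r\<bar> * \<bar>fst (picard P u0 u1 k r)\<bar> \<le> B * (D * (B * r) ^ k / fact k)"
        using Suc.IH[OF r1] B[OF r1] B0 unfolding D_def by (intro mult_mono) auto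
      then show "norm (- P r * fst (picard P u0 u1 k r)) \<le> D * B ^ Suc k * r ^ k / fact k"
        by (simp add: abs_mult power_mult_distrib mult_ac)
    qed
    then show ?thesis using integral_unique[OF I[OF y]] by simp
  qed
  have "\<bar>integral {0..x} (\<lambda>t. integral {0..t} (\<lambda>r. - P r * fst (picard P u0 u1 k r)))\<bar>
      \<le> D * (B * x) ^ Suc k / fact (Suc k) * (x - 0)"
  proof -
    have "norm (integral {0..x} (\<lambda>t. integral {0..t} (\<lambda>r. - P r * fst (picard P u0 u1 k r))))
       \<le> D * (B * x) ^ Suc k / fact (Suc k) * (x - 0)"
    proof (rule integral_bound)
      show "0 \<le> x" using Suc.prems by auto
      show "continuous_on {0..x} (\<lambda>t. integral {0..t} (\<lambda>r. - P r * fst (picard P u0 u1 k r)))"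
        using continuous_on_subset[OF c sub[OF Suc.prems]]
        by (intro indefinite_integral_continuous_1 integrable_continuous_interval)
      fix t assume t: "t \<in> {0..x}"
      then have "t \<in> {0..1}" using Suc.prems by auto
      from 1[OF this] have "norm (integral {0..t} (\<lambda>r. - P r * fst (picard P u0 u1 k r))) \<le> D * (B * t) ^ Suc k / fact (Suc k)"
        by simp
      also have "\<dots> \<le> D * (B * x) ^ Suc k / fact (Suc k)"
        using t B0 D0 by (intro divide_right_mono mult_left_mono power_mono) (auto intro!: mult_nonneg_nonneg mult_left_mono)
      finally show "norm (integral {0..t} (\<lambda>r. - P r * fst (picard P u0 u1 k r))) \<le> D * (B * x) ^ Suc k / fact (Suc k)" .
    qed
    then show ?thesis by simp
  qed
  also have "\<dots> \<le> D * (B * x) ^ Suc k / fact (Suc k) * 1"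
    using Suc.prems B0 D0 by (intro mult_left_mono) (auto intro!: divide_nonneg_pos mult_nonneg_nonneg)
  finally show ?case using 1[OF Suc.prems] by (simp add: D_def)
qed

text \<open>The terms satisfy \<open>f_0'' = 0\<close> and \<open>f_(k+1)'' = - P f_k\<close>.
  Summable majorants of \<open>f'\<close> and \<open>f''\<close> justify two termwise
  differentiations, and the index shift turns the sum of the second derivatives into
  \<open>- P\<close> times the sum.\<close>

lemma ode_sol_exists:
  assumes P: "continuous_on {0..1} P"
  shows "\<exists>z. ode_sol P (\<lambda>_. 0) z \<and> z 0 = u"
proof -
  obtain B where B: "\<And>x. x \<in> {0..1} \<Longrightarrow> \<bar>P x\<bar> \<le> B"
    using compact_imp_bounded[OF compact_continuous_image[OF P]]
    by (force simp: bounded_iff)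
  have B0: "B \<ge> 0" using B[of 0] by auto
  define f where "f k x = fst (picard P (fst u) (snd u) k x)" for k x
  define f' where "f' k x = snd (picard P (fst u) (snd u) k x)" for k x
  define f'' where "f'' k x = (case k of 0 \<Rightarrow> 0 | Suc j \<Rightarrow> - P x * f j x)" for k x
  define D where "D = \<bar>fst u\<bar> + \<bar>snd u\<bar>"
  have D0: "D \<ge> 0" by (simp add: D_def)
  define M where "M k = D * (B ^ k / fact k)" for k
  have sM: "summable M"
    unfolding M_def using summable_mult[OF summable_exp[of B], of D] by (simp add: field_simps)
  have le: "D * (B * x) ^ k / fact k \<le> M k" if "x \<in> {0..1}" for x k
    using that B0 D0 unfolding M_def
    by (auto simp: power_mult_distrib intro!: divide_right_mono mult_left_mono mult_left_le power_le_one)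
  have bf: "\<bar>f k x\<bar> \<le> M k" "\<bar>f' k x\<bar> \<le> M k" if "x \<in> {0..1}" for x k
    using picard_bound[OF P B that, of "fst u" "snd u" k] le[OF that, of k]
    unfolding f_def f'_def D_def by auto
  define M2 where "M2 k = (case k of 0 \<Rightarrow> 0 | Suc j \<Rightarrow> B * M j)" for k
  have sM2: "summable M2"
    using sM by (subst summable_Suc_iff[symmetric]) (simp add: M2_def summable_mult)
  have bf'': "\<bar>f'' k x\<bar> \<le> M2 k" if "x \<in> {0..1}" for x k
    using bf(1)[OF that] B[OF that] B0 by (auto simp: f''_def M2_def abs_mult split: nat.split intro!: mult_mono)
  have d1: "(f k has_real_derivative f' k x) (at x within {0..1})" if "x \<in> {0..1}" for k x
    using picard_deriv(1)[OF P that] unfolding f_def f'_def .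
  have d2: "(f' k has_real_derivative f'' k x) (at x within {0..1})" if "x \<in> {0..1}" for k x
    using picard_deriv(2)[OF P that, of "fst u" "snd u" k] unfolding f_def f'_def f''_def .
  have u1: "uniform_limit {0..1} (\<lambda>n x. \<Sum>i<n. f' i x) (\<lambda>x. \<Sum>i. f' i x) sequentially"
    by (rule Weierstrass_m_test[OF _ sM]) (use bf in auto)
  have u2: "uniform_limit {0..1} (\<lambda>n x. \<Sum>i<n. f'' i x) (\<lambda>x. \<Sum>i. f'' i x) sequentially"
    by (rule Weierstrass_m_test[OF _ sM2]) (use bf'' in auto)
  have s: "summable (\<lambda>n. f n x)" "summable (\<lambda>n. f' n x)" if "x \<in> {0..1}" for x
    using bf[OF that] by (auto intro!: summable_comparison_test'[OF sM])
  obtain g where g: "\<And>x. x\<in>{0..1} \<Longrightarrow> (\<lambda>n. f n x) sums g x \<and> (g has_real_derivative (\<Sum>i. f' i x)) (at x within {0..1})"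
    using has_field_derivative_series[OF _ d1 u1, of 0] s[of 0] by (metis atLeastAtMost_iff convex_real_interval(5) order_refl zero_le_one)
  obtain h where h: "\<And>x. x\<in>{0..1} \<Longrightarrow> (\<lambda>n. f' n x) sums h x \<and> (h has_real_derivative (\<Sum>i. f'' i x)) (at x within {0..1})"
    using has_field_derivative_series[OF _ d2 u2, of 0] s[of 0] by (metis atLeastAtMost_iff convex_real_interval(5) order_refl zero_le_one)
  have h_eq: "(\<Sum>i. f' i x) = h x" if "x \<in> {0..1}" for x
    using h[OF that] by (auto simp: sums_iff)
  have h'_eq: "(\<Sum>i. f'' i x) = - P x * g x" if "x \<in> {0..1}" for x
  proof -
    have "(\<lambda>n. - P x * f n x) sums (- P x * g x)" using g[OF that] by (intro sums_mult) auto
    then have "(\<lambda>n. f'' (Suc n) x) sums (- P x * g x)" by (simp add: f''_def)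
    then have "(\<lambda>n. f'' n x) sums (- P x * g x + f'' 0 x)" by (rule sums_Suc)
    then show ?thesis by (simp add: sums_iff f''_def)
  qed
  have sol: "ode_sol P (\<lambda>_. 0) (\<lambda>x. (g x, h x))"
    unfolding ode_sol_def
  proof (intro ballI)
    fix x :: real assume x: "x \<in> {0..1}"
    show "((\<lambda>x. fst (g x, h x)) has_real_derivative snd (g x, h x)) (at x within {0..1}) \<and>
         ((\<lambda>x. snd (g x, h x)) has_real_derivative 0 - P x * fst (g x, h x)) (at x within {0..1})"
      using g[OF x] h[OF x] h_eq[OF x] h'_eq[OF x] by simp
  qed
  have f0: "f n 0 = 0" "f' n 0 = 0" if "n \<noteq> 0" for n
    using that by (cases n; simp add: f_def f'_def)+
  have "g 0 = fst u"
  proof -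
    have "(\<lambda>n. f n 0) sums f 0 0"
      using sums_finite[of "{0}" "\<lambda>n. f n 0"] f0 by auto
    then show ?thesis using g[of 0] sums_unique2[of "\<lambda>n. f n 0"] by (auto simp: f_def)
  qed
  moreover have "h 0 = snd u"
  proof -
    have "(\<lambda>n. f' n 0) sums f' 0 0"
      using sums_finite[of "{0}" "\<lambda>n. f' n 0"] f0 by auto
    then show ?thesis using h[of 0] sums_unique2[of "\<lambda>n. f' n 0"] by (auto simp: f'_def)
  qed
  ultimately show ?thesis using sol by (intro exI[of _ "\<lambda>x. (g x, h x)"]) (simp add: prod_eq_iff)
qed

section \<open>The solution operator and its dependence on the potential\<close>

definition flow :: "(real \<Rightarrow> real) \<Rightarrow> real \<times> real \<Rightarrow> real \<Rightarrow> real \<times> real" where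
  "flow P u = (SOME z. ode_sol P (\<lambda>_. 0) z \<and> z 0 = u)"

lemma flow_sol: "continuous_on {0..1} P \<Longrightarrow> ode_sol P (\<lambda>_. 0) (flow P u)"
  and flow_0 [simp]: "continuous_on {0..1} P \<Longrightarrow> flow P u 0 = u"
  unfolding flow_def using someI_ex[OF ode_sol_exists] by blast+

lemma flow_unique:
  assumes "continuous_on {0..1} P" "ode_sol P (\<lambda>_. 0) z" "x \<in> {0..1}" "u = z 0"
  shows "flow P u x = z x"
  by (rule ode_sol_unique[OF flow_sol[OF assms(1)] assms(2,1) _ assms(3)]) (simp add: assms)

lemma flow_add:
  assumes "continuous_on {0..1} P" "x \<in> {0..1}"
  shows "flow P (u + w) x = flow P u x + flow P w x"
proof -
  have "ode_sol P (\<lambda>_. 0) (\<lambda>x. flow P u x + flow P w x)"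
    using ode_sol_add[OF flow_sol[OF assms(1)] flow_sol[OF assms(1)]] by simp
  then show ?thesis using assms by (intro flow_unique) auto
qed

lemma flow_scaleR:
  assumes "continuous_on {0..1} P" "x \<in> {0..1}"
  shows "flow P (c *\<^sub>R u) x = c *\<^sub>R flow P u x"
proof -
  have "ode_sol P (\<lambda>_. 0) (\<lambda>x. c *\<^sub>R flow P u x)"
    using ode_sol_scale[OF flow_sol[OF assms(1)], of c] by simp
  then show ?thesis using assms by (intro flow_unique) auto
qed

lemma flow_diff:
  assumes "continuous_on {0..1} P" "x \<in> {0..1}"
  shows "flow P (u - w) x = flow P u x - flow P w x"
  using flow_add[OF assms, of u "(-1) *\<^sub>R w"] flow_scaleR[OF assms, of "-1" w] by simp

lemma flow_norm_le:
  assumes "continuous_on {0..1} P" "\<And>x. x \<in> {0..1} \<Longrightarrow> \<bar>P x\<bar> \<le> B" "x \<in> {0..1}"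
  shows "norm (flow P u x) \<le> exp (B + 2) * norm u"
proof -
  have B0: "B \<ge> 0" using assms(2)[of 0] by auto
  have "(norm (flow P u x))\<^sup>2 \<le> exp (B + 2) * (norm u)\<^sup>2"
    using ode_energy_upper[OF flow_sol[OF assms(1)] assms(2), of 0 x u] assms by simp
  also have "\<dots> \<le> (exp (B + 2))\<^sup>2 * (norm u)\<^sup>2"
    using B0 by (intro mult_right_mono) (auto simp: power2_eq_square)
  finally show ?thesis
    by (metis power_mult_distrib abs_le_square_iff abs_of_nonneg exp_ge_zero mult_nonneg_nonneg norm_ge_zero)
qed

lemma flow_norm_ge:
  assumes "continuous_on {0..1} P" "\<And>x. x \<in> {0..1} \<Longrightarrow> \<bar>P x\<bar> \<le> B" "x \<in> {0..1}"
  shows "(norm u)\<^sup>2 \<le> exp (B + 1) * (norm (flow P u x))\<^sup>2"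
  using ode_energy_lower[OF flow_sol[OF assms(1)] assms(2), of x u] assms by simp

lemma flow_eq_0_iff:
  assumes "continuous_on {0..1} P" "x \<in> {0..1}"
  shows "flow P u x = 0 \<longleftrightarrow> u = 0"
proof -
  obtain B where B: "\<And>x. x \<in> {0..1} \<Longrightarrow> \<bar>P x\<bar> \<le> B"
    using compact_imp_bounded[OF compact_continuous_image[OF assms(1)]]
    by (force simp: bounded_iff)
  from flow_norm_ge[OF assms(1) B assms(2), of u] flow_norm_le[OF assms(1) B assms(2), of u]
  show ?thesis by auto
qed

text \<open>The difference starts at 0 and solves the equation for \<open>P\<close> with forcing
  \<open>(R - P) y\<close>, where \<open>y\<close> is the solution for \<open>R\<close>; the energy
  estimate is applied to it.\<close>

lemma flow_perturb:
  assumes "continuous_on {0..1} P" "continuous_on {0..1} R"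
    "\<And>x. x \<in> {0..1} \<Longrightarrow> \<bar>P x\<bar> \<le> B" "\<And>x. x \<in> {0..1} \<Longrightarrow> \<bar>R x\<bar> \<le> B"
    "\<And>x. x \<in> {0..1} \<Longrightarrow> \<bar>P x - R x\<bar> \<le> \<epsilon>" and x: "x \<in> {0..1}"
  shows "norm (flow P u x - flow R u x) \<le> exp (2 * B + 4) * \<epsilon> * norm u"
proof -
  have B0: "B \<ge> 0" using assms(3)[of 0] by auto
  have e0: "\<epsilon> \<ge> 0" using assms(5)[of 0] by auto
  let ?z = "\<lambda>x. flow P u x - flow R u x"
  let ?f = "\<lambda>x. (R x - P x) * fst (flow R u x)"
  let ?F = "\<epsilon> * (exp (B + 2) * norm u)"
  have sol: "ode_sol P ?f ?z"
    unfolding ode_sol_def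
  proof
    fix t :: real assume t: "t \<in> {0..1}"
    show "((\<lambda>x. fst (?z x)) has_real_derivative snd (?z t)) (at t within {0..1}) \<and>
      ((\<lambda>x. snd (?z x)) has_real_derivative ?f t - P t * fst (?z t)) (at t within {0..1})"
      using DERIV_diff[OF ode_solD(1)[OF flow_sol[OF assms(1), of u] t] ode_solD(1)[OF flow_sol[OF assms(2), of u] t]]
        DERIV_diff[OF ode_solD(2)[OF flow_sol[OF assms(1), of u] t] ode_solD(2)[OF flow_sol[OF assms(2), of u] t]]
      by (simp add: algebra_simps)
  qed
  have F: "\<bar>?f t\<bar> \<le> ?F" if t: "t \<in> {0..1}" for t
  proof -
    have "\<bar>fst (flow R u t)\<bar> \<le> norm (flow R u t)" using norm_fst_le[of "fst (flow R u t)" "snd (flow R u t)"] by simp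
    also have "\<dots> \<le> exp (B + 2) * norm u" by (rule flow_norm_le[OF assms(2,4) t])
    finally show ?thesis using assms(5)[OF t] e0 by (auto simp: abs_mult abs_minus_commute intro!: mult_mono)
  qed
  have "(norm (?z x))\<^sup>2 \<le> exp (B + 2) * ((norm (?z 0))\<^sup>2 + ?F\<^sup>2)"
    by (rule ode_energy_upper[OF sol assms(3) F x])
  also have "?z 0 = 0" using assms by simp
  finally have "(norm (?z x))\<^sup>2 \<le> exp (B + 2) * ?F\<^sup>2" by simp
  also have "\<dots> \<le> (exp (B + 2))\<^sup>2 * ?F\<^sup>2"
    using B0 by (intro mult_right_mono) (auto simp: power2_eq_square)
  also have "\<dots> = (exp (2 * B + 4) * \<epsilon> * norm u)\<^sup>2"
    by (simp add: power_mult_distrib power2_eq_square mult_ac flip: exp_add)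
  finally show ?thesis
    using e0 by (metis abs_le_square_iff abs_of_nonneg exp_ge_zero mult_nonneg_nonneg norm_ge_zero)
qed

text \<open>The initial value, the potential and the point are changed one after the other, and each
  change has its own estimate.\<close>

lemma flow_continuous_param:
  fixes P :: "'a::metric_space \<Rightarrow> real \<Rightarrow> real" and u :: "'a \<Rightarrow> real \<times> real"
  assumes "\<And>p. p \<in> K \<Longrightarrow> continuous_on {0..1} (P p)"
    and "\<And>p x. p \<in> K \<Longrightarrow> x \<in> {0..1} \<Longrightarrow> \<bar>P p x\<bar> \<le> B"
    and "\<And>p r x. p \<in> K \<Longrightarrow> r \<in> K \<Longrightarrow> x \<in> {0..1} \<Longrightarrow> \<bar>P p x - P r x\<bar> \<le> M * dist p r"
    and u: "continuous_on K u"
  shows "continuous_on (K \<times> {0..1}) (\<lambda>(p, x). flow (P p) (u p) x)"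
  unfolding continuous_on_def
proof
  fix px :: "'a \<times> real" assume px: "px \<in> K \<times> {0..1}"
  then obtain p x where eq: "px = (p, x)" and p: "p \<in> K" and x: "x \<in> {0..1}" by auto
  let ?F = "at px within K \<times> {0..1}"
  let ?h = "\<lambda>y. exp (B + 2) * norm (u (fst y) - u p) + exp (2 * B + 4) * (M * dist (fst y) p) * norm (u p)
      + norm (flow (P p) (u p) (snd y) - flow (P p) (u p) x)"
  have fs: "((\<lambda>y. fst y) \<longlongrightarrow> p) ?F" "((\<lambda>y. snd y) \<longlongrightarrow> x) ?F"
    by (auto intro!: tendsto_eq_intros simp: eq)
  have evK: "\<forall>\<^sub>F y in ?F. y \<in> K \<times> {0..1}" by (simp add: eventually_at_filter)
  have t1: "((\<lambda>y. u (fst y)) \<longlongrightarrow> u p) ?F"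
    by (rule continuous_on_tendsto_compose[OF u fs(1) p]) (use evK in \<open>auto elim: eventually_mono\<close>)
  have t2: "((\<lambda>y. flow (P p) (u p) (snd y)) \<longlongrightarrow> flow (P p) (u p) x) ?F"
    by (rule continuous_on_tendsto_compose[OF ode_sol_continuous[OF flow_sol[OF assms(1)[OF p]]] fs(2) x])
      (use evK in \<open>auto elim: eventually_mono\<close>)
  have "(?h \<longlongrightarrow> exp (B + 2) * norm (u p - u p) + exp (2 * B + 4) * (M * dist p p) * norm (u p)
      + norm (flow (P p) (u p) x - flow (P p) (u p) x)) ?F"
    by (intro tendsto_intros t1 t2 fs)
  then have h0: "(?h \<longlongrightarrow> 0) ?F" by simp
  have "((\<lambda>y. (case y of (p, x) \<Rightarrow> flow (P p) (u p) x) - flow (P p) (u p) x) \<longlongrightarrow> 0) ?F"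
  proof (rule Lim_null_comparison[OF _ h0], rule eventually_mono[OF evK])
    fix y :: "'a \<times> real" assume y: "y \<in> K \<times> {0..1}"
    obtain r t where yr: "y = (r, t)" by fastforce
    then have r: "r \<in> K" and t: "t \<in> {0..1}" using y by auto
    have "flow (P r) (u r) t - flow (P p) (u p) x
       = flow (P r) (u r - u p) t + (flow (P r) (u p) t - flow (P p) (u p) t)
          + (flow (P p) (u p) t - flow (P p) (u p) x)"
      using flow_diff[OF assms(1)[OF r] t] by simp
    moreover have "norm (flow (P r) (u r - u p) t) \<le> exp (B + 2) * norm (u r - u p)"
      by (rule flow_norm_le[OF assms(1)[OF r] assms(2)[OF r] t])
    moreover have "norm (flow (P r) (u p) t - flow (P p) (u p) t) \<le> exp (2 * B + 4) * (M * dist r p) * norm (u p)"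
      by (rule flow_perturb[OF assms(1)[OF r] assms(1)[OF p] assms(2)[OF r] assms(2)[OF p] assms(3)[OF r p] t])
    ultimately show "norm ((case y of (p, x) \<Rightarrow> flow (P p) (u p) x) - flow (P p) (u p) x) \<le> ?h y"
      unfolding yr by (simp only: prod.case fst_conv snd_conv) (intro norm_triangle_le add_mono; simp)
  qed
  then show "((\<lambda>(p, x). flow (P p) (u p) x) \<longlongrightarrow> (case px of (p, x) \<Rightarrow> flow (P p) (u p) x)) ?F"
    using eq by (simp add: Lim_null[symmetric] LIM_zero_iff)
qed

section \<open>Decaying radial solutions\<close>

lemma continuous_Icc_bounded:
  fixes f :: "real \<Rightarrow> real"
  assumes "continuous_on {a..c} f" shows "\<exists>M. \<forall>x\<in>{a..c}. \<bar>f x\<bar> \<le> M"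
  using compact_imp_bounded[OF compact_continuous_image[OF assms]] by (force simp: bounded_iff)

text \<open>Lagrange's identity. With equal potentials it says that the Wronskian is constant; with
  two parameter values it controls the dependence on the parameter.\<close>

lemma ode_wronskian:
  assumes "ode_sol P (\<lambda>_. 0) z" "ode_sol R (\<lambda>_. 0) w"
  shows "((\<lambda>x. (P x - R x) * fst (z x) * fst (w x)) has_integral
     (fst (z 1) * snd (w 1) - snd (z 1) * fst (w 1)) - (fst (z 0) * snd (w 0) - snd (z 0) * fst (w 0))) {0..1}"
proof (rule fundamental_theorem_of_calculus)
  fix x :: real assume x: "x \<in> {0..1}"
  have "((\<lambda>x. fst (z x) * snd (w x) - snd (z x) * fst (w x)) has_real_derivative
     (P x - R x) * fst (z x) * fst (w x)) (at x within {0..1})"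
    by (rule derivative_eq_intros ode_solD[OF assms(1) x] ode_solD[OF assms(2) x] refl)+
      (simp add: algebra_simps)
  then show "((\<lambda>x. fst (z x) * snd (w x) - snd (z x) * fst (w x)) has_vector_derivative
     (P x - R x) * fst (z x) * fst (w x)) (at x within {0..1})"
    by (simp add: has_real_derivative_iff_has_vector_derivative)
qed simp

text \<open>For positive \<mu> these two functions are \<open>cos (sqrt \<mu>)\<close> and
  \<open>sin (sqrt \<mu>) / sqrt \<mu>\<close>, for negative \<mu> their hyperbolic analogues. The
  definition by the flow makes them continuous through 0 without a case distinction.\<close>

definition cosq :: "real \<Rightarrow> real" where "cosq \<mu> = fst (flow (\<lambda>_. \<mu>) (1, 0) 1)"
definition sinq :: "real \<Rightarrow> real" where "sinq \<mu> = fst (flow (\<lambda>_. \<mu>) (0, 1) 1)"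

text \<open>For a constant potential the derivative of a solution is a solution again, so the
  sine-type solution determines the cosine-type one.\<close>

lemma flow_const_aux:
  assumes x: "x \<in> {0..1}"
  shows "flow (\<lambda>_. \<mu>) (1, 0) x = (snd (flow (\<lambda>_. \<mu>) (0, 1) x), - \<mu> * fst (flow (\<lambda>_. \<mu>) (0, 1) x))"
proof (rule flow_unique[OF _ _ x])
  show "ode_sol (\<lambda>_. \<mu>) (\<lambda>_. 0) (\<lambda>x. (snd (flow (\<lambda>_. \<mu>) (0, 1) x), - \<mu> * fst (flow (\<lambda>_. \<mu>) (0, 1) x)))"
    unfolding ode_sol_def
  proof (intro ballI conjI)
    fix x :: real assume x: "x \<in> {0..1}"
    note d = ode_solD[OF flow_sol[of "\<lambda>_. \<mu>" "(0, 1)"] x]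
    from d show "((\<lambda>x. fst (snd (flow (\<lambda>_. \<mu>) (0, 1) x), - \<mu> * fst (flow (\<lambda>_. \<mu>) (0, 1) x))) has_real_derivative
          snd (snd (flow (\<lambda>_. \<mu>) (0, 1) x), - \<mu> * fst (flow (\<lambda>_. \<mu>) (0, 1) x))) (at x within {0..1})"
      by simp
    from DERIV_cmult[OF d(1), of "-\<mu>"] show "((\<lambda>x. snd (snd (flow (\<lambda>_. \<mu>) (0, 1) x), - \<mu> * fst (flow (\<lambda>_. \<mu>) (0, 1) x))) has_real_derivative
          0 - \<mu> * fst (snd (flow (\<lambda>_. \<mu>) (0, 1) x), - \<mu> * fst (flow (\<lambda>_. \<mu>) (0, 1) x))) (at x within {0..1})"
      by simp
  qed
qed auto

lemma flow_const_1:
  "flow (\<lambda>_. \<mu>) u 1 = (cosq \<mu> * fst u + sinq \<mu> * snd u, - \<mu> * sinq \<mu> * fst u + cosq \<mu> * snd u)"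
proof -
  have "flow (\<lambda>_. \<mu>) u 1 = flow (\<lambda>_. \<mu>) (fst u *\<^sub>R (1, 0) + snd u *\<^sub>R (0, 1)) 1" by simp
  also have "\<dots> = fst u *\<^sub>R flow (\<lambda>_. \<mu>) (1, 0) 1 + snd u *\<^sub>R flow (\<lambda>_. \<mu>) (0, 1) 1"
    by (subst flow_add; simp add: flow_scaleR del: scaleR_Pair)
  finally show ?thesis
    using flow_const_aux[of 1 \<mu>] by (simp add: cosq_def sinq_def prod_eq_iff)
qed

text \<open>The constant Wronskian of the two fundamental solutions. It makes \<open>B\<close> the
  determinant of the transfer map \<open>B0\<close>.\<close>

lemma cosq_sinq: "(cosq \<mu>)\<^sup>2 + \<mu> * (sinq \<mu>)\<^sup>2 = 1"
proof -
  have "((\<lambda>x. 0) has_integral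
     (fst (flow (\<lambda>_. \<mu>) (1, 0) 1) * snd (flow (\<lambda>_. \<mu>) (0, 1) 1) - snd (flow (\<lambda>_. \<mu>) (1, 0) 1) * fst (flow (\<lambda>_. \<mu>) (0, 1) 1)) - 1) {0..1::real}"
    using ode_wronskian[OF flow_sol[of "\<lambda>_. \<mu>" "(1,0)"] flow_sol[of "\<lambda>_. \<mu>" "(0,1)"]] by simp
  then have "(fst (flow (\<lambda>_. \<mu>) (1, 0) 1) * snd (flow (\<lambda>_. \<mu>) (0, 1) 1) - snd (flow (\<lambda>_. \<mu>) (1, 0) 1) * fst (flow (\<lambda>_. \<mu>) (0, 1) 1)) - 1 = 0"
    using has_integral_unique[OF _ has_integral_0] by blast
  then show ?thesis by (simp add: flow_const_1 power2_eq_square)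
qed

lemma continuous_cosq_sinq: "bounded J \<Longrightarrow> continuous_on J cosq \<and> continuous_on J sinq"
proof -
  assume "bounded J"
  then obtain B where B: "\<And>\<mu>. \<mu> \<in> J \<Longrightarrow> \<bar>\<mu>\<bar> \<le> B" by (auto simp: bounded_iff)
  have "continuous_on (J \<times> {0..1}) (\<lambda>(\<mu>, x). flow (\<lambda>_. \<mu>) u x)" for u
    by (rule flow_continuous_param[where B=B and M=1]) (auto simp: B dist_real_def)
  then have "continuous_on J (\<lambda>\<mu>. (case (\<mu>, 1) of (\<mu>, x) \<Rightarrow> flow (\<lambda>_. \<mu>) u x))" for u
    by (rule continuous_on_compose2) (auto intro!: continuous_intros)
  then have "continuous_on J (\<lambda>\<mu>. flow (\<lambda>_. \<mu>) u 1)" for u by simp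
  then show ?thesis unfolding cosq_def[abs_def] sinq_def[abs_def] by (intro conjI continuous_on_fst)
qed

section \<open>Transfer maps over one generation\<close>

locale radial =
  fixes b :: nat and q :: "real \<Rightarrow> real" and c C :: real
  assumes b2: "b \<ge> 2" and q_cont: "continuous_on UNIV q" and c_pos: "c > 0"
    and q_lower: "\<And>t. t \<ge> 0 \<Longrightarrow> c * real b powr (- 2 * t) \<le> q t"
    and q_upper: "\<And>t. t \<ge> 0 \<Longrightarrow> q t \<le> C * real b powr (- 2 * t)"
    and q_diff: "\<And>t. t > 0 \<Longrightarrow> (q has_real_derivative deriv q t) (at t)"
    and q_deriv: "\<And>t. t > 0 \<Longrightarrow> \<bar>deriv q t\<bar> \<le> C * real b powr (- 2 * t)"
begin

abbreviation B :: real where "B \<equiv> real b"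

text \<open>A bound for \<open>q\<close> on the whole edge between the heights \<open>n\<close> and
  \<open>n + 1\<close>. Its fall by \<open>B\<^sup>2\<close> per generation drives all convergence
  arguments.\<close>

definition qbar :: "nat \<Rightarrow> real" where "qbar n = C * (1 / B\<^sup>2) ^ n"

lemma B2: "B \<ge> 2" using b2 by simp

lemma C_pos: "C > 0"
  using q_lower[of 0] q_upper[of 0] c_pos B2 by simp

lemma qbar_pos: "qbar n > 0"
  using C_pos B2 by (simp add: qbar_def)

lemma qbar_add: "qbar (n + j) = qbar n * (1 / B\<^sup>2) ^ j"
  by (simp add: qbar_def power_add)

lemma qbar_antimono: "n \<le> m \<Longrightarrow> qbar m \<le> qbar n"
  using C_pos B2 by (auto simp: qbar_def intro!: mult_left_mono power_decreasing)

lemma q_pos: "t \<ge> 0 \<Longrightarrow> q t > 0"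
  using q_lower[of t] c_pos B2 by (smt (verit) mult_pos_pos powr_gt_zero)

lemma q_le_qbar:
  assumes "x \<in> {0..1}" shows "q (real n + 1 - x) \<le> qbar n"
proof -
  have "q (real n + 1 - x) \<le> C * B powr (- 2 * (real n + 1 - x))"
    using assms by (intro q_upper) auto
  also have "\<dots> \<le> C * B powr (- 2 * real n)"
  proof -
    have "- 2 * (real n + 1 - x) \<le> - 2 * real n" using assms by simp
    then show ?thesis using C_pos B2 by (simp add: powr_mono)
  qed
  also have "B powr (- 2 * real n) = (1 / B\<^sup>2) ^ n"
  proof -
    have "B powr (- 2 * real n) = 1 / B powr real (2 * n)" by (simp add: powr_minus divide_inverse)
    also have "\<dots> = 1 / B ^ (2 * n)" using B2 by (subst powr_realpow) auto
    finally show ?thesis by (simp add: power_one_over power_mult)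
  qed
  finally show ?thesis by (simp add: qbar_def)
qed

text \<open>A parameter is a pair \<open>p = (s, \<mu>)\<close>.  Between the heights \<open>n\<close> and \<open>n + 1\<close> the variable is
  \<open>x = n + 1 - t\<close>, so the transfer maps lead towards the root.\<close>

definition pot :: "nat \<Rightarrow> real \<times> real \<Rightarrow> real \<Rightarrow> real" where
  "pot n p x = snd p + fst p * q (real n + 1 - x)"

lemma q_cont': "continuous_on S q"
  using q_cont continuous_on_subset by blast

lemma pot_cont: "continuous_on S (pot n p)"
  unfolding pot_def by (intro continuous_intros continuous_on_compose2[OF q_cont]) auto

lemma q_abs_le: "x \<in> {0..1} \<Longrightarrow> \<bar>q (real n + 1 - x)\<bar> \<le> qbar n"
  using q_le_qbar[of x n] q_pos[of "real n + 1 - x"] by auto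

lemma pot_diff:
  assumes "x \<in> {0..1}"
  shows "\<bar>pot n p x - pot n r x\<bar> \<le> (1 + qbar n) * dist p r"
proof -
  have "pot n p x - pot n r x = (snd p - snd r) + (fst p - fst r) * q (real n + 1 - x)"
    by (simp add: pot_def algebra_simps)
  moreover have "\<bar>snd p - snd r\<bar> \<le> dist p r" "\<bar>fst p - fst r\<bar> \<le> dist p r"
    using dist_snd_le[of p r] dist_fst_le[of p r] by (auto simp: dist_real_def)
  moreover have "\<bar>(fst p - fst r) * q (real n + 1 - x)\<bar> \<le> dist p r * qbar n"
    using calculation(3) q_abs_le[OF assms, of n] by (auto simp: abs_mult intro!: mult_mono)
  ultimately show ?thesis by (simp add: algebra_simps)
qed

text \<open>A state at a vertex is the value with the derivative on each of the \<open>b\<close> edges above the vertex;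
  the derivative on the edge below it is \<open>b\<close> times as large.\<close>

definition Bk :: "nat \<Rightarrow> real \<times> real \<Rightarrow> real \<times> real \<Rightarrow> real \<times> real" where
  "Bk n p u = (let z = flow (pot n p) (fst u, - B * snd u) 1 in (fst z, - snd z))"

text \<open>The transfer map for \<open>s = 0\<close>, a matrix of trace
  \<open>(1 + B) cosq \<mu>\<close> and determinant \<open>B\<close>. Its eigenvalues are real when
  the modulus of the trace is at least \<open>2 sqrt B\<close>, which describes the closed
  gaps.\<close>

definition B0 :: "real \<Rightarrow> real \<times> real \<Rightarrow> real \<times> real" where
  "B0 \<mu> u = (cosq \<mu> * fst u - B * sinq \<mu> * snd u, \<mu> * sinq \<mu> * fst u + B * cosq \<mu> * snd u)"

lemma Bk_zero: "Bk n (0, \<mu>) u = B0 \<mu> u"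
proof -
  have "pot n (0, \<mu>) = (\<lambda>_. \<mu>)" by (simp add: pot_def fun_eq_iff)
  then show ?thesis by (simp add: Bk_def B0_def flow_const_1 Let_def algebra_simps)
qed

lemma Bk_diff: "Bk n p (u - w) = Bk n p u - Bk n p w"
  using flow_diff[OF pot_cont, of 1 n p "(fst u, - B * snd u)" "(fst w, - B * snd w)"]
  by (simp add: Bk_def Let_def prod_eq_iff algebra_simps)

lemma Bk_eq_0_iff: "Bk n p u = 0 \<longleftrightarrow> u = 0"
  using flow_eq_0_iff[OF pot_cont, of 1 n p "(fst u, - B * snd u)"] B2
  by (auto simp: Bk_def Let_def prod_eq_iff)

lemma norm_scaled_le:
  fixes u :: "real \<times> real"
  shows "norm (fst u, - B * snd u) \<le> B * norm u"
proof -
  have "1 * (fst u)\<^sup>2 \<le> B\<^sup>2 * (fst u)\<^sup>2" using B2 by (intro mult_right_mono) (auto simp: one_le_power)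
  then have "(norm (fst u, - B * snd u))\<^sup>2 \<le> (B * fst u)\<^sup>2 + (B * snd u)\<^sup>2"
    by (simp add: norm_Pair power_mult_distrib)
  also have "\<dots> = (B * norm u)\<^sup>2"
    by (cases u) (simp add: norm_Pair power_mult_distrib algebra_simps)
  finally show ?thesis by (rule power2_le_imp_le) simp
qed

lemma norm_neg_snd: "norm (fst z, - snd z) = norm (z :: real \<times> real)"
  by (cases z) (simp add: norm_Pair)

lemma pot_bound:
  assumes "x \<in> {0..1}" "0 \<le> fst p" "fst p * qbar n \<le> h" "\<bar>snd p\<bar> \<le> D"
  shows "\<bar>pot n p x\<bar> \<le> D + h"
proof -
  have "fst p * q (real n + 1 - x) \<le> fst p * qbar n"
    using q_le_qbar[OF assms(1)] assms(2) by (intro mult_left_mono)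
  moreover have "0 \<le> fst p * q (real n + 1 - x)"
    using q_pos[of "real n + 1 - x"] assms by (intro mult_nonneg_nonneg) auto
  ultimately show ?thesis using assms by (simp add: pot_def)
qed

lemma Bk_perturb:
  assumes "0 \<le> s" "s * qbar n \<le> 1" "\<bar>\<mu>\<bar> \<le> D"
  shows "norm (Bk n (s, \<mu>) u - B0 \<mu> u) \<le> exp (2 * (D + 1) + 4) * (s * qbar n) * (B * norm u)"
proof -
  let ?w = "(fst u, - B * snd u)"
  have "Bk n (s, \<mu>) u - B0 \<mu> u
     = (\<lambda>z. (fst z, - snd z)) (flow (pot n (s, \<mu>)) ?w 1 - flow (pot n (0, \<mu>)) ?w 1)"
    by (simp add: Bk_zero[symmetric, of _ _ n]) (simp add: Bk_def Let_def)
  then have "norm (Bk n (s, \<mu>) u - B0 \<mu> u) = norm (flow (pot n (s, \<mu>)) ?w 1 - flow (pot n (0, \<mu>)) ?w 1)"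
    by (simp only: norm_neg_snd)
  also have "\<dots> \<le> exp (2 * (D + 1) + 4) * (s * qbar n) * norm ?w"
  proof (rule flow_perturb[OF pot_cont pot_cont])
    fix x :: real assume x: "x \<in> {0..1}"
    show "\<bar>pot n (s, \<mu>) x\<bar> \<le> D + 1" "\<bar>pot n (0, \<mu>) x\<bar> \<le> D + 1"
      using pot_bound[OF x, of "(s, \<mu>)" n 1 D] pot_bound[OF x, of "(0, \<mu>)" n 1 D] assms by auto
    show "\<bar>pot n (s, \<mu>) x - pot n (0, \<mu>) x\<bar> \<le> s * qbar n"
      using q_abs_le[OF x, of n] assms by (simp add: pot_def abs_mult mult_left_mono)
  qed simp
  also have "\<dots> \<le> exp (2 * (D + 1) + 4) * (s * qbar n) * (B * norm u)"
    using assms qbar_pos[of n] by (intro mult_left_mono norm_scaled_le mult_nonneg_nonneg) auto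
  finally show ?thesis .
qed

end

text \<open>A compact set of levels from the closure of one gap. \<open>sg\<close> is the sign of
  the trace of \<open>B0 \<mu>\<close>, and the last condition makes its eigenvalues real. The
  condition on \<open>sinq\<close> keeps away from the Dirichlet eigenvalues of the unit interval,
  where the eigenvector for the larger eigenvalue has first coordinate 0.\<close>

locale window = radial +
  fixes J :: "real set" and sg :: real
  assumes J_compact: "compact J" and sg: "sg = 1 \<or> sg = -1"
    and J_sinq: "\<And>\<mu>. \<mu> \<in> J \<Longrightarrow> sinq \<mu> \<noteq> 0"
    and J_cosq: "\<And>\<mu>. \<mu> \<in> J \<Longrightarrow> 2 * sqrt B \<le> (1 + B) * (sg * cosq \<mu>)"
begin

text \<open>\<open>bet \<mu>\<close> is the eigenvalue of \<open>B0 \<mu>\<close> of larger modulus and \<open>(1, slope \<mu>)\<close> an eigenvector.\<close>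

definition bet :: "real \<Rightarrow> real" where
  "bet \<mu> = sg * (((1 + B) * (sg * cosq \<mu>) + sqrt (((1 + B) * (sg * cosq \<mu>))\<^sup>2 - 4 * B)) / 2)"

definition slope :: "real \<Rightarrow> real" where
  "slope \<mu> = (cosq \<mu> - bet \<mu>) / (B * sinq \<mu>)"

lemma sg_sq: "sg * sg = 1" "sg\<^sup>2 = 1" "\<bar>sg\<bar> = 1" using sg by auto

text \<open>The two roots of the characteristic equation have product \<open>B\<close>; so the
  larger one has modulus at least \<open>sqrt B\<close>, and strictly more unless the roots
  coincide.\<close>

lemma bet_props:
  assumes "\<mu> \<in> J"
  shows "sqrt B \<le> sg * bet \<mu>" "bet \<mu> * bet \<mu> + B = (1 + B) * cosq \<mu> * bet \<mu>"
    "2 * sqrt B < (1 + B) * (sg * cosq \<mu>) \<Longrightarrow> sqrt B < sg * bet \<mu>"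
proof -
  define y where "y = (1 + B) * (sg * cosq \<mu>)"
  have y: "2 * sqrt B \<le> y" using J_cosq[OF assms] by (simp add: y_def)
  have sb: "sg * bet \<mu> = (y + sqrt (y\<^sup>2 - 4 * B)) / 2"
    using sg_sq by (simp add: bet_def y_def mult.assoc[symmetric])
  have "(2 * sqrt B)\<^sup>2 \<le> y\<^sup>2" using y by (intro power_mono) auto
  then have ge: "y\<^sup>2 - 4 * B \<ge> 0" by (simp add: power_mult_distrib)
  define r where "r = sqrt (y\<^sup>2 - 4 * B)"
  have "r \<ge> 0" using ge by (simp add: r_def)
  then show "sqrt B \<le> sg * bet \<mu>" "2 * sqrt B < (1 + B) * (sg * cosq \<mu>) \<Longrightarrow> sqrt B < sg * bet \<mu>"
    unfolding sb y_def[symmetric] r_def[symmetric] using y by (auto simp: field_simps)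
  have "(sg * bet \<mu>) * (sg * bet \<mu>) + B = y * (sg * bet \<mu>)"
    unfolding sb using real_sqrt_mult_self[of "y\<^sup>2 - 4 * B"] ge by (simp add: field_simps power2_eq_square)
  moreover have "(sg * bet \<mu>) * (sg * bet \<mu>) = bet \<mu> * bet \<mu>"
    using sg by auto
  moreover have "y * (sg * bet \<mu>) = (1 + B) * cosq \<mu> * bet \<mu>" using sg by (auto simp: y_def)
  ultimately show "bet \<mu> * bet \<mu> + B = (1 + B) * cosq \<mu> * bet \<mu>" by simp
qed

lemma bet_abs:
  assumes "\<mu> \<in> J" shows "\<bar>bet \<mu>\<bar> = sg * bet \<mu>" "\<bar>bet \<mu>\<bar> \<ge> sqrt B" "\<bar>bet \<mu>\<bar> \<ge> 1" "bet \<mu> \<noteq> 0" "(bet \<mu>)\<^sup>2 \<ge> B"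
proof -
  have s1: "sqrt B \<ge> 1" using B2 by simp
  have "sg * bet \<mu> > 0" using bet_props(1)[OF assms] s1 by linarith
  then show 1: "\<bar>bet \<mu>\<bar> = sg * bet \<mu>" using sg by auto
  then show 2: "\<bar>bet \<mu>\<bar> \<ge> sqrt B" using bet_props(1)[OF assms] by simp
  then show "\<bar>bet \<mu>\<bar> \<ge> 1" using s1 by linarith
  then show "bet \<mu> \<noteq> 0" by auto
  have "(sqrt B)\<^sup>2 \<le> \<bar>bet \<mu>\<bar>\<^sup>2" using 2 by (intro power_mono) auto
  then show "(bet \<mu>)\<^sup>2 \<ge> B" by simp
qed

definition evec :: "real \<Rightarrow> real \<times> real" where "evec \<mu> = (1, slope \<mu>)"

text \<open>In the coordinates \<open>fst u\<close> and \<open>snd u - slope \<mu> fst u\<close> the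
  map is triangular with diagonal \<open>bet \<mu>\<close> and \<open>B / bet \<mu>\<close>. A
  diagonal form would break down at the ends of the gap, where these two numbers coincide.\<close>

lemma B0_coord:
  assumes "\<mu> \<in> J"
  shows "fst (B0 \<mu> u) = bet \<mu> * fst u - B * sinq \<mu> * (snd u - slope \<mu> * fst u)"
    "snd (B0 \<mu> u) - slope \<mu> * fst (B0 \<mu> u) = B / bet \<mu> * (snd u - slope \<mu> * fst u)"
proof -
  have s: "B * sinq \<mu> * slope \<mu> = cosq \<mu> - bet \<mu>"
    using J_sinq[OF assms] B2 by (simp add: slope_def)
  show 1: "fst (B0 \<mu> u) = bet \<mu> * fst u - B * sinq \<mu> * (snd u - slope \<mu> * fst u)"
    using arg_cong[OF s, of "\<lambda>z. z * fst u"] by (simp add: B0_def algebra_simps)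
  have nz: "bet \<mu> \<noteq> 0" "B * sinq \<mu> \<noteq> 0" using bet_abs[OF assms] J_sinq[OF assms] B2 by auto
  have e: "B / bet \<mu> = (1 + B) * cosq \<mu> - bet \<mu>"
    using bet_props(2)[OF assms] nz by (simp add: field_simps)
  \<comment> \<open>This is the second row of the eigenvector equation. After multiplication by the
    nonzero number \<open>B sinq \<mu>\<close> it follows from \<open>cosq_sinq\<close> and the
    characteristic equation.\<close>
  have "\<mu> * sinq \<mu> + slope \<mu> * (B * cosq \<mu> - bet \<mu>) = 0"
  proof -
    have "(B * sinq \<mu>) * (\<mu> * sinq \<mu> + slope \<mu> * (B * cosq \<mu> - bet \<mu>))
        = B * (\<mu> * (sinq \<mu>)\<^sup>2) + (B * sinq \<mu> * slope \<mu>) * (B * cosq \<mu> - bet \<mu>)"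
      by (simp add: algebra_simps power2_eq_square)
    also have "\<mu> * (sinq \<mu>)\<^sup>2 = 1 - (cosq \<mu>)\<^sup>2" using cosq_sinq[of \<mu>] by simp
    also have "B * (1 - (cosq \<mu>)\<^sup>2) + (B * sinq \<mu> * slope \<mu>) * (B * cosq \<mu> - bet \<mu>) = 0"
      unfolding s using bet_props(2)[OF assms] by (simp add: algebra_simps power2_eq_square)
    finally show ?thesis using nz by simp
  qed
  then have m: "\<mu> * sinq \<mu> = slope \<mu> * bet \<mu> - slope \<mu> * (B * cosq \<mu>)" by (simp add: algebra_simps)
  have "snd (B0 \<mu> u) - slope \<mu> * fst (B0 \<mu> u)
     = (\<mu> * sinq \<mu>) * fst u + B * cosq \<mu> * snd u - slope \<mu> * bet \<mu> * fst u + (B * sinq \<mu> * slope \<mu>) * (snd u - slope \<mu> * fst u)"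
    unfolding 1 by (simp add: B0_def algebra_simps)
  also have "\<dots> = ((1 + B) * cosq \<mu> - bet \<mu>) * (snd u - slope \<mu> * fst u)"
    unfolding s m by (simp add: algebra_simps)
  finally show "snd (B0 \<mu> u) - slope \<mu> * fst (B0 \<mu> u) = B / bet \<mu> * (snd u - slope \<mu> * fst u)"
    unfolding e .
qed

lemma J_bounded: "bounded J" using J_compact compact_imp_bounded by blast

lemma bet_cont: "continuous_on J bet"
  unfolding bet_def[abs_def] using continuous_cosq_sinq[OF J_bounded] by (auto intro!: continuous_intros)

lemma slope_cont: "continuous_on J slope"
  unfolding slope_def[abs_def] using continuous_cosq_sinq[OF J_bounded] bet_cont J_sinq B2
  by (auto intro!: continuous_intros)

lemma bounded_on_J: "continuous_on J f \<Longrightarrow> \<exists>M>0. \<forall>\<mu>\<in>J. \<bar>f \<mu> :: real\<bar> \<le> M"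
proof -
  assume "continuous_on J f"
  from compact_imp_bounded[OF compact_continuous_image[OF this J_compact]]
  show ?thesis by (force simp: bounded_pos)
qed

definition "D0 = (SOME M. M > 0 \<and> (\<forall>\<mu>\<in>J. \<bar>\<mu>\<bar> \<le> M))"
definition "M0 = (SOME M. M > 0 \<and> (\<forall>\<mu>\<in>J. \<bar>slope \<mu>\<bar> \<le> M))"
definition "S0 = (SOME M. M > 0 \<and> (\<forall>\<mu>\<in>J. \<bar>sinq \<mu>\<bar> \<le> M))"

lemma D0: "D0 > 0" "\<mu> \<in> J \<Longrightarrow> \<bar>\<mu>\<bar> \<le> D0"
  using someI_ex[of "\<lambda>M. M > 0 \<and> (\<forall>\<mu>\<in>J. \<bar>\<mu>\<bar> \<le> M)"] bounded_on_J[OF continuous_on_id] unfolding D0_def by auto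
lemma M0: "M0 > 0" "\<mu> \<in> J \<Longrightarrow> \<bar>slope \<mu>\<bar> \<le> M0"
  using someI_ex[of "\<lambda>M. M > 0 \<and> (\<forall>\<mu>\<in>J. \<bar>slope \<mu>\<bar> \<le> M)"] bounded_on_J[OF slope_cont] unfolding M0_def by auto
lemma S0: "S0 > 0" "\<mu> \<in> J \<Longrightarrow> \<bar>sinq \<mu>\<bar> \<le> S0"
  using someI_ex[of "\<lambda>M. M > 0 \<and> (\<forall>\<mu>\<in>J. \<bar>sinq \<mu>\<bar> \<le> M)"] bounded_on_J[of sinq] continuous_cosq_sinq[OF J_bounded]
  unfolding S0_def by auto

text \<open>The weight of the second coordinate is large enough for \<open>B0 \<mu> / bet \<mu>\<close>, which need not be
  a contraction, to have norm at most \<open>3/2\<close>.\<close>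

definition L0 :: real where "L0 = 1 + 2 * B * S0"

definition nrm :: "real \<Rightarrow> real \<times> real \<Rightarrow> real" where
  "nrm \<mu> u = \<bar>fst u\<bar> + L0 * \<bar>snd u - slope \<mu> * fst u\<bar>"

lemma L0_ge: "L0 \<ge> 1" using S0 B2 by (simp add: L0_def)

lemma nrm_triangle: "nrm \<mu> (u + w) \<le> nrm \<mu> u + nrm \<mu> w"
proof -
  have "L0 * \<bar>snd (u + w) - slope \<mu> * fst (u + w)\<bar> \<le> L0 * (\<bar>snd u - slope \<mu> * fst u\<bar> + \<bar>snd w - slope \<mu> * fst w\<bar>)"
    using L0_ge by (intro mult_left_mono) (auto simp: algebra_simps)
  then show ?thesis by (simp add: nrm_def algebra_simps)
qed

lemma nrm_scaleR: "nrm \<mu> (r *\<^sub>R u) = \<bar>r\<bar> * nrm \<mu> u"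
proof -
  have "snd (r *\<^sub>R u) - slope \<mu> * fst (r *\<^sub>R u) = r * (snd u - slope \<mu> * fst u)" by (simp add: algebra_simps)
  then show ?thesis unfolding nrm_def by (simp add: abs_mult distrib_left)
qed

lemma nrm_nonneg: "nrm \<mu> u \<ge> 0" using L0_ge by (simp add: nrm_def)

lemma nrm_le_norm:
  assumes "\<mu> \<in> J" shows "nrm \<mu> u \<le> (1 + L0 * (1 + M0)) * norm u"
proof -
  have 1: "\<bar>fst u\<bar> \<le> norm u" "\<bar>snd u\<bar> \<le> norm u"
    using norm_fst_le[of "fst u" "snd u"] norm_snd_le[of "snd u" "fst u"] by auto
  have "\<bar>slope \<mu> * fst u\<bar> \<le> M0 * norm u"
    using M0(2)[OF assms] 1 M0(1) by (auto simp: abs_mult intro!: mult_mono)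
  then have "\<bar>snd u - slope \<mu> * fst u\<bar> \<le> (1 + M0) * norm u" using 1 by (simp add: algebra_simps)
  then have "L0 * \<bar>snd u - slope \<mu> * fst u\<bar> \<le> L0 * ((1 + M0) * norm u)"
    using L0_ge by (intro mult_left_mono) auto
  then show ?thesis using 1 by (simp add: nrm_def algebra_simps)
qed

lemma norm_le_nrm:
  assumes "\<mu> \<in> J" shows "norm u \<le> (1 + M0) * nrm \<mu> u"
proof -
  have "norm u \<le> \<bar>fst u\<bar> + \<bar>snd u\<bar>" by (cases u) (simp add: norm_Pair sqrt_sum_squares_le_sum_abs)
  also have "\<bar>snd u\<bar> \<le> \<bar>snd u - slope \<mu> * fst u\<bar> + \<bar>slope \<mu> * fst u\<bar>" by simp
  also have "\<bar>slope \<mu> * fst u\<bar> \<le> M0 * \<bar>fst u\<bar>"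
    using M0(2)[OF assms] by (auto simp: abs_mult intro!: mult_right_mono)
  also have "\<bar>snd u - slope \<mu> * fst u\<bar> \<le> L0 * \<bar>snd u - slope \<mu> * fst u\<bar>"
    using L0_ge by (intro mult_right_mono[of 1 L0, simplified]) auto
  finally have 1: "norm u \<le> (1 + M0) * \<bar>fst u\<bar> + L0 * \<bar>snd u - slope \<mu> * fst u\<bar>" by (simp add: algebra_simps)
  have "L0 * \<bar>snd u - slope \<mu> * fst u\<bar> \<le> (1 + M0) * (L0 * \<bar>snd u - slope \<mu> * fst u\<bar>)"
    using M0 L0_ge by (intro mult_right_mono[of 1 "1 + M0", simplified]) auto
  with 1 show ?thesis by (simp add: nrm_def algebra_simps)
qed

section \<open>Normalised transfer maps and the decaying solution\<close>

definition A :: "nat \<Rightarrow> real \<times> real \<Rightarrow> real \<times> real \<Rightarrow> real \<times> real" where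
  "A n p u = (1 / bet (snd p)) *\<^sub>R Bk n p u"

definition A0 :: "real \<Rightarrow> real \<times> real \<Rightarrow> real \<times> real" where
  "A0 \<mu> u = (1 / bet \<mu>) *\<^sub>R B0 \<mu> u"

lemma A_diff: "A n p (u - w) = A n p u - A n p w"
  by (simp add: A_def Bk_diff scaleR_diff_right)

lemma A_zero: "A n (0, \<mu>) u = A0 \<mu> u" by (simp add: A_def A0_def Bk_zero)

lemma A0_evec: "\<mu> \<in> J \<Longrightarrow> A0 \<mu> (evec \<mu>) = evec \<mu>"
  using B0_coord[of \<mu> "evec \<mu>"] bet_abs[of \<mu>]
  by (simp add: A0_def evec_def prod_eq_iff)

lemma nrm_evec: "nrm \<mu> (evec \<mu>) = 1" by (simp add: nrm_def evec_def)

text \<open>After division by \<open>bet \<mu>\<close> the diagonal entries are 1 and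
  \<open>B / (bet \<mu>)\<^sup>2\<close>, which is at most 1. The off-diagonal entry is at most
  \<open>B S0\<close>, hence at most half of the weight \<open>L0\<close>, and adds the remaining
  \<open>1/2\<close>.\<close>

lemma nrm_A0:
  assumes "\<mu> \<in> J" shows "nrm \<mu> (A0 \<mu> u) \<le> 3 / 2 * nrm \<mu> u"
proof -
  let ?d = "snd u - slope \<mu> * fst u"
  note ba = bet_abs[OF assms]
  have 1: "fst (A0 \<mu> u) = fst u - B * sinq \<mu> / bet \<mu> * ?d"
    using ba by (simp add: A0_def B0_coord[OF assms] field_simps)
  have "snd (A0 \<mu> u) - slope \<mu> * fst (A0 \<mu> u) = (snd (B0 \<mu> u) - slope \<mu> * fst (B0 \<mu> u)) / bet \<mu>"
    by (simp add: A0_def diff_divide_distrib)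
  then have 2: "snd (A0 \<mu> u) - slope \<mu> * fst (A0 \<mu> u) = B / (bet \<mu>)\<^sup>2 * ?d"
    by (simp add: B0_coord(2)[OF assms] power2_eq_square)
  have "\<bar>B * sinq \<mu> / bet \<mu>\<bar> \<le> B * S0 / 1"
    unfolding abs_divide abs_mult using S0(1) S0(2)[OF assms] ba B2 by (intro frac_le mult_mono) auto
  also have "\<dots> \<le> L0 / 2" by (simp add: L0_def)
  finally have "\<bar>B * sinq \<mu> / bet \<mu> * ?d\<bar> \<le> L0 / 2 * \<bar>?d\<bar>"
    by (simp only: abs_mult) (intro mult_right_mono, auto)
  then have f: "\<bar>fst (A0 \<mu> u)\<bar> \<le> \<bar>fst u\<bar> + L0 / 2 * \<bar>?d\<bar>" unfolding 1 by linarith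
  have "\<bar>B / (bet \<mu>)\<^sup>2\<bar> \<le> 1" using ba B2 by (simp add: divide_simps)
  then have "\<bar>B / (bet \<mu>)\<^sup>2 * ?d\<bar> \<le> 1 * \<bar>?d\<bar>"
    by (simp only: abs_mult) (intro mult_right_mono, auto)
  then have s: "L0 * \<bar>B / (bet \<mu>)\<^sup>2 * ?d\<bar> \<le> L0 * \<bar>?d\<bar>" using L0_ge by (intro mult_left_mono) auto
  have "nrm \<mu> (A0 \<mu> u) \<le> \<bar>fst u\<bar> + L0 / 2 * \<bar>?d\<bar> + L0 * \<bar>?d\<bar>"
    unfolding nrm_def 2 using f s by linarith
  also have "\<dots> \<le> 3 / 2 * nrm \<mu> u" by (simp add: nrm_def algebra_simps)
  finally show ?thesis .
qed

text \<open>The product of the costs of passing between \<open>norm\<close> and \<open>nrm\<close>,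
  of the perturbation estimate for the flow, and of scaling the derivative at a vertex.\<close>

definition K0 :: real where
  "K0 = (1 + L0 * (1 + M0)) * (exp (2 * (D0 + 1) + 4) * (B * (1 + M0)))"

lemma K0_ge: "K0 \<ge> 1"
proof -
  have "1 * (1 * (1 * 1)) \<le> K0"
    unfolding K0_def using L0_ge M0 D0 B2 by (intro mult_mono) auto
  then show ?thesis by simp
qed

lemma A_perturb:
  assumes "\<mu> \<in> J" "0 \<le> s" "s * qbar n \<le> 1"
  shows "nrm \<mu> (A n (s, \<mu>) u - A0 \<mu> u) \<le> K0 * (s * qbar n) * nrm \<mu> u"
proof -
  have "nrm \<mu> (A n (s, \<mu>) u - A0 \<mu> u) = 1 / \<bar>bet \<mu>\<bar> * nrm \<mu> (Bk n (s, \<mu>) u - B0 \<mu> u)"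
    using nrm_scaleR[of \<mu> "1 / bet \<mu>" "Bk n (s, \<mu>) u - B0 \<mu> u"]
    by (simp add: A_def A0_def scaleR_diff_right)
  also have "\<dots> \<le> 1 * nrm \<mu> (Bk n (s, \<mu>) u - B0 \<mu> u)"
    using bet_abs[OF assms(1)] by (intro mult_right_mono nrm_nonneg) auto
  also have "\<dots> \<le> (1 + L0 * (1 + M0)) * norm (Bk n (s, \<mu>) u - B0 \<mu> u)"
    using nrm_le_norm[OF assms(1)] by simp
  also have "\<dots> \<le> (1 + L0 * (1 + M0)) * (exp (2 * (D0 + 1) + 4) * (s * qbar n) * (B * norm u))"
    using L0_ge M0 by (intro mult_left_mono Bk_perturb assms D0) auto
  also have "\<dots> \<le> (1 + L0 * (1 + M0)) * (exp (2 * (D0 + 1) + 4) * (s * qbar n) * (B * ((1 + M0) * nrm \<mu> u)))"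
    using L0_ge M0 assms qbar_pos[of n] B2 by (intro mult_left_mono norm_le_nrm) auto
  finally show ?thesis by (simp add: K0_def mult_ac)
qed

text \<open>The threshold of weak coupling. \<open>K0 h0 = 1/8\<close> keeps the expansion of the
  perturbed maps below \<open>3/2 + 1/8\<close>, hence below 2, and a geometric series of ratio
  \<open>1/2\<close> then keeps the decaying solution within \<open>1/4\<close> of the Floquet
  vector.\<close>

definition h0 :: real where "h0 = 1 / (8 * K0)"

lemma h0_pos: "h0 > 0" and h0_le: "h0 \<le> 1" and K0_h0: "K0 * h0 = 1 / 8"
  using K0_ge by (auto simp: h0_def field_simps)

lemma nrm_A:
  assumes "\<mu> \<in> J" "0 \<le> s" "s * qbar n \<le> h0"
  shows "nrm \<mu> (A n (s, \<mu>) u) \<le> 2 * nrm \<mu> u"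
proof -
  have "nrm \<mu> (A n (s, \<mu>) u) \<le> nrm \<mu> (A0 \<mu> u) + nrm \<mu> (A n (s, \<mu>) u - A0 \<mu> u)"
    using nrm_triangle[of \<mu> "A0 \<mu> u" "A n (s, \<mu>) u - A0 \<mu> u"] by simp
  also have "\<dots> \<le> 3 / 2 * nrm \<mu> u + K0 * (s * qbar n) * nrm \<mu> u"
    using assms h0_le by (intro add_mono nrm_A0 A_perturb) auto
  also have "K0 * (s * qbar n) * nrm \<mu> u \<le> (K0 * h0) * nrm \<mu> u"
    using assms K0_ge by (intro mult_right_mono mult_left_mono nrm_nonneg) auto
  finally show ?thesis using K0_h0 nrm_nonneg[of \<mu> u] by simp
qed

text \<open>The decaying solution at \<open>n\<close> is approximated by continuing the Floquet solution backwards
  from \<open>n + j\<close>.\<close>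

primrec tr :: "nat \<Rightarrow> nat \<Rightarrow> real \<times> real \<Rightarrow> real \<times> real" where
  "tr 0 n p = evec (snd p)"
| "tr (Suc j) n p = A n p (tr j (Suc n) p)"

text \<open>The two approximations differ only in the map of generation \<open>n + j\<close>,
  applied to a fixed vector of \<open>A0 \<mu>\<close>; this causes an error of order
  \<open>s qbar (n + j)\<close>. Each of the \<open>j\<close> maps on the way back at most doubles
  it, while \<open>qbar\<close> has lost a factor of at least 4 per generation.\<close>

lemma tr_step:
  assumes "\<mu> \<in> J" "0 \<le> s" "s * qbar n \<le> h0"
  shows "nrm \<mu> (tr (Suc j) n (s, \<mu>) - tr j n (s, \<mu>)) \<le> K0 * (s * qbar n) * (1 / 2) ^ j"
  using assms(3)
proof (induction j arbitrary: n)
  case 0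
  then show ?case
    using A_perturb[OF assms(1,2), of n "evec \<mu>"] A0_evec[OF assms(1)] nrm_evec[of \<mu>] h0_le by simp
next
  case (Suc j)
  have le: "s * qbar (Suc n) \<le> s * qbar n"
    using assms by (intro mult_left_mono qbar_antimono) auto
  have "nrm \<mu> (tr (Suc (Suc j)) n (s, \<mu>) - tr (Suc j) n (s, \<mu>))
      = nrm \<mu> (A n (s, \<mu>) (tr (Suc j) (Suc n) (s, \<mu>) - tr j (Suc n) (s, \<mu>)))"
    by (simp add: A_diff)
  also have "\<dots> \<le> 2 * nrm \<mu> (tr (Suc j) (Suc n) (s, \<mu>) - tr j (Suc n) (s, \<mu>))"
    by (rule nrm_A[OF assms(1,2) Suc.prems])
  also have "\<dots> \<le> 2 * (K0 * (s * qbar (Suc n)) * (1 / 2) ^ j)"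
    using Suc.IH[of "Suc n"] le Suc.prems by simp
  also have "qbar (Suc n) = qbar n * (1 / B\<^sup>2)" using qbar_add[of n 1] by simp
  also have "2 * (K0 * (s * (qbar n * (1 / B\<^sup>2))) * (1 / 2) ^ j)
     = K0 * (s * qbar n) * (1 / 2) ^ j * (2 / B\<^sup>2)" by simp
  also have "\<dots> \<le> K0 * (s * qbar n) * (1 / 2) ^ j * (1 / 2)"
  proof (rule mult_left_mono)
    have "2\<^sup>2 \<le> B\<^sup>2" using B2 by (intro power_mono) auto
    then show "2 / B\<^sup>2 \<le> 1 / 2" using B2 by (subst pos_divide_le_eq) auto
  qed (use K0_ge assms qbar_pos[of n] in auto)
  finally show ?case by simp
qed

text \<open>The state is normalised by a power of \<open>bet\<close>: the solution itself takes the
  state \<open>v n\<close> times \<open>bet^(-n)\<close> at height \<open>n\<close>.\<close>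

definition v :: "nat \<Rightarrow> real \<times> real \<Rightarrow> real \<times> real" where
  "v n p = lim (\<lambda>j. tr j n p)"

lemma tr_sum: "tr j n p = evec (snd p) + (\<Sum>i<j. tr (Suc i) n p - tr i n p)"
  by (induction j) auto

text \<open>The uniformity over all weak couplings and all levels of the window, possible ends of
  the gap included, is what makes \<open>v\<close> continuous there.\<close>

lemma tr_uniform:
  "uniform_limit {p. 0 \<le> fst p \<and> fst p * qbar n \<le> h0 \<and> snd p \<in> J} (\<lambda>j. tr j n) (v n) sequentially"
proof -
  let ?U = "{p. 0 \<le> fst p \<and> fst p * qbar n \<le> h0 \<and> snd p \<in> J}"
  have "uniform_limit ?U (\<lambda>j p. \<Sum>i<j. tr (Suc i) n p - tr i n p) (\<lambda>p. \<Sum>i. tr (Suc i) n p - tr i n p) sequentially"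
  proof (rule Weierstrass_m_test)
    fix i p assume p: "p \<in> ?U"
    then obtain s \<mu> where eq: "p = (s, \<mu>)" and s: "\<mu> \<in> J" "0 \<le> s" "s * qbar n \<le> h0" by (cases p) auto
    have "norm (tr (Suc i) n p - tr i n p) \<le> (1 + M0) * nrm \<mu> (tr (Suc i) n p - tr i n p)"
      by (rule norm_le_nrm[OF s(1)])
    also have "\<dots> \<le> (1 + M0) * (K0 * (s * qbar n) * (1 / 2) ^ i)"
      unfolding eq using M0 by (intro mult_left_mono tr_step s) auto
    also have "\<dots> \<le> (1 + M0) * (K0 * h0 * (1 / 2) ^ i)"
      using M0 K0_ge s by (intro mult_left_mono mult_right_mono) auto
    finally show "norm (tr (Suc i) n p - tr i n p) \<le> (1 + M0) * (K0 * h0 * (1 / 2) ^ i)" .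
  next
    show "summable (\<lambda>i. (1 + M0) * (K0 * h0 * (1 / 2) ^ i))"
      by (intro summable_mult) (simp add: summable_geometric)
  qed
  then have u: "uniform_limit ?U (\<lambda>j p. evec (snd p) + (\<Sum>i<j. tr (Suc i) n p - tr i n p))
      (\<lambda>p. evec (snd p) + (\<Sum>i. tr (Suc i) n p - tr i n p)) sequentially"
    by (intro uniform_limit_intros)
  have "(\<lambda>j p. evec (snd p) + (\<Sum>i<j. tr (Suc i) n p - tr i n p)) = (\<lambda>j. tr j n)"
    by (intro ext) (rule tr_sum[symmetric])
  with u have u': "uniform_limit ?U (\<lambda>j. tr j n) (\<lambda>p. evec (snd p) + (\<Sum>i. tr (Suc i) n p - tr i n p)) sequentially"
    by (simp only:)
  have "v n p = evec (snd p) + (\<Sum>i. tr (Suc i) n p - tr i n p)" if "p \<in> ?U" for p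
    unfolding v_def by (rule limI) (use tendsto_uniform_limitI[OF u' that] in simp)
  then show ?thesis by (intro uniform_limit_cong'[THEN iffD1, OF _ _ u']) auto
qed

lemma small_eventually: "\<exists>N. \<forall>n\<ge>N. s * qbar n \<le> h0" if "0 \<le> s"
proof -
  have "1 < B\<^sup>2" using B2 by (simp add: one_less_power)
  then have "(\<lambda>n. s * (C * (1 / B\<^sup>2) ^ n)) \<longlonglongrightarrow> s * (C * 0)"
    by (intro tendsto_mult tendsto_const LIMSEQ_realpow_zero) (auto simp: divide_less_eq)
  then have "\<forall>\<^sub>F n in sequentially. s * qbar n < h0"
    using h0_pos by (intro order_tendstoD(2)) (auto simp: qbar_def)
  then show ?thesis by (meson eventually_sequentially less_imp_le)
qed

lemma A_param_continuous:
  assumes "continuous_on ({0..g} \<times> J) u"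
  shows "continuous_on ({0..g} \<times> J \<times> {0..1}) (\<lambda>(s, \<mu>, x). flow (pot n (s, \<mu>)) (fst (u (s, \<mu>)), - B * snd (u (s, \<mu>))) x)"
    "continuous_on ({0..g} \<times> J) (\<lambda>p. A n p (u p))"
proof -
  let ?K = "{0..g} \<times> J"
  have c: "continuous_on (?K \<times> {0..1}) (\<lambda>(p, x). flow (pot n p) (fst (u p), - B * snd (u p)) x)"
  proof (rule flow_continuous_param[where B="D0 + g * qbar n" and M="1 + qbar n"])
    fix p x assume p: "p \<in> ?K" and x: "x \<in> {0..1::real}"
    show "\<bar>pot n p x\<bar> \<le> D0 + g * qbar n"
      using p qbar_pos[of n] D0 by (intro pot_bound[OF x]) (auto intro!: mult_right_mono)
  qed (use assms in \<open>auto intro!: pot_cont pot_diff continuous_intros\<close>)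
  then have "continuous_on ({0..g} \<times> J \<times> {0..1})
      (\<lambda>y. case ((fst y, fst (snd y)), snd (snd y)) of (p, x) \<Rightarrow> flow (pot n p) (fst (u p), - B * snd (u p)) x)"
    by (rule continuous_on_compose2) (auto intro!: continuous_intros)
  then show "continuous_on ({0..g} \<times> J \<times> {0..1}) (\<lambda>(s, \<mu>, x). flow (pot n (s, \<mu>)) (fst (u (s, \<mu>)), - B * snd (u (s, \<mu>))) x)"
    by (simp add: case_prod_beta)
  have "continuous_on ?K (\<lambda>p. case (p, 1) of (p, x) \<Rightarrow> flow (pot n p) (fst (u p), - B * snd (u p)) x)"
    by (rule continuous_on_compose2[OF c]) (auto intro!: continuous_intros)
  then have f: "continuous_on ?K (\<lambda>p. flow (pot n p) (fst (u p), - B * snd (u p)) 1)" by simp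
  have bc: "continuous_on ?K (\<lambda>p. bet (snd p))"
    by (rule continuous_on_compose2[OF bet_cont]) (auto intro!: continuous_intros)
  have "continuous_on ?K (\<lambda>p. 1 / bet (snd p))"
    by (intro continuous_on_divide continuous_on_const bc) (auto dest: bet_abs(4))
  from continuous_on_scaleR[OF this continuous_on_Pair[OF continuous_on_fst[OF f]
        continuous_on_minus[OF continuous_on_snd[OF f]]]]
  show "continuous_on ?K (\<lambda>p. A n p (u p))"
    by (simp add: A_def Bk_def Let_def)
qed

lemma tr_cont: "continuous_on ({0..g} \<times> J) (tr j n)"
proof (induction j arbitrary: n)
  case 0
  have "continuous_on ({0..g} \<times> J) (\<lambda>p. slope (snd p))"
    by (rule continuous_on_compose2[OF slope_cont]) (auto intro!: continuous_intros)
  then show ?case by (simp add: evec_def continuous_on_Pair fun_eq_iff cong: continuous_on_cong)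
next
  case (Suc j)
  from A_param_continuous(2)[OF Suc.IH] show ?case by (simp cong: continuous_on_cong)
qed

lemma A_tendsto:
  assumes "p \<in> {0..} \<times> J" "X \<longlonglongrightarrow> y"
  shows "(\<lambda>j. A n p (X j)) \<longlonglongrightarrow> A n p y"
proof -
  obtain M where M: "\<And>x. x \<in> {0..1} \<Longrightarrow> \<bar>pot n p x\<bar> \<le> M"
    using continuous_Icc_bounded[OF pot_cont] by blast
  have "(\<lambda>j. flow (pot n p) (fst (X j), - B * snd (X j)) 1) \<longlonglongrightarrow> flow (pot n p) (fst y, - B * snd y) 1"
  proof (rule LIM_zero_cancel, rule Lim_null_comparison[OF always_eventually], rule allI)
    fix j
    have "flow (pot n p) (fst (X j), - B * snd (X j)) 1 - flow (pot n p) (fst y, - B * snd y) 1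
       = flow (pot n p) ((fst (X j), - B * snd (X j)) - (fst y, - B * snd y)) 1"
      by (rule flow_diff[OF pot_cont, symmetric]) simp
    then show "norm (flow (pot n p) (fst (X j), - B * snd (X j)) 1 - flow (pot n p) (fst y, - B * snd y) 1)
       \<le> exp (M + 2) * norm ((fst (X j), - B * snd (X j)) - (fst y, - B * snd y))"
      using flow_norm_le[OF pot_cont M] by simp
  next
    have "(\<lambda>j. exp (M + 2) * norm ((fst (X j), - B * snd (X j)) - (fst y, - B * snd y)))
       \<longlonglongrightarrow> exp (M + 2) * norm ((fst y, - B * snd y) - (fst y, - B * snd y))"
      by (intro tendsto_intros assms)
    then show "(\<lambda>j. exp (M + 2) * norm ((fst (X j), - B * snd (X j)) - (fst y, - B * snd y))) \<longlonglongrightarrow> 0" by simp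
  qed
  then show ?thesis unfolding A_def Bk_def Let_def by (intro tendsto_intros)
qed

text \<open>The geometric estimate needs weak coupling, which holds from some height on. From there
  convergence is carried towards the root through finitely many continuous maps; continuity and
  nonvanishing of \<open>v\<close> are obtained by the same downward induction.\<close>

lemma tr_tendsto:
  assumes p: "p \<in> {0..} \<times> J"
  shows "(\<lambda>j. tr j n p) \<longlonglongrightarrow> v n p"
proof -
  obtain N where N: "\<forall>n\<ge>N. fst p * qbar n \<le> h0" using small_eventually[of "fst p"] p by auto
  have big: "(\<lambda>j. tr j n p) \<longlonglongrightarrow> v n p" if "n \<ge> N" for n
    using tendsto_uniform_limitI[OF tr_uniform, of p n] N that p by auto
  show ?thesis
  proof (cases "n \<ge> N")
    case False
    then have "n \<le> N" by simp
    then show ?thesis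
    proof (induction n rule: inc_induct)
      case base
      show ?case by (rule big) simp
    next
      case (step n)
      from A_tendsto[OF p step.IH, of n] have "(\<lambda>j. tr (Suc j) n p) \<longlonglongrightarrow> A n p (v (Suc n) p)" by simp
      then have t: "(\<lambda>j. tr j n p) \<longlonglongrightarrow> A n p (v (Suc n) p)" by (rule LIMSEQ_imp_Suc)
      then show ?case unfolding v_def using limI by metis
    qed
  qed (rule big)
qed

lemma v_rec:
  assumes p: "p \<in> {0..} \<times> J"
  shows "v n p = A n p (v (Suc n) p)"
proof -
  have "(\<lambda>j. tr (Suc j) n p) \<longlonglongrightarrow> A n p (v (Suc n) p)"
    using A_tendsto[OF p tr_tendsto[OF p, of "Suc n"], of n] by simp
  then show ?thesis using LIMSEQ_unique tr_tendsto[OF p, of n, THEN LIMSEQ_Suc] by blast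
qed

lemma nrm_tendsto: "X \<longlonglongrightarrow> y \<Longrightarrow> (\<lambda>j. nrm \<mu> (X j)) \<longlonglongrightarrow> nrm \<mu> y"
  unfolding nrm_def by (intro tendsto_intros)

lemma v_near:
  assumes "\<mu> \<in> J" "0 \<le> s" "s * qbar n \<le> h0"
  shows "nrm \<mu> (v n (s, \<mu>) - evec \<mu>) \<le> 1 / 4"
proof (rule LIMSEQ_le_const2)
  show "(\<lambda>j. nrm \<mu> (tr j n (s, \<mu>) - evec \<mu>)) \<longlonglongrightarrow> nrm \<mu> (v n (s, \<mu>) - evec \<mu>)"
    using assms by (intro nrm_tendsto tendsto_intros tr_tendsto) auto
  have "nrm \<mu> (tr j n (s, \<mu>) - evec \<mu>) \<le> (\<Sum>i<j. K0 * (s * qbar n) * (1 / 2) ^ i)" for j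
  proof (induction j)
    case 0
    then show ?case by (simp add: nrm_def)
  next
    case (Suc j)
    have "nrm \<mu> (tr (Suc j) n (s, \<mu>) - evec \<mu>) \<le> nrm \<mu> (tr j n (s, \<mu>) - evec \<mu>) + nrm \<mu> (tr (Suc j) n (s, \<mu>) - tr j n (s, \<mu>))"
      using nrm_triangle[of \<mu> "tr j n (s, \<mu>) - evec \<mu>" "tr (Suc j) n (s, \<mu>) - tr j n (s, \<mu>)"] by simp
    with Suc tr_step[OF assms, of j] show ?case by simp
  qed
  moreover have "(\<Sum>i<j. K0 * (s * qbar n) * (1 / 2) ^ i) \<le> 1 / 4" for j
  proof -
    have "(\<Sum>i<j. K0 * (s * qbar n) * (1 / 2) ^ i) = K0 * (s * qbar n) * (2 * (1 - (1 / 2) ^ j))"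
      by (simp add: sum_distrib_left[symmetric] sum_gp_strict)
    also have "\<dots> \<le> (K0 * h0) * (2 * 1)"
      using K0_ge assms qbar_pos[of n] h0_pos by (intro mult_mono mult_left_mono) (auto simp: power_le_one)
    finally show ?thesis using K0_h0 by simp
  qed
  ultimately show "\<exists>N. \<forall>j\<ge>N. nrm \<mu> (tr j n (s, \<mu>) - evec \<mu>) \<le> 1 / 4" by (meson order_trans)
qed

text \<open>The distance \<open>1/4\<close> keeps the first coordinate positive, so the decaying
  solution does not vanish at a vertex of weak coupling.\<close>

lemma v_near_coord:
  assumes "\<mu> \<in> J" "0 \<le> s" "s * qbar n \<le> h0"
  shows "\<bar>fst (v n (s, \<mu>)) - 1\<bar> \<le> 1 / 4" "norm (v n (s, \<mu>)) \<le> 2 * (1 + M0)"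
proof -
  have "0 \<le> L0 * \<bar>snd (v n (s, \<mu>) - evec \<mu>) - slope \<mu> * fst (v n (s, \<mu>) - evec \<mu>)\<bar>" using L0_ge by simp
  then show "\<bar>fst (v n (s, \<mu>)) - 1\<bar> \<le> 1 / 4"
    using v_near[OF assms] by (simp add: nrm_def evec_def)
  have "nrm \<mu> (v n (s, \<mu>)) \<le> nrm \<mu> (v n (s, \<mu>) - evec \<mu>) + nrm \<mu> (evec \<mu>)"
    using nrm_triangle[of \<mu> "v n (s, \<mu>) - evec \<mu>" "evec \<mu>"] by simp
  also have "\<dots> \<le> 2" using v_near[OF assms] nrm_evec by simp
  finally have "(1 + M0) * nrm \<mu> (v n (s, \<mu>)) \<le> (1 + M0) * 2" using M0 by (intro mult_left_mono) auto
  then show "norm (v n (s, \<mu>)) \<le> 2 * (1 + M0)" using norm_le_nrm[OF assms(1), of "v n (s, \<mu>)"] by simp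
qed

lemma v_zero: "\<mu> \<in> J \<Longrightarrow> v n (0, \<mu>) = evec \<mu>"
proof -
  assume "\<mu> \<in> J"
  then have "tr j n (0, \<mu>) = evec \<mu>" for j n
    by (induction j arbitrary: n) (auto simp: A_zero A0_evec)
  then show ?thesis by (simp add: v_def)
qed

lemma v_cont: "continuous_on ({0..g} \<times> J) (v n)" if g: "0 \<le> g"
proof -
  obtain N where N: "\<forall>n\<ge>N. g * qbar n \<le> h0" using small_eventually[OF g] by auto
  have big: "continuous_on ({0..g} \<times> J) (v n)" if "n \<ge> N" for n
  proof (rule uniform_limit_theorem[OF always_eventually])
    show "\<forall>j. continuous_on ({0..g} \<times> J) (tr j n)" by (simp add: tr_cont)
    show "uniform_limit ({0..g} \<times> J) (\<lambda>j. tr j n) (v n) sequentially"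
    proof (rule uniform_limit_on_subset[OF tr_uniform])
      show "{0..g} \<times> J \<subseteq> {p. 0 \<le> fst p \<and> fst p * qbar n \<le> h0 \<and> snd p \<in> J}"
      proof
        fix p assume p: "p \<in> {0..g} \<times> J"
        have "fst p * qbar n \<le> g * qbar n" using p qbar_pos[of n] by (intro mult_right_mono) auto
        then show "p \<in> {p. 0 \<le> fst p \<and> fst p * qbar n \<le> h0 \<and> snd p \<in> J}" using N that p by auto
      qed
    qed
  qed simp
  show ?thesis
  proof (cases "n \<ge> N")
    case False
    then have "n \<le> N" by simp
    then show ?thesis
    proof (induction n rule: inc_induct)
      case base
      show ?case by (rule big) simp
    next
      case (step n)
      have "continuous_on ({0..g} \<times> J) (\<lambda>p. A n p (v (Suc n) p))" by (rule A_param_continuous(2)[OF step.IH])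
      moreover have "v n p = A n p (v (Suc n) p)" if "p \<in> {0..g} \<times> J" for p
        by (rule v_rec) (use that in auto)
      ultimately show ?case by (simp cong: continuous_on_cong)
    qed
  qed (rule big)
qed

lemma A_eq_0_iff: "snd p \<in> J \<Longrightarrow> A n p u = 0 \<longleftrightarrow> u = 0"
  using bet_abs[of "snd p"] by (simp add: A_def Bk_eq_0_iff)

lemma v_nonzero:
  assumes p: "p \<in> {0..} \<times> J" shows "v n p \<noteq> 0"
proof -
  obtain N where N: "\<forall>n\<ge>N. fst p * qbar n \<le> h0" using small_eventually[of "fst p"] p by auto
  have big: "v n p \<noteq> 0" if "n \<ge> N" for n
  proof -
    have "\<bar>fst (v n (fst p, snd p)) - 1\<bar> \<le> 1 / 4" by (rule v_near_coord) (use p N that in auto)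
    then show ?thesis by auto
  qed
  show ?thesis
  proof (cases "n \<ge> N")
    case False
    then have "n \<le> N" by simp
    then show ?thesis
    proof (induction n rule: inc_induct)
      case base
      show ?case by (rule big) simp
    next
      case (step n)
      have "snd p \<in> J" using p by auto
      then show ?case using v_rec[OF p, of n] A_eq_0_iff[of p n "v (Suc n) p"] step.IH by metis
    qed
  qed (rule big)
qed

text \<open>Compactness of the parameter set deals with the finitely many heights of strong
  coupling, \<open>v_near_coord\<close> with all others. The bound is uniform in the height, so that
  remainders with a factor tending to 0 vanish in the limit.\<close>

lemma v_bounded: "\<exists>M>0. \<forall>n. \<forall>p\<in>{0..g} \<times> J. norm (v n p) \<le> M" if g: "0 \<le> g"
proof -
  obtain N where N: "\<forall>n\<ge>N. g * qbar n \<le> h0" using small_eventually[OF g] by auto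
  have "bounded (\<Union>n<N. v n ` ({0..g} \<times> J))"
    using J_compact by (intro bounded_UN ballI compact_imp_bounded compact_continuous_image v_cont g compact_Times) auto
  then obtain M where M: "\<forall>n<N. \<forall>p\<in>{0..g} \<times> J. norm (v n p) \<le> M" "M > 0" by (auto simp: bounded_pos)
  have "norm (v n p) \<le> max M (2 * (1 + M0))" if p: "p \<in> {0..g} \<times> J" for n p
  proof (cases "n < N")
    case False
    have "fst p * qbar n \<le> g * qbar n" using p qbar_pos[of n] by (intro mult_right_mono) auto
    moreover have "g * qbar n \<le> h0" using N False by auto
    ultimately have "norm (v n (fst p, snd p)) \<le> 2 * (1 + M0)"
      using p by (intro v_near_coord) auto
    then show ?thesis by simp
  qed (use M p in force)
  then show ?thesis using M(2) by (intro exI[of _ "max M (2 * (1 + M0))"]) auto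
qed

end

section \<open>Zeros in the coupling constant\<close>

text \<open>The product of \<open>f\<close> with the exponential of minus the integral of
  \<open>f' / f\<close> is constant. The imaginary part of this integral is the change of the
  argument along the curve, with no choice of a branch.\<close>

lemma exp_log_derivative:
  fixes f :: "real \<Rightarrow> complex"
  assumes d: "\<And>x. x \<in> {0..1} \<Longrightarrow> (f has_vector_derivative f' x) (at x within {0..1})"
    and nz: "\<And>x. x \<in> {0..1} \<Longrightarrow> f x \<noteq> 0" and f': "continuous_on {0..1} f'"
  shows "f 1 = f 0 * exp (integral {0..1} (\<lambda>x. f' x / f x))"
proof -
  define I where "I x = integral {0..x} (\<lambda>x. f' x / f x)" for x
  have fc: "continuous_on {0..1} f"
    using d has_vector_derivative_continuous continuous_on_eq_continuous_within by blast
  have c: "continuous_on {0..1} (\<lambda>x. f' x / f x)"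
    using nz by (intro continuous_on_divide f' fc) auto
  have dI: "(I has_vector_derivative f' x / f x) (at x within {0..1})" if "x \<in> {0..1}" for x
    unfolding I_def by (rule integral_has_vector_derivative[OF c that])
  define h where "h x = f x * exp (- I x)" for x
  have "(h has_vector_derivative 0) (at x within {0..1})" if x: "x \<in> {0..1}" for x
  proof -
    have "((exp \<circ> (\<lambda>x. - I x)) has_vector_derivative (- (f' x / f x)) * exp (- I x)) (at x within {0..1})"
      by (rule field_vector_diff_chain_within[OF has_vector_derivative_minus[OF dI[OF x]]])
        (use DERIV_exp DERIV_subset in blast)
    from has_vector_derivative_mult[OF d[OF x] this]
    show ?thesis using nz[OF x] by (simp add: h_def[abs_def] o_def)
  qed
  then obtain w where "\<And>x. x \<in> {0..1} \<Longrightarrow> h x = w"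
    using has_vector_derivative_zero_constant[of "{0..1}" h] by auto
  then have "h 1 = h 0" by auto
  then show ?thesis by (simp add: h_def I_def exp_minus field_simps)
qed

text \<open>The product of \<open>a + i z\<close> with the conjugate of \<open>a + i y\<close> has
  imaginary part \<open>a z - a y\<close> and real part \<open>a^2 + y z\<close>, which is positive.
  So the arctangent is the angle between the two points, and its derivative is the difference of
  their angular velocities.\<close>

lemma DERIV_arctan_ratio:
  fixes a y z :: "real \<Rightarrow> real"
  assumes "(a has_real_derivative a') (at x)" "(y has_real_derivative y') (at x)" "(z has_real_derivative z') (at x)"
    and pos: "(a x)\<^sup>2 + y x * z x > 0"
  shows "((\<lambda>x. arctan ((a x * z x - a x * y x) / ((a x)\<^sup>2 + y x * z x))) has_real_derivative
     (a x * z' - z x * a') / ((a x)\<^sup>2 + (z x)\<^sup>2) - (a x * y' - y x * a') / ((a x)\<^sup>2 + (y x)\<^sup>2)) (at x)"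
proof -
  define A Y Z where "A = a x" "Y = y x" "Z = z x"
  define M where "M = A\<^sup>2 + Y * Z"
  define N where "N = A * Z - A * Y"
  define M' where "M' = 2 * A * a' + (y' * Z + z' * Y)"
  define N' where "N' = (a' * Z + z' * A) - (a' * Y + y' * A)"
  have M: "M > 0" using pos by (simp add: M_def A_Y_Z_def)
  have "((\<lambda>x. (a x * z x - a x * y x) / ((a x)\<^sup>2 + y x * z x)) has_real_derivative (N' * M - N * M') / (M * M)) (at x)"
    using M unfolding M_def N_def M'_def N'_def A_Y_Z_def
    by (auto intro!: derivative_eq_intros assms)
  then have 1: "((\<lambda>x. arctan ((a x * z x - a x * y x) / ((a x)\<^sup>2 + y x * z x))) has_real_derivative
      inverse (1 + (N / M)\<^sup>2) * ((N' * M - N * M') / (M * M))) (at x)"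
    using DERIV_chain2[OF DERIV_arctan] by (fastforce simp: M_def N_def A_Y_Z_def)
  \<comment> \<open>Multiplicativity of the modulus for the product of \<open>a + i z\<close> with
    the conjugate of \<open>a + i y\<close>.\<close>
  have MN: "M\<^sup>2 + N\<^sup>2 = (A\<^sup>2 + Y\<^sup>2) * (A\<^sup>2 + Z\<^sup>2)"
    by (simp add: M_def N_def power2_eq_square algebra_simps)
  have "M\<^sup>2 + N\<^sup>2 > 0" using M by (simp add: sum_power2_gt_zero_iff)
  then have nz: "A\<^sup>2 + Y\<^sup>2 \<noteq> 0" "A\<^sup>2 + Z\<^sup>2 \<noteq> 0" unfolding MN by auto
  have "inverse (1 + (N / M)\<^sup>2) = M\<^sup>2 / (M\<^sup>2 + N\<^sup>2)" using M by (simp add: field_simps power2_eq_square)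
  then have "inverse (1 + (N / M)\<^sup>2) * ((N' * M - N * M') / (M * M)) = (N' * M - N * M') / (M\<^sup>2 + N\<^sup>2)"
    using M by (simp add: power2_eq_square)
  also have "\<dots> = ((A * z' - Z * a') * (A\<^sup>2 + Y\<^sup>2) - (A * y' - Y * a') * (A\<^sup>2 + Z\<^sup>2)) / (M\<^sup>2 + N\<^sup>2)"
    by (simp add: M_def N_def M'_def N'_def power2_eq_square algebra_simps)
  also have "\<dots> = (A * z' - Z * a') / (A\<^sup>2 + Z\<^sup>2) - (A * y' - Y * a') / (A\<^sup>2 + Y\<^sup>2)"
    unfolding MN using nz by (simp add: diff_frac_eq mult.commute)
  finally show ?thesis using 1 by (simp add: A_Y_Z_def)
qed

lemma cis_Im_Ln: "z \<noteq> 0 \<Longrightarrow> z = of_real (norm z) * cis (Im (Ln z))"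
  by (metis Re_Ln exp_Ln exp_eq_polar exp_ln zero_less_norm_iff)

text \<open>A Wronskian reveals an increment of the angle only through its sine. Continuity confines
  small increments to less than \<open>pi\<close>, where the increment has the sign of its sine.
  Hence to the right of every point before \<open>y\<close> there is a larger value, and the maximum
  over \<open>{x..y}\<close> is attained at \<open>y\<close>.\<close>

lemma strict_increase_from_local:
  fixes f :: "real \<Rightarrow> real"
  assumes c: "continuous_on {\<alpha>..\<beta>} f"
    and loc: "\<And>x. x \<in> {\<alpha>..\<beta>} \<Longrightarrow> \<exists>d>0. \<forall>y\<in>{\<alpha>..\<beta>}. \<bar>y - x\<bar> < d \<longrightarrow> y \<noteq> x \<longrightarrow> (y - x) * sin (f y - f x) > 0"
    and xy: "\<alpha> \<le> x" "x < y" "y \<le> \<beta>"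
  shows "f x < f y"
proof -
  have inc: "\<exists>t. m < t \<and> t \<le> y \<and> f m < f t" if m: "m \<in> {x..y}" "m < y" for m
  proof -
    have mI: "m \<in> {\<alpha>..\<beta>}" using m xy by auto
    obtain d where d: "d > 0" "\<And>t. t \<in> {\<alpha>..\<beta>} \<Longrightarrow> \<bar>t - m\<bar> < d \<Longrightarrow> t \<noteq> m \<Longrightarrow> (t - m) * sin (f t - f m) > 0"
      using loc[OF mI] by blast
    obtain e where e: "e > 0" "\<And>t. t \<in> {\<alpha>..\<beta>} \<Longrightarrow> \<bar>t - m\<bar> < e \<Longrightarrow> \<bar>f t - f m\<bar> < pi"
      using c mI pi_gt_zero unfolding continuous_on_iff dist_real_def by metis
    define t where "t = m + min (min (d / 2) (e / 2)) (y - m)"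
    have t: "m < t" "t \<le> y" "\<bar>t - m\<bar> < d" "\<bar>t - m\<bar> < e" using d(1) e(1) m unfolding t_def by linarith+
    have tI: "t \<in> {\<alpha>..\<beta>}" using t m xy by auto
    have s: "sin (f t - f m) > 0"
      using d(2)[OF tI t(3)] t(1) by (simp add: zero_less_mult_iff)
    have "f t > f m"
    proof (rule ccontr)
      assume "\<not> f m < f t"
      then have "sin (f m - f t) \<ge> 0" using e(2)[OF tI t(4)] by (intro sin_ge_zero) auto
      moreover have "sin (f m - f t) = - sin (f t - f m)" by (metis minus_diff_eq sin_minus)
      ultimately show False using s by simp
    qed
    then show ?thesis using t by blast
  qed
  have "continuous_on {x..y} f" using c xy by (auto intro: continuous_on_subset)
  then obtain m where m: "m \<in> {x..y}" "\<And>t. t \<in> {x..y} \<Longrightarrow> f t \<le> f m"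
    using continuous_attains_sup[of "{x..y}" f] xy by auto
  have "m = y"
  proof (rule ccontr)
    assume "m \<noteq> y"
    then have "m < y" using m(1) by auto
    then obtain t where t: "m < t" "t \<le> y" "f m < f t" using inc[OF m(1)] by blast
    then show False using m(2)[of t] m(1) by auto
  qed
  show "f x < f y"
  proof -
    obtain t where t: "x < t" "t \<le> y" "f x < f t" using inc[of x] xy by auto
    then show ?thesis using m(2)[of t] \<open>m = y\<close> by auto
  qed
qed

lemma card_int_between:
  fixes a c :: real
  shows "finite {j::int. a < j * pi \<and> j * pi < c}"
    and "a \<le> c \<Longrightarrow> \<bar>pi * card {j::int. a < j * pi \<and> j * pi < c} - (c - a)\<bar> \<le> pi"
proof -
  have eq: "{j::int. a < j * pi \<and> j * pi < c} = {\<lfloor>a / pi\<rfloor> <..< \<lceil>c / pi\<rceil>}"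
    by (auto simp: floor_less_iff less_ceiling_iff field_simps)
  show "finite {j::int. a < j * pi \<and> j * pi < c}" unfolding eq by simp
  assume ac: "a \<le> c"
  define A where "A = a / pi"
  define D where "D = c / pi"
  have AD: "A \<le> D" using ac by (simp add: A_def D_def divide_right_mono)
  have "card {j::int. a < j * pi \<and> j * pi < c} = nat (\<lceil>D\<rceil> - (\<lfloor>A\<rfloor> + 1))"
    unfolding eq A_def D_def by simp
  moreover have "\<bar>real (nat (\<lceil>D\<rceil> - (\<lfloor>A\<rfloor> + 1))) - (D - A)\<bar> \<le> 1"
  proof (cases "\<lceil>D\<rceil> - (\<lfloor>A\<rfloor> + 1) \<ge> 0")
    case True
    then have "real (nat (\<lceil>D\<rceil> - (\<lfloor>A\<rfloor> + 1))) = of_int \<lceil>D\<rceil> - of_int \<lfloor>A\<rfloor> - 1" by simp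
    then show ?thesis by linarith
  next
    case False
    then have "real (nat (\<lceil>D\<rceil> - (\<lfloor>A\<rfloor> + 1))) = 0" by simp
    then show ?thesis using AD False by linarith
  qed
  ultimately have "\<bar>real (card {j::int. a < j * pi \<and> j * pi < c}) - (D - A)\<bar> \<le> 1" by simp
  then have "pi * \<bar>real (card {j::int. a < j * pi \<and> j * pi < c}) - (D - A)\<bar> \<le> pi * 1"
    by (intro mult_left_mono) auto
  moreover have "pi * \<bar>real (card {j::int. a < j * pi \<and> j * pi < c}) - (D - A)\<bar>
     = \<bar>pi * card {j::int. a < j * pi \<and> j * pi < c} - (c - a)\<bar>"
  proof -
    have "pi * \<bar>x - (D - A)\<bar> = \<bar>pi * x - (c - a)\<bar>" for x
    proof -
      have "pi * \<bar>x - (D - A)\<bar> = \<bar>pi * (x - (D - A))\<bar>" by (simp only: abs_mult abs_of_pos[OF pi_gt_zero])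
      then show ?thesis by (simp add: A_def D_def right_diff_distrib)
    qed
    then show ?thesis .
  qed
  ultimately show "\<bar>pi * card {j::int. a < j * pi \<and> j * pi < c} - (c - a)\<bar> \<le> pi" by simp
qed

lemma bij_betw_crossings:
  fixes f :: "real \<Rightarrow> real"
  assumes g: "0 < g" and c: "continuous_on {0..g} f"
    and mono: "\<And>x y. 0 \<le> x \<Longrightarrow> x < y \<Longrightarrow> y \<le> g \<Longrightarrow> f x < f y"
  shows "\<exists>h. bij_betw h {j::int. f 0 < j * pi \<and> j * pi < f g} {s\<in>{0<..<g}. sin (f s) = 0}"
proof -
  let ?S = "{s\<in>{0<..<g}. sin (f s) = 0}" and ?I = "{j::int. f 0 < j * pi \<and> j * pi < f g}"
  define k where "k s = (THE j::int. f s = j * pi)" for s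
  have k: "f s = k s * pi" if "sin (f s) = 0" for s
  proof -
    obtain j :: int where j: "f s = of_int j * pi" using \<open>sin (f s) = 0\<close> by (auto simp: sin_zero_iff_int2)
    then have "k s = j" unfolding k_def by (intro the_equality) auto
    then show ?thesis using j by simp
  qed
  have "bij_betw k ?S ?I"
    unfolding bij_betw_def
  proof
    show "inj_on k ?S"
    proof (rule inj_onI)
      fix s t assume "s \<in> ?S" "t \<in> ?S" "k s = k t"
      then have "f s = f t" "0 \<le> s" "0 \<le> t" "s \<le> g" "t \<le> g" using k[of s] k[of t] by auto
      then show "s = t" using mono[of s t] mono[of t s] by linarith
    qed
    show "k ` ?S = ?I"
    proof
      show "k ` ?S \<subseteq> ?I"
      proof
        fix j assume "j \<in> k ` ?S"
        then obtain s where s: "s \<in> ?S" "j = k s" by auto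
        then show "j \<in> ?I" using k[of s] mono[of 0 s] mono[of s g] by auto
      qed
      show "?I \<subseteq> k ` ?S"
      proof
        fix j assume j: "j \<in> ?I"
        then obtain s where s: "0 \<le> s" "s \<le> g" "f s = j * pi"
          using IVT'[of f 0 "j * pi" g] c g by force
        then have "s \<noteq> 0" "s \<noteq> g" using j by auto
        moreover have z: "sin (f s) = 0" using s(3) by (auto simp: sin_zero_iff_int2)
        ultimately have "s \<in> ?S" using s by auto
        moreover have "k s = j" using k[OF z] s(3) by simp
        ultimately show "j \<in> k ` ?S" by blast
      qed
    qed
  qed
  then show ?thesis using bij_betw_inv by blast
qed

context window
begin

text \<open>The levels strictly inside the gap: there \<open>\<bar>bet \<mu>\<bar> > sqrt B\<close>,
  so \<open>b^n\<close> edges with amplitude \<open>\<bar>bet \<mu>\<bar>^(-n)\<close> have summable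
  squares. At an end of the gap this series diverges.\<close>

definition J0 :: "real set" where
  "J0 = {\<mu> \<in> J. 2 * sqrt B < (1 + B) * (sg * cosq \<mu>)}"

section \<open>The angle of the decaying solution\<close>

definition Y :: "nat \<Rightarrow> real \<times> real \<Rightarrow> real \<Rightarrow> real \<times> real" where
  "Y n p = flow (pot n p) (fst (v (Suc n) p), - B * snd (v (Suc n) p))"

lemma Y_sol: "ode_sol (pot n p) (\<lambda>_. 0) (Y n p)"
  unfolding Y_def by (rule flow_sol[OF pot_cont])

lemma Y_0: "Y n p 0 = (fst (v (Suc n) p), - B * snd (v (Suc n) p))"
  by (simp add: Y_def pot_cont)

lemma Y_1:
  assumes "p \<in> {0..} \<times> J"
  shows "Y n p 1 = (bet (snd p) * fst (v n p), - bet (snd p) * snd (v n p))"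
proof -
  have nz: "bet (snd p) \<noteq> 0" using assms bet_abs by auto
  have "v n p = (1 / bet (snd p)) *\<^sub>R (fst (Y n p 1), - snd (Y n p 1))"
    using v_rec[OF assms, of n] by (simp add: A_def Bk_def Let_def Y_def)
  then show ?thesis using nz by (simp add: prod_eq_iff)
qed

lemma Y_nonzero:
  assumes "p \<in> {0..} \<times> J" "x \<in> {0..1}"
  shows "Y n p x \<noteq> 0" "0 < (snd (Y n p x))\<^sup>2 + (fst (Y n p x))\<^sup>2"
proof -
  have "(fst (v (Suc n) p), - B * snd (v (Suc n) p)) \<noteq> 0"
    using v_nonzero[OF assms(1), of "Suc n"] B2 by (auto simp: prod_eq_iff)
  then show 1: "Y n p x \<noteq> 0" unfolding Y_def by (simp only: flow_eq_0_iff[OF pot_cont assms(2)]) simp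
  then show "0 < (snd (Y n p x))\<^sup>2 + (fst (Y n p x))\<^sup>2"
    by (auto simp: sum_power2_gt_zero_iff prod_eq_iff)
qed

lemma Y_cont_param:
  assumes "0 \<le> g"
  shows "continuous_on (({0..g} \<times> J) \<times> {0..1}) (\<lambda>(p, x). Y n p x)"
proof -
  have "continuous_on (({0..g} \<times> J) \<times> {0..1}) (\<lambda>y. (\<lambda>(s, \<mu>, x). flow (pot n (s, \<mu>)) (fst (v (Suc n) (s, \<mu>)), - B * snd (v (Suc n) (s, \<mu>))) x)
       (fst (fst y), snd (fst y), snd y))"
    by (rule continuous_on_compose2[OF A_param_continuous(1)[OF v_cont[OF assms]]])
      (auto intro!: continuous_intros)
  then show ?thesis by (simp add: Y_def case_prod_beta)
qed

lemma Y_cont: "continuous_on {0..1} (Y n p)"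
  by (rule ode_sol_continuous[OF Y_sol])

text \<open>The angular velocity of \<open>y' + i y\<close>, that is the imaginary part of
  \<open>(y'' + i y') / (y' + i y)\<close>.\<close>

definition rate :: "nat \<Rightarrow> real \<times> real \<Rightarrow> real \<Rightarrow> real" where
  "rate n p x = ((snd (Y n p x))\<^sup>2 + pot n p x * (fst (Y n p x))\<^sup>2) / ((snd (Y n p x))\<^sup>2 + (fst (Y n p x))\<^sup>2)"

definition D :: "nat \<Rightarrow> real \<times> real \<Rightarrow> real" where "D n p = integral {0..1} (rate n p)"

text \<open>The angle of \<open>\<zeta>\<close> is the Pruefer angle of the decaying solution at the vertex of height
  \<open>n\<close>, in reversed time.\<close>

definition \<zeta> :: "nat \<Rightarrow> real \<times> real \<Rightarrow> complex" where
  "\<zeta> n p = Complex (- snd (v n p)) (fst (v n p))"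

text \<open>Passing a vertex multiplies the derivative by \<open>B\<close>. The principal logarithm
  measures the resulting turn continuously, because the quotient has positive real part.\<close>

definition jump :: "nat \<Rightarrow> real \<times> real \<Rightarrow> real" where
  "jump n p = Im (Ln (Complex (- B * snd (v n p)) (fst (v n p)) / \<zeta> n p))"

text \<open>A lift of the argument of \<open>\<zeta> k\<close>, up to powers of \<open>sg\<close>.
  It starts at a height \<open>T\<close> of weak coupling, where \<open>\<zeta> T\<close> lies in
  the upper half plane and the principal logarithm is continuous, and adds the turns on the way
  towards the root.\<close>

definition Om :: "nat \<Rightarrow> nat \<Rightarrow> real \<times> real \<Rightarrow> real" where
  "Om T k p = Im (Ln (\<zeta> T p)) + (\<Sum>n\<in>{k..<T}. D n p + jump (Suc n) p)"

lemma zeta_nz: "p \<in> {0..} \<times> J \<Longrightarrow> \<zeta> n p \<noteq> 0"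
  using v_nonzero[of p n] by (auto simp: \<zeta>_def complex_eq_iff prod_eq_iff)

lemma jump_Re:
  assumes "p \<in> {0..} \<times> J"
  shows "Re (Complex (- B * snd (v n p)) (fst (v n p)) / \<zeta> n p) > 0"
proof -
  have n0: "0 < (snd (v n p))\<^sup>2 + (fst (v n p))\<^sup>2"
    using v_nonzero[OF assms, of n] by (auto simp: sum_power2_gt_zero_iff prod_eq_iff)
  have "0 < B * (snd (v n p))\<^sup>2 + (fst (v n p))\<^sup>2"
  proof (cases "snd (v n p) = 0")
    case False
    then show ?thesis using B2 by (intro add_pos_nonneg) auto
  qed (use n0 in auto)
  then show ?thesis using n0
    by (simp add: \<zeta>_def Re_divide power2_eq_square mult.assoc add_divide_distrib[symmetric])
qed

lemma jump_bound: "p \<in> {0..} \<times> J \<Longrightarrow> \<bar>jump n p\<bar> \<le> pi / 2"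
  using Re_Ln_pos_lt[of "Complex (- B * snd (v n p)) (fst (v n p)) / \<zeta> n p"] jump_Re[of p n]
  by (auto simp: jump_def) (metis Re_complex_div_gt_0 abs_le_D1 divide_eq_0_iff less_eq_real_def less_irrefl zero_complex.sel(1))

lemma rate_cont_param:
  assumes "0 \<le> g"
  shows "continuous_on (({0..g} \<times> J) \<times> cbox 0 1) (\<lambda>(p, x). rate n p x)"
proof -
  have yc: "continuous_on (({0..g} \<times> J) \<times> {0..1}) (\<lambda>y. Y n (fst y) (snd y))"
    using Y_cont_param[OF assms, of n] by (simp add: case_prod_beta)
  have "continuous_on (({0..g} \<times> J) \<times> {0..1}) (\<lambda>y. rate n (fst y) (snd y))"
    unfolding rate_def pot_def
  proof (intro continuous_on_divide continuous_on_add continuous_on_mult continuous_on_power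
      continuous_on_fst[OF yc] continuous_on_snd[OF yc])
    show "continuous_on (({0..g} \<times> J) \<times> {0..1}) (\<lambda>x. q (real n + 1 - snd x))"
      by (rule continuous_on_compose2[OF q_cont]) (auto intro!: continuous_intros)
  next
    show "\<forall>x\<in>({0..g} \<times> J) \<times> {0..1}. (snd (Y n (fst x) (snd x)))\<^sup>2 + (fst (Y n (fst x) (snd x)))\<^sup>2 \<noteq> 0"
    proof
      fix x assume x: "x \<in> ({0..g} \<times> J) \<times> {0..1::real}"
      then have "fst x \<in> {0..} \<times> J" "snd x \<in> {0..1}" by auto
      from Y_nonzero(2)[OF this, of n] show "(snd (Y n (fst x) (snd x)))\<^sup>2 + (fst (Y n (fst x) (snd x)))\<^sup>2 \<noteq> 0" by linarith
    qed
  qed (intro continuous_intros)+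
  then show ?thesis by (simp add: case_prod_beta)
qed

lemma D_cont: "0 \<le> g \<Longrightarrow> continuous_on ({0..g} \<times> J) (D n)"
  using integral_continuous_on_param[OF rate_cont_param] by (simp add: D_def[abs_def] cbox_interval)

lemma rate_cont:
  assumes "p \<in> {0..} \<times> J" shows "continuous_on {0..1} (rate n p)"
proof -
  have "\<forall>x\<in>{0..1}. (snd (Y n p x))\<^sup>2 + (fst (Y n p x))\<^sup>2 \<noteq> 0"
    using Y_nonzero(2)[OF assms, of _ n] by (metis less_irrefl)
  then show ?thesis unfolding rate_def
    by (intro continuous_on_divide continuous_on_add continuous_on_mult continuous_on_power
      continuous_on_fst[OF Y_cont] continuous_on_snd[OF Y_cont] pot_cont)
qed

lemma zeta_cont: "0 \<le> g \<Longrightarrow> continuous_on ({0..g} \<times> J) (\<zeta> n)"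
proof -
  assume g: "0 \<le> g"
  have "\<zeta> n = (\<lambda>p. - of_real (snd (v n p)) + \<i> * of_real (fst (v n p)))"
    by (auto simp: \<zeta>_def fun_eq_iff complex_eq_iff)
  then show ?thesis using v_cont[OF g, of n] by (auto intro!: continuous_intros)
qed

lemma jump_cont: "0 \<le> g \<Longrightarrow> continuous_on ({0..g} \<times> J) (jump n)"
proof -
  assume g: "0 \<le> g"
  have eq: "(\<lambda>p. Complex (- B * snd (v n p)) (fst (v n p))) = (\<lambda>p. - of_real B * of_real (snd (v n p)) + \<i> * of_real (fst (v n p)))"
    by (auto simp: fun_eq_iff complex_eq_iff)
  have "continuous_on ({0..g} \<times> J) (\<lambda>p. - of_real B * of_real (snd (v n p)) + \<i> * complex_of_real (fst (v n p)))"
    using v_cont[OF g, of n] by (auto intro!: continuous_intros)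
  then have c: "continuous_on ({0..g} \<times> J) (\<lambda>p. Complex (- B * snd (v n p)) (fst (v n p)))"
    unfolding eq .
  have nn: "Complex (- B * snd (v n p)) (fst (v n p)) / \<zeta> n p \<notin> \<real>\<^sub>\<le>\<^sub>0" if "p \<in> {0..g} \<times> J" for p
    using jump_Re[of p n] that by (auto simp: complex_nonpos_Reals_iff)
  have "continuous_on ({0..g} \<times> J) (\<lambda>p. Complex (- B * snd (v n p)) (fst (v n p)) / \<zeta> n p)"
    by (intro continuous_on_divide c zeta_cont g) (auto intro!: zeta_nz)
  then have "continuous_on ({0..g} \<times> J) (\<lambda>p. Ln (Complex (- B * snd (v n p)) (fst (v n p)) / \<zeta> n p))"
    using nn by (intro continuous_on_Ln') blast
  then show ?thesis unfolding jump_def[abs_def] by (rule continuous_on_Im)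
qed

lemma zeta_Im_pos:
  assumes "p \<in> {0..g} \<times> J" "g * qbar T \<le> h0"
  shows "Im (\<zeta> T p) > 0"
proof -
  have "fst p * qbar T \<le> g * qbar T" using assms qbar_pos[of T] by (intro mult_right_mono) auto
  then have "\<bar>fst (v T (fst p, snd p)) - 1\<bar> \<le> 1 / 4" using assms by (intro v_near_coord) auto
  then have "1 - 1 / 4 \<le> fst (v T p)" by (simp only: abs_le_iff prod.collapse) linarith
  then show ?thesis by (simp add: \<zeta>_def)
qed

lemma Om_cont:
  assumes g: "0 \<le> g" and T: "g * qbar T \<le> h0"
  shows "continuous_on ({0..g} \<times> J) (Om T k)"
proof -
  have "\<zeta> T p \<notin> \<real>\<^sub>\<le>\<^sub>0" if "p \<in> {0..g} \<times> J" for p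
    using zeta_Im_pos[OF that T] by (auto simp: complex_nonpos_Reals_iff)
  then have "continuous_on ({0..g} \<times> J) (\<lambda>p. Ln (\<zeta> T p))"
    by (intro continuous_on_Ln' zeta_cont g) blast
  then show ?thesis unfolding Om_def[abs_def]
    by (intro continuous_on_add continuous_on_sum continuous_on_Im D_cont jump_cont g)
qed

text \<open>The curve turns by \<open>jump (Suc n)\<close> at the upper vertex and by
  \<open>D n\<close> along the edge. The normalisation divides by \<open>bet\<close>, of which only
  the sign \<open>sg\<close> affects the angle.\<close>

lemma zeta_step:
  assumes p: "p \<in> {0..} \<times> J"
  shows "\<exists>r>0. sg * \<zeta> n p = of_real r * \<zeta> (Suc n) p * cis (D n p + jump (Suc n) p)"
proof -
  define Z where "Z x = Complex (snd (Y n p x)) (fst (Y n p x))" for x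
  define Z' where "Z' x = Complex (- pot n p x * fst (Y n p x)) (snd (Y n p x))" for x
  have ZE: "Z = (\<lambda>x. of_real (snd (Y n p x)) + \<i> * of_real (fst (Y n p x)))"
    "Z' = (\<lambda>x. of_real (- pot n p x * fst (Y n p x)) + \<i> * of_real (snd (Y n p x)))"
    by (auto simp: Z_def Z'_def fun_eq_iff complex_eq_iff)
  have nz: "Z x \<noteq> 0" if "x \<in> {0..1}" for x
    using Y_nonzero(1)[OF p that, of n] by (auto simp: Z_def complex_eq_iff prod_eq_iff)
  have d: "(Z has_vector_derivative Z' x) (at x within {0..1})" if x: "x \<in> {0..1}" for x
    unfolding ZE using ode_solD[OF Y_sol x, of n p]
    by (intro has_vector_derivative_add has_vector_derivative_mult_right has_vector_derivative_of_real)
      (simp_all add: has_real_derivative_iff_has_vector_derivative)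
  have cont: "continuous_on {0..1} Z" "continuous_on {0..1} Z'"
    unfolding ZE by (intro continuous_intros pot_cont continuous_on_fst[OF Y_cont] continuous_on_snd[OF Y_cont])+
  define E where "E = integral {0..1} (\<lambda>x. Z' x / Z x)"
  have Z1: "Z 1 = Z 0 * exp E" unfolding E_def by (rule exp_log_derivative[OF d nz cont(2)])
  have "(\<lambda>x. Z' x / Z x) integrable_on {0..1}"
    using nz by (intro integrable_continuous_interval continuous_on_divide cont) auto
  then have "Im E = integral {0..1} (\<lambda>x. Im (Z' x / Z x))"
    unfolding E_def by (metis has_integral_Im integrable_integral integral_unique)
  also have "(\<lambda>x. Im (Z' x / Z x)) = rate n p"
    by (simp add: fun_eq_iff Z_def Z'_def Im_divide rate_def power2_eq_square algebra_simps)
  finally have ImE: "Im E = D n p" by (simp add: D_def)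
  have expE: "exp E = of_real (exp (Re E)) * cis (D n p)" by (simp add: exp_eq_polar ImE)
  let ?w = "Complex (- B * snd (v (Suc n) p)) (fst (v (Suc n) p)) / \<zeta> (Suc n) p"
  have wnz: "?w \<noteq> 0" using jump_Re[OF p, of "Suc n"] by (metis less_irrefl zero_complex.sel(1))
  have Z0: "Z 0 = \<zeta> (Suc n) p * (of_real (norm ?w) * cis (jump (Suc n) p))"
  proof -
    have "Z 0 = \<zeta> (Suc n) p * ?w" using zeta_nz[OF p] by (simp add: Z_def Y_0)
    then show ?thesis using cis_Im_Ln[OF wnz] by (simp add: jump_def)
  qed
  have "Z 1 = of_real (bet (snd p)) * \<zeta> n p"
    by (simp add: Z_def Y_1[OF p] \<zeta>_def complex_eq_iff)
  then have "of_real (bet (snd p)) * \<zeta> n p = of_real (norm ?w * exp (Re E)) * \<zeta> (Suc n) p * cis (D n p + jump (Suc n) p)"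
    using Z1 by (simp add: Z0 expE cis_mult[symmetric] mult_ac)
  moreover have bp: "\<bar>bet (snd p)\<bar> > 0" "bet (snd p) = sg * \<bar>bet (snd p)\<bar>"
    using bet_abs[of "snd p"] p sg by auto
  ultimately have "of_real \<bar>bet (snd p)\<bar> * (sg * \<zeta> n p) = of_real (norm ?w * exp (Re E)) * \<zeta> (Suc n) p * cis (D n p + jump (Suc n) p)"
    by (metis mult.assoc mult.commute of_real_mult)
  then have "sg * \<zeta> n p = of_real (norm ?w * exp (Re E) / \<bar>bet (snd p)\<bar>) * \<zeta> (Suc n) p * cis (D n p + jump (Suc n) p)"
    using bp(1) by (simp add: field_simps)
  moreover have "norm ?w * exp (Re E) / \<bar>bet (snd p)\<bar> > 0" using wnz bp(1) by auto
  ultimately show ?thesis by blast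
qed

lemma zeta_Om:
  assumes p: "p \<in> {0..} \<times> J" and k: "k \<le> T"
  shows "\<exists>r>0. of_real (sg ^ (T - k)) * \<zeta> k p = of_real r * cis (Om T k p)"
  using k
proof (induction k rule: inc_induct)
  case base
  then show ?case
    using zeta_nz[OF p, of T] cis_Im_Ln[OF zeta_nz[OF p, of T]]
    by (intro exI[of _ "norm (\<zeta> T p)"]) (simp add: Om_def)
next
  case (step n)
  obtain r where r: "r > 0" "of_real (sg ^ (T - Suc n)) * \<zeta> (Suc n) p = of_real r * cis (Om T (Suc n) p)"
    using step.IH by blast
  obtain r' where r': "r' > 0" "sg * \<zeta> n p = of_real r' * \<zeta> (Suc n) p * cis (D n p + jump (Suc n) p)"
    using zeta_step[OF p] by blast
  have "of_real (sg ^ (T - n)) * \<zeta> n p = of_real (sg ^ (T - Suc n)) * (sg * \<zeta> n p)"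
    using step.hyps by (simp add: Suc_diff_Suc[symmetric] power_Suc2 del: power_Suc)
  also have "\<dots> = of_real r' * (of_real (sg ^ (T - Suc n)) * \<zeta> (Suc n) p) * cis (D n p + jump (Suc n) p)"
    unfolding r'(2) by (simp add: mult_ac)
  also have "\<dots> = of_real (r' * r) * cis (Om T (Suc n) p + (D n p + jump (Suc n) p))"
    unfolding r(2) by (simp add: cis_mult[symmetric] mult_ac)
  also have "Om T (Suc n) p + (D n p + jump (Suc n) p) = Om T n p"
    using step.hyps by (simp add: Om_def sum.atLeast_Suc_lessThan)
  finally show ?case using r(1) r'(1) by (intro exI[of _ "r' * r"]) auto
qed

lemma fst_v_eq_0_iff:
  assumes p: "p \<in> {0..} \<times> J" and k: "k \<le> T"
  shows "fst (v k p) = 0 \<longleftrightarrow> sin (Om T k p) = 0"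
proof -
  obtain r where r: "r > 0" "of_real (sg ^ (T - k)) * \<zeta> k p = of_real r * cis (Om T k p)"
    using zeta_Om[OF p k] by blast
  from arg_cong[OF r(2), of Im] have "sg ^ (T - k) * fst (v k p) = r * sin (Om T k p)"
    by (simp add: \<zeta>_def)
  moreover have "sg ^ (T - k) \<noteq> 0" using sg by auto
  ultimately show ?thesis using r(1) by (metis less_irrefl mult_eq_0_iff)
qed

section \<open>Monotonicity of the angle in the coupling and in the level\<close>

definition wr :: "nat \<Rightarrow> real \<times> real \<Rightarrow> real \<times> real \<Rightarrow> real" where
  "wr n p r = fst (v n p) * snd (v n r) - snd (v n p) * fst (v n r)"

text \<open>The power of \<open>sg\<close> enters both states and cancels, so the Wronskian has the
  sign of the sine of the difference of the lifts.\<close>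

lemma wr_Om:
  assumes "p \<in> {0..} \<times> J" "r \<in> {0..} \<times> J" "k \<le> T"
  shows "\<exists>c>0. wr k p r = c * sin (Om T k r - Om T k p)"
proof -
  obtain a where a: "a > 0" "of_real (sg ^ (T - k)) * \<zeta> k p = of_real a * cis (Om T k p)"
    using zeta_Om[OF assms(1,3)] by blast
  obtain c where c: "c > 0" "of_real (sg ^ (T - k)) * \<zeta> k r = of_real c * cis (Om T k r)"
    using zeta_Om[OF assms(2,3)] by blast
  have s: "sg ^ (T - k) * sg ^ (T - k) = 1"
    using sg_sq(1) by (simp add: power_mult_distrib[symmetric])
  have "wr k p r = (sg ^ (T - k) * sg ^ (T - k)) * wr k p r" by (simp add: s)
  also have "\<dots> = Im (of_real (sg ^ (T - k)) * \<zeta> k r) * Re (of_real (sg ^ (T - k)) * \<zeta> k p)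
     - Re (of_real (sg ^ (T - k)) * \<zeta> k r) * Im (of_real (sg ^ (T - k)) * \<zeta> k p)"
    by (simp add: wr_def \<zeta>_def algebra_simps)
  also have "\<dots> = (a * c) * sin (Om T k r - Om T k p)"
    unfolding a(2) c(2) by (simp add: sin_diff algebra_simps)
  finally show ?thesis using a(1) c(1) by (intro exI[of _ "a * c"]) auto
qed

text \<open>The factors \<open>bet\<close> undo the normalisation at the lower end of the edge, and
  \<open>B\<close> is the scaling of the derivatives at its upper end.\<close>

lemma wr_step:
  assumes "p \<in> {0..} \<times> J" "r \<in> {0..} \<times> J"
  shows "((\<lambda>x. (pot n r x - pot n p x) * fst (Y n p x) * fst (Y n r x)) has_integral
     (bet (snd p) * bet (snd r) * wr n p r - B * wr (Suc n) p r)) {0..1}"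
proof -
  have "((\<lambda>x. - ((pot n p x - pot n r x) * fst (Y n p x) * fst (Y n r x))) has_integral
     - ((fst (Y n p 1) * snd (Y n r 1) - snd (Y n p 1) * fst (Y n r 1)) - (fst (Y n p 0) * snd (Y n r 0) - snd (Y n p 0) * fst (Y n r 0)))) {0..1}"
    by (intro has_integral_neg ode_wronskian Y_sol)
  moreover have "- ((fst (Y n p 1) * snd (Y n r 1) - snd (Y n p 1) * fst (Y n r 1)) - (fst (Y n p 0) * snd (Y n r 0) - snd (Y n p 0) * fst (Y n r 0)))
     = bet (snd p) * bet (snd r) * wr n p r - B * wr (Suc n) p r"
    by (simp add: Y_0 Y_1[OF assms(1)] Y_1[OF assms(2)] wr_def algebra_simps)
  moreover have "(\<lambda>x. - ((pot n p x - pot n r x) * fst (Y n p x) * fst (Y n r x)))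
     = (\<lambda>x. (pot n r x - pot n p x) * fst (Y n p x) * fst (Y n r x))"
    by (simp add: fun_eq_iff algebra_simps)
  ultimately show ?thesis by (simp only:)
qed

lemma wr_bounded: "0 \<le> g \<Longrightarrow> \<exists>M>0. \<forall>n. \<forall>p\<in>{0..g}\<times>J. \<forall>r\<in>{0..g}\<times>J. \<bar>wr n p r\<bar> \<le> M"
proof -
  assume "0 \<le> g"
  then obtain M where M: "M > 0" "\<And>n p. p \<in> {0..g} \<times> J \<Longrightarrow> norm (v n p) \<le> M" using v_bounded[of g] by blast
  have fs: "\<bar>fst (v n p)\<bar> \<le> M" "\<bar>snd (v n p)\<bar> \<le> M" if "p \<in> {0..g} \<times> J" for n p
    using M(2)[OF that, of n] norm_fst_le[of "fst (v n p)" "snd (v n p)"] norm_snd_le[of "snd (v n p)" "fst (v n p)"] by auto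
  have "\<bar>wr n p r\<bar> \<le> M * M + M * M" if "p \<in> {0..g} \<times> J" "r \<in> {0..g} \<times> J" for n p r
  proof -
    have "\<bar>fst (v n p) * snd (v n r)\<bar> \<le> M * M" "\<bar>snd (v n p) * fst (v n r)\<bar> \<le> M * M"
      unfolding abs_mult using fs[OF that(1)] fs[OF that(2)] M(1) by (auto intro!: mult_mono)
    then show ?thesis unfolding wr_def by linarith
  qed
  then show ?thesis using M(1) by (intro exI[of _ "M * M + M * M"]) auto
qed

lemma Y_bounded: "0 \<le> g \<Longrightarrow> \<exists>M>0. \<forall>n. \<forall>p\<in>{0..g}\<times>J. \<forall>x\<in>{0..1}. norm (Y n p x) \<le> M"
proof -
  assume g: "0 \<le> g"
  then obtain M where M: "M > 0" "\<And>n p. p \<in> {0..g} \<times> J \<Longrightarrow> norm (v n p) \<le> M" using v_bounded[of g] by blast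
  have "norm (Y n p x) \<le> exp (D0 + g * qbar 0 + 2) * (B * M)" if p: "p \<in> {0..g} \<times> J" and x: "x \<in> {0..1}" for n p x
  proof -
    have b: "\<bar>pot n p x\<bar> \<le> D0 + g * qbar 0" if x: "x \<in> {0..1}" for x
      using p qbar_pos[of n] g qbar_antimono[of 0 n] D0
      by (intro pot_bound[OF x] mult_mono) auto
    have "norm (Y n p x) \<le> exp (D0 + g * qbar 0 + 2) * norm (fst (v (Suc n) p), - B * snd (v (Suc n) p))"
      unfolding Y_def by (rule flow_norm_le[OF pot_cont b x])
    also have "\<dots> \<le> exp (D0 + g * qbar 0 + 2) * (B * M)"
      using M(2)[OF p, of "Suc n"] B2
      by (intro mult_left_mono order_trans[OF norm_scaled_le]) auto
    finally show ?thesis .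
  qed
  then show ?thesis using M(1) B2 by (intro exI[of _ "exp (D0 + g * qbar 0 + 2) * (B * M)"]) auto
qed

text \<open>Lagrange's identity expresses the Wronskian of two decaying solutions as a series, whose
  sum is continuous in the second parameter and positive on the diagonal.\<close>

lemma wr_sign_local:
  assumes g: "0 \<le> g" and p: "p \<in> {0..g} \<times> J0"
    and wc: "\<And>n. continuous_on {0..1} (\<rho> n)" and wp: "\<And>n x. x \<in> {0..1} \<Longrightarrow> 0 < \<rho> n x"
    and wb: "\<And>n x. x \<in> {0..1} \<Longrightarrow> \<rho> n x \<le> W"
  shows "\<exists>\<delta>>0. \<forall>r\<in>{0..g}\<times>J0. \<forall>\<tau>. dist r p < \<delta> \<longrightarrow> \<tau> \<noteq> 0 \<longrightarrow>
    (\<forall>n. \<forall>x\<in>{0..1}. pot n r x - pot n p x = \<tau> * \<rho> n x) \<longrightarrow> 0 < \<tau> * wr k p r"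
proof -
  have pJ: "p \<in> {0..} \<times> J" "p \<in> {0..g} \<times> J" using p by (auto simp: J0_def)
  \<comment> \<open>The edge integrals of Lagrange's identity, with the parameter difference \<tau>
    split off.\<close>
  define R where "R n r = integral {0..1} (\<lambda>x. \<rho> n x * fst (Y n p x) * fst (Y n r x))" for n r
  \<comment> \<open>The ratio by which a Wronskian is damped from one generation to the next on the
    way to the root. It is below 1 at \<open>p\<close> because the level lies strictly inside the
    gap, and by continuity below one bound \<open>\<kappa>1 < 1\<close> near
    \<open>p\<close>.\<close>
  define \<kappa> where "\<kappa> r = B / (bet (snd p) * bet (snd r))" for r :: "real \<times> real"
  have bb: "B < bet (snd r) * bet (snd r)" if "snd r \<in> J0" for r :: "real \<times> real"
  proof -
    have rJ: "snd r \<in> J" using that by (auto simp: J0_def)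
    have "sqrt B < sg * bet (snd r)" using bet_props(3)[OF rJ] that by (auto simp: J0_def)
    moreover have "sqrt B > 0" using B2 by simp
    ultimately have "sqrt B * sqrt B < (sg * bet (snd r)) * (sg * bet (snd r))" by (intro mult_strict_mono) linarith+
    then show ?thesis using sg by auto
  qed
  have bpos: "bet (snd p) * bet (snd r) > 0" if "snd r \<in> J" for r :: "real \<times> real"
  proof -
    have "sg * bet (snd p) > 0" "sg * bet (snd r) > 0"
      using bet_abs(1,3)[of "snd p"] bet_abs(1,3)[OF that] pJ by auto
    then have "(sg * bet (snd p)) * (sg * bet (snd r)) > 0" by (rule mult_pos_pos)
    then show ?thesis using sg by auto
  qed
  obtain M where M: "M > 0" "\<And>n r x. r \<in> {0..g}\<times>J \<Longrightarrow> x \<in> {0..1} \<Longrightarrow> norm (Y n r x) \<le> M"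
    using Y_bounded[OF g] by blast
  have fY: "\<bar>fst (Y n r x)\<bar> \<le> M" if "r \<in> {0..g}\<times>J" "x \<in> {0..1}" for n r x
    using M(2)[OF that, of n] norm_fst_le[of "fst (Y n r x)" "snd (Y n r x)"] by auto
  have cI: "continuous_on {0..1} (\<lambda>x. \<rho> n x * fst (Y n p x) * fst (Y n r x))" for n r
    by (intro continuous_on_mult wc continuous_on_fst[OF Y_cont])
  have Rb: "\<bar>R n r\<bar> \<le> W * M * M" if r: "r \<in> {0..g}\<times>J" for n r
  proof -
    have "norm (R n r) \<le> W * M * M * (1 - 0)"
      unfolding R_def
    proof (rule integral_bound[OF _ cI])
      fix x :: real assume x: "x \<in> {0..1}"
      have "\<bar>\<rho> n x\<bar> * \<bar>fst (Y n p x)\<bar> * \<bar>fst (Y n r x)\<bar> \<le> W * M * M"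
        using wp[OF x, of n] wb[OF x, of n] fY[OF pJ(2) x, of n] fY[OF r x, of n] M(1)
        by (intro mult_mono) auto
      then show "norm (\<rho> n x * fst (Y n p x) * fst (Y n r x)) \<le> W * M * M" by (simp add: abs_mult)
    qed simp
    then show ?thesis by simp
  qed
  have Rc: "continuous_on ({0..g} \<times> J) (R n)" for n
  proof -
    have yc: "continuous_on (({0..g} \<times> J) \<times> {0..1}) (\<lambda>y. Y n (fst y) (snd y))"
      using Y_cont_param[OF g, of n] by (simp add: case_prod_beta)
    have "continuous_on (({0..g} \<times> J) \<times> {0..1}) (\<lambda>y. \<rho> n (snd y) * fst (Y n p (snd y)) * fst (Y n (fst y) (snd y)))"
      by (intro continuous_on_mult continuous_on_fst[OF yc] continuous_on_compose2[OF wc]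
          continuous_on_fst continuous_on_compose2[OF Y_cont]) (auto intro!: continuous_intros)
    then show ?thesis unfolding R_def[abs_def]
      using integral_continuous_on_param[of "{0..g} \<times> J" 0 "1::real" "\<lambda>r x. \<rho> n x * fst (Y n p x) * fst (Y n r x)"]
      by (simp add: case_prod_beta cbox_interval)
  qed
  define \<kappa>1 where "\<kappa>1 = (1 + \<kappa> p) / 2"
  have kp: "\<kappa> p < 1" "0 < \<kappa> p" using bb[of p] bpos[of p] p pJ B2 by (auto simp: \<kappa>_def divide_simps)
  have k1: "\<kappa> p < \<kappa>1" "\<kappa>1 < 1" "0 < \<kappa>1" using kp by (auto simp: \<kappa>1_def)
  have kc: "continuous_on ({0..g} \<times> J) \<kappa>"
  proof -
    have bc: "continuous_on ({0..g} \<times> J) (\<lambda>r. bet (snd r))"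
      by (rule continuous_on_compose2[OF bet_cont]) (auto intro!: continuous_intros)
    have "bet (snd p) * bet (snd r) \<noteq> 0" if "r \<in> {0..g} \<times> J" for r using bpos[of r] that by auto
    then show ?thesis unfolding \<kappa>_def[abs_def]
      by (intro continuous_on_divide continuous_on_mult continuous_on_const bc) auto
  qed
  define U where "U = {r \<in> {0..g} \<times> J. \<kappa> r \<le> \<kappa>1}"
  define H where "H r = (\<Sum>j. \<kappa> r ^ j * R (k + j) r)" for r
  have term_bound: "norm (\<kappa> r ^ j * R (k + j) r) \<le> \<kappa>1 ^ j * (W * M * M)" if "r \<in> U" for r j
  proof -
    have rJ: "r \<in> {0..g} \<times> J" using that by (simp add: U_def)
    have k: "0 \<le> \<kappa> r" "\<kappa> r \<le> \<kappa>1" using that bpos[of r] B2 by (auto simp: U_def \<kappa>_def)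
    have "norm (\<kappa> r ^ j * R (k + j) r) = \<kappa> r ^ j * \<bar>R (k + j) r\<bar>"
      using k by (simp add: abs_mult)
    also have "\<dots> \<le> \<kappa>1 ^ j * (W * M * M)"
      using k Rb[OF rJ, of "k + j"] by (intro mult_mono power_mono) auto
    finally show ?thesis .
  qed
  have sm: "summable (\<lambda>j. \<kappa>1 ^ j * (W * M * M))"
    using k1 by (intro summable_mult2 summable_geometric) auto
  have UL: "uniform_limit U (\<lambda>N r. \<Sum>j<N. \<kappa> r ^ j * R (k + j) r) H sequentially"
    unfolding H_def by (rule Weierstrass_m_test[OF term_bound sm])
  have CC: "continuous_on U (\<lambda>r. \<Sum>j<N. \<kappa> r ^ j * R (k + j) r)" for N
    by (intro continuous_on_sum continuous_on_mult continuous_on_power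
        continuous_on_subset[OF kc] continuous_on_subset[OF Rc]) (auto simp: U_def)
  have Hc: "continuous_on U H"
    by (rule uniform_limit_theorem[OF always_eventually[OF allI[OF CC]] UL]) simp
  have pU: "p \<in> U" using pJ k1 by (auto simp: U_def)
  have Rnn: "R n p \<ge> 0" for n
    unfolding R_def using wp by (intro integral_nonneg integrable_continuous_interval cI)
      (auto simp: mult.assoc less_imp_le)
  \<comment> \<open>The integrand is nonnegative on the diagonal; a vanishing integral would make
    the solution vanish on the edge together with its derivative.\<close>
  have Rk: "R k p > 0"
  proof (rule ccontr)
    assume "\<not> R k p > 0"
    then have "integral {0..1} (\<lambda>x. \<rho> k x * fst (Y k p x) * fst (Y k p x)) = 0" using Rnn[of k] by (simp add: R_def)
    then have z: "\<forall>x\<in>{0..1}. \<rho> k x * fst (Y k p x) * fst (Y k p x) = 0"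
      using wp integral_eq_0_iff[OF cI] by (auto simp: mult.assoc less_imp_le)
    then have f0: "fst (Y k p x) = 0" if "x \<in> {0..1}" for x using wp[OF that, of k] that by force
    have "((\<lambda>x. fst (Y k p x)) has_real_derivative snd (Y k p (1/2))) (at (1/2) within {0..1})"
      using ode_solD(1)[OF Y_sol[of k p], of "1/2"] by simp
    then have "((\<lambda>x. 0) has_real_derivative snd (Y k p (1/2))) (at (1/2) within {0..1})"
      by (rule has_field_derivative_transform_within[OF _ zero_less_one]) (auto simp: f0)
    then have "((\<lambda>x. 0) has_real_derivative snd (Y k p (1/2))) (at (1/2))" by (simp add: at_within_Icc_at)
    then have "snd (Y k p (1/2)) = 0" using DERIV_unique DERIV_const by blast
    then show False using f0[of "1/2"] Y_nonzero(1)[OF pJ(1), of "1/2" k] by (simp add: prod_eq_iff)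
  qed
  have Hp: "H p > 0"
  proof -
    have s: "summable (\<lambda>j. \<kappa> p ^ j * R (k + j) p)"
      by (rule summable_comparison_test'[OF sm]) (use term_bound[OF pU] in auto)
    have "0 < (\<Sum>j<1. \<kappa> p ^ j * R (k + j) p)" using Rk by simp
    also have "\<dots> \<le> H p" unfolding H_def using kp Rnn by (intro sum_le_suminf s) auto
    finally show ?thesis .
  qed
  obtain \<delta>1 where \<delta>1: "\<delta>1 > 0" "\<And>r. r \<in> U \<Longrightarrow> dist r p < \<delta>1 \<Longrightarrow> dist (H r) (H p) < H p"
    using Hc pU Hp unfolding continuous_on_iff by metis
  obtain \<delta>2 where \<delta>2: "\<delta>2 > 0" "\<And>r. r \<in> {0..g} \<times> J \<Longrightarrow> dist r p < \<delta>2 \<Longrightarrow> dist (\<kappa> r) (\<kappa> p) < \<kappa>1 - \<kappa> p"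
    using kc pJ(2) k1(1) unfolding continuous_on_iff by (metis diff_gt_0_iff_gt)
  show ?thesis
  proof (intro exI[of _ "min \<delta>1 \<delta>2"] conjI ballI allI impI)
    fix r \<tau> assume r: "r \<in> {0..g} \<times> J0" and d: "dist r p < min \<delta>1 \<delta>2" and \<tau>: "\<tau> \<noteq> (0::real)"
      and pot: "\<forall>n. \<forall>x\<in>{0..1}. pot n r x - pot n p x = \<tau> * \<rho> n x"
    have rJ: "r \<in> {0..} \<times> J" "r \<in> {0..g} \<times> J" using r by (auto simp: J0_def)
    have rU: "r \<in> U" using \<delta>2(2)[OF rJ(2)] d rJ by (auto simp: U_def dist_real_def)
    have Hr: "H r > 0" using \<delta>1(2)[OF rU] d by (auto simp: dist_real_def)
    have bpr: "bet (snd p) * bet (snd r) > 0" using bpos[of r] rJ by auto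
    have step: "wr n p r = \<kappa> r * wr (Suc n) p r + (\<tau> * \<kappa> r / B) * R n r" for n
    proof -
      have "((\<lambda>x. \<tau> * (\<rho> n x * fst (Y n p x) * fst (Y n r x))) has_integral \<tau> * R n r) {0..1}"
        unfolding R_def by (intro has_integral_mult_right integrable_integral integrable_continuous_interval cI)
      then have "((\<lambda>x. (pot n r x - pot n p x) * fst (Y n p x) * fst (Y n r x)) has_integral \<tau> * R n r) {0..1}"
        by (rule has_integral_eq[rotated]) (use pot in auto)
      from has_integral_unique[OF this wr_step[OF pJ(1) rJ(1)]]
      have "\<tau> * R n r = bet (snd p) * bet (snd r) * wr n p r - B * wr (Suc n) p r" .
      then have "wr n p r = (B * wr (Suc n) p r + \<tau> * R n r) / (bet (snd p) * bet (snd r))"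
        using bpr by (subst nonzero_eq_divide_eq) (auto simp: mult_ac)
      then show ?thesis using B2 by (simp add: \<kappa>_def add_divide_distrib)
    qed
    \<comment> \<open>Since the Wronskians are bounded in the height and
      \<open>\<kappa> r < 1\<close>, the first term disappears as \<open>N\<close> grows and the
      series \<open>H r\<close> remains.\<close>
    have iter: "wr k p r = \<kappa> r ^ N * wr (k + N) p r + (\<tau> * \<kappa> r / B) * (\<Sum>j<N. \<kappa> r ^ j * R (k + j) r)" for N
    proof (induction N)
      case (Suc N)
      then show ?case using step[of "k + N"] by (simp add: algebra_simps)
    qed simp
    obtain M' where M': "M' > 0" "\<And>n. \<bar>wr n p r\<bar> \<le> M'" using wr_bounded[OF g] pJ(2) rJ(2) by blast
    have kr: "0 < \<kappa> r" using bpr B2 by (simp add: \<kappa>_def)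
    have kr1: "\<kappa> r < 1" using rU k1 by (auto simp: U_def)
    have "(\<lambda>N. \<kappa> r ^ N * wr (k + N) p r) \<longlonglongrightarrow> 0"
    proof (rule Lim_null_comparison[OF always_eventually])
      show "\<forall>N. norm (\<kappa> r ^ N * wr (k + N) p r) \<le> \<kappa> r ^ N * M'"
        using M' kr by (auto simp: abs_mult intro!: mult_left_mono)
      show "(\<lambda>N. \<kappa> r ^ N * M') \<longlonglongrightarrow> 0"
        using kr kr1 by (intro tendsto_mult_left_zero LIMSEQ_realpow_zero) auto
    qed
    moreover have "(\<lambda>N. \<Sum>j<N. \<kappa> r ^ j * R (k + j) r) \<longlonglongrightarrow> H r"
      unfolding H_def by (intro summable_LIMSEQ summable_comparison_test'[OF sm]) (use term_bound[OF rU] in auto)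
    ultimately have "(\<lambda>N. \<kappa> r ^ N * wr (k + N) p r + (\<tau> * \<kappa> r / B) * (\<Sum>j<N. \<kappa> r ^ j * R (k + j) r)) \<longlonglongrightarrow> 0 + (\<tau> * \<kappa> r / B) * H r"
      by (intro tendsto_intros)
    then have "(\<lambda>N. wr k p r) \<longlonglongrightarrow> 0 + (\<tau> * \<kappa> r / B) * H r" by (simp only: iter[symmetric])
    then have "wr k p r = (\<tau> * \<kappa> r / B) * H r" by (simp add: LIMSEQ_const_iff)
    then have "\<tau> * wr k p r = \<tau> * \<tau> * (\<kappa> r / B * H r)" by simp
    moreover have "\<tau> * \<tau> > 0" using \<tau> by (metis not_real_square_gt_zero)
    ultimately show "0 < \<tau> * wr k p r" using kr Hr B2 by simp
  qed (use \<delta>1 \<delta>2 in auto)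
qed

text \<open>A change of \<open>s\<close> by \<tau> changes the potential by \<open>\<tau> q\<close>
  with \<open>q > 0\<close>; for a change of the level the positive weight is the constant
  1.\<close>

lemma Om_strict_s:
  assumes \<mu>: "\<mu> \<in> J0" and g: "0 \<le> g" "g * qbar T \<le> h0" and k: "k \<le> T"
    and s: "0 \<le> s1" "s1 < s2" "s2 \<le> g"
  shows "Om T k (s1, \<mu>) < Om T k (s2, \<mu>)"
proof (rule strict_increase_from_local[of 0 g "\<lambda>s. Om T k (s, \<mu>)"])
  show "continuous_on {0..g} (\<lambda>s. Om T k (s, \<mu>))"
    by (rule continuous_on_compose2[OF Om_cont[OF g]]) (use \<mu> in \<open>auto intro!: continuous_intros simp: J0_def\<close>)
  fix s assume s: "s \<in> {0..g}"
  have "\<exists>\<delta>>0. \<forall>r\<in>{0..g}\<times>J0. \<forall>\<tau>. dist r (s, \<mu>) < \<delta> \<longrightarrow> \<tau> \<noteq> 0 \<longrightarrow>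
    (\<forall>n. \<forall>x\<in>{0..1}. pot n r x - pot n (s, \<mu>) x = \<tau> * q (real n + 1 - x)) \<longrightarrow> 0 < \<tau> * wr k (s, \<mu>) r"
  proof (rule wr_sign_local[OF g(1)])
    show "continuous_on {0..1} (\<lambda>x. q (real n + 1 - x))" for n
      by (rule continuous_on_compose2[OF q_cont]) (auto intro!: continuous_intros)
    show "q (real n + 1 - x) \<le> qbar 0" if "x \<in> {0..1}" for n x
      using q_le_qbar[OF that, of n] qbar_antimono[of 0 n] by simp
  qed (use s \<mu> q_pos in auto)
  then obtain \<delta> where \<delta>: "\<delta> > 0" "\<And>r \<tau>. r \<in> {0..g}\<times>J0 \<Longrightarrow> dist r (s, \<mu>) < \<delta> \<Longrightarrow> \<tau> \<noteq> 0 \<Longrightarrow>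
    (\<And>n x. x\<in>{0..1} \<Longrightarrow> pot n r x - pot n (s, \<mu>) x = \<tau> * q (real n + 1 - x)) \<Longrightarrow> 0 < \<tau> * wr k (s, \<mu>) r"
    by metis
  show "\<exists>d>0. \<forall>t\<in>{0..g}. \<bar>t - s\<bar> < d \<longrightarrow> t \<noteq> s \<longrightarrow> 0 < (t - s) * sin (Om T k (t, \<mu>) - Om T k (s, \<mu>))"
  proof (intro exI[of _ \<delta>] conjI ballI impI \<delta>(1))
    fix t assume t: "t \<in> {0..g}" "\<bar>t - s\<bar> < \<delta>" "t \<noteq> s"
    have "0 < (t - s) * wr k (s, \<mu>) (t, \<mu>)"
      using t \<mu> by (intro \<delta>(2)) (auto simp: dist_Pair_Pair dist_real_def pot_def algebra_simps)
    moreover obtain c where "c > 0" "wr k (s, \<mu>) (t, \<mu>) = c * sin (Om T k (t, \<mu>) - Om T k (s, \<mu>))"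
      using wr_Om[of "(s, \<mu>)" "(t, \<mu>)" k T] s t \<mu> k by (auto simp: J0_def)
    ultimately have "0 < c * ((t - s) * sin (Om T k (t, \<mu>) - Om T k (s, \<mu>)))" by (simp add: mult_ac)
    then show "0 < (t - s) * sin (Om T k (t, \<mu>) - Om T k (s, \<mu>))"
      using \<open>c > 0\<close> by (rule zero_less_mult_pos)
  qed
qed (use s in auto)

lemma Om_strict_mu:
  assumes \<mu>: "{\<mu>1..\<mu>2} \<subseteq> J0" "\<mu>1 < \<mu>2" and g: "0 \<le> g" "g * qbar T \<le> h0" and k: "k \<le> T"
    and s: "0 \<le> s" "s \<le> g"
  shows "Om T k (s, \<mu>1) < Om T k (s, \<mu>2)"
proof (rule strict_increase_from_local[of \<mu>1 \<mu>2 "\<lambda>\<mu>. Om T k (s, \<mu>)"])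
  show "continuous_on {\<mu>1..\<mu>2} (\<lambda>\<mu>. Om T k (s, \<mu>))"
    by (rule continuous_on_compose2[OF Om_cont[OF g]]) (use \<mu> s in \<open>auto intro!: continuous_intros simp: J0_def\<close>)
  fix \<mu> assume m: "\<mu> \<in> {\<mu>1..\<mu>2}"
  have "\<exists>\<delta>>0. \<forall>r\<in>{0..g}\<times>J0. \<forall>\<tau>. dist r (s, \<mu>) < \<delta> \<longrightarrow> \<tau> \<noteq> 0 \<longrightarrow>
    (\<forall>n. \<forall>x\<in>{0..1}. pot n r x - pot n (s, \<mu>) x = \<tau> * 1) \<longrightarrow> 0 < \<tau> * wr k (s, \<mu>) r"
    by (rule wr_sign_local[OF g(1), where \<rho> = "\<lambda>_ _. 1" and W = 1]) (use s m \<mu> in auto)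
  then obtain \<delta> where \<delta>: "\<delta> > 0" "\<And>r \<tau>. r \<in> {0..g}\<times>J0 \<Longrightarrow> dist r (s, \<mu>) < \<delta> \<Longrightarrow> \<tau> \<noteq> 0 \<Longrightarrow>
    (\<And>n x. x\<in>{0..1} \<Longrightarrow> pot n r x - pot n (s, \<mu>) x = \<tau> * 1) \<Longrightarrow> 0 < \<tau> * wr k (s, \<mu>) r"
    by metis
  show "\<exists>d>0. \<forall>t\<in>{\<mu>1..\<mu>2}. \<bar>t - \<mu>\<bar> < d \<longrightarrow> t \<noteq> \<mu> \<longrightarrow> 0 < (t - \<mu>) * sin (Om T k (s, t) - Om T k (s, \<mu>))"
  proof (intro exI[of _ \<delta>] conjI ballI impI \<delta>(1))
    fix t assume t: "t \<in> {\<mu>1..\<mu>2}" "\<bar>t - \<mu>\<bar> < \<delta>" "t \<noteq> \<mu>"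
    have "0 < (t - \<mu>) * wr k (s, \<mu>) (s, t)"
      using t \<mu> s by (intro \<delta>(2)) (auto simp: dist_Pair_Pair dist_real_def pot_def algebra_simps)
    moreover have "\<mu> \<in> J" "t \<in> J" using t m \<mu> by (auto simp: J0_def)
    then obtain c where "c > 0" "wr k (s, \<mu>) (s, t) = c * sin (Om T k (s, t) - Om T k (s, \<mu>))"
      using wr_Om[of "(s, \<mu>)" "(s, t)" k T] s k by auto
    ultimately have "0 < c * ((t - \<mu>) * sin (Om T k (s, t) - Om T k (s, \<mu>)))" by (simp add: mult_ac)
    then show "0 < (t - \<mu>) * sin (Om T k (s, t) - Om T k (s, \<mu>))"
      using \<open>c > 0\<close> by (rule zero_less_mult_pos)
  qed
qed (use \<mu> in auto)

section \<open>Growth of the angle across an edge\<close>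

definition dq :: "nat \<Rightarrow> real" where
  "dq n = integral {0..1} (\<lambda>x. sqrt (q (real n + 1 - x)))"

text \<open>\<open>pi\<close> pays for the change of curve at the two ends of the edge,
  \<open>D0 + 1\<close> for the term with \<open>\<mu> - 1\<close>, 1 for the distance between
  \<open>sqrt (1 + s q)\<close> and \<open>sqrt (s q)\<close>, and \<open>C / c\<close> for the
  variation of \<open>q\<close>, as it bounds \<open>|q'| / q\<close>.\<close>

definition Kd :: real where "Kd = pi + D0 + 2 + C / c"

text \<open>Replacing \<open>y' + i y\<close> by \<open>y' + i r y\<close> with \<open>r = sqrt (1 + s q)\<close> changes the total
  rotation by at most \<open>pi\<close>, and the modified curve rotates at speed \<open>r + O(1)\<close>.\<close>

lemma D_estimate:
  assumes s: "0 \<le> s" and \<mu>: "\<mu> \<in> J"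
  shows "\<bar>D n (s, \<mu>) - sqrt s * dq n\<bar> \<le> Kd"
proof -
  define p where "p = (s, \<mu>)"
  have p: "p \<in> {0..} \<times> J" using s \<mu> by (simp add: p_def)
  define qt where "qt x = q (real n + 1 - x)" for x
  define r where "r x = sqrt (1 + s * qt x)" for x
  define r' where "r' x = s * (- deriv q (real n + 1 - x)) / (2 * r x)" for x
  define a where "a x = snd (Y n p x)" for x
  define y where "y x = fst (Y n p x)" for x
  define z where "z x = r x * y x" for x
  define z' where "z' x = r' x * y x + r x * a x" for x
  \<comment> \<open>The angle from \<open>y' + i y\<close> to \<open>y' + i r y\<close>, whose
    modulus is at most \<open>pi / 2\<close>.\<close>
  define h where "h x = arctan ((a x * z x - a x * y x) / ((a x)\<^sup>2 + y x * z x))" for x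
  \<comment> \<open>The angular velocity of the modified curve.\<close>
  define R2 where "R2 x = (a x * z' x - z x * (- pot n p x * y x)) / ((a x)\<^sup>2 + (z x)\<^sup>2)" for x
  have qt: "qt x > 0" if "x \<in> {0..1}" for x using that q_pos by (auto simp: qt_def)
  have qtc: "continuous_on {0..1} qt"
    unfolding qt_def by (rule continuous_on_compose2[OF q_cont]) (auto intro!: continuous_intros)
  have r2: "(r x)\<^sup>2 = 1 + s * qt x" "r x \<ge> 1" if "x \<in> {0..1}" for x
    using qt[OF that] s by (auto simp: r_def)
  have ay: "0 < (a x)\<^sup>2 + (y x)\<^sup>2" if "x \<in> {0..1}" for x
    using Y_nonzero(2)[OF p that, of n] by (simp add: a_def y_def)
  have pos: "0 < (a x)\<^sup>2 + y x * z x" if "x \<in> {0..1}" for x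
  proof -
    have "1 * (y x)\<^sup>2 \<le> r x * (y x)\<^sup>2" using r2[OF that] by (intro mult_right_mono) auto
    then show ?thesis using ay[OF that] by (simp add: z_def power2_eq_square algebra_simps)
  qed
  have yc: "continuous_on {0..1} y" "continuous_on {0..1} a"
    unfolding y_def a_def by (intro continuous_on_fst continuous_on_snd Y_cont)+
  have rc: "continuous_on {0..1} r" unfolding r_def by (intro continuous_intros qtc)
  have zc: "continuous_on {0..1} z" unfolding z_def by (intro continuous_on_mult rc yc)
  have hc: "continuous_on {0..1} h"
    unfolding h_def using pos
    by (intro continuous_on_arctan continuous_on_divide continuous_on_diff continuous_on_add
        continuous_on_mult continuous_on_power yc zc) force
  have dh: "(h has_real_derivative (R2 x - rate n p x)) (at x)" if x: "0 < x" "x < 1" for x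
  proof -
    have x1: "x \<in> {0..1}" and at: "at x within {0..1} = at x" using x by (auto simp: at_within_Icc_at)
    note d = ode_solD[OF Y_sol x1, of n p, unfolded at]
    have da: "(a has_real_derivative (- pot n p x * y x)) (at x)" "(y has_real_derivative a x) (at x)"
      using d unfolding a_def y_def by simp_all
    have dqt: "(qt has_real_derivative deriv q (real n + 1 - x) * (0 - 1)) (at x)"
      unfolding qt_def by (rule DERIV_chain2[OF q_diff]) (use x in \<open>auto intro!: derivative_eq_intros\<close>)
    have "1 + s * qt x > 0" using r2[OF x1] by (smt (verit) one_le_power)
    then have dr: "(r has_real_derivative r' x) (at x)"
      unfolding r_def[abs_def] r'_def
      by (auto intro!: derivative_eq_intros dqt simp: r_def field_simps)
    have dz: "(z has_real_derivative z' x) (at x)"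
      unfolding z_def[abs_def] z'_def using DERIV_mult[OF dr da(2)] by (simp add: mult_ac)
    have "rate n p x = (a x * a x - y x * (- pot n p x * y x)) / ((a x)\<^sup>2 + (y x)\<^sup>2)"
      by (simp add: rate_def a_def y_def power2_eq_square algebra_simps)
    then show ?thesis
      using DERIV_arctan_ratio[OF da dz pos[OF x1]] unfolding h_def[abs_def] R2_def by simp
  qed
  have "((\<lambda>x. R2 x - rate n p x) has_integral (h 1 - h 0)) {0..1}"
    using dh by (intro fundamental_theorem_of_calculus_interior hc)
      (auto simp: has_real_derivative_iff_has_vector_derivative)
  moreover have "(rate n p has_integral D n p) {0..1}"
    unfolding D_def by (intro integrable_integral integrable_continuous_interval rate_cont p)
  ultimately have "((\<lambda>x. (R2 x - rate n p x) + rate n p x) has_integral (h 1 - h 0 + D n p)) {0..1}"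
    by (rule has_integral_add)
  then have R2I: "(R2 has_integral (h 1 - h 0 + D n p)) {0..1}" by simp
  have hb: "\<bar>h x\<bar> \<le> pi / 2" for x
    using arctan_bounded[of "(a x * z x - a x * y x) / ((a x)\<^sup>2 + y x * z x)"] unfolding h_def by linarith
  have rI: "((\<lambda>x. sqrt s * sqrt (qt x)) has_integral sqrt s * dq n) {0..1}"
    unfolding dq_def qt_def[symmetric]
    by (intro has_integral_mult_right integrable_integral integrable_continuous_interval continuous_intros qtc)
  have diff: "\<bar>R2 x - sqrt s * sqrt (qt x)\<bar> \<le> D0 + 2 + C / c" if x: "0 < x" "x < 1" for x
  proof -
    have x1: "x \<in> {0..1}" using x by auto
    define E where "E = (a x)\<^sup>2 + (z x)\<^sup>2"
    have rx: "r x \<ge> 1" "(r x)\<^sup>2 = 1 + s * qt x" using r2[OF x1] by auto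
    have "1 * (y x)\<^sup>2 \<le> (r x)\<^sup>2 * (y x)\<^sup>2" using rx(1) by (intro mult_right_mono) (auto simp: one_le_power)
    then have E: "E > 0" using ay[OF x1] by (simp add: E_def z_def power_mult_distrib)
    have pt: "pot n p x = (r x)\<^sup>2 + (\<mu> - 1)" by (simp add: pot_def p_def rx qt_def)
    \<comment> \<open>With \<open>pot = r^2 + (\<mu> - 1)\<close> the leading terms combine to
      \<open>r\<close> times the squared modulus \<open>E\<close>; what remains comes from the
      variation of \<open>r\<close> and from \<open>\<mu> - 1\<close>.\<close>
    have num: "a x * z' x - z x * (- pot n p x * y x) = r x * E + r' x * (a x * y x) + r x * (\<mu> - 1) * (y x)\<^sup>2"
      unfolding pt by (simp add: z'_def z_def E_def power2_eq_square algebra_simps)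
    have R2: "R2 x = r x + (r' x * (a x * y x)) / E + (r x * (\<mu> - 1) * (y x)\<^sup>2) / E"
      unfolding R2_def num using E by (simp add: E_def[symmetric] add_divide_distrib)
    have b1: "\<bar>r x - sqrt s * sqrt (qt x)\<bar> \<le> 1"
    proof -
      have "0 \<le> s * qt x" using qt[OF x1] s by simp
      then have "sqrt (s * qt x) \<le> r x" unfolding r_def by simp
      moreover have "r x \<le> sqrt 1 + sqrt (s * qt x)" unfolding r_def
        using qt[OF x1] s by (intro sqrt_add_le_add_sqrt) auto
      ultimately show ?thesis by (simp add: real_sqrt_mult)
    qed
    \<comment> \<open>\<open>2 r r'\<close> is the derivative of \<open>s q\<close>, so that
      \<open>|r'|\<close> is at most \<open>C / c\<close> times \<open>r\<close>; the product
      \<open>r |a y|\<close> is \<open>|a z|\<close>, which \<open>E\<close> dominates.\<close>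
    have b2: "\<bar>(r' x * (a x * y x)) / E\<bar> \<le> C / c"
    proof -
      have "2 * \<bar>a x\<bar> * \<bar>z x\<bar> \<le> E" unfolding E_def using sum_squares_bound[of "\<bar>a x\<bar>" "\<bar>z x\<bar>"] by simp
      then have 1: "r x * \<bar>a x * y x\<bar> \<le> E" using rx E by (simp add: z_def abs_mult mult_ac)
      have tp: "0 < real n + 1 - x" using x by simp
      have "\<bar>deriv q (real n + 1 - x)\<bar> \<le> C / c * (c * B powr (- 2 * (real n + 1 - x)))"
        using q_deriv[OF tp] c_pos by simp
      also have "\<dots> \<le> C / c * qt x"
        unfolding qt_def using q_lower[of "real n + 1 - x"] tp C_pos c_pos by (intro mult_left_mono) auto
      finally have "s * \<bar>deriv q (real n + 1 - x)\<bar> \<le> s * (C / c * qt x)" using s by (rule mult_left_mono)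
      also have "s * (C / c * qt x) = C / c * (s * qt x)" by simp
      also have "\<dots> \<le> C / c * (r x)\<^sup>2" unfolding rx(2) using C_pos c_pos by (intro mult_left_mono) auto
      finally have 2: "s * \<bar>deriv q (real n + 1 - x)\<bar> \<le> C / c * (r x * r x)" by (simp add: power2_eq_square)
      have "\<bar>r' x\<bar> = s * \<bar>deriv q (real n + 1 - x)\<bar> / (2 * r x)" using s rx by (simp add: r'_def abs_mult)
      also have "\<dots> \<le> C / c * (r x * r x) / (2 * r x)" using 2 rx by (intro divide_right_mono) auto
      also have "\<dots> = C / c * r x / 2" using rx by simp
      also have "\<dots> \<le> C / c * r x"
      proof -
        have "0 \<le> C / c * r x" using C_pos c_pos rx by (intro mult_nonneg_nonneg) auto
        then show ?thesis by simp
      qed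
      finally have "\<bar>r' x\<bar> * \<bar>a x * y x\<bar> \<le> C / c * r x * \<bar>a x * y x\<bar>" by (intro mult_right_mono) auto
      also have "\<dots> \<le> C / c * E" using mult_left_mono[OF 1, of "C / c"] C_pos c_pos by (simp add: mult.assoc)
      finally show ?thesis using E by (simp add: abs_mult pos_divide_le_eq)
    qed
    have b3: "\<bar>(r x * (\<mu> - 1) * (y x)\<^sup>2) / E\<bar> \<le> D0 + 1"
    proof -
      have "r x * (y x)\<^sup>2 \<le> (r x)\<^sup>2 * (y x)\<^sup>2" using rx(1) by (intro mult_right_mono) (auto simp: power2_eq_square)
      also have "\<dots> \<le> E" by (simp add: E_def z_def power_mult_distrib)
      finally have "\<bar>\<mu> - 1\<bar> * (r x * (y x)\<^sup>2) \<le> (D0 + 1) * E"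
        using D0(2)[OF \<mu>] rx by (intro mult_mono) auto
      then show ?thesis using E rx by (simp add: abs_mult pos_divide_le_eq mult_ac)
    qed
    show ?thesis unfolding R2 using b1 b2 b3 by linarith
  qed
  have nn: "D0 + 2 + C / c \<ge> 0" using D0 C_pos c_pos by simp
  have RI: "((\<lambda>x. R2 x - sqrt s * sqrt (qt x)) has_integral (h 1 - h 0 + D n p) - sqrt s * dq n) {0..1}"
    by (rule has_integral_diff[OF R2I rI])
  have "norm (R2 x - sqrt s * sqrt (qt x)) \<le> D0 + 2 + C / c" if "x \<in> {0..1} - {0, 1}" for x
    using diff[of x] that by auto
  then have "\<bar>(h 1 - h 0 + D n p) - sqrt s * dq n\<bar> \<le> D0 + 2 + C / c"
    using has_integral_bound_real[OF nn _ RI, of "{0, 1}"] by simp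
  then show ?thesis using hb[of 0] hb[of 1] unfolding Kd_def p_def[symmetric] by linarith
qed

text \<open>Covers, for one edge, the error \<open>Kd\<close> and a jump of at most
  \<open>pi / 2\<close> at each of the couplings \<open>g\<close> and 0.\<close>

definition K1 :: real where "K1 = 2 * pi + 2 * Kd"

text \<open>The turn at coupling 0 is itself of bounded size per edge, so only \<open>sqrt g\<close>
  times the integrals of \<open>sqrt q\<close> is large. The separate \<open>pi\<close> stands for
  the two starting logarithms, whose imaginary parts lie between 0 and \<open>pi\<close>.\<close>

lemma Om_estimate:
  assumes \<mu>: "\<mu> \<in> J" and g: "0 \<le> g" "g * qbar T \<le> h0" and k: "k \<le> T"
  shows "\<bar>(Om T k (g, \<mu>) - Om T k (0, \<mu>)) - sqrt g * (\<Sum>n\<in>{k..<T}. dq n)\<bar> \<le> pi + K1 * (T - k)"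
proof -
  have gp: "(g, \<mu>) \<in> {0..g} \<times> J" "(0, \<mu>) \<in> {0..g} \<times> J" "(g, \<mu>) \<in> {0..} \<times> J" "(0::real, \<mu>) \<in> {0..} \<times> J" using \<mu> g by auto
  have L: "0 < Im (Ln (\<zeta> T p)) \<and> Im (Ln (\<zeta> T p)) < pi" if "p \<in> {0..g} \<times> J" for p
    using zeta_Im_pos[OF that g(2)] Im_Ln_pos_lt_imp[of "\<zeta> T p"] by (auto simp: Im_Ln_pos_lt)
  have "\<bar>(D n (g, \<mu>) + jump (Suc n) (g, \<mu>)) - (D n (0, \<mu>) + jump (Suc n) (0, \<mu>)) - sqrt g * dq n\<bar> \<le> K1" for n
    using D_estimate[OF g(1) \<mu>, of n] D_estimate[OF order_refl \<mu>, of n] jump_bound[OF gp(3), of "Suc n"] jump_bound[OF gp(4), of "Suc n"]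
      pi_gt_zero unfolding K1_def abs_le_iff by (simp only: real_sqrt_zero mult_zero_left) linarith
  then have "(\<Sum>n\<in>{k..<T}. \<bar>(D n (g, \<mu>) + jump (Suc n) (g, \<mu>)) - (D n (0, \<mu>) + jump (Suc n) (0, \<mu>)) - sqrt g * dq n\<bar>) \<le> (\<Sum>n\<in>{k..<T}. K1)"
    by (intro sum_mono)
  then have "\<bar>\<Sum>n\<in>{k..<T}. (D n (g, \<mu>) + jump (Suc n) (g, \<mu>)) - (D n (0, \<mu>) + jump (Suc n) (0, \<mu>)) - sqrt g * dq n\<bar> \<le> K1 * (T - k)"
    using k by (intro order_trans[OF sum_abs]) (simp add: of_nat_diff mult.commute)
  moreover have "(\<Sum>n\<in>{k..<T}. (D n (g, \<mu>) + jump (Suc n) (g, \<mu>)) - (D n (0, \<mu>) + jump (Suc n) (0, \<mu>)) - sqrt g * dq n)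
     = (\<Sum>n\<in>{k..<T}. D n (g, \<mu>) + jump (Suc n) (g, \<mu>)) - (\<Sum>n\<in>{k..<T}. D n (0, \<mu>) + jump (Suc n) (0, \<mu>)) - sqrt g * (\<Sum>n\<in>{k..<T}. dq n)"
    by (simp add: sum_subtractf sum_distrib_left)
  ultimately show ?thesis using L[OF gp(1)] L[OF gp(2)] unfolding Om_def by linarith
qed

section \<open>Zeros of the vertex value as crossings of the angle\<close>

definition zeros :: "nat \<Rightarrow> real \<Rightarrow> real \<Rightarrow> real set" where
  "zeros k g \<mu> = {s \<in> {0<..<g}. fst (v k (s, \<mu>)) = 0}"

lemma zeros_bij:
  assumes \<mu>: "\<mu> \<in> J0" and g: "0 < g" "g * qbar T \<le> h0" and k: "k \<le> T"
  shows "\<exists>h. bij_betw h {j::int. Om T k (0, \<mu>) < j * pi \<and> j * pi < Om T k (g, \<mu>)} (zeros k g \<mu>)"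
proof -
  have mJ: "\<mu> \<in> J" using \<mu> by (simp add: J0_def)
  have c: "continuous_on {0..g} (\<lambda>s. Om T k (s, \<mu>))"
    by (rule continuous_on_compose2[OF Om_cont[OF _ g(2)]]) (use mJ g in \<open>auto intro!: continuous_intros\<close>)
  have "zeros k g \<mu> = {s \<in> {0<..<g}. sin (Om T k (s, \<mu>)) = 0}"
    unfolding zeros_def using fst_v_eq_0_iff[OF _ k] mJ by auto
  then show ?thesis
    using bij_betw_crossings[OF g(1) c] Om_strict_s[OF \<mu> _ g(2) k] g by simp
qed

text \<open>One \<open>pi\<close> comes from the angle estimate, the other from counting the
  multiples of \<open>pi\<close> in an open interval by its length.\<close>

lemma zeros_card:
  assumes \<mu>: "\<mu> \<in> J0" and g: "0 < g" "g * qbar T \<le> h0" and k: "k \<le> T"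
  shows "finite (zeros k g \<mu>)"
    "\<bar>pi * card (zeros k g \<mu>) - sqrt g * (\<Sum>n\<in>{k..<T}. dq n)\<bar> \<le> 2 * pi + K1 * (T - k)"
proof -
  have mJ: "\<mu> \<in> J" using \<mu> by (simp add: J0_def)
  obtain h where h: "bij_betw h {j::int. Om T k (0, \<mu>) < j * pi \<and> j * pi < Om T k (g, \<mu>)} (zeros k g \<mu>)"
    using zeros_bij[OF assms] by blast
  show "finite (zeros k g \<mu>)" using bij_betw_finite[OF h] card_int_between(1) by blast
  have "Om T k (0, \<mu>) \<le> Om T k (g, \<mu>)" using Om_strict_s[OF \<mu> _ g(2) k, of 0 g] g by simp
  from card_int_between(2)[OF this] bij_betw_same_card[OF h] Om_estimate[OF mJ _ g(2) k] g
  show "\<bar>pi * card (zeros k g \<mu>) - sqrt g * (\<Sum>n\<in>{k..<T}. dq n)\<bar> \<le> 2 * pi + K1 * (T - k)" by simp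
qed

text \<open>The final angle, at coupling \<open>g\<close>, increases with the level. The initial
  angle, at coupling 0, cannot cross a multiple of \<open>pi\<close>, because the Floquet vector has
  first coordinate 1. So multiples of \<open>pi\<close> between the two can be gained but not
  lost.\<close>

lemma zeros_mono:
  assumes \<mu>: "{\<mu>1..\<mu>2} \<subseteq> J0" "\<mu>1 \<le> \<mu>2" and g: "0 < g" "g * qbar T \<le> h0" and k: "k \<le> T"
  shows "card (zeros k g \<mu>1) \<le> card (zeros k g \<mu>2)"
proof (cases "\<mu>1 = \<mu>2")
  case False
  then have lt: "\<mu>1 < \<mu>2" using \<mu> by simp
  have m: "\<mu>1 \<in> J0" "\<mu>2 \<in> J0" using \<mu> by auto
  obtain h1 where h1: "bij_betw h1 {j::int. Om T k (0, \<mu>1) < j * pi \<and> j * pi < Om T k (g, \<mu>1)} (zeros k g \<mu>1)"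
    using zeros_bij[OF m(1) g k] by blast
  obtain h2 where h2: "bij_betw h2 {j::int. Om T k (0, \<mu>2) < j * pi \<and> j * pi < Om T k (g, \<mu>2)} (zeros k g \<mu>2)"
    using zeros_bij[OF m(2) g k] by blast
  have "{j::int. Om T k (0, \<mu>1) < j * pi \<and> j * pi < Om T k (g, \<mu>1)} \<subseteq> {j::int. Om T k (0, \<mu>2) < j * pi \<and> j * pi < Om T k (g, \<mu>2)}"
  proof
    fix j :: int assume "j \<in> {j::int. Om T k (0, \<mu>1) < j * pi \<and> j * pi < Om T k (g, \<mu>1)}"
    then have j: "Om T k (0, \<mu>1) < j * pi" "j * pi < Om T k (g, \<mu>1)" by auto
    have "j * pi < Om T k (g, \<mu>2)"
      using j(2) Om_strict_mu[OF \<mu>(1) lt _ g(2) k, of g] g by simp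
    moreover have "Om T k (0, \<mu>2) < j * pi"
    proof (rule ccontr)
      assume n: "\<not> Om T k (0, \<mu>2) < j * pi"
      have "continuous_on {\<mu>1..\<mu>2} (\<lambda>\<mu>. Om T k (0, \<mu>))"
        by (rule continuous_on_compose2[OF Om_cont[OF _ g(2)]]) (use \<mu> g in \<open>auto intro!: continuous_intros simp: J0_def\<close>)
      then obtain \<mu> where mu: "\<mu>1 \<le> \<mu>" "\<mu> \<le> \<mu>2" "Om T k (0, \<mu>) = j * pi"
        using IVT'[of "\<lambda>\<mu>. Om T k (0, \<mu>)" \<mu>1 "j * pi" \<mu>2] j(1) n lt by auto
      then have mJ: "\<mu> \<in> J" using \<mu> by (auto simp: J0_def)
      have "sin (Om T k (0, \<mu>)) = 0" unfolding mu(3) by (auto simp: sin_zero_iff_int2)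
      then have "fst (v k (0, \<mu>)) = 0" using fst_v_eq_0_iff[of "(0, \<mu>)" k T] mJ k by auto
      then show False using v_zero[OF mJ, of k] by (simp add: evec_def)
    qed
    ultimately show "j \<in> {j::int. Om T k (0, \<mu>2) < j * pi \<and> j * pi < Om T k (g, \<mu>2)}" by simp
  qed
  from card_mono[OF card_int_between(1) this] show ?thesis
    using bij_betw_same_card[OF h1] bij_betw_same_card[OF h2] by simp
qed simp

lemma no_zeros:
  assumes "\<mu> \<in> J" "g * qbar k \<le> h0" "0 \<le> s" "s \<le> g"
  shows "fst (v k (s, \<mu>)) \<noteq> 0"
  using zeta_Im_pos[of "(s, \<mu>)" g k] assms by (auto simp: \<zeta>_def)

end

section \<open>Weak derivatives\<close>

text \<open>The step is \<open>3 y^2 - 2 y^3\<close> between 0 and 1. Taking an antiderivative of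
  the clipped derivative avoids gluing at the two ends; comparison with the polynomial shows that
  the total rise is 1.\<close>

lemma smoothstep_exists:
  "\<exists>S. (\<forall>y. (S has_real_derivative max 0 (6 * y * (1 - y))) (at y)) \<and> (\<forall>y\<le>0. S y = 0) \<and>
     (\<forall>y\<ge>1. S y = (1::real)) \<and> (\<forall>y. 0 \<le> S y \<and> S y \<le> 1)"
proof -
  let ?d = "\<lambda>y::real. max 0 (6 * y * (1 - y))"
  have "\<exists>F. \<forall>x::real. (-\<infinity>::ereal) < x \<longrightarrow> x < (\<infinity>::ereal) \<longrightarrow> (F has_vector_derivative ?d x) (at x)"
    by (rule einterval_antiderivative) (auto intro!: continuous_intros)
  then obtain F where F: "\<And>x. (F has_real_derivative ?d x) (at x)"
    by (auto simp: has_real_derivative_iff_has_vector_derivative)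
  have cF: "continuous_on S F" for S
    using F DERIV_isCont continuous_at_imp_continuous_on by blast
  have neg: "F y = F 0" if "y \<le> 0" for y
  proof (cases "y = 0")
    case False
    then have "y < 0" using that by simp
    have "F 0 = F y"
    proof (rule DERIV_isconst2[OF \<open>y < 0\<close> cF])
      fix x assume "y < x" "x < 0"
      then have "?d x = 0" by (auto simp: max_def mult_le_0_iff zero_le_mult_iff)
      then show "DERIV F x :> 0" using F[of x] by simp
    qed (use that in auto)
    then show ?thesis by simp
  qed simp
  have pos: "F y = F 1" if "y \<ge> 1" for y
  proof (cases "y = 1")
    case False
    then have "1 < y" using that by simp
    show ?thesis
    proof (rule DERIV_isconst2[OF \<open>1 < y\<close> cF])
      fix x assume "1 < x" "x < y"
      then have "?d x = 0" by (auto simp: max_def mult_le_0_iff zero_le_mult_iff)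
      then show "DERIV F x :> 0" using F[of x] by simp
    qed (use that in auto)
  qed simp
  let ?G = "\<lambda>y. F y - (3 * y\<^sup>2 - 2 * y ^ 3)"
  have "?G 1 = ?G 0"
  proof (rule DERIV_isconst2[of 0 1])
    show "continuous_on {0..1} ?G" by (intro continuous_intros cF)
    fix x :: real assume x: "0 < x" "x < 1"
    then have "?d x = 6 * x * (1 - x)" by (simp add: max_def)
    then show "DERIV ?G x :> 0"
      using F[of x] by (auto intro!: derivative_eq_intros simp: algebra_simps power2_eq_square)
  qed auto
  then have F1: "F 1 = F 0 + 1" by simp
  have mono: "F x \<le> F y" if "x \<le> y" for x y
    by (rule DERIV_nonneg_imp_nondecreasing[OF that]) (use F in \<open>force simp: max_def\<close>)
  have b: "F 0 \<le> F y \<and> F y \<le> F 1" for y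
    using mono[of 0 y] mono[of y 1] neg[of y] pos[of y] F1 by linarith
  show ?thesis
  proof (intro exI[of _ "\<lambda>y. F y - F 0"] conjI allI impI)
    show "((\<lambda>y. F y - F 0) has_real_derivative ?d y) (at y)" for y
      using F[of y] by (auto intro!: derivative_eq_intros)
    show "F y - F 0 = 0" if "y \<le> 0" for y using neg[OF that] by simp
    show "F y - F 0 = 1" if "1 \<le> y" for y using pos[OF that] F1 by simp
    show "0 \<le> F y - F 0" "F y - F 0 \<le> 1" for y using b[of y] F1 by auto
  qed
qed

definition smoothstep :: "real \<Rightarrow> real" where
  "smoothstep = (SOME S. (\<forall>y. (S has_real_derivative max 0 (6 * y * (1 - y))) (at y)) \<and> (\<forall>y\<le>0. S y = 0) \<and>
     (\<forall>y\<ge>1. S y = 1) \<and> (\<forall>y. 0 \<le> S y \<and> S y \<le> 1))"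

lemma smoothstep:
  "(smoothstep has_real_derivative max 0 (6 * y * (1 - y))) (at y)"
  "y \<le> 0 \<Longrightarrow> smoothstep y = 0" "1 \<le> y \<Longrightarrow> smoothstep y = 1" "0 \<le> smoothstep y" "smoothstep y \<le> 1"
  using someI_ex[OF smoothstep_exists] unfolding smoothstep_def[symmetric] by auto

text \<open>The point \<open>s\<close> may be an end of the interval, because the kernels are
  required to have mass 1 on the interval itself.\<close>

lemma approx_identity:
  fixes h :: "real \<Rightarrow> complex" and k :: "nat \<Rightarrow> real \<Rightarrow> real"
  assumes h: "continuous_on {a..c} h" and s: "s \<in> {a..c}"
    and k: "\<forall>\<^sub>F n in sequentially. continuous_on {a..c} (k n) \<and> (\<forall>x\<in>{a..c}. 0 \<le> k n x) \<and> integral {a..c} (k n) = 1 \<and>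
       (\<forall>x\<in>{a..c}. k n x \<noteq> 0 \<longrightarrow> \<bar>x - s\<bar> \<le> 2 / real n)"
  shows "(\<lambda>n. integral {a..c} (\<lambda>x. h x * of_real (k n x))) \<longlonglongrightarrow> h s"
proof (rule LIMSEQ_I)
  fix e :: real assume e: "0 < e"
  obtain d where d: "d > 0" "\<And>x. x \<in> {a..c} \<Longrightarrow> \<bar>x - s\<bar> < d \<Longrightarrow> norm (h x - h s) < e / 2"
    using h s e unfolding continuous_on_iff dist_norm real_norm_def by (metis half_gt_zero)
  have "\<forall>\<^sub>F n in sequentially. 2 / real n < d"
    using d(1) by (intro order_tendstoD(2)[of _ 0]) (auto intro!: tendsto_divide_0[OF tendsto_const] filterlim_real_sequentially filterlim_at_top_imp_at_infinity)
  with k have "\<forall>\<^sub>F n in sequentially. norm (integral {a..c} (\<lambda>x. h x * of_real (k n x)) - h s) < e"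
  proof eventually_elim
    case (elim n)
    have ci: "continuous_on {a..c} (\<lambda>x. (h x - h s) * of_real (k n x))"
      "continuous_on {a..c} (\<lambda>x. h x * of_real (k n x))" "continuous_on {a..c} (\<lambda>x. h s * of_real (k n x))"
      using elim h by (auto intro!: continuous_intros)
    have "((\<lambda>x. h s * of_real (k n x)) has_integral h s * of_real (integral {a..c} (k n))) {a..c}"
      using elim by (intro has_integral_mult_right has_integral_of_real integrable_integral integrable_continuous_interval) auto
    then have "integral {a..c} (\<lambda>x. h s * of_real (k n x)) = h s * of_real (integral {a..c} (k n))"
      by (rule integral_unique)
    then have "integral {a..c} (\<lambda>x. h x * of_real (k n x)) - h s = integral {a..c} (\<lambda>x. (h x - h s) * of_real (k n x))"
      using elim ci by (simp add: left_diff_distrib integral_diff integrable_continuous_interval)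
    also have "norm \<dots> \<le> integral {a..c} (\<lambda>x. e / 2 * k n x)"
    proof (rule integral_norm_bound_integral)
      show "(\<lambda>x. (h x - h s) * of_real (k n x)) integrable_on {a..c}" using ci by (intro integrable_continuous_interval)
      show "(\<lambda>x. e / 2 * k n x) integrable_on {a..c}" using elim by (intro integrable_continuous_interval continuous_intros) auto
      fix x assume x: "x \<in> {a..c}"
      show "norm ((h x - h s) * of_real (k n x)) \<le> e / 2 * k n x"
      proof (cases "k n x = 0")
        case False
        then have "\<bar>x - s\<bar> < d" using elim x by fastforce
        from d(2)[OF x this] have "norm (h x - h s) * k n x \<le> e / 2 * k n x"
          using elim x by (intro mult_right_mono) auto
        then show ?thesis using elim x by (simp add: norm_mult)
      qed simp
    qed
    also have "\<dots> = e / 2" using elim by simp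
    also have "\<dots> < e" using e by simp
    finally show ?case .
  qed
  then show "\<exists>N. \<forall>n\<ge>N. norm (integral {a..c} (\<lambda>x. h x * of_real (k n x)) - h s) < e"
    by (simp add: eventually_sequentially)
qed

lemma integrable_indicator_Ioo:
  fixes a c :: real
  shows "integrable lborel (indicat_real {a<..<c})"
proof (rule integrable_real_indicator)
  have "bounded {a<..<c}" by (rule bounded_subset[OF bounded_closed_interval[of a c]]) auto
  then show "emeasure lborel {a<..<c} < \<infinity>" by (rule emeasure_bounded_finite)
qed simp

lemma square_integrable_imp_integrable:
  assumes "square_integrable_on_interval a c v"
  shows "set_integrable lborel {a<..<c} v"
  unfolding set_integrable_def
proof (rule Bochner_Integration.integrable_bound)
  have "set_integrable lborel {a<..<c} (\<lambda>t. (1::real))"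
    unfolding set_integrable_def
    by (simp add: integrable_indicator_Ioo)
  then show "integrable lborel (\<lambda>t. indicator {a<..<c} t *\<^sub>R (1 + (cmod (v t))\<^sup>2))"
    using assms set_integral_add(1)[of lborel "{a<..<c}" "\<lambda>t. 1::real" "\<lambda>t. (cmod (v t))\<^sup>2"]
    unfolding square_integrable_on_interval_def by (auto simp: set_integrable_def)
  show "(\<lambda>t. indicator {a<..<c} t *\<^sub>R v t) \<in> borel_measurable lborel"
    using assms by (simp add: square_integrable_on_interval_def set_borel_measurable_def)
  have "x \<le> 1 + x\<^sup>2" for x :: real
  proof (cases "x \<le> 1")
    case False
    then have "x * 1 \<le> x * x" by (intro mult_left_mono) auto
    then show ?thesis by (simp add: power2_eq_square)
  qed (use zero_le_power2[of x] in linarith)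
  then show "AE t in lborel. norm (indicator {a<..<c} t *\<^sub>R v t) \<le> norm (indicator {a<..<c} t *\<^sub>R (1 + (cmod (v t))\<^sup>2))"
    by (intro AE_I2) (auto simp: indicator_def)
qed

lemma set_integrable_continuous_Ioo:
  fixes f :: "real \<Rightarrow> 'a::{banach, second_countable_topology}"
  assumes "continuous_on {a..c} f"
  shows "set_integrable lborel {a<..<c} f"
  using borel_integrable_atLeastAtMost'[OF assms] by (rule set_integrable_subset) auto

text \<open>The defining identity is tested with \<open>cut\<^sub>n g\<close>, where the cutoffs \<open>cut\<^sub>n\<close> increase to the
  indicator function of the interval from \<open>s\<close> to \<open>t\<close>.\<close>

lemma weak_integration_by_parts:
  fixes u v :: "real \<Rightarrow> complex" and g :: "real \<Rightarrow> real"
  assumes wd: "has_weak_derivative a c u v" and f: "continuous_on {a..c} f"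
    and fu: "\<And>x. x \<in> {a<..<c} \<Longrightarrow> f x = u x"
    and g: "\<And>x. (g has_real_derivative g' x) (at x)" and g': "continuous_on UNIV g'"
    and st: "a \<le> s" "s < t" "t \<le> c"
  shows "(LINT x:{s<..<t}|lborel. v x * of_real (g x))
     = f t * of_real (g t) - f s * of_real (g s) - (LINT x:{s<..<t}|lborel. f x * of_real (g' x))"
proof -
  define d where "d y = max 0 (6 * y * (1 - y))" for y :: real
  \<comment> \<open>The shifts \<open>- 1\<close> and \<open>+ 2\<close> place the rise on
    \<open>[s + 1/n, s + 2/n]\<close> and the fall on \<open>[t - 2/n, t - 1/n]\<close>. Thus the
    support stays inside the open interval even if \<open>s = a\<close> or
    \<open>t = c\<close>.\<close>
  define cut where "cut n x = smoothstep (real n * (x - s) - 1) - smoothstep (real n * (x - t) + 2)" for n x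
  define k1 where "k1 n x = real n * d (real n * (x - s) - 1)" for n x
  define k2 where "k2 n x = real n * d (real n * (x - t) + 2)" for n x
  define \<phi> where "\<phi> n x = cut n x * g x" for n x
  have gc: "continuous_on S g" for S using g DERIV_isCont continuous_at_imp_continuous_on by blast
  have gc': "continuous_on S g'" for S using g' continuous_on_subset by blast
  have dd: "(smoothstep has_real_derivative d y) (at y)" for y using smoothstep(1) unfolding d_def .
  have dc: "continuous_on S (\<lambda>x. d (h x))" if "continuous_on S h" for S and h :: "real \<Rightarrow> real"
    unfolding d_def using that by (auto intro!: continuous_intros)
  have kc: "continuous_on S (k1 n)" "continuous_on S (k2 n)" for S n
    unfolding k1_def k2_def by (auto intro!: continuous_intros dc)
  have d0: "d y = 0" if "y \<le> 0 \<or> y \<ge> 1" for y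
    using that by (auto simp: d_def max_def mult_le_0_iff zero_le_mult_iff)
  have s1: "((\<lambda>x. smoothstep (real n * (x - s) - 1)) has_real_derivative k1 n x) (at x)" for n x
  proof -
    have "((\<lambda>x. real n * (x - s) - 1) has_real_derivative real n) (at x)" by (auto intro!: derivative_eq_intros)
    from DERIV_chain2[OF dd this] show ?thesis by (simp add: k1_def mult.commute)
  qed
  have s2: "((\<lambda>x. smoothstep (real n * (x - t) + 2)) has_real_derivative k2 n x) (at x)" for n x
  proof -
    have "((\<lambda>x. real n * (x - t) + 2) has_real_derivative real n) (at x)" by (auto intro!: derivative_eq_intros)
    from DERIV_chain2[OF dd this] show ?thesis by (simp add: k2_def mult.commute)
  qed
  have \<phi>': "(\<phi> n has_real_derivative (k1 n x - k2 n x) * g x + cut n x * g' x) (at x)" for n x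
    unfolding \<phi>_def[abs_def] using DERIV_mult[OF DERIV_diff[OF s1 s2] g]
    by (simp add: cut_def[abs_def] algebra_simps)
  have cutc: "continuous_on S (cut n)" for S n
    unfolding cut_def[abs_def] using s1 s2 by (intro continuous_on_diff)
      (meson DERIV_isCont continuous_at_imp_continuous_on)+
  \<comment> \<open>For such \<open>n\<close> the rise ends before the fall begins.\<close>
  have big: "\<forall>\<^sub>F n in sequentially. 4 / (t - s) < real n"
    using filterlim_real_sequentially unfolding filterlim_at_top_dense by blast
  have n_pos: "real n > 0 \<and> 4 < real n * (t - s)" if "4 / (t - s) < real n" for n
  proof -
    have "0 < 4 / (t - s)" using st by simp
    then have "0 < real n" using that by linarith
    then show ?thesis using that st by (simp add: pos_divide_less_eq)
  qed
  have cut_supp: "cut n x = 0" if n: "4 / (t - s) < real n" and x: "x \<le> s + 1 / n \<or> t - 1 / n \<le> x" for n x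
  proof (cases "x \<le> s + 1 / n")
    case True
    have n0: "real n > 0" "4 < real n * (t - s)" using n_pos[OF n] by auto
    have "real n * (x - s) \<le> real n * (1 / n)" using True n0 by (intro mult_left_mono) auto
    then have 1: "real n * (x - s) \<le> 1" using n0 by simp
    have "real n * (x - t) = real n * (x - s) - real n * (t - s)" by (simp add: algebra_simps)
    then show ?thesis using 1 n0 smoothstep(2) by (simp add: cut_def)
  next
    case False
    have n0: "real n > 0" "4 < real n * (t - s)" using n_pos[OF n] by auto
    have "real n * (t - x) \<le> real n * (1 / n)" using False x n0 by (intro mult_left_mono) auto
    then have 1: "real n * (t - x) \<le> 1" using n0 by simp
    have "real n * (x - t) = - (real n * (t - x))" "real n * (x - s) = real n * (t - s) - real n * (t - x)"
      by (simp_all add: algebra_simps)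
    then show ?thesis using 1 n0 smoothstep(3) by (simp add: cut_def)
  qed
  have test: "test_function a c (\<phi> n)" if n: "4 / (t - s) < real n" for n
    unfolding test_function_def
  proof
    show "\<phi> n C1_differentiable_on UNIV"
      unfolding C1_differentiable_on_def using \<phi>'
      by (intro exI[of _ "\<lambda>x. (k1 n x - k2 n x) * g x + cut n x * g' x"])
        (auto simp: has_real_derivative_iff_has_vector_derivative intro!: continuous_intros kc gc gc' cutc)
    show "\<exists>a' c'. a < a' \<and> c' < c \<and> (\<forall>x. x \<notin> {a'..c'} \<longrightarrow> \<phi> n x = 0)"
      using cut_supp[OF n] n_pos[OF n] st
      by (intro exI[of _ "s + 1 / n"] exI[of _ "t - 1 / n"]) (auto simp: \<phi>_def add_pos_nonneg intro!: less_le_trans[of "t - 1 / n" t c] le_less_trans[of a s "s + 1 / n"])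
  qed
  have vi: "set_integrable lborel {a<..<c} v"
    using wd by (intro square_integrable_imp_integrable) (simp add: has_weak_derivative_def)
  \<comment> \<open>The defining identity of the weak derivative for \<open>\<phi> n\<close>. The
    derivative of the cutoff is a difference of two kernels, which concentrate at \<open>s\<close>
    and at \<open>t\<close> and produce the boundary terms.\<close>
  have key: "integral {a..c} (\<lambda>x. (f x * of_real (g x)) * of_real (k1 n x)) - integral {a..c} (\<lambda>x. (f x * of_real (g x)) * of_real (k2 n x))
        + integral {a..c} (\<lambda>x. f x * of_real (g' x) * of_real (cut n x))
       = - (LINT x|lborel. indicator {a<..<c} x *\<^sub>R (v x * of_real (g x) * of_real (cut n x)))"
    if n: "4 / (t - s) < real n" for n
  proof -
    have D: "deriv (\<phi> n) x = (k1 n x - k2 n x) * g x + cut n x * g' x" for x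
      by (rule DERIV_imp_deriv[OF \<phi>'])
    have ci: "continuous_on {a..c} (\<lambda>x. f x * of_real ((k1 n x - k2 n x) * g x + cut n x * g' x))"
      by (intro continuous_intros f kc gc gc' cutc)
    have w0: "(LINT x:{a<..<c}|lborel. u x * of_real (deriv (\<phi> n) x)) = - (LINT x:{a<..<c}|lborel. v x * of_real (\<phi> n x))"
      using wd test[OF n] unfolding has_weak_derivative_def by blast
    have "(LINT x:{a<..<c}|lborel. u x * of_real (deriv (\<phi> n) x))
       = (LINT x:{a<..<c}|lborel. f x * of_real ((k1 n x - k2 n x) * g x + cut n x * g' x))"
      by (rule set_lebesgue_integral_cong) (auto simp: D fu)
    also have "\<dots> = integral {a<..<c} (\<lambda>x. f x * of_real ((k1 n x - k2 n x) * g x + cut n x * g' x))"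
      by (rule set_borel_integral_eq_integral(2)[OF set_integrable_continuous_Ioo[OF ci]])
    also have "\<dots> = integral {a..c} (\<lambda>x. f x * of_real ((k1 n x - k2 n x) * g x + cut n x * g' x))"
      by (rule integral_open_interval_real[symmetric])
    also have "\<dots> = integral {a..c} (\<lambda>x. ((f x * of_real (g x)) * of_real (k1 n x) - (f x * of_real (g x)) * of_real (k2 n x))
        + f x * of_real (g' x) * of_real (cut n x))"
      by (rule arg_cong[of _ _ "integral {a..c}"]) (simp add: fun_eq_iff algebra_simps)
    also have "\<dots> = integral {a..c} (\<lambda>x. (f x * of_real (g x)) * of_real (k1 n x)) - integral {a..c} (\<lambda>x. (f x * of_real (g x)) * of_real (k2 n x))
        + integral {a..c} (\<lambda>x. f x * of_real (g' x) * of_real (cut n x))"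
      by (subst integral_add integral_diff; (intro integrable_continuous_interval continuous_intros f kc gc gc' cutc)?)+ simp
    finally show ?thesis using w0 by (simp add: set_lebesgue_integral_def \<phi>_def mult_ac)
  qed
  have kint: "integral {a..c} (k n) = 1" if "\<And>x. ((\<lambda>x. smoothstep (h x)) has_real_derivative k n x) (at x)"
     "h c \<ge> 1" "h a \<le> 0" for k :: "nat \<Rightarrow> real \<Rightarrow> real" and n and h :: "real \<Rightarrow> real"
  proof -
    have "(k n has_integral smoothstep (h c) - smoothstep (h a)) {a..c}"
      using that(1) st by (intro fundamental_theorem_of_calculus)
        (auto simp: has_real_derivative_iff_has_vector_derivative[symmetric] intro: DERIV_subset)
    then show ?thesis using smoothstep(2,3) that by (simp add: integral_unique)
  qed
  have l1: "(\<lambda>n. integral {a..c} (\<lambda>x. (f x * of_real (g x)) * of_real (k1 n x))) \<longlonglongrightarrow> f s * of_real (g s)"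
  proof (rule approx_identity[of a c "\<lambda>x. f x * of_real (g x)"])
    show "\<forall>\<^sub>F n in sequentially. continuous_on {a..c} (k1 n) \<and> (\<forall>x\<in>{a..c}. 0 \<le> k1 n x) \<and> integral {a..c} (k1 n) = 1 \<and>
       (\<forall>x\<in>{a..c}. k1 n x \<noteq> 0 \<longrightarrow> \<bar>x - s\<bar> \<le> 2 / real n)"
      using big
    proof eventually_elim
      case (elim n)
      note n0 = n_pos[OF elim]
      have "real n * (t - s) \<le> real n * (c - s)" using st n0 by (intro mult_left_mono) auto
      moreover have "real n * (a - s) \<le> 0" using st n0 by (intro mult_nonneg_nonpos) auto
      ultimately have "integral {a..c} (k1 n) = 1" using n0 by (intro kint[OF s1]) linarith+
      moreover have "\<bar>x - s\<bar> \<le> 2 / real n" if "k1 n x \<noteq> 0" for x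
      proof -
        have "0 < real n * (x - s) - 1 \<and> real n * (x - s) - 1 < 1"
          using that d0[of "real n * (x - s) - 1"] unfolding k1_def by (metis mult_zero_right not_le)
        then have "0 < real n * (x - s)" "real n * (x - s) \<le> 2" by auto
        then show ?thesis using n0 by (auto simp: zero_less_mult_iff pos_le_divide_eq mult.commute)
      qed
      ultimately show ?case using kc by (auto simp: k1_def d_def)
    qed
  qed (use st in \<open>auto intro!: continuous_intros f gc\<close>)
  have l2: "(\<lambda>n. integral {a..c} (\<lambda>x. (f x * of_real (g x)) * of_real (k2 n x))) \<longlonglongrightarrow> f t * of_real (g t)"
  proof (rule approx_identity[of a c "\<lambda>x. f x * of_real (g x)"])
    show "\<forall>\<^sub>F n in sequentially. continuous_on {a..c} (k2 n) \<and> (\<forall>x\<in>{a..c}. 0 \<le> k2 n x) \<and> integral {a..c} (k2 n) = 1 \<and>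
       (\<forall>x\<in>{a..c}. k2 n x \<noteq> 0 \<longrightarrow> \<bar>x - t\<bar> \<le> 2 / real n)"
      using big
    proof eventually_elim
      case (elim n)
      note n0 = n_pos[OF elim]
      have "real n * (t - s) \<le> real n * (t - a)" using st n0 by (intro mult_left_mono) auto
      moreover have "real n * (a - t) = - (real n * (t - a))" by (simp add: algebra_simps)
      moreover have "real n * (c - t) \<ge> 0" using st n0 by (intro mult_nonneg_nonneg) auto
      ultimately have "integral {a..c} (k2 n) = 1" using n0 by (intro kint[OF s2]) linarith+
      moreover have "\<bar>x - t\<bar> \<le> 2 / real n" if "k2 n x \<noteq> 0" for x
      proof -
        have "0 < real n * (x - t) + 2 \<and> real n * (x - t) + 2 < 1"
          using that d0[of "real n * (x - t) + 2"] unfolding k2_def by (metis mult_zero_right not_le)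
        moreover have "real n * (x - t) = - (real n * (t - x))" by (simp add: algebra_simps)
        ultimately have "0 < real n * (t - x)" "real n * (t - x) \<le> 2" by auto
        then show ?thesis using n0 by (auto simp: zero_less_mult_iff pos_le_divide_eq mult.commute)
      qed
      ultimately show ?case using kc by (auto simp: k2_def d_def)
    qed
  qed (use st in \<open>auto intro!: continuous_intros f gc\<close>)
  have cutlim: "(\<lambda>n. cut n x) \<longlonglongrightarrow> indicator {s<..<t} x" for x
  proof (cases "x \<in> {s<..<t}")
    case True
    have "\<forall>\<^sub>F n in sequentially. 2 / (x - s) < real n" "\<forall>\<^sub>F n in sequentially. 2 / (t - x) < real n"
      using filterlim_real_sequentially unfolding filterlim_at_top_dense by blast+
    then have "\<forall>\<^sub>F n in sequentially. cut n x = 1"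
    proof eventually_elim
      case (elim n)
      have "2 < real n * (x - s)" "2 < real n * (t - x)" using elim True by (auto simp: pos_divide_less_eq)
      moreover have "real n * (x - t) = - (real n * (t - x))" by (simp add: algebra_simps)
      ultimately show ?case using smoothstep(2,3) by (simp add: cut_def)
    qed
    then show ?thesis using True by (simp add: tendsto_eventually)
  next
    case False
    have "\<forall>\<^sub>F n in sequentially. cut n x = 0"
      using big
    proof eventually_elim
      case (elim n)
      have "1 / real n > 0" using n_pos[OF elim] by simp
      moreover have "x \<le> s \<or> t \<le> x" using False by auto
      ultimately have "x \<le> s + 1 / real n \<or> t - 1 / real n \<le> x" by linarith
      then show ?case by (rule cut_supp[OF elim])
    qed
    then show ?thesis using False by (simp add: tendsto_eventually)
  qed
  have cutb: "\<bar>cut n x\<bar> \<le> 1" for n x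
    unfolding cut_def using smoothstep(4,5)[of "real n * (x - s) - 1"] smoothstep(4,5)[of "real n * (x - t) + 2"] by auto
  have dom: "(\<lambda>n. LINT x|lborel. indicator {a<..<c} x *\<^sub>R (w x * of_real (cut n x))) \<longlonglongrightarrow> (LINT x:{s<..<t}|lborel. w x)"
    if w: "set_integrable lborel {a<..<c} w" for w :: "real \<Rightarrow> complex"
  proof -
    have "(\<lambda>n. LINT x|lborel. indicator {a<..<c} x *\<^sub>R (w x * of_real (cut n x)))
       \<longlonglongrightarrow> (LINT x|lborel. indicator {a<..<c} x *\<^sub>R (w x * of_real (indicator {s<..<t} x)))"
    proof (rule integral_dominated_convergence[where w="\<lambda>x. norm (indicator {a<..<c} x *\<^sub>R w x)"])
      have wm[measurable]: "(\<lambda>x. indicator {a<..<c} x *\<^sub>R w x) \<in> borel_measurable lborel"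
        using w by (auto simp: set_integrable_def)
      have [measurable]: "cut n \<in> borel_measurable borel" for n by (rule borel_measurable_continuous_onI[OF cutc])
      have eq: "indicator {a<..<c} x *\<^sub>R (w x * of_real z) = (indicator {a<..<c} x *\<^sub>R w x) * of_real z" for x z by simp
      show "(\<lambda>x. indicator {a<..<c} x *\<^sub>R (w x * of_real (indicator {s<..<t} x))) \<in> borel_measurable lborel"
        unfolding eq by measurable
      show "(\<lambda>x. indicator {a<..<c} x *\<^sub>R (w x * of_real (cut n x))) \<in> borel_measurable lborel" for n
        unfolding eq by measurable
      show "integrable lborel (\<lambda>x. norm (indicator {a<..<c} x *\<^sub>R w x))"
        using w unfolding set_integrable_def by (rule integrable_norm)
      show "AE x in lborel. (\<lambda>n. indicator {a<..<c} x *\<^sub>R (w x * of_real (cut n x))) \<longlonglongrightarrow> indicator {a<..<c} x *\<^sub>R (w x * of_real (indicator {s<..<t} x))"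
        by (intro AE_I2 tendsto_intros cutlim)
      show "AE x in lborel. norm (indicator {a<..<c} x *\<^sub>R (w x * of_real (cut n x))) \<le> norm (indicator {a<..<c} x *\<^sub>R w x)" for n
        using cutb by (intro AE_I2) (auto simp: norm_mult indicator_def intro!: mult_left_le)
    qed
    also have "(\<lambda>x. indicator {a<..<c} x *\<^sub>R (w x * of_real (indicator {s<..<t} x))) = (\<lambda>x. indicator {s<..<t} x *\<^sub>R w x)"
      using st by (auto simp: fun_eq_iff indicator_def)
    finally show ?thesis by (simp add: set_lebesgue_integral_def)
  qed
  have fg: "continuous_on {a..c} (\<lambda>x. f x * of_real (g' x))" by (intro continuous_intros f gc')
  have l3: "(\<lambda>n. integral {a..c} (\<lambda>x. f x * of_real (g' x) * of_real (cut n x))) \<longlonglongrightarrow> (LINT x:{s<..<t}|lborel. f x * of_real (g' x))"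
  proof -
    have "integral {a..c} (\<lambda>x. f x * of_real (g' x) * of_real (cut n x)) = (LINT x|lborel. indicator {a<..<c} x *\<^sub>R (f x * of_real (g' x) * of_real (cut n x)))" for n
    proof -
      have "continuous_on {a..c} (\<lambda>x. f x * of_real (g' x) * of_real (cut n x))" by (intro continuous_intros fg cutc)
      from set_borel_integral_eq_integral(2)[OF set_integrable_continuous_Ioo[OF this]] show ?thesis
        by (simp add: integral_open_interval_real set_lebesgue_integral_def)
    qed
    then show ?thesis using dom[OF set_integrable_continuous_Ioo[OF fg]] by simp
  qed
  have vg: "set_integrable lborel {a<..<c} (\<lambda>x. v x * of_real (g x))"
  proof -
    have "\<exists>G. \<forall>x\<in>{a..c}. norm (g x) \<le> G"
      using compact_imp_bounded[OF compact_continuous_image[OF gc compact_Icc, of a c]] by (auto simp: bounded_iff)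
    then obtain G where G: "\<And>x. x \<in> {a..c} \<Longrightarrow> norm (g x) \<le> G" by blast
    have [measurable]: "g \<in> borel_measurable borel" by (rule borel_measurable_continuous_onI[OF gc])
    have [measurable]: "(\<lambda>x. indicator {a<..<c} x *\<^sub>R v x) \<in> borel_measurable lborel" using vi by (auto simp: set_integrable_def)
    show ?thesis unfolding set_integrable_def
    proof (rule Bochner_Integration.integrable_bound[where f="\<lambda>x. G *\<^sub>R (indicator {a<..<c} x *\<^sub>R v x)"])
      show "integrable lborel (\<lambda>x. G *\<^sub>R (indicator {a<..<c} x *\<^sub>R v x))"
        using vi unfolding set_integrable_def by (rule integrable_scaleR_right)
      have eq: "(\<lambda>x. indicator {a<..<c} x *\<^sub>R (v x * of_real (g x))) = (\<lambda>x. (indicator {a<..<c} x *\<^sub>R v x) * of_real (g x))" by simp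
      show "(\<lambda>x. indicator {a<..<c} x *\<^sub>R (v x * of_real (g x))) \<in> borel_measurable lborel"
        unfolding eq by measurable
      show "AE x in lborel. norm (indicator {a<..<c} x *\<^sub>R (v x * of_real (g x))) \<le> norm (G *\<^sub>R (indicator {a<..<c} x *\<^sub>R v x))"
      proof (rule AE_I2)
        fix x
        have "x \<in> {a<..<c} \<Longrightarrow> \<bar>g x\<bar> \<le> \<bar>G\<bar>" using G[of x] by auto
        then show "norm (indicator {a<..<c} x *\<^sub>R (v x * of_real (g x))) \<le> norm (G *\<^sub>R (indicator {a<..<c} x *\<^sub>R v x))"
          by (auto simp: norm_mult indicator_def mult.commute[of "\<bar>G\<bar>"] intro!: mult_left_mono)
      qed
    qed
  qed
  have lim1: "(\<lambda>n. - (LINT x|lborel. indicator {a<..<c} x *\<^sub>R (v x * of_real (g x) * of_real (cut n x))))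
     \<longlonglongrightarrow> - (LINT x:{s<..<t}|lborel. v x * of_real (g x))"
    by (intro tendsto_minus dom vg)
  have lim2: "(\<lambda>n. integral {a..c} (\<lambda>x. (f x * of_real (g x)) * of_real (k1 n x)) - integral {a..c} (\<lambda>x. (f x * of_real (g x)) * of_real (k2 n x))
        + integral {a..c} (\<lambda>x. f x * of_real (g' x) * of_real (cut n x)))
     \<longlonglongrightarrow> f s * of_real (g s) - f t * of_real (g t) + (LINT x:{s<..<t}|lborel. f x * of_real (g' x))"
    by (intro tendsto_intros l1 l2 l3)
  have ev: "\<forall>\<^sub>F n in sequentially. - (LINT x|lborel. indicator {a<..<c} x *\<^sub>R (v x * of_real (g x) * of_real (cut n x)))
     = integral {a..c} (\<lambda>x. (f x * of_real (g x)) * of_real (k1 n x)) - integral {a..c} (\<lambda>x. (f x * of_real (g x)) * of_real (k2 n x))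
        + integral {a..c} (\<lambda>x. f x * of_real (g' x) * of_real (cut n x))"
    using big by eventually_elim (simp only: key)
  have "- (LINT x:{s<..<t}|lborel. v x * of_real (g x))
     = f s * of_real (g s) - f t * of_real (g t) + (LINT x:{s<..<t}|lborel. f x * of_real (g' x))"
    by (rule LIMSEQ_unique[OF lim1 tendsto_cong[OF ev, THEN iffD2, OF lim2]])
  then show ?thesis by (simp add: algebra_simps)
qed

section \<open>Identification of weak derivatives\<close>

lemma weak_derivative_increment:
  assumes wd: "has_weak_derivative a c u v" and f: "continuous_on {a..c} f"
    and fu: "\<And>x. x \<in> {a<..<c} \<Longrightarrow> f x = u x" and st: "a \<le> s" "s < t" "t \<le> c"
  shows "(LINT x:{s<..<t}|lborel. v x) = f t - f s"
  using weak_integration_by_parts[OF wd f fu _ _ st, of "\<lambda>_. 1" "\<lambda>_. 0"] by simp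

text \<open>Induction over Borel sets shows that all set integrals vanish. The step for complements
  needs the integral over the line, which is a limit of integrals over bounded intervals.\<close>

lemma AE_zero_if_interval_integrals_zero:
  fixes f :: "real \<Rightarrow> complex"
  assumes f: "integrable lborel f" and z: "\<And>s t. s \<le> t \<Longrightarrow> (LINT x:{s..t}|lborel. f x) = 0"
  shows "AE x in lborel. f x = 0"
proof (rule sigma_finite_measure.density_zero[OF sigma_finite_lborel f])
  have si: "set_integrable lborel A f" if "A \<in> sets borel" for A
    unfolding set_integrable_def using that f by (intro integrable_mult_indicator) auto
  have U: "(LINT x|lborel. f x) = 0"
  proof (rule LIMSEQ_unique)
    show "(\<lambda>n. LINT x:{- real n..real n}|lborel. f x) \<longlonglongrightarrow> (LINT x|lborel. f x)"
      unfolding set_lebesgue_integral_def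
    proof (rule integral_dominated_convergence[where w="\<lambda>x. norm (f x)"])
      show "AE x in lborel. (\<lambda>i. indicat_real {- real i..real i} x *\<^sub>R f x) \<longlonglongrightarrow> f x"
      proof (rule AE_I2)
        fix x :: real
        have "\<forall>\<^sub>F n in sequentially. \<bar>x\<bar> < real n"
          using filterlim_real_sequentially unfolding filterlim_at_top_dense by blast
        then have "\<forall>\<^sub>F n in sequentially. indicat_real {- real n..real n} x *\<^sub>R f x = f x"
          by eventually_elim (auto simp: indicator_def)
        then show "(\<lambda>i. indicat_real {- real i..real i} x *\<^sub>R f x) \<longlonglongrightarrow> f x" by (rule tendsto_eventually)
      qed
    qed (use f in \<open>auto simp: indicator_def intro!: borel_measurable_scaleR\<close>)
    show "(\<lambda>n. LINT x:{- real n..real n}|lborel. f x) \<longlonglongrightarrow> 0" by (simp add: z)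
  qed
  fix A :: "real set" assume "A \<in> sets lborel"
  then have "A \<in> sets borel" by simp
  then show "(LINT x:A|lborel. f x) = 0"
  proof (induction rule: borel_set_induct)
    case empty
    then show ?case by (simp add: set_lebesgue_integral_def)
  next
    case (interval a b)
    then show ?case by (rule z)
  next
    case (compl A)
    have "(LINT x:A \<union> -A|lborel. f x) = (LINT x:A|lborel. f x) + (LINT x:-A|lborel. f x)"
      using compl.hyps by (intro set_integral_Un si) auto
    then show ?case using compl.IH U by (simp add: set_lebesgue_integral_def)
  next
    case (union F)
    have "(LINT x:(\<Union>i. F i)|lborel. f x) = (\<Sum>i. (LINT x:F i|lborel. f x))"
      using union.hyps by (intro lebesgue_integral_countable_add si) (auto simp: disjoint_family_on_def)
    then show ?case using union.IH by simp
  qed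
qed

text \<open>Both functions integrate to the increments of \<open>f\<close> over all subintervals.
  This is how the arbitrarily chosen representative in \<open>tree_deriv\<close> is replaced by an
  explicit function.\<close>

lemma weak_derivative_unique:
  assumes wd: "has_weak_derivative a c u v" and f: "continuous_on {a..c} f"
    and fu: "\<And>x. x \<in> {a<..<c} \<Longrightarrow> f x = u x"
    and d: "set_integrable lborel {a<..<c} d"
    and inc: "\<And>s t. a \<le> s \<Longrightarrow> s < t \<Longrightarrow> t \<le> c \<Longrightarrow> (LINT x:{s<..<t}|lborel. d x) = f t - f s"
  shows "AE x in lborel. x \<in> {a<..<c} \<longrightarrow> v x = d x"
proof -
  have v: "set_integrable lborel {a<..<c} v"
    using wd by (intro square_integrable_imp_integrable) (simp add: has_weak_derivative_def)
  let ?h = "\<lambda>x. indicator {a<..<c} x *\<^sub>R (v x - d x)"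
  have hi: "integrable lborel ?h"
    using set_integral_diff(1)[OF v d] by (simp add: set_integrable_def)
  have "AE x in lborel. ?h x = 0"
  proof (rule AE_zero_if_interval_integrals_zero[OF hi])
    fix s t :: real assume st: "s \<le> t"
    define s' where "s' = max s a"
    define t' where "t' = min t c"
    show "(LINT x:{s..t}|lborel. ?h x) = 0"
    proof (cases "s' < t'")
      case True
      then have b: "a \<le> s'" "t' \<le> c" by (auto simp: s'_def t'_def)
      have sub: "{s'<..<t'} \<subseteq> {a<..<c}" using b by auto
      have i: "set_integrable lborel {s'<..<t'} v" "set_integrable lborel {s'<..<t'} d"
        by (rule set_integrable_subset[OF v _ sub] set_integrable_subset[OF d _ sub]; simp)+
      have "(LINT x:{s..t}|lborel. ?h x) = (LINT x:{s'<..<t'}|lborel. v x - d x)"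
        unfolding set_lebesgue_integral_def
      proof (rule integral_cong_AE)
        have "AE x in lborel. x \<noteq> s" "AE x in lborel. x \<noteq> t"
          by (rule AE_lborel_singleton)+
        then show "AE x in lborel. indicat_real {s..t} x *\<^sub>R ?h x = indicat_real {s'<..<t'} x *\<^sub>R (v x - d x)"
          by eventually_elim (auto simp: indicator_def s'_def t'_def)
        show "(\<lambda>x. indicat_real {s..t} x *\<^sub>R ?h x) \<in> borel_measurable lborel"
          by (intro borel_measurable_scaleR borel_measurable_integrable[OF hi]) auto
        show "(\<lambda>x. indicat_real {s'<..<t'} x *\<^sub>R (v x - d x)) \<in> borel_measurable lborel"
          using set_integral_diff(1)[OF i] by (auto simp: set_integrable_def)
      qed
      also have "\<dots> = (LINT x:{s'<..<t'}|lborel. v x) - (LINT x:{s'<..<t'}|lborel. d x)"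
        by (rule set_integral_diff(2)[OF i])
      also have "\<dots> = 0"
        using weak_derivative_increment[OF wd f fu b(1) True b(2)] inc[OF b(1) True b(2)] by simp
      finally show ?thesis .
    next
      case False
      have "AE x in lborel. x \<noteq> s" "AE x in lborel. x \<noteq> t" by (rule AE_lborel_singleton)+
      then have "AE x in lborel. indicat_real {s..t} x *\<^sub>R ?h x = 0"
        by eventually_elim (use False in \<open>auto simp: indicator_def s'_def t'_def\<close>)
      then show ?thesis unfolding set_lebesgue_integral_def by (rule integral_eq_zero_AE)
    qed
  qed
  then show ?thesis by eventually_elim (auto simp: indicator_def)
qed

text \<open>The finite exceptional set admits the kinks of hat functions. The last claim is the
  input for \<open>weak_derivative_unique\<close>.\<close>

lemma has_weak_derivativeI:
  fixes f d :: "real \<Rightarrow> complex"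
  assumes ac: "a < c" and f: "continuous_on {a..c} f" and F: "finite F"
    and fd: "\<And>x. x \<in> {a<..<c} - F \<Longrightarrow> (f has_vector_derivative d x) (at x)"
    and dm: "set_borel_measurable lborel {a<..<c} d" and db: "\<And>x. x \<in> {a<..<c} \<Longrightarrow> norm (d x) \<le> M"
    and fu: "\<And>x. x \<in> {a<..<c} \<Longrightarrow> u x = f x"
  shows "has_weak_derivative a c u d" "u \<in> H1_interval a c" "set_integrable lborel {a<..<c} d"
    "\<And>s t. a \<le> s \<Longrightarrow> s < t \<Longrightarrow> t \<le> c \<Longrightarrow> (LINT x:{s<..<t}|lborel. d x) = f t - f s"
proof -
  have sq: "square_integrable_on_interval a c w"
    if wm: "set_borel_measurable lborel {a<..<c} w" and wb: "\<And>x. x \<in> {a<..<c} \<Longrightarrow> norm (w x) \<le> N" for w N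
    unfolding square_integrable_on_interval_def
  proof (rule conjI[OF wm])
    have [measurable]: "(\<lambda>x. indicator {a<..<c} x *\<^sub>R w x) \<in> borel_measurable lborel"
      using wm by (simp add: set_borel_measurable_def)
    have eq: "(\<lambda>x. indicat_real {a<..<c} x *\<^sub>R (cmod (w x))\<^sup>2) = (\<lambda>x. (cmod (indicator {a<..<c} x *\<^sub>R w x))\<^sup>2)"
      by (auto simp: indicator_def)
    show "set_integrable lborel {a<..<c} (\<lambda>t. (cmod (w t))\<^sup>2)"
      unfolding set_integrable_def
    proof (rule Bochner_Integration.integrable_bound[where f="\<lambda>x. indicat_real {a<..<c} x *\<^sub>R N\<^sup>2"])
      show "integrable lborel (\<lambda>x. indicat_real {a<..<c} x *\<^sub>R N\<^sup>2)" by (simp add: integrable_indicator_Ioo)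
      show "(\<lambda>x. indicat_real {a<..<c} x *\<^sub>R (cmod (w x))\<^sup>2) \<in> borel_measurable lborel" unfolding eq by measurable
      show "AE x in lborel. norm (indicat_real {a<..<c} x *\<^sub>R (cmod (w x))\<^sup>2) \<le> norm (indicat_real {a<..<c} x *\<^sub>R N\<^sup>2)"
        using wb by (intro AE_I2) (auto simp: indicator_def power_mono)
    qed
  qed
  have sqd: "square_integrable_on_interval a c d" by (rule sq[OF dm db])
  then show di: "set_integrable lborel {a<..<c} d" by (rule square_integrable_imp_integrable)
  have "\<exists>N. \<forall>x\<in>{a..c}. norm (f x) \<le> N"
    using compact_imp_bounded[OF compact_continuous_image[OF f compact_Icc]] by (auto simp: bounded_iff)
  then obtain N where N: "\<And>x. x \<in> {a..c} \<Longrightarrow> norm (f x) \<le> N" by blast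
  have um: "set_borel_measurable lborel {a<..<c} u"
  proof -
    have "set_borel_measurable lborel {a<..<c} f"
      using set_integrable_continuous_Ioo[OF f] by (auto simp: set_integrable_def set_borel_measurable_def)
    moreover have "(\<lambda>x. indicat_real {a<..<c} x *\<^sub>R u x) = (\<lambda>x. indicat_real {a<..<c} x *\<^sub>R f x)"
    proof
      show "indicat_real {a<..<c} x *\<^sub>R u x = indicat_real {a<..<c} x *\<^sub>R f x" for x
        by (cases "x \<in> {a<..<c}") (simp_all add: fu)
    qed
    ultimately show ?thesis by (simp add: set_borel_measurable_def)
  qed
  have squ: "square_integrable_on_interval a c u"
    by (rule sq[OF um, where N=N]) (use N fu in auto)
  show wd: "has_weak_derivative a c u d"
    unfolding has_weak_derivative_def
  proof (intro conjI allI impI sqd)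
    fix \<phi> assume t: "test_function a c \<phi>"
    then obtain D where D: "\<And>x. (\<phi> has_vector_derivative D x) (at x)" "continuous_on UNIV D"
      by (auto simp: test_function_def C1_differentiable_on_def)
    obtain a' c' where supp: "a < a'" "c' < c" "\<And>x. x \<notin> {a'..c'} \<Longrightarrow> \<phi> x = 0" using t by (auto simp: test_function_def)
    have D': "(\<phi> has_real_derivative D x) (at x)" for x
      using D by (simp add: has_real_derivative_iff_has_vector_derivative)
    have dphi: "deriv \<phi> x = D x" for x by (rule DERIV_imp_deriv[OF D'])
    have pc: "continuous_on S \<phi>" for S using D' DERIV_isCont continuous_at_imp_continuous_on by blast
    have Dc: "continuous_on S D" for S using D(2) continuous_on_subset by blast
    have p0: "\<phi> a = 0" "\<phi> c = 0" using supp by auto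
    have 1: "((\<lambda>x. f x * of_real (D x) + d x * of_real (\<phi> x)) has_integral f c * of_real (\<phi> c) - f a * of_real (\<phi> a)) {a..c}"
    proof (rule fundamental_theorem_of_calculus_interior_strong[OF F])
      show "a \<le> c" using ac by simp
      show "continuous_on {a..c} (\<lambda>x. f x * of_real (\<phi> x))" by (intro continuous_intros f pc)
      fix x assume "x \<in> {a<..<c} - F"
      from has_vector_derivative_mult[OF fd[OF this] has_vector_derivative_of_real[OF D']]
      show "((\<lambda>x. f x * of_real (\<phi> x)) has_vector_derivative f x * of_real (D x) + d x * of_real (\<phi> x)) (at x)" .
    qed
    have "\<exists>P. \<forall>x\<in>{a..c}. norm (\<phi> x) \<le> P"
      using compact_imp_bounded[OF compact_continuous_image[OF pc compact_Icc, of a c]] by (auto simp: bounded_iff)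
    then obtain P where P: "\<And>x. x \<in> {a..c} \<Longrightarrow> norm (\<phi> x) \<le> P" by blast
    have [measurable]: "\<phi> \<in> borel_measurable borel" by (rule borel_measurable_continuous_onI[OF pc])
    have dmm[measurable]: "(\<lambda>x. indicator {a<..<c} x *\<^sub>R d x) \<in> borel_measurable lborel" using dm by (simp add: set_borel_measurable_def)
    have dpi: "set_integrable lborel {a<..<c} (\<lambda>x. d x * of_real (\<phi> x))"
    proof (rule square_integrable_imp_integrable[OF sq[where N="M * P"]])
      have eq: "(\<lambda>x. indicator {a<..<c} x *\<^sub>R (d x * of_real (\<phi> x))) = (\<lambda>x. (indicator {a<..<c} x *\<^sub>R d x) * of_real (\<phi> x))" by simp
      show "set_borel_measurable lborel {a<..<c} (\<lambda>x. d x * of_real (\<phi> x))"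
        unfolding set_borel_measurable_def eq by measurable
      fix x assume x: "x \<in> {a<..<c}"
      show "norm (d x * of_real (\<phi> x)) \<le> M * P"
        using db[OF x] P[of x] x by (auto simp: norm_mult intro!: mult_mono order_trans[OF norm_ge_zero db[OF x]])
    qed
    have fDc: "continuous_on {a..c} (\<lambda>x. f x * of_real (D x))" by (intro continuous_intros f Dc)
    have fDi: "set_integrable lborel {a<..<c} (\<lambda>x. f x * of_real (D x))" by (rule set_integrable_continuous_Ioo[OF fDc])
    have "(LINT x:{a<..<c}|lborel. f x * of_real (D x)) + (LINT x:{a<..<c}|lborel. d x * of_real (\<phi> x))
      = (LINT x:{a<..<c}|lborel. f x * of_real (D x) + d x * of_real (\<phi> x))"
      by (rule set_integral_add(2)[OF fDi dpi, symmetric])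
    also have "\<dots> = integral {a<..<c} (\<lambda>x. f x * of_real (D x) + d x * of_real (\<phi> x))"
      by (rule set_borel_integral_eq_integral(2)[OF set_integral_add(1)[OF fDi dpi]])
    also have "\<dots> = 0" using 1 by (simp add: integral_open_interval_real[symmetric] p0 integral_unique)
    finally have "(LINT x:{a<..<c}|lborel. f x * of_real (D x)) = - (LINT x:{a<..<c}|lborel. d x * of_real (\<phi> x))"
      by (simp add: eq_neg_iff_add_eq_0)
    moreover have "(LINT x:{a<..<c}|lborel. u x * of_real (deriv \<phi> x)) = (LINT x:{a<..<c}|lborel. f x * of_real (D x))"
      by (rule set_lebesgue_integral_cong) (auto simp: dphi fu)
    ultimately show "(LINT x:{a<..<c}|lborel. u x * of_real (deriv \<phi> x)) = - (LINT x:{a<..<c}|lborel. d x * of_real (\<phi> x))"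
      by simp
  qed
  show "u \<in> H1_interval a c" using squ wd by (auto simp: H1_interval_def)
  fix s t assume st: "a \<le> s" "s < t" "t \<le> c"
  have di': "set_integrable lborel {s<..<t} d" by (rule set_integrable_subset[OF di]) (use st in auto)
  have "(d has_integral f t - f s) {s..t}"
    by (rule fundamental_theorem_of_calculus_interior_strong[OF F])
      (use st in \<open>auto intro!: fd continuous_on_subset[OF f]\<close>)
  then show "(LINT x:{s<..<t}|lborel. d x) = f t - f s"
    using set_borel_integral_eq_integral(2)[OF di'] by (simp add: integral_open_interval_real[symmetric] integral_unique)
qed

section \<open>Edges, integrals and continuity on the tree\<close>

definition words :: "nat \<Rightarrow> nat list set" where "words b = {w. set w \<subseteq> {..<b}}"
definition words_lt :: "nat \<Rightarrow> nat \<Rightarrow> nat list set" where "words_lt b N = {w \<in> words b. length w < N}"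
text \<open>Open edges differ from the sections of the tree by finitely many points, a null set, so
  integrals need not record which edge owns a vertex.\<close>

definition eI :: "nat list \<Rightarrow> real set" where "eI w = {real (length w) <..< real (length w) + 1}"

lemma finite_words_lt: "finite (words_lt b N)"
  by (rule finite_subset[OF _ finite_lists_length_le[of "{..<b}" N]]) (auto simp: words_lt_def words_def)

lemma words_Nil: "[] \<in> words b" and words_snoc: "w @ [j] \<in> words b \<longleftrightarrow> w \<in> words b \<and> j < b"
  by (auto simp: words_def)

lemma mem_tree: "(w, t) \<in> tree b \<longleftrightarrow> w = [] \<and> t = 0 \<or> w \<in> words b \<and> real (length w) < t \<and> t \<le> real (length w) + 1"
  by (auto simp: tree_def tree_root_def words_def)

section \<open>Sections of the tree and integration over it\<close>

lemma tree_section: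
  assumes "w \<in> words b"
  shows "eI w \<subseteq> {t. (w, t) \<in> tree b}" "finite ({t. (w, t) \<in> tree b} - eI w)"
proof -
  show "eI w \<subseteq> {t. (w, t) \<in> tree b}" using assms by (auto simp: mem_tree eI_def)
  have "{t. (w, t) \<in> tree b} - eI w \<subseteq> {0, real (length w) + 1}" by (auto simp: mem_tree eI_def)
  then show "finite ({t. (w, t) \<in> tree b} - eI w)" by (rule finite_subset) simp
qed

lemma tree_section_empty: "w \<notin> words b \<Longrightarrow> (w, t) \<notin> tree b"
  using words_Nil by (auto simp: mem_tree)

abbreviation cI :: "nat list \<Rightarrow> real set" where "cI w \<equiv> {real (length w)..real (length w) + 1}"

lemma eI_borel: "eI w \<in> sets borel" by (simp add: eI_def)

lemma tree_sets: "tree b \<in> sets (count_space UNIV \<Otimes>\<^sub>M lborel)"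
proof -
  have s: "{t. (w, t) \<in> tree b} \<in> sets borel" for w
  proof (cases "w \<in> words b")
    case True
    have "{t. (w, t) \<in> tree b} = eI w \<union> ({t. (w, t) \<in> tree b} - eI w)" using tree_section(1)[OF True] by auto
    moreover have "\<dots> \<in> sets borel" by (intro sets.Un eI_borel sets.finite_UN borel_closed finite_imp_closed tree_section(2) True)
    ultimately show ?thesis by simp
  next
    case False
    then show ?thesis using tree_section_empty[OF False] by simp
  qed
  have "(\<Union>w. {w} \<times> {t. (w, t) \<in> tree b}) \<in> sets (count_space UNIV \<Otimes>\<^sub>M lborel)"
    using s by (intro sets.countable_UN'' pair_measureI) auto
  also have "(\<Union>w. {w} \<times> {t. (w, t) \<in> tree b}) = tree b" by auto
  finally show ?thesis .
qed

interpretation count_lborel: pair_sigma_finite "count_space UNIV :: nat list measure" "lborel :: real measure"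
  by (intro pair_sigma_finite.intro sigma_finite_measure_count_space sigma_finite_lborel)

lemma AE_section:
  "AE t in lborel. indicat_real (tree b) (w, t) = (if w \<in> words b then indicat_real (eI w) t else 0)"
proof (cases "w \<in> words b")
  case True
  have "AE t in lborel. t \<notin> {t. (w, t) \<in> tree b} - eI w"
    by (rule AE_not_in) (use finite_imp_null_set_lborel[OF tree_section(2)[OF True]] in auto)
  then show ?thesis
    by eventually_elim (use tree_section(1)[OF True] True in \<open>auto simp: indicator_def\<close>)
qed (use tree_section_empty in \<open>auto simp: indicator_def\<close>)

lemma section_measurable:
  fixes F :: "tpoint \<Rightarrow> 'a::{banach, second_countable_topology}"
  assumes "w \<in> words b \<Longrightarrow> set_borel_measurable lborel (eI w) (\<lambda>t. F (w, t))"
  shows "(\<lambda>t. indicat_real (tree b) (w, t) *\<^sub>R F (w, t)) \<in> borel_measurable lborel"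
proof (cases "w \<in> words b")
  case True
  define P where "P = {t. (w, t) \<in> tree b} - eI w"
  have fP: "finite P" unfolding P_def by (rule tree_section(2)[OF True])
  have "indicat_real (tree b) (w, t) *\<^sub>R F (w, t) = indicat_real (eI w) t *\<^sub>R F (w, t) + (\<Sum>p\<in>P. indicat_real {p} t *\<^sub>R F (w, p))" for t
  proof -
    have "(\<Sum>p\<in>P. indicat_real {p} t *\<^sub>R F (w, p)) = (\<Sum>p\<in>P. if t = p then F (w, t) else 0)"
      by (intro sum.cong) (auto simp: indicator_def)
    also have "\<dots> = (if t \<in> P then F (w, t) else 0)" using fP by simp
    finally show ?thesis using tree_section(1)[OF True] by (auto simp: P_def indicator_def)
  qed
  moreover have "(\<lambda>t. indicat_real (eI w) t *\<^sub>R F (w, t)) \<in> borel_measurable lborel"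
    using assms[OF True] by (simp add: set_borel_measurable_def)
  ultimately show ?thesis by simp
next
  case False
  then show ?thesis using tree_section_empty[OF False] by (simp add: indicator_def)
qed

text \<open>Fubini's theorem for the product with a counting measure. Truncation by the length of
  the word leaves finite sums, and dominated convergence removes the truncation.\<close>

lemma tree_integral:
  fixes F :: "tpoint \<Rightarrow> 'a::{banach, second_countable_topology}"
  assumes F: "integrable (tree_measure b) F"
  shows "w \<in> words b \<Longrightarrow> set_integrable lborel (eI w) (\<lambda>t. F (w, t))"
    "(\<lambda>N. \<Sum>w\<in>words_lt b N. (LINT t:eI w|lborel. F (w, t))) \<longlonglongrightarrow> (LINT x|tree_measure b. F x)"
proof -
  let ?M = "count_space UNIV \<Otimes>\<^sub>M lborel :: tpoint measure"
  define G where "G x = indicat_real (tree b) x *\<^sub>R F x" for x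
  have ts: "tree b \<inter> space ?M \<in> sets ?M" using tree_sets by (simp add: space_pair_measure)
  have G: "integrable ?M G"
    using F ts unfolding tree_measure_def G_def by (simp add: integrable_restrict_space)
  have LG: "(LINT x|tree_measure b. F x) = (LINT x|?M. G x)"
    unfolding tree_measure_def G_def by (rule integral_restrict_space[OF ts])
  have Gs: "integrable lborel (\<lambda>t. G (w, t))" for w
    using count_lborel.AE_integrable_fst'[OF G] by (simp add: AE_count_space)
  have AEG: "AE t in lborel. G (w, t) = (if w \<in> words b then indicat_real (eI w) t *\<^sub>R F (w, t) else 0)" for w
    using AE_section[of b w] by eventually_elim (auto simp: G_def)
  have meas: "(\<lambda>t. indicat_real (eI w) t *\<^sub>R F (w, t)) \<in> borel_measurable lborel" if w: "w \<in> words b" for w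
  proof -
    have "(\<lambda>t. indicat_real (eI w) t *\<^sub>R G (w, t)) \<in> borel_measurable lborel"
      using eI_borel by (intro borel_measurable_scaleR borel_measurable_integrable[OF Gs]) auto
    moreover have "indicat_real (eI w) t *\<^sub>R G (w, t) = indicat_real (eI w) t *\<^sub>R F (w, t)" for t
      using tree_section(1)[OF w] by (auto simp: G_def indicator_def)
    ultimately show ?thesis by simp
  qed
  show si: "set_integrable lborel (eI w) (\<lambda>t. F (w, t))" if w: "w \<in> words b" for w
    unfolding set_integrable_def
    by (rule integrable_cong_AE_imp[OF Gs[of w] meas[OF w]]) (use AEG[of w] w in \<open>auto elim: AE_mp\<close>)
  have LGs: "(LINT t|lborel. G (w, t)) = (if w \<in> words b then LINT t:eI w|lborel. F (w, t) else 0)" for w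
  proof (cases "w \<in> words b")
    case True
    then show ?thesis unfolding set_lebesgue_integral_def
      using AEG[of w] by (simp, intro integral_cong_AE borel_measurable_integrable[OF Gs] meas) auto
  next
    case False
    then show ?thesis using integral_eq_zero_AE[OF AEG[of w, unfolded if_not_P[OF False]]] by simp
  qed
  define GN where "GN N x = (if length (fst x) < N then G x else 0)" for N :: nat and x
  have GNi: "integrable ?M (GN N)" for N
  proof (rule Bochner_Integration.integrable_bound[OF G])
    have "(\<lambda>x. indicat_real {x. length (fst x) < N} x *\<^sub>R G x) \<in> borel_measurable ?M"
    proof (rule borel_measurable_scaleR[OF borel_measurable_indicator borel_measurable_integrable[OF G]])
      have "{w. length w < N} \<times> UNIV \<in> sets ?M" by (intro pair_measureI) auto
      moreover have "{w. length w < N} \<times> UNIV = {x :: tpoint. length (fst x) < N}" by auto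
      ultimately show "{x. length (fst x) < N} \<in> sets ?M" by simp
    qed
    moreover have "(\<lambda>x. indicat_real {x. length (fst x) < N} x *\<^sub>R G x) = GN N" by (auto simp: GN_def indicator_def)
    ultimately show "GN N \<in> borel_measurable ?M" by simp
    show "AE x in ?M. norm (GN N x) \<le> norm (G x)" by (auto simp: GN_def)
  qed
  have "(\<lambda>N. LINT x|?M. GN N x) \<longlonglongrightarrow> (LINT x|?M. G x)"
  proof (rule integral_dominated_convergence[where w="\<lambda>x. norm (G x)"])
    show "AE x in ?M. (\<lambda>N. GN N x) \<longlonglongrightarrow> G x"
    proof (rule AE_I2)
      fix x
      have "\<forall>\<^sub>F N in sequentially. GN N x = G x"
        unfolding eventually_sequentially by (intro exI[of _ "Suc (length (fst x))"]) (auto simp: GN_def)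
      then show "(\<lambda>N. GN N x) \<longlonglongrightarrow> G x" by (rule tendsto_eventually)
    qed
    show "AE x in ?M. norm (GN N x) \<le> norm (G x)" for N by (auto simp: GN_def)
  qed (use G GNi in auto)
  moreover have "(LINT x|?M. GN N x) = (\<Sum>w\<in>words_lt b N. (LINT t:eI w|lborel. F (w, t)))" for N
  proof -
    have s: "(LINT t|lborel. GN N (w, t)) = (if w \<in> words_lt b N then LINT t:eI w|lborel. F (w, t) else 0)" for w
      using LGs[of w] by (cases "length w < N") (simp_all add: GN_def words_lt_def)
    have "(LINT x|?M. GN N x) = (LINT w|count_space UNIV. LINT t|lborel. GN N (w, t))"
      using count_lborel.integral_fst'[OF GNi[of N]] by simp
    also have "\<dots> = (\<Sum>w\<in>{w \<in> UNIV. (LINT t|lborel. GN N (w, t)) \<noteq> 0}. LINT t|lborel. GN N (w, t))"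
      unfolding s by (intro lebesgue_integral_count_space_finite_support finite_subset[OF _ finite_words_lt[of b N]])
        (auto split: if_splits)
    also have "\<dots> = (\<Sum>w\<in>words_lt b N. LINT t|lborel. GN N (w, t))"
      unfolding s by (intro sum.mono_neutral_left finite_words_lt) auto
    also have "\<dots> = (\<Sum>w\<in>words_lt b N. (LINT t:eI w|lborel. F (w, t)))"
      unfolding s by (intro sum.cong) auto
    finally show ?thesis .
  qed
  ultimately show "(\<lambda>N. \<Sum>w\<in>words_lt b N. (LINT t:eI w|lborel. F (w, t))) \<longlonglongrightarrow> (LINT x|tree_measure b. F x)"
    unfolding LG by simp
qed

lemma tree_borel_measurableI:
  fixes F :: "tpoint \<Rightarrow> 'a::{banach, second_countable_topology}"
  assumes "\<And>w. w \<in> words b \<Longrightarrow> set_borel_measurable lborel (eI w) (\<lambda>t. F (w, t))"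
  shows "F \<in> borel_measurable (tree_measure b)"
proof -
  let ?M = "count_space UNIV \<Otimes>\<^sub>M lborel :: tpoint measure"
  have ts: "tree b \<inter> space ?M \<in> sets ?M" using tree_sets by (simp add: space_pair_measure)
  have "(\<lambda>x. indicat_real (tree b) x *\<^sub>R F x) \<in> borel_measurable ?M"
    by (rule measurable_pair_measure_countable1[OF countableI_type section_measurable[OF assms]])
  then show ?thesis unfolding tree_measure_def using ts by (simp add: borel_measurable_restrict_space_iff)
qed

text \<open>Every finite set of edges lies among the words below some length, so \<open>K\<close>
  bounds all finite sums of edge norms; they are summable, and the converse of Fubini's theorem
  applies.\<close>

lemma tree_integrableI:
  fixes F :: "tpoint \<Rightarrow> 'a::{banach, second_countable_topology}"
  assumes F: "\<And>w. w \<in> words b \<Longrightarrow> set_integrable lborel (eI w) (\<lambda>t. F (w, t))"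
    and K: "\<And>N. (\<Sum>w\<in>words_lt b N. (LINT t:eI w|lborel. norm (F (w, t)))) \<le> K"
  shows "integrable (tree_measure b) F"
proof -
  let ?M = "count_space UNIV \<Otimes>\<^sub>M lborel :: tpoint measure"
  define G where "G x = indicat_real (tree b) x *\<^sub>R F x" for x
  have ts: "tree b \<inter> space ?M \<in> sets ?M" using tree_sets by (simp add: space_pair_measure)
  have Fm: "set_borel_measurable lborel (eI w) (\<lambda>t. F (w, t))" if "w \<in> words b" for w
    using F[OF that] by (auto simp: set_integrable_def set_borel_measurable_def)
  have Gm: "G \<in> borel_measurable ?M"
    unfolding G_def by (rule measurable_pair_measure_countable1[OF countableI_type section_measurable[OF Fm]])
  have Gsm: "(\<lambda>t. G (w, t)) \<in> borel_measurable lborel" for w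
    unfolding G_def by (rule section_measurable[OF Fm])
  have AEG: "AE t in lborel. G (w, t) = (if w \<in> words b then indicat_real (eI w) t *\<^sub>R F (w, t) else 0)" for w
    using AE_section[of b w] by eventually_elim (auto simp: G_def)
  have Gs: "integrable lborel (\<lambda>t. G (w, t))" for w
  proof (cases "w \<in> words b")
    case True
    show ?thesis
      by (rule integrable_cong_AE_imp[OF F[OF True, unfolded set_integrable_def] Gsm]) (use AEG[of w] True in auto)
  next
    case False
    show ?thesis
      by (rule integrable_cong_AE_imp[OF integrable_zero Gsm]) (use AEG[of w] False in auto)
  qed
  have LGs: "(LINT t|lborel. norm (G (w, t))) = (if w \<in> words b then LINT t:eI w|lborel. norm (F (w, t)) else 0)" for w
  proof (cases "w \<in> words b")
    case True
    have "(LINT t|lborel. norm (G (w, t))) = (LINT t|lborel. indicat_real (eI w) t *\<^sub>R norm (F (w, t)))"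
    proof (rule integral_cong_AE)
      show "AE t in lborel. norm (G (w, t)) = indicat_real (eI w) t *\<^sub>R norm (F (w, t))"
        using AEG[of w] by eventually_elim (use True in auto)
      show "(\<lambda>t. indicat_real (eI w) t *\<^sub>R norm (F (w, t))) \<in> borel_measurable lborel"
        using borel_measurable_integrable[OF set_integrable_norm[OF F[OF True], unfolded set_integrable_def]] .
    qed (use Gsm in simp)
    then show ?thesis using True by (simp add: set_lebesgue_integral_def)
  next
    case False
    have "AE t in lborel. norm (G (w, t)) = 0" using AEG[of w] by eventually_elim (use False in auto)
    from integral_eq_zero_AE[OF this] show ?thesis using False by simp
  qed
  have "(\<lambda>w. LINT t|lborel. norm (G (w, t))) summable_on UNIV"
  proof (rule nonneg_bdd_above_summable_on)
    show "bdd_above (sum (\<lambda>w. LINT t|lborel. norm (G (w, t))) ` {F. F \<subseteq> UNIV \<and> finite F})"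
    proof (rule bdd_aboveI2)
      fix W :: "nat list set" assume W: "W \<in> {F. F \<subseteq> UNIV \<and> finite F}"
      define N where "N = Suc (Max (insert 0 (length ` W)))"
      have "length w < N" if "w \<in> W" for w
        using W that unfolding N_def by (intro le_imp_less_Suc Max_ge) auto
      then have sub: "W \<inter> words b \<subseteq> words_lt b N" by (auto simp: words_lt_def)
      have "(\<Sum>w\<in>W. LINT t|lborel. norm (G (w, t))) = (\<Sum>w\<in>W \<inter> words b. LINT t:eI w|lborel. norm (F (w, t)))"
        using W unfolding LGs by (subst sum.inter_restrict) auto
      also have "\<dots> \<le> (\<Sum>w\<in>words_lt b N. LINT t:eI w|lborel. norm (F (w, t)))"
        by (intro sum_mono2 finite_words_lt sub) (auto simp: set_lebesgue_integral_def)
      also have "\<dots> \<le> K" by (rule K)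
      finally show "(\<Sum>w\<in>W. LINT t|lborel. norm (G (w, t))) \<le> K" .
    qed
  qed simp
  then have "Infinite_Sum.abs_summable_on (\<lambda>w. LINT t|lborel. norm (G (w, t))) UNIV"
    by (simp add: abs_of_nonneg)
  then have "integrable (count_space UNIV) (\<lambda>w. LINT t|lborel. norm (G (w, t)))"
    unfolding abs_summable_equivalent abs_summable_on_def .
  then have "integrable ?M G"
    by (rule count_lborel.Fubini_integrable[OF Gm]) (auto simp: AE_count_space Gs)
  then show ?thesis unfolding tree_measure_def G_def using ts by (simp add: integrable_restrict_space)
qed

lemma tree_integral_finite_support:
  fixes F :: "tpoint \<Rightarrow> 'a::{banach, second_countable_topology}"
  assumes F: "\<And>w. w \<in> S \<Longrightarrow> set_integrable lborel (eI w) (\<lambda>t. F (w, t))"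
    and S: "finite S" "S \<subseteq> words b"
    and z: "\<And>w. w \<in> words b - S \<Longrightarrow> AE t in lborel. t \<in> eI w \<longrightarrow> F (w, t) = 0"
    and Fm: "\<And>w. w \<in> words b - S \<Longrightarrow> set_borel_measurable lborel (eI w) (\<lambda>t. F (w, t))"
  shows "(LINT x|tree_measure b. F x) = (\<Sum>w\<in>S. (LINT t:eI w|lborel. F (w, t)))"
proof -
  have z': "AE t in lborel. indicat_real (eI w) t *\<^sub>R F (w, t) = 0" "AE t in lborel. indicat_real (eI w) t *\<^sub>R norm (F (w, t)) = 0"
    if "w \<in> words b - S" for w
    using z[OF that] by (eventually_elim, auto simp: indicator_def)+
  have i: "set_integrable lborel (eI w) (\<lambda>t. F (w, t))" if w: "w \<in> words b" for w
  proof (cases "w \<in> S")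
    case False
    then show ?thesis unfolding set_integrable_def
      by (intro integrable_cong_AE_imp[OF integrable_zero Fm[unfolded set_borel_measurable_def]])
        (use w z'(1)[of w] in auto)
  qed (rule F)
  have l0: "(LINT t:eI w|lborel. F (w, t)) = 0" "(LINT t:eI w|lborel. norm (F (w, t))) = 0" if "w \<in> words b - S" for w
    unfolding set_lebesgue_integral_def using z'[OF that] by (simp_all only: integral_eq_zero_AE)
  have "integrable (tree_measure b) F"
  proof (rule tree_integrableI[OF i])
    fix N
    have "(\<Sum>w\<in>words_lt b N. (LINT t:eI w|lborel. norm (F (w, t)))) = (\<Sum>w\<in>words_lt b N \<inter> S. (LINT t:eI w|lborel. norm (F (w, t))))"
      by (intro sum.mono_neutral_right finite_words_lt) (auto simp: words_lt_def intro!: l0(2))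
    also have "\<dots> \<le> (\<Sum>w\<in>S. (LINT t:eI w|lborel. norm (F (w, t))))"
      using S by (intro sum_mono2) (auto simp: set_lebesgue_integral_def)
    finally show "(\<Sum>w\<in>words_lt b N. (LINT t:eI w|lborel. norm (F (w, t)))) \<le> (\<Sum>w\<in>S. (LINT t:eI w|lborel. norm (F (w, t))))" .
  qed
  from tree_integral(2)[OF this]
  have L: "(\<lambda>N. \<Sum>w\<in>words_lt b N. (LINT t:eI w|lborel. F (w, t))) \<longlonglongrightarrow> (LINT x|tree_measure b. F x)" .
  obtain N0 where N0: "\<And>w. w \<in> S \<Longrightarrow> length w < N0"
    using finite_imageI[OF S(1), of length] by (metis finite_nat_set_iff_bounded imageI)
  have "\<forall>\<^sub>F N in sequentially. (\<Sum>w\<in>words_lt b N. (LINT t:eI w|lborel. F (w, t))) = (\<Sum>w\<in>S. (LINT t:eI w|lborel. F (w, t)))"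
    unfolding eventually_sequentially
  proof (intro exI[of _ N0] allI impI sum.mono_neutral_right finite_words_lt)
    fix N assume "N0 \<le> N"
    then show "S \<subseteq> words_lt b N" using N0 S(2) by (force simp: words_lt_def)
  qed (auto simp: words_lt_def intro!: l0(1))
  then have "(\<lambda>N. \<Sum>w\<in>words_lt b N. (LINT t:eI w|lborel. F (w, t))) \<longlonglongrightarrow> (\<Sum>w\<in>S. (LINT t:eI w|lborel. F (w, t)))"
    by (rule tendsto_eventually)
  with L show ?thesis by (rule LIMSEQ_unique)
qed

text \<open>The lower end of an edge is stored as the upper end of its predecessor.\<close>

definition parent_vertex :: "nat list \<Rightarrow> tpoint" where
  "parent_vertex w = (if w = [] then tree_root else (butlast w, real (length w)))"

text \<open>Closes an edge at its lower end by substituting the stored representative of that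
  vertex; on the closed edge this is an isometry.\<close>

definition edge_path :: "nat list \<Rightarrow> real \<Rightarrow> tpoint" where
  "edge_path w t = (if t \<le> real (length w) then parent_vertex w else (w, t))"

lemma lcp_prefix: "prefix p w \<Longrightarrow> longest_common_prefix p w = p"
  by (meson longest_common_prefix_max_prefix longest_common_prefix_prefix1 prefix_order.dual_order.antisym prefix_order.order_refl)

lemma parent_vertex_tree: "w \<in> words b \<Longrightarrow> parent_vertex w \<in> tree b"
  by (cases w rule: rev_cases) (auto simp: parent_vertex_def tree_root_def mem_tree words_snoc)

lemma edge_path_tree: "w \<in> words b \<Longrightarrow> t \<le> real (length w) + 1 \<Longrightarrow> edge_path w t \<in> tree b"
  by (simp add: edge_path_def parent_vertex_tree mem_tree)

lemma tree_dist_commute: "x \<in> tree b \<Longrightarrow> y \<in> tree b \<Longrightarrow> tree_dist x y = tree_dist y x"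
  by (rule Metric_space.commute[OF Metric_space_tree])

lemma tree_dist_parent:
  assumes "w \<in> words b" "real (length w) < t" "t \<le> real (length w) + 1"
  shows "tree_dist (parent_vertex w) (w, t) = t - real (length w)"
proof (cases w rule: rev_cases)
  case Nil
  then show ?thesis using assms by (simp add: parent_vertex_def tree_root_def tree_dist_def)
next
  case (snoc v j)
  have "longest_common_prefix v (v @ [j]) = v" by (rule lcp_prefix) simp
  then show ?thesis using assms snoc by (simp add: parent_vertex_def tree_dist_def)
qed

lemma edge_path_dist:
  assumes w: "w \<in> words b" and s: "s \<in> cI w" and t: "t \<in> cI w"
  shows "tree_dist (edge_path w s) (edge_path w t) = \<bar>s - t\<bar>"
proof -
  have lcp: "longest_common_prefix w w = w" by (rule lcp_prefix) simp
  have pp: "tree_dist (parent_vertex w) (parent_vertex w) = 0"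
    using Metric_space.mdist_zero[OF Metric_space_tree parent_vertex_tree[OF w]] .
  show ?thesis
  proof (cases "s \<le> real (length w)"; cases "t \<le> real (length w)")
    assume "s \<le> real (length w)" "t \<le> real (length w)"
    then show ?thesis using s t pp by (simp add: edge_path_def)
  next
    assume "s \<le> real (length w)" "\<not> t \<le> real (length w)"
    then show ?thesis using s t tree_dist_parent[OF w, of t] by (simp add: edge_path_def)
  next
    assume a: "\<not> s \<le> real (length w)" "t \<le> real (length w)"
    then have "(w, s) \<in> tree b" using s w by (simp add: mem_tree)
    then show ?thesis using a s t tree_dist_parent[OF w, of s] tree_dist_commute[OF _ parent_vertex_tree[OF w]]
      by (simp add: edge_path_def)
  next
    assume "\<not> s \<le> real (length w)" "\<not> t \<le> real (length w)"
    then show ?thesis using s t by (auto simp: edge_path_def tree_dist_def lcp min_def)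
  qed
qed

section \<open>Continuity on the tree and along its edges\<close>

lemma tree_continuous_iff_eps:
  fixes u :: "tpoint \<Rightarrow> complex"
  shows "continuous_map (Metric_space.mtopology (tree b) tree_dist) euclidean u \<longleftrightarrow>
    (\<forall>x\<in>tree b. \<forall>e>0. \<exists>r>0. \<forall>y\<in>tree b. tree_dist x y < r \<longrightarrow> dist (u y) (u x) < e)"
proof -
  interpret Metric_space "tree b" tree_dist by (rule Metric_space_tree)
  show ?thesis
  proof
    assume c: "continuous_map mtopology euclidean u"
    show "\<forall>x\<in>tree b. \<forall>e>0. \<exists>r>0. \<forall>y\<in>tree b. tree_dist x y < r \<longrightarrow> dist (u y) (u x) < e"
    proof (intro ballI allI impI)
      fix x and e :: real assume x: "x \<in> tree b" and e: "0 < e"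
      have "openin mtopology {y \<in> topspace mtopology. u y \<in> ball (u x) e}"
        by (rule openin_continuous_map_preimage[OF c]) simp
      moreover have "x \<in> {y \<in> topspace mtopology. u y \<in> ball (u x) e}" using x e by simp
      ultimately obtain r where "r > 0" "mball x r \<subseteq> {y \<in> topspace mtopology. u y \<in> ball (u x) e}"
        unfolding openin_mtopology by blast
      then show "\<exists>r>0. \<forall>y\<in>tree b. tree_dist x y < r \<longrightarrow> dist (u y) (u x) < e"
        using x by (intro exI[of _ r]) (auto simp: subset_iff dist_commute)
    qed
  next
    assume e: "\<forall>x\<in>tree b. \<forall>e>0. \<exists>r>0. \<forall>y\<in>tree b. tree_dist x y < r \<longrightarrow> dist (u y) (u x) < e"
    show "continuous_map mtopology euclidean u"
      unfolding continuous_map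
    proof (intro conjI allI impI)
      fix U :: "complex set" assume "openin euclidean U"
      then have U: "open U" by simp
      show "openin mtopology {x \<in> topspace mtopology. u x \<in> U}"
        unfolding openin_mtopology
      proof (intro conjI allI impI)
        fix x assume x: "x \<in> {x \<in> topspace mtopology. u x \<in> U}"
        then obtain d where d: "d > 0" "ball (u x) d \<subseteq> U" using U open_contains_ball by blast
        obtain r where r: "r > 0" "\<And>y. y \<in> tree b \<Longrightarrow> tree_dist x y < r \<Longrightarrow> dist (u y) (u x) < d"
          using e x d(1) by (metis (no_types, lifting) mem_Collect_eq topspace_mtopology)
        show "\<exists>r>0. mball x r \<subseteq> {x \<in> topspace mtopology. u x \<in> U}"
          using r d(2) by (intro exI[of _ r]) (auto simp: subset_iff dist_commute)
      qed auto
    qed auto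
  qed
qed

lemma tree_continuous_imp_edge:
  fixes u :: "tpoint \<Rightarrow> complex"
  assumes c: "continuous_map (Metric_space.mtopology (tree b) tree_dist) euclidean u" and w: "w \<in> words b"
  shows "continuous_on (cI w) (\<lambda>t. u (edge_path w t))"
  unfolding continuous_on_iff
proof (intro ballI allI impI)
  fix s and e :: real assume s: "s \<in> cI w" and e: "0 < e"
  have "edge_path w s \<in> tree b" using edge_path_tree[OF w] s by simp
  then obtain r where r: "r > 0" "\<And>y. y \<in> tree b \<Longrightarrow> tree_dist (edge_path w s) y < r \<Longrightarrow> dist (u y) (u (edge_path w s)) < e"
    using c e unfolding tree_continuous_iff_eps by blast
  show "\<exists>d>0. \<forall>t\<in>cI w. dist t s < d \<longrightarrow> dist (u (edge_path w t)) (u (edge_path w s)) < e"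
  proof (intro exI[of _ r] conjI ballI impI r(1))
    fix t assume t: "t \<in> cI w" "dist t s < r"
    show "dist (u (edge_path w t)) (u (edge_path w s)) < e"
      using t edge_path_dist[OF w s t(1)] edge_path_tree[OF w] by (intro r(2)) (auto simp: dist_real_def abs_minus_commute)
  qed
qed

text \<open>Localises continuity: a ball that does not reach the lower end of the edge meets this
  edge and the edges starting at its upper end, and distances there are differences of
  heights.\<close>

lemma tree_dist_near:
  assumes x: "w \<in> words b" "real (length w) < s" "s \<le> real (length w) + 1"
    and y: "(v, \<tau>) \<in> tree b" and d: "tree_dist (w, s) (v, \<tau>) < s - real (length w)"
  shows "tree_dist (w, s) (v, \<tau>) = \<bar>s - \<tau>\<bar> \<and> (v = w \<or> s < \<tau> \<and> real (length w) + 1 < \<tau> \<and> (length v = Suc (length w) \<and> butlast v = w))"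
proof -
  define m where "m = length (longest_common_prefix w v)"
  have ml: "m \<le> length w" "m \<le> length v" using length_lcp_le[of w v] by (auto simp: m_def)
  have dist: "tree_dist (w, s) (v, \<tau>) = s + \<tau> - 2 * min (min s \<tau>) (real m + 1)"
    by (simp add: tree_dist_def m_def)
  have \<tau>: "0 \<le> \<tau>" using tree_snd[OF y] by simp
  have root: "\<not> (v = [] \<and> \<tau> = 0)"
  proof
    assume "v = [] \<and> \<tau> = 0"
    then have "tree_dist (w, s) (v, \<tau>) = s" using x dist by simp
    then show False using d by simp
  qed
  then have v: "v \<in> words b" "real (length v) < \<tau>" "\<tau> \<le> real (length v) + 1" using y by (auto simp: mem_tree)
  \<comment> \<open>Otherwise the geodesics would separate at height \<open>m + 1\<close>, strictly
    below both points. Since the distance does not reach the lower end of the edge, this forces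
    \<open>m = length w\<close>, and then \<open>m + 1\<close> is not below
    \<open>s\<close>.\<close>
  have full: "min s \<tau> \<le> real m + 1"
  proof (rule ccontr)
    assume a: "\<not> min s \<tau> \<le> real m + 1"
    then have "min (min s \<tau>) (real m + 1) = real m + 1" by linarith
    then have "tree_dist (w, s) (v, \<tau>) = s + \<tau> - 2 * (real m + 1)" unfolding dist by simp
    then have "real m + 1 > real (length w)" using d a by auto
    then have "m = length w" using ml by linarith
    then show False using a x by auto
  qed
  then have d': "tree_dist (w, s) (v, \<tau>) = \<bar>s - \<tau>\<bar>" unfolding dist by (simp add: min_def abs_if split: if_splits)
  have mw: "m = length w"
  proof (rule ccontr)
    assume "m \<noteq> length w"
    then have "real m + 1 \<le> real (length w)" using ml by linarith
    then have "\<tau> \<le> real (length w)" using full x by (auto simp: min_def split: if_splits)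
    then show False using d d' by auto
  qed
  have lw: "longest_common_prefix w v = w"
  proof -
    obtain zs where zs: "w = longest_common_prefix w v @ zs" using longest_common_prefix_prefix1[of w v] by (auto simp: prefix_def)
    have "length w = m + length zs" using arg_cong[OF zs, of length] by (simp add: m_def)
    then show ?thesis using zs mw by simp
  qed
  then have pre: "prefix w v" by (metis longest_common_prefix_prefix2)
  show ?thesis
  proof (cases "v = w")
    case False
    then obtain j z where z: "v = w @ j # z" using pre by (metis append_Nil2 neq_Nil_conv prefix_def)
    then have lv: "real (length w) + 1 \<le> real (length v)" by simp
    then have t: "s < \<tau>" "real (length w) + 1 < \<tau>" using v x by linarith+
    have "\<tau> < s + (s - real (length w))" using d d' t by linarith
    then have "\<tau> < real (length w) + 2" using x by linarith
    then have "length v < length w + 2" using v by linarith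
    then have "z = []" using z by (cases z) auto
    then show ?thesis using d' t z by auto
  qed (use d' in auto)
qed

text \<open>The radii found on the separate edges can be combined because only finitely many
  branches start at a vertex.\<close>

lemma edge_imp_tree_continuous:
  fixes u :: "tpoint \<Rightarrow> complex"
  assumes c: "\<And>w. w \<in> words b \<Longrightarrow> continuous_on (cI w) (\<lambda>t. u (edge_path w t))"
  shows "continuous_map (Metric_space.mtopology (tree b) tree_dist) euclidean u"
  unfolding tree_continuous_iff_eps
proof (intro ballI allI impI)
  fix x and e :: real assume x: "x \<in> tree b" and e: "0 < e"
  have loc: "\<exists>d>0. \<forall>t. t \<in> cI w \<longrightarrow> \<bar>t - s\<bar> < d \<longrightarrow> dist (u (edge_path w t)) (u (edge_path w s)) < e"
    if "w \<in> words b" "s \<in> cI w" for w s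
    using c[OF that(1)] that(2) e unfolding continuous_on_iff dist_real_def by blast
  obtain w s where ws: "x = (w, s)" by fastforce
  show "\<exists>r>0. \<forall>y\<in>tree b. tree_dist x y < r \<longrightarrow> dist (u y) (u x) < e"
  proof (cases "w = [] \<and> s = 0")
    case True
    obtain d where d: "d > 0" "\<And>t. t \<in> {0..1} \<Longrightarrow> \<bar>t\<bar> < d \<Longrightarrow> dist (u (edge_path [] t)) (u x) < e"
      using loc[OF words_Nil, of 0] True ws by (auto simp: edge_path_def parent_vertex_def tree_root_def)
    show ?thesis
    proof (intro exI[of _ "min d 1"] conjI ballI impI)
      fix y assume y: "y \<in> tree b" "tree_dist x y < min d 1"
      obtain v \<tau> where vt: "y = (v, \<tau>)" by fastforce
      have t0: "0 \<le> \<tau>" using tree_snd[OF y(1)] vt by simp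
      then have "tree_dist x y = \<tau>" using True ws vt by (simp add: tree_dist_def)
      then have t: "\<tau> < d" "\<tau> < 1" using y by auto
      have "v = []"
      proof (rule ccontr)
        assume "v \<noteq> []"
        then have "real (length v) \<ge> 1" "real (length v) < \<tau>" using y(1) vt by (cases v; auto simp: mem_tree)+
        then show False using t by linarith
      qed
      then have "edge_path [] \<tau> = y" using y(1) vt by (auto simp: edge_path_def parent_vertex_def tree_root_def mem_tree)
      then show "dist (u y) (u x) < e" using d(2)[of \<tau>] t t0 by auto
    qed (use d in auto)
  next
    case False
    then have w: "w \<in> words b" "real (length w) < s" "s \<le> real (length w) + 1" using x ws by (auto simp: mem_tree)
    obtain d where d: "d > 0" "\<And>t. t \<in> cI w \<Longrightarrow> \<bar>t - s\<bar> < d \<Longrightarrow> dist (u (edge_path w t)) (u (edge_path w s)) < e"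
      using loc[OF w(1), of s] w by auto
    have same: "dist (u (w, \<tau>)) (u x) < e" if "real (length w) < \<tau>" "\<tau> \<le> real (length w) + 1" "\<bar>\<tau> - s\<bar> < d" for \<tau>
      using d(2)[of \<tau>] that w ws by (simp add: edge_path_def)
    show ?thesis
    proof (cases "s = real (length w) + 1")
      case False
      let ?r = "min d (min (s - real (length w)) (real (length w) + 1 - s))"
      show ?thesis
      proof (intro exI[of _ ?r] conjI ballI impI)
        fix y assume y: "y \<in> tree b" "tree_dist x y < ?r"
        obtain v \<tau> where vt: "y = (v, \<tau>)" by fastforce
        have n: "tree_dist (w, s) (v, \<tau>) = \<bar>s - \<tau>\<bar> \<and> (v = w \<or> s < \<tau> \<and> real (length w) + 1 < \<tau> \<and> (length v = Suc (length w) \<and> butlast v = w))"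
          using y vt ws by (intro tree_dist_near[OF w]) auto
        have r1: "tree_dist (w, s) (v, \<tau>) < real (length w) + 1 - s" "tree_dist (w, s) (v, \<tau>) < d"
          using y(2) vt ws by simp_all
        have "v = w"
        proof (rule ccontr)
          assume "v \<noteq> w"
          then have "s < \<tau>" "real (length w) + 1 < \<tau>" using n by auto
          then show False using n r1 by linarith
        qed
        have "real (length w) < \<tau> \<and> \<tau> \<le> real (length w) + 1"
        proof -
          have "\<bar>s - \<tau>\<bar> < s - real (length w)" using n y(2) ws vt by simp
          then have "real (length w) < \<tau>" by linarith
          then show ?thesis using y(1) vt \<open>v = w\<close> by (auto simp: mem_tree)
        qed
        moreover have "\<bar>\<tau> - s\<bar> < d" using n r1 by linarith
        ultimately show "dist (u y) (u x) < e" using same[of \<tau>] vt \<open>v = w\<close> by simp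
      qed (use d w False in auto)
    next
      case True
      have "\<exists>d>0. \<forall>t. t \<in> {real (length w) + 1..real (length w) + 2} \<longrightarrow> \<bar>t - s\<bar> < d \<longrightarrow> dist (u (edge_path (w @ [j]) t)) (u x) < e" if "j < b" for j
        using loc[of "w @ [j]" s] that w True ws
        by (auto simp: words_snoc edge_path_def parent_vertex_def add.commute add.left_commute)
      then obtain dj where dj: "\<And>j. j < b \<Longrightarrow> dj j > 0"
        "\<And>j t. j < b \<Longrightarrow> t \<in> {real (length w) + 1..real (length w) + 2} \<Longrightarrow> \<bar>t - s\<bar> < dj j \<Longrightarrow> dist (u (edge_path (w @ [j]) t)) (u x) < e"
        by metis
      define r where "r = Min (insert (min d 1) (dj ` {..<b}))"
      have r: "0 < r" "\<And>j. j < b \<Longrightarrow> r \<le> dj j" using d(1) dj(1) by (auto simp: r_def)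
      have "r \<le> min d 1" unfolding r_def by (rule Min_le) auto
      note r = r(1) this r(2)
      show ?thesis
      proof (intro exI[of _ r] conjI ballI impI r(1))
        fix y assume y: "y \<in> tree b" "tree_dist x y < r"
        obtain v \<tau> where vt: "y = (v, \<tau>)" by fastforce
        have n: "tree_dist (w, s) (v, \<tau>) = \<bar>s - \<tau>\<bar> \<and> (v = w \<or> s < \<tau> \<and> real (length w) + 1 < \<tau> \<and> (length v = Suc (length w) \<and> butlast v = w))"
          using y vt ws True r(2) by (intro tree_dist_near[OF w]) auto
        show "dist (u y) (u x) < e"
        proof (cases "v = w")
          case vw: True
          have "real (length w) < \<tau> \<and> \<tau> \<le> real (length w) + 1"
          proof -
            have "\<bar>s - \<tau>\<bar> < s - real (length w)" using n y(2) ws vt r(2) True by simp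
            then have "real (length w) < \<tau>" by linarith
            then show ?thesis using y(1) vt vw by (auto simp: mem_tree)
          qed
          then show ?thesis using same[of \<tau>] n y vt ws vw r(2) by auto
        next
          case False
          then have v: "s < \<tau>" "real (length w) + 1 < \<tau>" "length v = Suc (length w)" "butlast v = w" using n by auto
          define j where "j = last v"
          have vj: "v = w @ [j]" using v(3,4) by (metis j_def append_butlast_last_id length_0_conv nat.distinct(1))
          have jb: "j < b" "\<tau> \<le> real (length w) + 2" using y(1) vt vj by (auto simp: mem_tree words_snoc)
          have "dist (u (edge_path (w @ [j]) \<tau>)) (u x) < e"
            using jb v n y(2) vt ws r(3)[OF jb(1)] by (intro dj(2)) auto
          then show ?thesis using v vj vt by (simp add: edge_path_def)
        qed
      qed
    qed
  qed
qed

section \<open>Sobolev functions on the tree\<close>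

definition level :: "nat \<Rightarrow> nat \<Rightarrow> nat list set" where "level b n = {w \<in> words b. length w = n}"

lemma finite_level: "finite (level b n)"
  by (rule finite_subset[OF _ finite_words_lt[of b "Suc n"]]) (auto simp: level_def words_lt_def)

lemma card_level: "card (level b n) = b ^ n"
  using card_lists_length_eq[of "{..<b}" n] by (simp add: level_def words_def)

lemma level_0: "level b 0 = {[]}" by (auto simp: level_def words_Nil)

lemma words_lt_Suc: "words_lt b (Suc n) = words_lt b n \<union> level b n" "words_lt b n \<inter> level b n = {}"
  by (auto simp: words_lt_def level_def)

lemma sum_words_lt_Suc: "(\<Sum>w\<in>words_lt b (Suc n). f w) = (\<Sum>w\<in>words_lt b n. f w) + (\<Sum>w\<in>level b n. f w)"
  unfolding words_lt_Suc(1) by (rule sum.union_disjoint[OF finite_words_lt finite_level words_lt_Suc(2)])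

lemma sum_words_lt: "(\<Sum>w\<in>words_lt b N. f w) = (\<Sum>n<N. \<Sum>w\<in>level b n. f w)"
  by (induction N) (simp_all add: sum_words_lt_Suc, simp add: words_lt_def)

lemma sum_level_Suc: "(\<Sum>w\<in>level b (Suc n). f w) = (\<Sum>w\<in>level b n. \<Sum>j<b. f (w @ [j]))"
proof -
  have "(\<Sum>w\<in>level b n. \<Sum>j<b. f (w @ [j])) = (\<Sum>(w, j)\<in>level b n \<times> {..<b}. f (w @ [j]))"
    by (rule sum.cartesian_product)
  also have "\<dots> = (\<Sum>w\<in>level b (Suc n). f w)"
  proof (rule sum.reindex_bij_witness[where i = "\<lambda>w. (butlast w, last w)" and j = "\<lambda>(w, j). w @ [j]"])
    fix w assume "w \<in> level b (Suc n)"
    then obtain v j where "w = v @ [j]" "v @ [j] \<in> words b" "length v = n"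
      by (cases w rule: rev_cases) (auto simp: level_def)
    then show "(butlast w, last w) \<in> level b n \<times> {..<b}" "(case (butlast w, last w) of (w, j) \<Rightarrow> w @ [j]) = w"
      by (auto simp: level_def words_snoc)
  qed (auto simp: level_def words_snoc)
  finally show ?thesis by simp
qed

lemma tree_deriv_weakI:
  assumes "has_weak_derivative (length w) (real (length w) + 1) (\<lambda>s. u (w, s)) d"
  shows "has_weak_derivative (length w) (real (length w) + 1) (\<lambda>s. u (w, s)) (\<lambda>t. tree_deriv u (w, t))"
proof -
  define P where "P = has_weak_derivative (length w) (real (length w) + 1) (\<lambda>s. u (w, s))"
  have "P d" using assms by (simp only: P_def)
  then have "P (SOME v. P v)" by (rule someI[of P d])
  moreover have "(\<lambda>t. tree_deriv u (w, t)) = (SOME v. P v)" by (simp add: tree_deriv_def P_def)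
  ultimately show ?thesis by (simp only: P_def)
qed

lemma tree_deriv_weak:
  assumes "u \<in> tree_H10 b" "w \<in> words b"
  shows "has_weak_derivative (length w) (real (length w) + 1) (\<lambda>s. u (w, s)) (\<lambda>t. tree_deriv u (w, t))"
proof -
  have "(\<lambda>t. u (w, t)) \<in> H1_interval (length w) (real (length w) + 1)"
    using assms by (auto simp: tree_H10_def words_def)
  then obtain d where "has_weak_derivative (length w) (real (length w) + 1) (\<lambda>s. u (w, s)) d"
    by (auto simp: H1_interval_def)
  then show ?thesis by (rule tree_deriv_weakI)
qed

lemma tree_H10_continuous:
  assumes "u \<in> tree_H10 b" "w \<in> words b"
  shows "continuous_on (cI w) (\<lambda>t. u (edge_path w t))"
  using assms by (intro tree_continuous_imp_edge) (auto simp: tree_H10_def)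

lemma edge_path_eI: "t \<in> eI w \<Longrightarrow> edge_path w t = (w, t)"
  by (simp add: eI_def edge_path_def)

lemma tree_H10_energy:
  assumes "u \<in> tree_H10 b"
  shows "integrable (tree_measure b) (\<lambda>x. (cmod (tree_deriv u x))\<^sup>2 + (cmod (u x))\<^sup>2)"
  using assms by (simp add: tree_H10_def)

lemma tree_H10_sections:
  assumes "u \<in> tree_H10 b" "w \<in> words b"
  shows "set_borel_measurable lborel (eI w) (\<lambda>t. u (w, t))" "set_borel_measurable lborel (eI w) (\<lambda>t. tree_deriv u (w, t))"
    "set_integrable lborel (eI w) (\<lambda>t. (cmod (tree_deriv u (w, t)))\<^sup>2 + (cmod (u (w, t)))\<^sup>2)"
    "set_integrable lborel (eI w) (\<lambda>t. tree_deriv u (w, t))" "set_integrable lborel (eI w) (\<lambda>t. u (w, t))"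
proof -
  have H: "(\<lambda>t. u (w, t)) \<in> H1_interval (length w) (real (length w) + 1)"
    using assms by (auto simp: tree_H10_def words_def)
  then have s: "square_integrable_on_interval (length w) (real (length w) + 1) (\<lambda>t. u (w, t))"
    by (simp add: H1_interval_def)
  have s': "square_integrable_on_interval (length w) (real (length w) + 1) (\<lambda>t. tree_deriv u (w, t))"
    using tree_deriv_weak[OF assms] by (simp add: has_weak_derivative_def)
  show "set_borel_measurable lborel (eI w) (\<lambda>t. u (w, t))" "set_borel_measurable lborel (eI w) (\<lambda>t. tree_deriv u (w, t))"
    using s s' by (simp_all add: square_integrable_on_interval_def eI_def)
  show "set_integrable lborel (eI w) (\<lambda>t. tree_deriv u (w, t))" "set_integrable lborel (eI w) (\<lambda>t. u (w, t))"
    using square_integrable_imp_integrable[OF s'] square_integrable_imp_integrable[OF s] by (simp_all add: eI_def)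
  show "set_integrable lborel (eI w) (\<lambda>t. (cmod (tree_deriv u (w, t)))\<^sup>2 + (cmod (u (w, t)))\<^sup>2)"
    by (rule tree_integral(1)[OF tree_H10_energy[OF assms(1)] assms(2)])
qed

lemma tree_H10_measurable:
  assumes "u \<in> tree_H10 b"
  shows "u \<in> borel_measurable (tree_measure b)" "tree_deriv u \<in> borel_measurable (tree_measure b)"
  using tree_H10_sections[OF assms] by (auto intro: tree_borel_measurableI)

lemma norm_mult_le_squares: "norm (a * cnj c) \<le> (cmod a)\<^sup>2 + (cmod c)\<^sup>2"
proof -
  have "2 * cmod a * cmod c \<le> (cmod a)\<^sup>2 + (cmod c)\<^sup>2" by (rule sum_squares_bound)
  moreover have "0 \<le> cmod a * cmod c" by simp
  ultimately show ?thesis unfolding norm_mult complex_mod_cnj by linarith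
qed

lemma borel_measurable_cnj [measurable]:
  "f \<in> borel_measurable M \<Longrightarrow> (\<lambda>x. cnj (f x)) \<in> borel_measurable M"
  by (rule borel_measurable_continuous_on[where f=cnj]) (intro continuous_intros)

lemma tree_product_integrable:
  assumes u: "u \<in> tree_H10 b" and h: "h \<in> tree_H10 b"
    and V: "continuous_on {0<..} V" "\<And>t. t > 0 \<Longrightarrow> \<bar>V t\<bar> \<le> M"
  shows "integrable (tree_measure b) (\<lambda>x. tree_deriv u x * cnj (tree_deriv h x))"
    "integrable (tree_measure b) (\<lambda>x. of_real (V (height x)) * u x * cnj (h x))"
proof -
  let ?e = "\<lambda>x. ((cmod (tree_deriv u x))\<^sup>2 + (cmod (u x))\<^sup>2) + ((cmod (tree_deriv h x))\<^sup>2 + (cmod (h x))\<^sup>2)"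
  have e: "integrable (tree_measure b) ?e"
    by (intro Bochner_Integration.integrable_add tree_H10_energy u h)
  note [measurable] = tree_H10_measurable[OF u] tree_H10_measurable[OF h]
  show "integrable (tree_measure b) (\<lambda>x. tree_deriv u x * cnj (tree_deriv h x))"
  proof (rule Bochner_Integration.integrable_bound[OF e])
    show "AE x in tree_measure b. norm (tree_deriv u x * cnj (tree_deriv h x)) \<le> norm (?e x)"
    proof (rule AE_I2)
      fix x
      have "norm (tree_deriv u x * cnj (tree_deriv h x)) \<le> ?e x"
        using norm_mult_le_squares[of "tree_deriv u x" "tree_deriv h x"] zero_le_power2[of "cmod (u x)"] zero_le_power2[of "cmod (h x)"]
        by linarith
      then show "norm (tree_deriv u x * cnj (tree_deriv h x)) \<le> norm (?e x)" by simp
    qed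
  qed measurable
  have VM[measurable]: "(\<lambda>x. V (height x)) \<in> borel_measurable (tree_measure b)"
  proof (rule tree_borel_measurableI)
    fix w assume w: "w \<in> words b"
    have sub: "eI w \<subseteq> {0<..}" by (auto simp: eI_def)
    have "indicat_real (eI w) t *\<^sub>R V t = indicat_real (eI w) t *\<^sub>R V (height (w, t))" for t
      using height_eq[of "(w, t)" b] w by (auto simp: indicator_def eI_def mem_tree)
    then have eq: "(\<lambda>t. indicat_real (eI w) t *\<^sub>R V t) = (\<lambda>t. indicat_real (eI w) t *\<^sub>R V (height (w, t)))" by (rule ext)
    show "set_borel_measurable lborel (eI w) (\<lambda>t. V (height (w, t)))"
      unfolding set_borel_measurable_def eq[symmetric] measurable_lborel2
      by (rule borel_measurable_continuous_on_indicator[OF eI_borel continuous_on_subset[OF V(1) sub]])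
  qed
  show "integrable (tree_measure b) (\<lambda>x. of_real (V (height x)) * u x * cnj (h x))"
  proof (rule Bochner_Integration.integrable_bound[OF integrable_scaleR_right[OF e, of "\<bar>M\<bar>"]])
    show "AE x in tree_measure b. norm (of_real (V (height x)) * u x * cnj (h x)) \<le> norm (\<bar>M\<bar> *\<^sub>R ?e x)"
    proof (rule AE_I2)
      fix x assume "x \<in> space (tree_measure b)"
      then have x: "x \<in> tree b" using tree_sets by (simp add: tree_measure_def space_restrict_space)
      show "norm (of_real (V (height x)) * u x * cnj (h x)) \<le> norm (\<bar>M\<bar> *\<^sub>R ?e x)"
      proof (cases "snd x = 0")
        case True
        then have "x = tree_root" using x by (cases x) (auto simp: mem_tree tree_root_def)
        then show ?thesis using u by (simp add: tree_H10_def)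
      next
        case False
        then have "height x > 0" using height_eq[OF x] tree_snd[OF x] by simp
        then have VM': "\<bar>V (height x)\<bar> \<le> \<bar>M\<bar>" using V(2)[of "height x"] by linarith
        have "norm (u x * cnj (h x)) \<le> ?e x"
          using norm_mult_le_squares[of "u x" "h x"] zero_le_power2[of "cmod (tree_deriv u x)"] zero_le_power2[of "cmod (tree_deriv h x)"]
          by linarith
        then have "\<bar>V (height x)\<bar> * norm (u x * cnj (h x)) \<le> \<bar>M\<bar> * ?e x" using VM' by (intro mult_mono) auto
        then show ?thesis by (simp add: norm_mult abs_mult mult.assoc)
      qed
    qed
  qed measurable
qed

text \<open>The generations are the terms of a convergent series. This is the form in which square
  integrability removes boundary terms at great height.\<close>

lemma level_energy_tendsto_0:
  assumes "u \<in> tree_H10 b"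
  shows "(\<lambda>n. \<Sum>w\<in>level b n. (LINT t:eI w|lborel. (cmod (tree_deriv u (w, t)))\<^sup>2 + (cmod (u (w, t)))\<^sup>2)) \<longlonglongrightarrow> 0"
proof -
  let ?S = "\<lambda>N. \<Sum>w\<in>words_lt b N. (LINT t:eI w|lborel. (cmod (tree_deriv u (w, t)))\<^sup>2 + (cmod (u (w, t)))\<^sup>2)"
  let ?L = "LINT x|tree_measure b. (cmod (tree_deriv u x))\<^sup>2 + (cmod (u x))\<^sup>2"
  have S: "?S \<longlonglongrightarrow> ?L" by (rule tree_integral(2)[OF tree_H10_energy[OF assms]])
  have "(\<lambda>n. ?S (Suc n) - ?S n) \<longlonglongrightarrow> ?L - ?L" by (intro tendsto_diff LIMSEQ_Suc S)
  then show ?thesis by (simp add: sum_words_lt_Suc)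
qed

text \<open>A trace estimate: integration by parts against \<open>t - k\<close>, which is 0 at the
  lower end of the edge and 1 at the upper end.\<close>

lemma edge_end_value_bound:
  assumes u: "u \<in> tree_H10 b" and w: "w \<in> words b"
  shows "norm (u (w, real (length w) + 1)) \<le> (LINT t:eI w|lborel. cmod (tree_deriv u (w, t)) + cmod (u (w, t)))"
proof -
  let ?k = "real (length w)"
  let ?f = "\<lambda>t. u (edge_path w t)"
  note sec = tree_H10_sections[OF u w]
  have i1: "set_integrable lborel (eI w) (\<lambda>t. cmod (tree_deriv u (w, t)))" "set_integrable lborel (eI w) (\<lambda>t. cmod (u (w, t)))"
    using sec(4,5) by (auto intro: set_integrable_norm)
  have fi: "set_integrable lborel (eI w) ?f"
    unfolding eI_def by (rule set_integrable_continuous_Ioo[OF tree_H10_continuous[OF u w]])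
  have "(LINT t:{?k<..<?k+1}|lborel. tree_deriv u (w, t) * of_real (t - ?k))
     = ?f (?k + 1) * of_real (?k + 1 - ?k) - ?f ?k * of_real (?k - ?k) - (LINT t:{?k<..<?k+1}|lborel. ?f t * of_real 1)"
    by (rule weak_integration_by_parts[OF tree_deriv_weak[OF u w] tree_H10_continuous[OF u w]])
      (auto intro!: derivative_eq_intros simp: edge_path_def)
  then have "u (w, ?k + 1) = (LINT t:eI w|lborel. tree_deriv u (w, t) * of_real (t - ?k)) + (LINT t:eI w|lborel. ?f t)"
    by (simp add: eI_def edge_path_def)
  also have "norm \<dots> \<le> norm (LINT t:eI w|lborel. tree_deriv u (w, t) * of_real (t - ?k)) + norm (LINT t:eI w|lborel. ?f t)"
    by (rule norm_triangle_ineq)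
  also have "norm (LINT t:eI w|lborel. tree_deriv u (w, t) * of_real (t - ?k)) \<le> (LINT t:eI w|lborel. cmod (tree_deriv u (w, t)))"
    unfolding set_lebesgue_integral_def
  proof (rule Bochner_Integration.integral_norm_bound_integral)
    show "integrable lborel (\<lambda>t. indicat_real (eI w) t *\<^sub>R cmod (tree_deriv u (w, t)))" using i1 by (simp add: set_integrable_def)
    have "(\<lambda>t. (indicat_real (eI w) t *\<^sub>R tree_deriv u (w, t)) * of_real (t - ?k)) \<in> borel_measurable lborel"
      using sec(2) unfolding set_borel_measurable_def by measurable
    then have m: "(\<lambda>t. indicat_real (eI w) t *\<^sub>R (tree_deriv u (w, t) * of_real (t - ?k))) \<in> borel_measurable lborel" by simp
    have le: "norm (indicat_real (eI w) t *\<^sub>R (tree_deriv u (w, t) * of_real (t - ?k))) \<le> indicat_real (eI w) t *\<^sub>R cmod (tree_deriv u (w, t))" for t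
    proof (cases "t \<in> eI w")
      case True
      then have "cmod (of_real (t - ?k)) \<le> 1" by (simp add: eI_def del: of_real_diff)
      then have "cmod (tree_deriv u (w, t)) * cmod (of_real (t - ?k)) \<le> cmod (tree_deriv u (w, t)) * 1"
        by (intro mult_left_mono) auto
      then show ?thesis using True by (simp add: norm_mult del: of_real_diff)
    qed simp
    show "integrable lborel (\<lambda>t. indicat_real (eI w) t *\<^sub>R (tree_deriv u (w, t) * of_real (t - ?k)))"
      by (rule Bochner_Integration.integrable_bound[OF i1(1)[unfolded set_integrable_def] m])
        (use le in \<open>auto intro!: AE_I2 intro: order_trans\<close>)
    show "norm (indicat_real (eI w) t *\<^sub>R (tree_deriv u (w, t) * of_real (t - ?k))) \<le> indicat_real (eI w) t *\<^sub>R cmod (tree_deriv u (w, t))" for t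
      by (rule le)
  qed
  also have "norm (LINT t:eI w|lborel. ?f t) \<le> (LINT t:eI w|lborel. norm (?f t))"
    unfolding set_lebesgue_integral_def
    by (rule order_trans[OF integral_norm_bound]) simp
  also have "(LINT t:eI w|lborel. norm (?f t)) = (LINT t:eI w|lborel. cmod (u (w, t)))"
    by (rule set_lebesgue_integral_cong) (auto simp: edge_path_eI eI_borel)
  also have "(LINT t:eI w|lborel. cmod (tree_deriv u (w, t))) + (LINT t:eI w|lborel. cmod (u (w, t)))
      = (LINT t:eI w|lborel. cmod (tree_deriv u (w, t)) + cmod (u (w, t)))"
    by (rule set_integral_add(2)[OF i1, symmetric])
  finally show ?thesis by simp
qed

definition tree_fun :: "nat \<Rightarrow> (nat list \<Rightarrow> real \<Rightarrow> complex) \<Rightarrow> tpoint \<Rightarrow> complex" where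
  "tree_fun b \<eta> = (\<lambda>(w, t). if (w, t) \<in> tree b then \<eta> w t else 0)"

definition vertex_compatible :: "nat \<Rightarrow> (nat list \<Rightarrow> real \<Rightarrow> complex) \<Rightarrow> bool" where
  "vertex_compatible b \<eta> \<longleftrightarrow> \<eta> [] 0 = 0 \<and>
     (\<forall>w j. w \<in> words b \<longrightarrow> j < b \<longrightarrow> \<eta> (w @ [j]) (real (length w) + 1) = \<eta> w (real (length w) + 1))"

lemma tree_fun_path:
  assumes c: "vertex_compatible b \<eta>" and w: "w \<in> words b" and t: "t \<in> cI w"
  shows "tree_fun b \<eta> (edge_path w t) = \<eta> w t"
proof (cases "t = real (length w)")
  case True
  show ?thesis
  proof (cases w rule: rev_cases)
    case Nil
    then show ?thesis using c True by (simp add: tree_fun_def edge_path_def parent_vertex_def tree_root_def mem_tree vertex_compatible_def)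
  next
    case (snoc v j)
    then have "v \<in> words b" "j < b" using w by (auto simp: words_snoc)
    then show ?thesis using c True snoc by (simp add: tree_fun_def edge_path_def parent_vertex_def mem_tree vertex_compatible_def add.commute)
  qed
next
  case False
  then show ?thesis using t w by (simp add: tree_fun_def edge_path_def mem_tree)
qed

lemma tree_fun_eI: "w \<in> words b \<Longrightarrow> t \<in> eI w \<Longrightarrow> tree_fun b \<eta> (w, t) = \<eta> w t"
  by (simp add: tree_fun_def mem_tree eI_def)

text \<open>Membership and derivative are obtained together, since the energy in the definition of
  the space refers to the chosen representative \<open>tree_deriv\<close>, which first has to be
  identified with \<open>d\<close> almost everywhere.\<close>

lemma tree_fun_H10:
  fixes d :: "nat list \<Rightarrow> real \<Rightarrow> complex"
  assumes c: "vertex_compatible b \<eta>"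
    and cont: "\<And>w. w \<in> words b \<Longrightarrow> continuous_on (cI w) (\<eta> w)"
    and fin: "\<And>w. finite (F w)"
    and der: "\<And>w t. w \<in> words b \<Longrightarrow> t \<in> eI w - F w \<Longrightarrow> (\<eta> w has_vector_derivative d w t) (at t)"
    and dm: "\<And>w. w \<in> words b \<Longrightarrow> set_borel_measurable lborel (eI w) (d w)"
    and db: "\<And>w t. w \<in> words b \<Longrightarrow> t \<in> eI w \<Longrightarrow> norm (d w t) \<le> M w"
    and K: "\<And>N. (\<Sum>w\<in>words_lt b N. (LINT t:eI w|lborel. (cmod (d w t))\<^sup>2 + (cmod (\<eta> w t))\<^sup>2)) \<le> K"
  shows "tree_fun b \<eta> \<in> tree_H10 b"
    "\<And>w. w \<in> words b \<Longrightarrow> AE t in lborel. t \<in> eI w \<longrightarrow> tree_deriv (tree_fun b \<eta>) (w, t) = d w t"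
proof -
  let ?u = "tree_fun b \<eta>"
  have wd: "has_weak_derivative (length w) (real (length w) + 1) (\<lambda>t. ?u (w, t)) (d w)"
      "(\<lambda>t. ?u (w, t)) \<in> H1_interval (length w) (real (length w) + 1)"
      "set_integrable lborel {real (length w)<..<real (length w) + 1} (d w)"
      "\<And>s t. real (length w) \<le> s \<Longrightarrow> s < t \<Longrightarrow> t \<le> real (length w) + 1 \<Longrightarrow> (LINT x:{s<..<t}|lborel. d w x) = \<eta> w t - \<eta> w s"
    if w: "w \<in> words b" for w
  proof -
    have a: "real (length w) < real (length w) + 1" by simp
    have d': "(\<eta> w has_vector_derivative d w x) (at x)" if "x \<in> {real (length w)<..<real (length w) + 1} - F w" for x
      using der[OF w, of x] that by (simp add: eI_def)
    have u: "?u (w, x) = \<eta> w x" if "x \<in> {real (length w)<..<real (length w) + 1}" for x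
      using tree_fun_eI[OF w, of x] that by (simp add: eI_def)
    note * = has_weak_derivativeI[OF a cont[OF w] fin[of w] d' dm[OF w, unfolded eI_def] db[OF w, unfolded eI_def], of "\<lambda>t. ?u (w, t)", OF _ _ u]
    show "has_weak_derivative (length w) (real (length w) + 1) (\<lambda>t. ?u (w, t)) (d w)"
      "(\<lambda>t. ?u (w, t)) \<in> H1_interval (length w) (real (length w) + 1)"
      "set_integrable lborel {real (length w)<..<real (length w) + 1} (d w)"
      using * by blast+
    show "\<And>s t. real (length w) \<le> s \<Longrightarrow> s < t \<Longrightarrow> t \<le> real (length w) + 1 \<Longrightarrow> (LINT x:{s<..<t}|lborel. d w x) = \<eta> w t - \<eta> w s"
      by (rule *(4))
  qed
  have wd': "has_weak_derivative (length w) (real (length w) + 1) (\<lambda>t. ?u (w, t)) (\<lambda>t. tree_deriv ?u (w, t))" if w: "w \<in> words b" for w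
    by (rule tree_deriv_weakI[OF wd(1)[OF w]])
  show AE: "AE t in lborel. t \<in> eI w \<longrightarrow> tree_deriv ?u (w, t) = d w t" if w: "w \<in> words b" for w
    unfolding eI_def
    by (rule weak_derivative_unique[OF wd'[OF w] cont[OF w] _ wd(3)[OF w] wd(4)[OF w]])
      (use tree_fun_eI[OF w] in \<open>auto simp: eI_def\<close>)
  have AE2: "AE t in lborel. indicat_real (eI w) t *\<^sub>R ((cmod (tree_deriv ?u (w, t)))\<^sup>2 + (cmod (?u (w, t)))\<^sup>2)
      = indicat_real (eI w) t *\<^sub>R ((cmod (d w t))\<^sup>2 + (cmod (\<eta> w t))\<^sup>2)" if w: "w \<in> words b" for w
    using AE[OF w] by eventually_elim (auto simp: indicator_def tree_fun_eI[OF w])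
  have si: "set_integrable lborel (eI w) (\<lambda>t. (cmod (tree_deriv ?u (w, t)))\<^sup>2 + (cmod (?u (w, t)))\<^sup>2)" if w: "w \<in> words b" for w
    using wd(2)[OF w] wd'[OF w] unfolding eI_def
    by (intro set_integral_add(1)) (auto simp: H1_interval_def has_weak_derivative_def square_integrable_on_interval_def)
  show "?u \<in> tree_H10 b"
    unfolding tree_H10_def
  proof (intro CollectI conjI allI impI)
    show "?u x = 0" if "x \<notin> tree b" for x using that by (cases x) (simp add: tree_fun_def)
    show "continuous_map (Metric_space.mtopology (tree b) tree_dist) euclidean ?u"
    proof (rule edge_imp_tree_continuous)
      fix w assume w: "w \<in> words b"
      show "continuous_on (cI w) (\<lambda>t. ?u (edge_path w t))"
        by (rule continuous_on_eq[OF cont[OF w]]) (simp add: tree_fun_path[OF c w])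
    qed
    show "(\<lambda>t. ?u (w, t)) \<in> H1_interval (length w) (real (length w) + 1)" if "set w \<subseteq> {..<b}" for w
      using wd(2)[of w] that by (simp add: words_def)
    show "?u tree_root = 0" using c by (simp add: tree_fun_def tree_root_def vertex_compatible_def)
    show "integrable (tree_measure b) (\<lambda>x. (cmod (tree_deriv ?u x))\<^sup>2 + (cmod (?u x))\<^sup>2)"
    proof (rule tree_integrableI[OF si])
      fix N
      have "(\<Sum>w\<in>words_lt b N. (LINT t:eI w|lborel. norm ((cmod (tree_deriv ?u (w, t)))\<^sup>2 + (cmod (?u (w, t)))\<^sup>2)))
         = (\<Sum>w\<in>words_lt b N. (LINT t:eI w|lborel. (cmod (d w t))\<^sup>2 + (cmod (\<eta> w t))\<^sup>2))"
      proof (rule sum.cong)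
        fix w assume "w \<in> words_lt b N"
        then have w: "w \<in> words b" by (simp add: words_lt_def)
        have ci: "continuous_on (cI w) (\<lambda>t. (cmod (\<eta> w t))\<^sup>2)" by (intro continuous_intros cont w)
        have [measurable]: "(\<lambda>t. indicat_real (eI w) t *\<^sub>R d w t) \<in> borel_measurable lborel" using dm[OF w] by (simp add: set_borel_measurable_def)
        have "(\<lambda>t. (cmod (indicat_real (eI w) t *\<^sub>R d w t))\<^sup>2 + indicat_real (eI w) t *\<^sub>R (cmod (\<eta> w t))\<^sup>2) \<in> borel_measurable lborel"
          using borel_measurable_integrable[OF set_integrable_continuous_Ioo[OF ci, unfolded set_integrable_def]]
          unfolding eI_def[symmetric] by measurable
        moreover have "(cmod (indicat_real (eI w) t *\<^sub>R d w t))\<^sup>2 + indicat_real (eI w) t *\<^sub>R (cmod (\<eta> w t))\<^sup>2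
            = indicat_real (eI w) t *\<^sub>R ((cmod (d w t))\<^sup>2 + (cmod (\<eta> w t))\<^sup>2)" for t
          by (simp add: indicator_def)
        ultimately have m: "(\<lambda>t. indicat_real (eI w) t *\<^sub>R ((cmod (d w t))\<^sup>2 + (cmod (\<eta> w t))\<^sup>2)) \<in> borel_measurable lborel" by simp
        have "(LINT t:eI w|lborel. (cmod (tree_deriv ?u (w, t)))\<^sup>2 + (cmod (?u (w, t)))\<^sup>2) = (LINT t:eI w|lborel. (cmod (d w t))\<^sup>2 + (cmod (\<eta> w t))\<^sup>2)"
          unfolding set_lebesgue_integral_def
          by (rule integral_cong_AE[OF borel_measurable_integrable[OF si[OF w, unfolded set_integrable_def]] m AE2[OF w]])
        then show "(LINT t:eI w|lborel. norm ((cmod (tree_deriv ?u (w, t)))\<^sup>2 + (cmod (?u (w, t)))\<^sup>2)) = (LINT t:eI w|lborel. (cmod (d w t))\<^sup>2 + (cmod (\<eta> w t))\<^sup>2)"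
          by simp
      qed simp
      then show "(\<Sum>w\<in>words_lt b N. (LINT t:eI w|lborel. norm ((cmod (tree_deriv ?u (w, t)))\<^sup>2 + (cmod (?u (w, t)))\<^sup>2))) \<le> K"
        using K[of N] by simp
    qed
  qed
qed

lemma tree_fun_H10_finite:
  fixes d :: "nat list \<Rightarrow> real \<Rightarrow> complex"
  assumes c: "vertex_compatible b \<eta>"
    and cont: "\<And>w. w \<in> words b \<Longrightarrow> continuous_on (cI w) (\<eta> w)"
    and fin: "\<And>w. finite (F w)"
    and der: "\<And>w t. w \<in> words b \<Longrightarrow> t \<in> eI w - F w \<Longrightarrow> (\<eta> w has_vector_derivative d w t) (at t)"
    and dm: "\<And>w. w \<in> words b \<Longrightarrow> set_borel_measurable lborel (eI w) (d w)"
    and db: "\<And>w t. w \<in> words b \<Longrightarrow> t \<in> eI w \<Longrightarrow> norm (d w t) \<le> M w"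
    and S: "finite S" "\<And>w. w \<notin> S \<Longrightarrow> \<eta> w = (\<lambda>_. 0)" "\<And>w. w \<notin> S \<Longrightarrow> d w = (\<lambda>_. 0)"
  shows "tree_fun b \<eta> \<in> tree_H10 b"
    "\<And>w. w \<in> words b \<Longrightarrow> AE t in lborel. t \<in> eI w \<longrightarrow> tree_deriv (tree_fun b \<eta>) (w, t) = d w t"
proof -
  let ?I = "\<lambda>w. LINT t:eI w|lborel. (cmod (d w t))\<^sup>2 + (cmod (\<eta> w t))\<^sup>2"
  have "(\<Sum>w\<in>words_lt b N. ?I w) \<le> (\<Sum>w\<in>S. ?I w)" for N
  proof -
    have "(\<Sum>w\<in>words_lt b N. ?I w) = (\<Sum>w\<in>words_lt b N \<inter> S. ?I w)"
      by (intro sum.mono_neutral_right finite_words_lt) (auto simp: S(2,3))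
    also have "\<dots> \<le> (\<Sum>w\<in>S. ?I w)"
      using S(1) by (intro sum_mono2) (auto simp: set_lebesgue_integral_def)
    finally show ?thesis .
  qed
  note K = this
  show "tree_fun b \<eta> \<in> tree_H10 b"
    by (rule tree_fun_H10(1)[where d=d and F=F and M=M]) (fact c cont fin der dm db K)+
  show "AE t in lborel. t \<in> eI w \<longrightarrow> tree_deriv (tree_fun b \<eta>) (w, t) = d w t" if "w \<in> words b" for w
    by (rule tree_fun_H10(2)[where d=d and F=F and M=M]) (fact c cont fin der dm db K that)+
qed

lemma eigenspace_iff:
  assumes V: "continuous_on {0<..} V" "\<And>t. t > 0 \<Longrightarrow> \<bar>V t\<bar> \<le> M"
  shows "u \<in> eigenspace b V \<mu> \<longleftrightarrow> u \<in> tree_H10 b \<and>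
    (\<forall>\<phi>\<in>tree_H10 b. (LINT x|tree_measure b. tree_deriv u x * cnj (tree_deriv \<phi> x) - of_real (\<mu> - V (height x)) * u x * cnj (\<phi> x)) = 0)"
proof (cases "u \<in> tree_H10 b")
  case u: True
  have "(\<lambda>x. of_real \<mu> * u x) \<in> tree_L2 b"
    unfolding tree_L2_def
  proof (intro CollectI conjI)
    note [measurable] = tree_H10_measurable[OF u]
    show "(\<lambda>x. of_real \<mu> * u x) \<in> borel_measurable (tree_measure b)" by measurable
    show "integrable (tree_measure b) (\<lambda>x. (cmod (of_real \<mu> * u x))\<^sup>2)"
    proof (rule Bochner_Integration.integrable_bound[OF integrable_scaleR_right[OF tree_H10_energy[OF u], of "\<mu>\<^sup>2"]])
      show "AE x in tree_measure b. norm ((cmod (of_real \<mu> * u x))\<^sup>2) \<le> norm (\<mu>\<^sup>2 *\<^sub>R ((cmod (tree_deriv u x))\<^sup>2 + (cmod (u x))\<^sup>2))"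
        by (intro AE_I2) (simp add: norm_mult power_mult_distrib mult_left_mono)
    qed measurable
  qed
  moreover have "schroedinger_form b V u \<phi> = (LINT x|tree_measure b. of_real \<mu> * u x * cnj (\<phi> x)) \<longleftrightarrow>
     (LINT x|tree_measure b. tree_deriv u x * cnj (tree_deriv \<phi> x) - of_real (\<mu> - V (height x)) * u x * cnj (\<phi> x)) = 0"
    if \<phi>: "\<phi> \<in> tree_H10 b" for \<phi>
  proof -
    have i1: "integrable (tree_measure b) (\<lambda>x. tree_deriv u x * cnj (tree_deriv \<phi> x) + of_real (V (height x)) * u x * cnj (\<phi> x))"
      by (intro Bochner_Integration.integrable_add tree_product_integrable[OF u \<phi> V])
    have i2: "integrable (tree_measure b) (\<lambda>x. of_real \<mu> * u x * cnj (\<phi> x))"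
      by (rule tree_product_integrable(2)[OF u \<phi>, of "\<lambda>_. \<mu>" "\<bar>\<mu>\<bar>"]) auto
    have "schroedinger_form b V u \<phi> - (LINT x|tree_measure b. of_real \<mu> * u x * cnj (\<phi> x))
       = (LINT x|tree_measure b. (tree_deriv u x * cnj (tree_deriv \<phi> x) + of_real (V (height x)) * u x * cnj (\<phi> x)) - of_real \<mu> * u x * cnj (\<phi> x))"
      unfolding schroedinger_form_def by (rule Bochner_Integration.integral_diff[OF i1 i2, symmetric])
    also have "\<dots> = (LINT x|tree_measure b. tree_deriv u x * cnj (tree_deriv \<phi> x) - of_real (\<mu> - V (height x)) * u x * cnj (\<phi> x))"
    proof -
      have "A + of_real r * a * c - of_real \<mu> * a * c = A - of_real (\<mu> - r) * a * c" for A a c :: complex and r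
        by (simp add: algebra_simps)
      then show ?thesis by (simp only:)
    qed
    finally show ?thesis by (simp only: eq_iff_diff_eq_0[of "schroedinger_form b V u \<phi>"])
  qed
  ultimately show ?thesis using u by (simp add: eigenspace_def schroedinger_op_def)
qed (simp add: eigenspace_def schroedinger_op_def)

section \<open>Regularity of eigenfunctions\<close>

lemma affine_integral:
  fixes h H HH :: "real \<Rightarrow> complex"
  assumes ac: "a \<le> c"
    and H: "\<And>t. t \<in> {a..c} \<Longrightarrow> (H has_vector_derivative h t) (at t within {a..c})"
    and HH: "\<And>t. t \<in> {a..c} \<Longrightarrow> (HH has_vector_derivative H t) (at t within {a..c})"
  shows "((\<lambda>t. h t * of_real (\<alpha> + \<beta> * t)) has_integral
     H c * of_real (\<alpha> + \<beta> * c) - H a * of_real (\<alpha> + \<beta> * a) - of_real \<beta> * (HH c - HH a)) {a..c}"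
proof -
  have "((\<lambda>t. h t * of_real (\<alpha> + \<beta> * t)) has_integral
     (H c * of_real (\<alpha> + \<beta> * c) - of_real \<beta> * HH c) - (H a * of_real (\<alpha> + \<beta> * a) - of_real \<beta> * HH a)) {a..c}"
  proof (rule fundamental_theorem_of_calculus[OF ac])
    fix t assume t: "t \<in> {a..c}"
    have "((\<lambda>t. \<alpha> + \<beta> * t) has_real_derivative \<beta>) (at t within {a..c})"
      by (auto intro!: derivative_eq_intros)
    from has_vector_derivative_diff[OF has_vector_derivative_mult[OF H[OF t] has_vector_derivative_of_real[OF this]]
        has_vector_derivative_mult_right[OF HH[OF t], of "of_real \<beta>"]]
    show "((\<lambda>t. H t * of_real (\<alpha> + \<beta> * t) - of_real \<beta> * HH t) has_vector_derivative h t * of_real (\<alpha> + \<beta> * t)) (at t within {a..c})"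
      by (simp add: mult.commute)
  qed
  then show ?thesis by (simp add: algebra_simps)
qed

lemma set_integral_eq_integral_Icc:
  fixes f :: "real \<Rightarrow> complex"
  assumes "continuous_on {a..c} f"
  shows "(LINT t:{a<..<c}|lborel. f t) = integral {a..c} f"
  using set_borel_integral_eq_integral(2)[OF set_integrable_continuous_Ioo[OF assms]]
  by (simp add: integral_open_interval_real)

text \<open>\<open>V\<close> is controlled at positive heights, because height 0 occurs only at the
  root, where the functions vanish. \<open>P\<close> continues \<open>\<mu> - V\<close> continuously
  to the line.\<close>

locale tree_potential =
  fixes b :: nat and V P :: "real \<Rightarrow> real" and \<mu> M :: real
  assumes V_cont: "continuous_on {0<..} V" and V_bound: "\<And>t. t > 0 \<Longrightarrow> \<bar>V t\<bar> \<le> M"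
    and P_cont: "continuous_on UNIV P" and P_eq: "\<And>t. t > 0 \<Longrightarrow> P t = \<mu> - V t"
begin

lemma P_cont': "continuous_on S P"
  using P_cont continuous_on_subset by blast

lemma eigenspace_P:
  "u \<in> eigenspace b V \<mu> \<longleftrightarrow> u \<in> tree_H10 b \<and>
    (\<forall>\<phi>\<in>tree_H10 b. (LINT x|tree_measure b. tree_deriv u x * cnj (tree_deriv \<phi> x) - of_real (P (height x)) * u x * cnj (\<phi> x)) = 0)"
proof -
  have eq: "(LINT x|tree_measure b. tree_deriv u x * cnj (tree_deriv \<phi> x) - of_real (\<mu> - V (height x)) * u x * cnj (\<phi> x))
     = (LINT x|tree_measure b. tree_deriv u x * cnj (tree_deriv \<phi> x) - of_real (P (height x)) * u x * cnj (\<phi> x))"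
    if u: "u \<in> tree_H10 b" for \<phi>
  proof (rule Bochner_Integration.integral_cong[OF refl])
    fix x assume "x \<in> space (tree_measure b)"
    then have x: "x \<in> tree b" using tree_sets by (simp add: tree_measure_def space_restrict_space)
    have "of_real (\<mu> - V (height x)) * u x = of_real (P (height x)) * u x"
    proof (cases "snd x = 0")
      case True
      then have "x = tree_root" using x by (cases x) (auto simp: mem_tree tree_root_def)
      then show ?thesis using u by (simp add: tree_H10_def)
    next
      case False
      then have "height x > 0" using height_eq[OF x] tree_snd[OF x] by simp
      then show ?thesis using P_eq by simp
    qed
    then show "tree_deriv u x * cnj (tree_deriv \<phi> x) - of_real (\<mu> - V (height x)) * u x * cnj (\<phi> x)
       = tree_deriv u x * cnj (tree_deriv \<phi> x) - of_real (P (height x)) * u x * cnj (\<phi> x)" by simp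
  qed
  note iff = eigenspace_iff[OF V_cont V_bound, of u b \<mu>]
  show ?thesis
  proof (cases "u \<in> tree_H10 b")
    case True
    show ?thesis using iff by (simp only: True simp_thms eq[OF True])
  qed (use iff in \<open>simp only: simp_thms\<close>)
qed

lemma form_integrable:
  assumes u: "u \<in> tree_H10 b" and h: "\<phi> \<in> tree_H10 b"
  shows "integrable (tree_measure b) (\<lambda>x. tree_deriv u x * cnj (tree_deriv \<phi> x))"
    "integrable (tree_measure b) (\<lambda>x. of_real (P (height x)) * u x * cnj (\<phi> x))"
  using tree_product_integrable[OF u h P_cont', of "\<bar>\<mu>\<bar> + M"] V_bound P_eq
  by (force simp: abs_le_iff)+

lemma height_eI: "w \<in> words b \<Longrightarrow> t \<in> eI w \<Longrightarrow> height (w, t) = t"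
  using height_eq[of "(w, t)" b] by (simp add: mem_tree eI_def)

text \<open>A test function that lives on finitely many edges turns the weak equation into a finite
  sum of integrals over edges, with explicit \<open>d\<close> in place of
  \<open>tree_deriv\<close>.\<close>

lemma eigenfunction_test:
  fixes \<eta> d :: "nat list \<Rightarrow> real \<Rightarrow> complex"
  assumes u: "u \<in> eigenspace b V \<mu>" and \<phi>: "tree_fun b \<eta> \<in> tree_H10 b"
    and d: "\<And>w. w \<in> words b \<Longrightarrow> AE t in lborel. t \<in> eI w \<longrightarrow> tree_deriv (tree_fun b \<eta>) (w, t) = d w t"
    and dm: "\<And>w. w \<in> words b \<Longrightarrow> set_borel_measurable lborel (eI w) (d w)"
    and S: "finite S" "S \<subseteq> words b" "\<And>w. w \<notin> S \<Longrightarrow> \<eta> w = (\<lambda>_. 0)" "\<And>w. w \<notin> S \<Longrightarrow> d w = (\<lambda>_. 0)"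
  shows "(\<Sum>w\<in>S. (LINT t:eI w|lborel. tree_deriv u (w, t) * cnj (d w t))) =
    (\<Sum>w\<in>S. (LINT t:eI w|lborel. of_real (P t) * u (edge_path w t) * cnj (\<eta> w t)))"
proof -
  let ?\<phi> = "tree_fun b \<eta>"
  have uH: "u \<in> tree_H10 b" using u eigenspace_P by blast
  define F1 where "F1 x = tree_deriv u x * cnj (tree_deriv ?\<phi> x)" for x
  define F2 where "F2 x = of_real (P (height x)) * u x * cnj (?\<phi> x)" for x
  have i: "integrable (tree_measure b) F1" "integrable (tree_measure b) F2"
    using form_integrable[OF uH \<phi>] unfolding F1_def[abs_def] F2_def[abs_def] .
  have "(LINT x|tree_measure b. F1 x - F2 x) = 0"
    using u \<phi> eigenspace_P unfolding F1_def F2_def by blast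
  then have eq: "(LINT x|tree_measure b. F1 x) = (LINT x|tree_measure b. F2 x)"
    using Bochner_Integration.integral_diff[OF i] by simp
  have s: "set_integrable lborel (eI w) (\<lambda>t. F1 (w, t))" "set_integrable lborel (eI w) (\<lambda>t. F2 (w, t))" if "w \<in> words b" for w
    using tree_integral(1)[OF i(1) that] tree_integral(1)[OF i(2) that] .
  have m: "set_borel_measurable lborel (eI w) (\<lambda>t. F1 (w, t))" "set_borel_measurable lborel (eI w) (\<lambda>t. F2 (w, t))" if "w \<in> words b" for w
    using s[OF that] by (auto simp: set_integrable_def set_borel_measurable_def)
  have F1_AE: "AE t in lborel. t \<in> eI w \<longrightarrow> F1 (w, t) = tree_deriv u (w, t) * cnj (d w t)" if "w \<in> words b" for w
    using d[OF that] by eventually_elim (simp add: F1_def)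
  have F2_eq: "F2 (w, t) = of_real (P t) * u (edge_path w t) * cnj (\<eta> w t)" if "w \<in> words b" "t \<in> eI w" for w t
    using that by (simp add: F2_def height_eI edge_path_eI tree_fun_eI)
  have "(LINT x|tree_measure b. F1 x) = (\<Sum>w\<in>S. (LINT t:eI w|lborel. F1 (w, t)))"
  proof (rule tree_integral_finite_support[OF s(1) S(1,2)])
    fix w assume w: "w \<in> words b - S"
    then have "AE t in lborel. t \<in> eI w \<longrightarrow> F1 (w, t) = tree_deriv u (w, t) * cnj (d w t)" using F1_AE by blast
    then show "AE t in lborel. t \<in> eI w \<longrightarrow> F1 (w, t) = 0"
      by eventually_elim (use w S(4) in auto)
  qed (use S m in auto)
  moreover have "(LINT t:eI w|lborel. F1 (w, t)) = (LINT t:eI w|lborel. tree_deriv u (w, t) * cnj (d w t))" if w: "w \<in> S" for w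
    unfolding set_lebesgue_integral_def
  proof (rule integral_cong_AE)
    have wb: "w \<in> words b" using w S by auto
    show "(\<lambda>t. indicat_real (eI w) t *\<^sub>R F1 (w, t)) \<in> borel_measurable lborel"
      using m(1)[OF wb] by (simp add: set_borel_measurable_def)
    have [measurable]: "(\<lambda>t. indicat_real (eI w) t *\<^sub>R d w t) \<in> borel_measurable lborel"
      "(\<lambda>t. indicat_real (eI w) t *\<^sub>R tree_deriv u (w, t)) \<in> borel_measurable lborel"
      using dm[OF wb] tree_H10_sections(2)[OF uH wb] by (simp_all add: set_borel_measurable_def)
    have "(\<lambda>t. (indicat_real (eI w) t *\<^sub>R tree_deriv u (w, t)) * cnj (indicat_real (eI w) t *\<^sub>R d w t)) \<in> borel_measurable lborel"
      by measurable
    moreover have "(\<lambda>t. (indicat_real (eI w) t *\<^sub>R tree_deriv u (w, t)) * cnj (indicat_real (eI w) t *\<^sub>R d w t))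
        = (\<lambda>t. indicat_real (eI w) t *\<^sub>R (tree_deriv u (w, t) * cnj (d w t)))"
      by (auto simp: indicator_def fun_eq_iff)
    ultimately show "(\<lambda>t. indicat_real (eI w) t *\<^sub>R (tree_deriv u (w, t) * cnj (d w t))) \<in> borel_measurable lborel" by simp
    show "AE t in lborel. indicat_real (eI w) t *\<^sub>R F1 (w, t) = indicat_real (eI w) t *\<^sub>R (tree_deriv u (w, t) * cnj (d w t))"
      using F1_AE[OF wb] by eventually_elim (auto simp: indicator_def)
  qed
  moreover have "(LINT x|tree_measure b. F2 x) = (\<Sum>w\<in>S. (LINT t:eI w|lborel. F2 (w, t)))"
  proof (rule tree_integral_finite_support[OF s(2) S(1,2)])
    fix w assume w: "w \<in> words b - S"
    then show "AE t in lborel. t \<in> eI w \<longrightarrow> F2 (w, t) = 0"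
      using F2_eq[of w] S(3)[of w] by (intro AE_I2) auto
  qed (use S m in auto)
  moreover have "(LINT t:eI w|lborel. F2 (w, t)) = (LINT t:eI w|lborel. of_real (P t) * u (edge_path w t) * cnj (\<eta> w t))" if w: "w \<in> S" for w
    by (rule set_lebesgue_integral_cong) (use F2_eq[of w] w S in \<open>auto simp: eI_borel\<close>)
  ultimately show ?thesis using eq by simp
qed

text \<open>Testing with the hat function of apex \<open>m\<close> on one edge shows that \<open>f + \<integral>\<integral> P f\<close> has the same
  difference quotient on both sides of \<open>m\<close>, hence is affine.\<close>

lemma eigenfunction_hat:
  assumes u: "u \<in> eigenspace b V \<mu>" and w: "w \<in> words b"
    and f: "f = (\<lambda>t. u (edge_path w t))" and k: "k = real (length w)"
    and H: "\<And>t. t \<in> {k..k+1} \<Longrightarrow> (H has_vector_derivative of_real (P t) * f t) (at t within {k..k+1})"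
    and HH: "\<And>t. t \<in> {k..k+1} \<Longrightarrow> (HH has_vector_derivative H t) (at t within {k..k+1})"
    and m: "k < m" "m < k + 1"
  shows "(f m + HH m) = (f k + HH k) + of_real (m - k) * ((f (k+1) + HH (k+1)) - (f k + HH k))"
proof -
  have uH: "u \<in> tree_H10 b" using u eigenspace_P by blast
  \<comment> \<open>The slopes of a hat of height 1 with apex \<open>m\<close>.\<close>
  define e1 where "e1 = 1 / (m - k)"
  define e2 where "e2 = 1 / (k + 1 - m)"
  define hat where "hat t = (if t \<le> m then e1 * (t - k) else e2 * (k + 1 - t))" for t
  define hd where "hd t = (if t < m then e1 else if m < t then - e2 else 0)" for t
  define \<eta> where "\<eta> v t = (if v = w then complex_of_real (hat t) else 0)" for v t
  define d where "d v t = (if v = w then complex_of_real (hd t) else 0)" for v t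
  have e: "e1 * (m - k) = 1" "e2 * (k + 1 - m) = 1" "e1 > 0" "e2 > 0" using m by (auto simp: e1_def e2_def)
  have hatk: "hat k = 0" "hat (k + 1) = 0" using m by (auto simp: hat_def)
  have hat_cont: "continuous_on UNIV hat"
  proof -
    have "continuous_on ({..m} \<union> {m..}) hat"
      unfolding hat_def using e by (intro continuous_on_If) (auto intro!: continuous_intros)
    moreover have "{..m} \<union> {m..} = (UNIV :: real set)" by auto
    ultimately show ?thesis by simp
  qed
  have hat_der: "(hat has_real_derivative hd t) (at t)" if "t \<noteq> m" for t
  proof (cases "t < m")
    case True
    have "((\<lambda>t. e1 * (t - k)) has_real_derivative e1) (at t)" by (auto intro!: derivative_eq_intros)
    then have "(hat has_real_derivative e1) (at t)"
      by (rule has_field_derivative_transform_within_open[where S="{..<m}"]) (auto simp: hat_def True)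
    then show ?thesis using True by (simp add: hd_def)
  next
    case False
    have "((\<lambda>t. e2 * (k + 1 - t)) has_real_derivative - e2) (at t)" by (auto intro!: derivative_eq_intros)
    then have "(hat has_real_derivative - e2) (at t)"
      by (rule has_field_derivative_transform_within_open[where S="{m<..}"]) (use False that in \<open>auto simp: hat_def\<close>)
    then show ?thesis using False that by (simp add: hd_def)
  qed
  have [measurable]: "hd \<in> borel_measurable borel" unfolding hd_def by measurable
  have vc: "vertex_compatible b \<eta>"
    unfolding vertex_compatible_def
  proof (intro conjI allI impI)
    show "\<eta> [] 0 = 0" using hatk k by (auto simp: \<eta>_def)
    fix v j assume "v \<in> words b" "j < b"
    show "\<eta> (v @ [j]) (real (length v) + 1) = \<eta> v (real (length v) + 1)"
      using hatk k by (auto simp: \<eta>_def add.commute)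
  qed
  have dm: "set_borel_measurable lborel (eI v) (d v)" for v
    unfolding set_borel_measurable_def d_def using eI_borel by (cases "v = w") auto
  have db: "norm (d v t) \<le> e1 + e2" for v t using e by (auto simp: d_def hd_def)
  have fin: "finite (if v = w then {m} else {})" for v by simp
  have der: "(\<eta> v has_vector_derivative d v t) (at t)" if "t \<in> eI v - (if v = w then {m} else {})" for v t
  proof (cases "v = w")
    case True
    then have "t \<noteq> m" using that by auto
    from has_vector_derivative_of_real[OF hat_der[OF this]] True show ?thesis by (simp add: \<eta>_def[abs_def] d_def)
  qed (simp add: \<eta>_def[abs_def] d_def)
  have \<eta>c: "continuous_on S (\<eta> v)" for S v
  proof (cases "v = w")
    case True
    then have "\<eta> v = (\<lambda>t. complex_of_real (hat t))" by (simp add: \<eta>_def fun_eq_iff)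
    then show ?thesis by (simp only: continuous_on_of_real[OF continuous_on_subset[OF hat_cont subset_UNIV]])
  next
    case False
    then have "\<eta> v = (\<lambda>t. 0)" by (simp add: \<eta>_def fun_eq_iff)
    then show ?thesis by simp
  qed
  have S: "\<And>v. v \<notin> {w} \<Longrightarrow> \<eta> v = (\<lambda>_. 0)" "\<And>v. v \<notin> {w} \<Longrightarrow> d v = (\<lambda>_. 0)" by (auto simp: \<eta>_def d_def)
  note T = tree_fun_H10_finite[where d=d and F="\<lambda>v. if v = w then {m} else {}" and M="\<lambda>_. e1 + e2" and S="{w}", OF vc \<eta>c fin der dm db _ S]
  have H10: "tree_fun b \<eta> \<in> tree_H10 b" by (rule T(1)) auto
  have AE: "AE t in lborel. t \<in> eI v \<longrightarrow> tree_deriv (tree_fun b \<eta>) (v, t) = d v t" if "v \<in> words b" for v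
    by (rule T(2)) (use that in auto)
  have E: "(LINT t:eI w|lborel. tree_deriv u (w, t) * cnj (d w t)) = (LINT t:eI w|lborel. of_real (P t) * u (edge_path w t) * cnj (\<eta> w t))"
    using eigenfunction_test[OF u H10 AE dm, of "{w}"] S w by simp
  have fc: "continuous_on {k..k+1} f" unfolding f k by (rule tree_H10_continuous[OF uH w])
  have wd: "has_weak_derivative k (k + 1) (\<lambda>t. u (w, t)) (\<lambda>t. tree_deriv u (w, t))" unfolding k by (rule tree_deriv_weak[OF uH w])
  have fu: "\<And>x. x \<in> {k<..<k+1} \<Longrightarrow> f x = u (w, x)" by (simp add: f edge_path_def k)
  have si: "set_integrable lborel {k<..<k+1} (\<lambda>t. tree_deriv u (w, t))" using tree_H10_sections(4)[OF uH w] by (simp add: eI_def k)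
  have si1: "set_integrable lborel {k<..<m} (\<lambda>t. tree_deriv u (w, t))" "set_integrable lborel {m<..<k+1} (\<lambda>t. tree_deriv u (w, t))"
    by (rule set_integrable_subset[OF si]; use m in auto)+
  have L: "(LINT t:eI w|lborel. tree_deriv u (w, t) * cnj (d w t)) = of_real e1 * (f m - f k) - of_real e2 * (f (k + 1) - f m)"
  proof -
    have "(LINT t:eI w|lborel. tree_deriv u (w, t) * cnj (d w t))
       = (LINT t|lborel. of_real e1 * (indicat_real {k<..<m} t *\<^sub>R tree_deriv u (w, t)) - of_real e2 * (indicat_real {m<..<k+1} t *\<^sub>R tree_deriv u (w, t)))"
      unfolding set_lebesgue_integral_def
      by (rule Bochner_Integration.integral_cong) (use m in \<open>auto simp: eI_def k[symmetric] indicator_def d_def hd_def\<close>)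
    also have "\<dots> = of_real e1 * (LINT t:{k<..<m}|lborel. tree_deriv u (w, t)) - of_real e2 * (LINT t:{m<..<k+1}|lborel. tree_deriv u (w, t))"
    proof -
      have "integrable lborel (\<lambda>t. of_real e1 * (indicat_real {k<..<m} t *\<^sub>R tree_deriv u (w, t)))"
        "integrable lborel (\<lambda>t. of_real e2 * (indicat_real {m<..<k+1} t *\<^sub>R tree_deriv u (w, t)))"
        using si1 unfolding set_integrable_def by (intro integrable_mult_right; simp)+
      from Bochner_Integration.integral_diff[OF this] show ?thesis
        unfolding set_lebesgue_integral_def by (simp only: integral_mult_right_zero)
    qed
    finally show ?thesis
      using weak_derivative_increment[OF wd fc fu, of k m] weak_derivative_increment[OF wd fc fu, of m "k+1"] m by simp
  qed
  have R: "(LINT t:eI w|lborel. of_real (P t) * u (edge_path w t) * cnj (\<eta> w t)) = of_real e2 * (HH (k+1) - HH m) - of_real e1 * (HH m - HH k)"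
  proof -
    have sub: "{k..m} \<subseteq> {k..k+1}" "{m..k+1} \<subseteq> {k..k+1}" using m by auto
    have d1: "\<And>t. t \<in> {k..m} \<Longrightarrow> (H has_vector_derivative of_real (P t) * f t) (at t within {k..m})"
       "\<And>t. t \<in> {k..m} \<Longrightarrow> (HH has_vector_derivative H t) (at t within {k..m})"
      using sub(1) H HH has_vector_derivative_within_subset by blast+
    have d2: "\<And>t. t \<in> {m..k+1} \<Longrightarrow> (H has_vector_derivative of_real (P t) * f t) (at t within {m..k+1})"
       "\<And>t. t \<in> {m..k+1} \<Longrightarrow> (HH has_vector_derivative H t) (at t within {m..k+1})"
      using sub(2) H HH has_vector_derivative_within_subset by blast+
    have I1: "((\<lambda>t. of_real (P t) * f t * of_real (hat t)) has_integral (H m - of_real e1 * (HH m - HH k))) {k..m}"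
    proof -
      have "((\<lambda>t. (of_real (P t) * f t) * of_real (- e1 * k + e1 * t)) has_integral
         H m * of_real (- e1 * k + e1 * m) - H k * of_real (- e1 * k + e1 * k) - of_real e1 * (HH m - HH k)) {k..m}"
        by (rule affine_integral[OF _ d1]) (use m in auto)
      moreover have "- e1 * k + e1 * m = 1" using e(1) by (simp add: algebra_simps)
      ultimately have "((\<lambda>t. (of_real (P t) * f t) * of_real (- e1 * k + e1 * t)) has_integral H m - of_real e1 * (HH m - HH k)) {k..m}"
        by (simp only:) simp
      then show ?thesis by (rule has_integral_eq[rotated]) (auto simp: hat_def algebra_simps)
    qed
    have I2: "((\<lambda>t. of_real (P t) * f t * of_real (hat t)) has_integral (- H m + of_real e2 * (HH (k+1) - HH m))) {m..k+1}"
    proof -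
      have "((\<lambda>t. (of_real (P t) * f t) * of_real (e2 * (k + 1) + (- e2) * t)) has_integral
         H (k+1) * of_real (e2 * (k + 1) + (- e2) * (k + 1)) - H m * of_real (e2 * (k + 1) + (- e2) * m) - of_real (- e2) * (HH (k+1) - HH m)) {m..k+1}"
        by (rule affine_integral[OF _ d2]) (use m in auto)
      moreover have "e2 * (k + 1) + (- e2) * m = 1" using e(2) by (simp add: algebra_simps)
      ultimately have "((\<lambda>t. (of_real (P t) * f t) * of_real (e2 * (k + 1) + (- e2) * t)) has_integral (- H m + of_real e2 * (HH (k+1) - HH m))) {m..k+1}"
        by (simp only:) simp
      moreover have "of_real (P t) * f t * of_real (e2 * (k + 1) + (- e2) * t) = of_real (P t) * f t * of_real (hat t)" if "t \<in> {m..k+1}" for t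
      proof -
        have "hat t = e2 * (k + 1) + (- e2) * t"
        proof (cases "t = m")
          case True
          then show ?thesis using e by (simp add: hat_def algebra_simps)
        next
          case False
          then show ?thesis using that by (simp add: hat_def algebra_simps)
        qed
        then show ?thesis by simp
      qed
      ultimately show ?thesis by (rule has_integral_eq[rotated])
    qed
    \<comment> \<open>The contributions \<open>H m\<close> of the two halves cancel, because the hat
      is continuous at its apex.\<close>
    have "((\<lambda>t. of_real (P t) * f t * of_real (hat t)) has_integral
        ((H m - of_real e1 * (HH m - HH k)) + (- H m + of_real e2 * (HH (k+1) - HH m)))) {k..k+1}"
      by (rule has_integral_combine[OF _ _ I1 I2]) (use m in auto)
    then have "integral {k..k+1} (\<lambda>t. of_real (P t) * f t * of_real (hat t)) = of_real e2 * (HH (k+1) - HH m) - of_real e1 * (HH m - HH k)"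
      by (simp add: integral_unique)
    moreover have "continuous_on {k..k+1} (\<lambda>t. of_real (P t) * f t * of_real (hat t))"
      using continuous_on_subset[OF hat_cont subset_UNIV] P_cont' fc by (intro continuous_intros) auto
    ultimately show ?thesis using set_integral_eq_integral_Icc[of k "k+1"]
      by (simp add: eI_def k f \<eta>_def)
  qed
  define x where "x = m - k"
  have x: "0 < x" "x < 1" "1 - x = k + 1 - m" using m by (auto simp: x_def)
  define A where "A = (f m + HH m) - (f k + HH k)"
  define D where "D = (f (k+1) + HH (k+1)) - (f k + HH k)"
  have "of_real e1 * A = of_real e2 * (D - A)"
    using E[unfolded L R] by (simp add: A_def D_def algebra_simps)
  then have "of_real (x * (1 - x)) * (of_real e1 * A) = of_real (x * (1 - x)) * (of_real e2 * (D - A))" by simp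
  moreover have "x * (1 - x) * e1 = 1 - x" "x * (1 - x) * e2 = x"
  proof -
    have "e1 * x = 1" "e2 * (1 - x) = 1" using e x(3) by (simp_all only: x_def)
    moreover have "x * (1 - x) * e1 = (1 - x) * (e1 * x)" "x * (1 - x) * e2 = x * (e2 * (1 - x))" by (simp_all only: mult_ac)
    ultimately show "x * (1 - x) * e1 = 1 - x" "x * (1 - x) * e2 = x" by simp_all
  qed
  ultimately have "of_real (1 - x) * A = of_real x * (D - A)"
    by (metis mult.assoc of_real_mult)
  then have "A = of_real x * D" by (simp add: algebra_simps)
  then show ?thesis by (simp add: A_def D_def x_def algebra_simps)
qed

text \<open>The hat functions show that \<open>f + HH\<close> is affine, and
  \<open>HH'' = P f\<close>. Thus the weak equation yields two classical derivatives up to the ends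
  of the edge.\<close>

lemma eigenfunction_C2:
  assumes u: "u \<in> eigenspace b V \<mu>" and w: "w \<in> words b"
  shows "\<exists>D. (\<forall>t\<in>cI w.
      ((\<lambda>t. u (edge_path w t)) has_vector_derivative D t) (at t within cI w) \<and>
      (D has_vector_derivative - of_real (P t) * u (edge_path w t)) (at t within cI w)) \<and>
    (AE t in lborel. t \<in> eI w \<longrightarrow> tree_deriv u (w, t) = D t)"
proof -
  have uH: "u \<in> tree_H10 b" using u eigenspace_P by blast
  define k where "k = real (length w)"
  define f where "f = (\<lambda>t. u (edge_path w t))"
  define H where "H t = integral {k..t} (\<lambda>t. of_real (P t) * f t)" for t
  define HH where "HH t = integral {k..t} H" for t
  have fc: "continuous_on {k..k+1} f" unfolding f_def k_def by (rule tree_H10_continuous[OF uH w])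
  have c: "continuous_on {k..k+1} (\<lambda>t. of_real (P t) * f t)" using P_cont' fc by (intro continuous_intros)
  have H: "(H has_vector_derivative of_real (P t) * f t) (at t within {k..k+1})" if "t \<in> {k..k+1}" for t
    unfolding H_def by (rule integral_has_vector_derivative[OF c that])
  have Hc: "continuous_on {k..k+1} H"
    using H has_vector_derivative_continuous continuous_on_eq_continuous_within by blast
  have HH: "(HH has_vector_derivative H t) (at t within {k..k+1})" if "t \<in> {k..k+1}" for t
    unfolding HH_def by (rule integral_has_vector_derivative[OF Hc that])
  define U0 where "U0 = f k + HH k"
  define E where "E = (f (k+1) + HH (k+1)) - (f k + HH k)"
  have aff: "f t = U0 + of_real (t - k) * E - HH t" if t: "t \<in> {k..k+1}" for t
  proof (cases "t = k \<or> t = k + 1")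
    case False
    then have "k < t" "t < k + 1" using t by auto
    from eigenfunction_hat[OF u w f_def k_def H HH this]
    show ?thesis by (simp add: U0_def E_def algebra_simps)
  qed (auto simp: U0_def E_def algebra_simps)
  define D where "D t = E - H t" for t
  have fD: "(f has_vector_derivative D t) (at t within {k..k+1})" if t: "t \<in> {k..k+1}" for t
  proof (rule has_vector_derivative_transform[OF t])
    have "((\<lambda>t. t - k) has_real_derivative 1) (at t within {k..k+1})" by (auto intro!: derivative_eq_intros)
    from has_vector_derivative_diff[OF has_vector_derivative_add[OF has_vector_derivative_const[of U0]
          has_vector_derivative_mult_left[OF has_vector_derivative_of_real[OF this], of E]] HH[OF t]]
    show "((\<lambda>t. U0 + of_real (t - k) * E - HH t) has_vector_derivative D t) (at t within {k..k+1})"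
      by (simp add: D_def)
  qed (use aff in auto)
  have DD: "(D has_vector_derivative - of_real (P t) * f t) (at t within {k..k+1})" if t: "t \<in> {k..k+1}" for t
    using has_vector_derivative_diff[OF has_vector_derivative_const[of E] H[OF t]] by (simp add: D_def[abs_def])
  have Dc: "continuous_on {k..k+1} D"
    using DD has_vector_derivative_continuous continuous_on_eq_continuous_within by blast
  have wd: "has_weak_derivative k (k + 1) (\<lambda>t. u (w, t)) (\<lambda>t. tree_deriv u (w, t))" unfolding k_def by (rule tree_deriv_weak[OF uH w])
  have fu: "\<And>x. x \<in> {k<..<k+1} \<Longrightarrow> f x = u (w, x)" by (simp add: f_def edge_path_def k_def)
  have "AE t in lborel. t \<in> {k<..<k+1} \<longrightarrow> tree_deriv u (w, t) = D t"
  proof (rule weak_derivative_unique[OF wd fc fu set_integrable_continuous_Ioo[OF Dc]])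
    fix s t assume st: "k \<le> s" "s < t" "t \<le> k + 1"
    have sub: "{s..t} \<subseteq> {k..k+1}" using st by auto
    have "(D has_integral f t - f s) {s..t}"
      by (rule fundamental_theorem_of_calculus) (use st sub fD has_vector_derivative_within_subset in \<open>blast | simp\<close>)+
    then show "(LINT x:{s<..<t}|lborel. D x) = f t - f s"
      using set_integral_eq_integral_Icc[OF continuous_on_subset[OF Dc sub]] by (simp add: integral_unique)
  qed auto
  then show ?thesis using fD DD by (intro exI[of _ D]) (simp add: k_def f_def eI_def)
qed

text \<open>The classical derivative on the closed edge, with one-sided values at the vertices;
  \<open>tree_deriv\<close> agrees with it only almost everywhere on the open edge.\<close>

definition edge_deriv :: "(tpoint \<Rightarrow> complex) \<Rightarrow> nat list \<Rightarrow> real \<Rightarrow> complex" where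
  "edge_deriv u w = (SOME D. (\<forall>t\<in>cI w.
      ((\<lambda>t. u (edge_path w t)) has_vector_derivative D t) (at t within cI w) \<and>
      (D has_vector_derivative - of_real (P t) * u (edge_path w t)) (at t within cI w)) \<and>
    (AE t in lborel. t \<in> eI w \<longrightarrow> tree_deriv u (w, t) = D t))"

lemma edge_deriv:
  assumes "u \<in> eigenspace b V \<mu>" "w \<in> words b"
  shows "t \<in> cI w \<Longrightarrow>
      ((\<lambda>t. u (edge_path w t)) has_vector_derivative edge_deriv u w t) (at t within cI w)"
    "t \<in> cI w \<Longrightarrow>
      (edge_deriv u w has_vector_derivative - of_real (P t) * u (edge_path w t)) (at t within cI w)"
    "AE t in lborel. t \<in> eI w \<longrightarrow> tree_deriv u (w, t) = edge_deriv u w t"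
  using someI_ex[OF eigenfunction_C2[OF assms]] unfolding edge_deriv_def[symmetric] by blast+

lemma edge_path_end: "edge_path w (real (length w) + 1) = (w, real (length w) + 1)"
  and edge_path_snoc: "edge_path (w @ [j]) (real (length w) + 1) = (w, real (length w) + 1)"
  by (auto simp: edge_path_def parent_vertex_def add.commute)

lemma edge_affine:
  assumes u: "u \<in> eigenspace b V \<mu>" and w: "w \<in> words b" and k: "k = real (length w)"
  shows "(LINT t:eI w|lborel. of_real (P t) * u (edge_path w t) * of_real (\<alpha> + \<beta> * t))
     = - edge_deriv u w (k+1) * of_real (\<alpha> + \<beta> * (k+1)) + edge_deriv u w k * of_real (\<alpha> + \<beta> * k)
       + of_real \<beta> * (u (edge_path w (k+1)) - u (edge_path w k))"
    "(LINT t:eI w|lborel. tree_deriv u (w, t)) = u (edge_path w (k+1)) - u (edge_path w k)"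
proof -
  have uH: "u \<in> tree_H10 b" using u eigenspace_P by blast
  note ed = edge_deriv[OF u w, folded k]
  have I: "((\<lambda>t. (of_real (P t) * u (edge_path w t)) * of_real (\<alpha> + \<beta> * t)) has_integral
     (- edge_deriv u w (k+1)) * of_real (\<alpha> + \<beta> * (k+1)) - (- edge_deriv u w k) * of_real (\<alpha> + \<beta> * k)
       - of_real \<beta> * ((- u (edge_path w (k+1))) - (- u (edge_path w k)))) {k..k+1}"
  proof (rule affine_integral)
    fix t assume t: "t \<in> {k..k+1}"
    show "((\<lambda>t. - edge_deriv u w t) has_vector_derivative of_real (P t) * u (edge_path w t)) (at t within {k..k+1})"
      using has_vector_derivative_minus[OF ed(2)[OF t]] by simp
    show "((\<lambda>t. - u (edge_path w t)) has_vector_derivative - edge_deriv u w t) (at t within {k..k+1})"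
      by (rule has_vector_derivative_minus[OF ed(1)[OF t]])
  qed simp
  have "continuous_on {k..k+1} (\<lambda>t. (of_real (P t) * u (edge_path w t)) * of_real (\<alpha> + \<beta> * t))"
    using tree_H10_continuous[OF uH w] P_cont' by (intro continuous_intros) (auto simp: k)
  from set_integral_eq_integral_Icc[OF this] integral_unique[OF I]
  show "(LINT t:eI w|lborel. of_real (P t) * u (edge_path w t) * of_real (\<alpha> + \<beta> * t))
     = - edge_deriv u w (k+1) * of_real (\<alpha> + \<beta> * (k+1)) + edge_deriv u w k * of_real (\<alpha> + \<beta> * k)
       + of_real \<beta> * (u (edge_path w (k+1)) - u (edge_path w k))"
    by (simp add: eI_def k[symmetric] algebra_simps)
  show "(LINT t:eI w|lborel. tree_deriv u (w, t)) = u (edge_path w (k+1)) - u (edge_path w k)"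
    unfolding eI_def k
    by (rule weak_derivative_increment[OF tree_deriv_weak[OF uH w] tree_H10_continuous[OF uH w]])
      (auto simp: edge_path_def)
qed

text \<open>The test function rises from 0 to 1 along \<open>w\<close> and falls back to 0 along
  each of its \<open>b\<close> continuations. After integration by parts only the one-sided
  derivatives at the apex survive.\<close>

lemma eigenfunction_kirchhoff:
  assumes u: "u \<in> eigenspace b V \<mu>" and w: "w \<in> words b"
  shows "edge_deriv u w (real (length w) + 1) = (\<Sum>j<b. edge_deriv u (w @ [j]) (real (length w) + 1))"
proof -
  define k where "k = real (length w)"
  define isc where "isc v \<longleftrightarrow> v \<noteq> [] \<and> butlast v = w \<and> v \<in> words b" for v
  define \<eta> where "\<eta> v t = (if v = w then complex_of_real (- k + 1 * t) else if isc v then complex_of_real ((k + 2) + (-1) * t) else 0)" for v t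
  define d where "d v t = (if v = w then 1 else if isc v then - 1 else (0::complex))" for v and t :: real
  define S where "S = insert w ((\<lambda>j. w @ [j]) ` {..<b})"
  have isc_S: "isc v \<longleftrightarrow> v \<in> (\<lambda>j. w @ [j]) ` {..<b}" for v
    by (cases v rule: rev_cases) (use w in \<open>auto simp: isc_def words_snoc\<close>)
  have isc_w: "\<not> isc w" unfolding isc_S by auto
  have isc_snoc: "isc (v @ [j]) \<longleftrightarrow> v = w \<and> j < b" for v j using w by (auto simp: isc_def words_snoc)
  have fS: "finite S" "S \<subseteq> words b" using w by (auto simp: S_def words_snoc)
  have zS: "\<eta> v = (\<lambda>_. 0)" "d v = (\<lambda>_. 0)" if "v \<notin> S" for v
    using that unfolding S_def by (auto simp: \<eta>_def d_def isc_S)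
  have vc: "vertex_compatible b \<eta>"
    unfolding vertex_compatible_def
  proof (intro conjI allI impI)
    show "\<eta> [] 0 = 0" by (auto simp: \<eta>_def isc_def k_def)
    fix v j assume v: "v \<in> words b" "j < b"
    show "\<eta> (v @ [j]) (real (length v) + 1) = \<eta> v (real (length v) + 1)"
    proof (cases "v = w")
      case True
      then show ?thesis using v isc_snoc[of w j] by (simp add: \<eta>_def k_def)
    next
      case False
      have "\<eta> (v @ [j]) (real (length v) + 1) = 0"
        using False isc_snoc[of v j] by (auto simp: \<eta>_def k_def)
      moreover have "\<eta> v (real (length v) + 1) = 0"
        using False by (auto simp: \<eta>_def k_def isc_S)
      ultimately show ?thesis by simp
    qed
  qed
  have \<eta>_cases: "\<eta> v = (\<lambda>t. complex_of_real (- k + 1 * t)) \<and> d v = (\<lambda>_. 1) \<or> \<eta> v = (\<lambda>t. complex_of_real ((k + 2) + (-1) * t)) \<and> d v = (\<lambda>_. -1)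
      \<or> \<eta> v = (\<lambda>_. 0) \<and> d v = (\<lambda>_. 0)" for v
    by (auto simp: \<eta>_def[abs_def] d_def[abs_def])
  have \<eta>c: "continuous_on T (\<eta> v)" for T v
    using \<eta>_cases[of v] by (elim disjE conjE) (simp_all add: continuous_intros)
  have der: "(\<eta> v has_vector_derivative d v t) (at t)" for v t
  proof -
    have 1: "((\<lambda>t. - k + 1 * t) has_real_derivative 1) (at t)" "((\<lambda>t. (k + 2) + (-1) * t) has_real_derivative -1) (at t)"
      by (auto intro!: derivative_eq_intros)
    show ?thesis
      using \<eta>_cases[of v] has_vector_derivative_of_real[OF 1(1)] has_vector_derivative_of_real[OF 1(2)]
      by (elim disjE conjE) simp_all
  qed
  have dm: "set_borel_measurable lborel (eI v) (d v)" for v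
    using \<eta>_cases[of v] eI_borel unfolding set_borel_measurable_def by (elim disjE conjE) simp_all
  have db: "norm (d v t) \<le> 1" for v t by (simp add: d_def)
  have fin: "finite {}" by simp
  note T = tree_fun_H10_finite[where d=d and F="\<lambda>v. {}" and M="\<lambda>_. 1" and S=S, OF vc \<eta>c fin der dm db fS(1) zS]
  have H10: "tree_fun b \<eta> \<in> tree_H10 b" by (rule T(1)) auto
  have AE: "AE t in lborel. t \<in> eI v \<longrightarrow> tree_deriv (tree_fun b \<eta>) (v, t) = d v t" if "v \<in> words b" for v
    by (rule T(2)) (use that in auto)
  have inj: "inj_on (\<lambda>j. w @ [j]) {..<b}" by (rule inj_onI) simp
  have sumS: "(\<Sum>v\<in>S. g v) = g w + (\<Sum>j<b. g (w @ [j]))" for g :: "nat list \<Rightarrow> complex"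
    unfolding S_def using inj by (subst sum.insert) (auto simp: sum.reindex)
  define f0 where "f0 = u (w, k + 1)"
  have "(\<Sum>v\<in>S. (LINT t:eI v|lborel. tree_deriv u (v, t) * cnj (d v t))) =
    (\<Sum>v\<in>S. (LINT t:eI v|lborel. of_real (P t) * u (edge_path v t) * cnj (\<eta> v t)))"
    by (rule eigenfunction_test[OF u H10 AE dm fS zS])
  moreover have "(LINT t:eI w|lborel. tree_deriv u (w, t) * cnj (d w t)) = f0 - u (edge_path w k)"
    using edge_affine(2)[OF u w k_def] edge_path_end[of w] by (simp add: d_def f0_def k_def)
  moreover have "(LINT t:eI w|lborel. of_real (P t) * u (edge_path w t) * cnj (\<eta> w t))
      = - edge_deriv u w (k + 1) + (f0 - u (edge_path w k))"
    using edge_affine(1)[OF u w k_def, of "- k" 1] edge_path_end[of w] by (simp add: \<eta>_def f0_def k_def)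
  moreover have "(LINT t:eI (w @ [j])|lborel. tree_deriv u (w @ [j], t) * cnj (d (w @ [j]) t)) = - (u (edge_path (w @ [j]) (k + 2)) - f0)"
    if j: "j < b" for j
    using edge_affine(2)[OF u, of "w @ [j]" "k + 1"] edge_path_snoc[of w j] w j isc_snoc[of w j]
    by (simp add: d_def f0_def k_def words_snoc set_lebesgue_integral_def add.commute add.left_commute)
  moreover have "(LINT t:eI (w @ [j])|lborel. of_real (P t) * u (edge_path (w @ [j]) t) * cnj (\<eta> (w @ [j]) t))
      = edge_deriv u (w @ [j]) (k + 1) - (u (edge_path (w @ [j]) (k + 2)) - f0)" if j: "j < b" for j
  proof -
    have wj: "w @ [j] \<in> words b" "k + 1 = real (length (w @ [j]))" using w j by (auto simp: words_snoc k_def)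
    have "\<eta> (w @ [j]) = (\<lambda>t. complex_of_real ((k + 2) + (-1) * t))" using isc_snoc[of w j] j by (auto simp: \<eta>_def fun_eq_iff)
    then have "(LINT t:eI (w @ [j])|lborel. of_real (P t) * u (edge_path (w @ [j]) t) * cnj (\<eta> (w @ [j]) t))
      = (LINT t:eI (w @ [j])|lborel. of_real (P t) * u (edge_path (w @ [j]) t) * of_real ((k + 2) + (-1) * t))" by simp
    also have "\<dots> = - edge_deriv u (w @ [j]) (k + 1 + 1) * of_real ((k + 2) + (-1) * (k + 1 + 1)) + edge_deriv u (w @ [j]) (k + 1) * of_real ((k + 2) + (-1) * (k + 1))
       + of_real (-1) * (u (edge_path (w @ [j]) (k + 1 + 1)) - u (edge_path (w @ [j]) (k + 1)))"
      by (rule edge_affine(1)[OF u wj])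
    also have "k + 1 + 1 = k + 2" by simp
    finally show ?thesis using edge_path_snoc[of w j] by (simp add: f0_def k_def)
  qed
  ultimately show ?thesis unfolding sumS by (simp add: sum_negf sum_subtractf k_def)
qed

end

section \<open>Eigenfunctions are multiples of the decaying solution\<close>

text \<open>The derivative is continued by its end values. The purpose is
  \<open>weak_integration_by_parts\<close>, which takes multipliers on the whole line, whereas the
  decaying solution is given edge by edge.\<close>

lemma extend_C1:
  fixes f f' :: "real \<Rightarrow> real"
  assumes ac: "a < c" and f: "\<And>x. x \<in> {a..c} \<Longrightarrow> (f has_real_derivative f' x) (at x within {a..c})"
    and f': "continuous_on {a..c} f'"
  shows "\<exists>g g'. (\<forall>x. (g has_real_derivative g' x) (at x)) \<and> continuous_on UNIV g' \<and> (\<forall>x\<in>{a..c}. g x = f x \<and> g' x = f' x)"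
proof -
  define h where "h x = f' (max a (min c x))" for x
  have hc: "continuous_on UNIV h"
    unfolding h_def by (rule continuous_on_compose2[OF f']) (use ac in \<open>auto intro!: continuous_intros\<close>)
  have "\<exists>F. \<forall>x::real. (-\<infinity>::ereal) < x \<longrightarrow> x < (\<infinity>::ereal) \<longrightarrow> (F has_vector_derivative h x) (at x)"
    by (rule einterval_antiderivative) (use hc in \<open>auto simp: continuous_on_eq_continuous_at\<close>)
  then obtain F where F: "\<And>x. (F has_real_derivative h x) (at x)"
    by (auto simp: has_real_derivative_iff_has_vector_derivative)
  have hf: "h x = f' x" if "x \<in> {a..c}" for x using that by (simp add: h_def)
  have "((\<lambda>x. F x - f x) has_real_derivative 0) (at x within {a..c})" if x: "x \<in> {a..c}" for x
    using DERIV_diff[OF DERIV_subset[OF F[of x] subset_UNIV] f[OF x]] hf[OF x] by simp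
  then obtain C where C: "\<And>x. x \<in> {a..c} \<Longrightarrow> F x - f x = C"
    using has_field_derivative_zero_constant[of "{a..c}" "\<lambda>x. F x - f x"] by auto
  have G: "((\<lambda>x. F x - C) has_real_derivative h x) (at x)" for x
    using DERIV_diff[OF F[of x] DERIV_const[of C]] by simp
  have eq: "\<forall>x\<in>{a..c}. F x - C = f x \<and> h x = f' x" using C hf by force
  show ?thesis using G hc eq by blast
qed

text \<open>The reflection \<open>x = c - t\<close> turns the data at the upper end into initial
  data on the unit interval; real and imaginary parts then vanish by uniqueness.\<close>

lemma complex_ode_zero:
  fixes G G' :: "real \<Rightarrow> complex"
  assumes P: "continuous_on UNIV P" and n: "c = a + 1"
    and G: "\<And>t. t \<in> {a..c} \<Longrightarrow> (G has_vector_derivative G' t) (at t within {a..c})"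
    and G': "\<And>t. t \<in> {a..c} \<Longrightarrow> (G' has_vector_derivative - of_real (P t) * G t) (at t within {a..c})"
    and z: "G c = 0" "G' c = 0" and t: "t \<in> {a..c}"
  shows "G t = 0 \<and> G' t = 0"
proof -
  let ?R = "\<lambda>x. P (c - x)"
  have im: "(\<lambda>x. c - x) ` {0..1} = {a..c}" using n by (simp add: image_diff_atLeastAtMost)
  have Rc: "continuous_on {0..1} ?R" by (rule continuous_on_compose2[OF P]) (auto intro!: continuous_intros)
  have zero: "ode_sol ?R (\<lambda>_. 0) (\<lambda>_. 0)" by (simp add: ode_sol_def)
  have "ode_sol ?R (\<lambda>_. 0) (\<lambda>x. (L (G (c - x)), - L (G' (c - x))))" if L: "bounded_linear L" "\<And>r z. L (of_real r * z) = r * L z"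
    for L :: "complex \<Rightarrow> real"
    unfolding ode_sol_def
  proof (intro ballI conjI)
    fix x :: real assume x: "x \<in> {0..1}"
    have cx: "c - x \<in> {a..c}" using x n by auto
    have m: "((\<lambda>x. c - x) has_real_derivative -1) (at x within {0..1})" by (auto intro!: derivative_eq_intros)
    have 1: "((\<lambda>t. L (G t)) has_real_derivative L (G' (c - x))) (at (c - x) within (\<lambda>x. c - x) ` {0..1})"
      using bounded_linear.has_vector_derivative[OF L(1) G[OF cx]] unfolding im
      by (simp add: has_real_derivative_iff_has_vector_derivative)
    have 2: "((\<lambda>t. L (G' t)) has_real_derivative L (- of_real (P (c - x)) * G (c - x))) (at (c - x) within (\<lambda>x. c - x) ` {0..1})"
      using bounded_linear.has_vector_derivative[OF L(1) G'[OF cx]] unfolding im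
      by (simp add: has_real_derivative_iff_has_vector_derivative)
    have L2: "L (- of_real (P (c - x)) * G (c - x)) = - P (c - x) * L (G (c - x))"
      using L(2)[of "- P (c - x)" "G (c - x)"] by simp
    from DERIV_image_chain[OF 1 m]
    show "((\<lambda>x. fst (L (G (c - x)), - L (G' (c - x)))) has_real_derivative snd (L (G (c - x)), - L (G' (c - x)))) (at x within {0..1})"
      by (simp add: o_def)
    from DERIV_minus[OF DERIV_image_chain[OF 2 m]]
    show "((\<lambda>x. snd (L (G (c - x)), - L (G' (c - x)))) has_real_derivative 0 - P (c - x) * fst (L (G (c - x)), - L (G' (c - x)))) (at x within {0..1})"
      using L2 by (simp add: o_def)
  qed
  then have *: "L (G (c - x)) = 0 \<and> L (G' (c - x)) = 0" if "bounded_linear L" "\<And>r z. L (of_real r * z) = r * L z" "x \<in> {0..1}" for L x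
    using ode_sol_unique[OF _ zero Rc _ that(3), of "\<lambda>x. (L (G (c - x)), - L (G' (c - x)))"] that(1,2) z linear_0[OF bounded_linear.linear[OF that(1)]]
    by (simp add: zero_prod_def)
  have "c - t \<in> {0..1}" using t n by auto
  from *[OF bounded_linear_Re _ this] *[OF bounded_linear_Im _ this] show ?thesis by (simp add: complex_eq_iff)
qed

locale decaying_eigenfunction = window +
  fixes s \<mu> :: real and V :: "real \<Rightarrow> real"
  assumes s0: "0 \<le> s" and mu: "\<mu> \<in> J0" and V_eq: "\<And>t. t > 0 \<Longrightarrow> V t = - s * q t"
begin

lemma q_le_C: "t > 0 \<Longrightarrow> q t \<le> C"
proof -
  assume t: "t > 0"
  have "B powr (- 2 * t) \<le> B powr 0" using B2 t by (intro powr_mono) auto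
  then have "C * B powr (- 2 * t) \<le> C * 1" using C_pos B2 by (intro mult_left_mono) auto
  then show ?thesis using q_upper[of t] t by simp
qed

sublocale tree_potential b V "\<lambda>t. \<mu> + s * q t" \<mu> "s * C"
proof
  show "continuous_on {0<..} V"
    by (rule continuous_on_eq[of _ "\<lambda>t. - s * q t"]) (use V_eq in \<open>auto intro!: continuous_intros q_cont'\<close>)
  show "\<bar>V t\<bar> \<le> s * C" if "t > 0" for t
    using V_eq[OF that] q_le_C[OF that] q_pos[of t] that s0 by (simp add: abs_mult mult_left_mono)
  show "continuous_on UNIV (\<lambda>t. \<mu> + s * q t)" by (intro continuous_intros q_cont)
  show "\<mu> + s * q t = \<mu> - V t" if "t > 0" for t using V_eq[OF that] by simp
qed

abbreviation "pp \<equiv> (s, \<mu>)"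
abbreviation "P \<equiv> \<lambda>t. \<mu> + s * q t"

lemma pp: "pp \<in> {0..} \<times> J" "pp \<in> {0..s} \<times> J" "\<mu> \<in> J" using s0 mu by (auto simp: J0_def)

section \<open>The decaying solution in the height variable\<close>

definition r :: real where "r = 1 / \<bar>bet \<mu>\<bar>"

text \<open>\<open>r\<close> is the amplitude factor per generation.
  \<open>B * r\<^sup>2 < 1\<close> expresses square summability over \<open>b^n\<close> edges of
  amplitude \<open>r^n\<close>; it holds because \<mu> lies strictly inside the gap.\<close>

lemma r: "0 < r" "r \<le> 1" "B * r\<^sup>2 < 1"
proof -
  have 1: "sqrt B < \<bar>bet \<mu>\<bar>"
    using bet_props(3)[OF pp(3)] mu bet_abs(1)[OF pp(3)] by (simp add: J0_def)
  show "0 < r" "r \<le> 1" using bet_abs[OF pp(3)] by (auto simp: r_def)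
  have "(sqrt B)\<^sup>2 < \<bar>bet \<mu>\<bar>\<^sup>2" using 1 B2 by (intro power_strict_mono) auto
  then show "B * r\<^sup>2 < 1" using B2 bet_abs(4)[OF pp(3)] by (simp add: r_def power_divide divide_simps)
qed

text \<open>Undoes the reflection and the normalisation. The exponent is \<open>Suc n\<close>
  because \<open>Y n\<close> starts from the state \<open>v (Suc n)\<close> at the upper end of the
  edge.\<close>

definition ps :: "nat \<Rightarrow> real \<Rightarrow> real" where
  "ps n t = (1 / bet \<mu>) ^ Suc n * fst (Y n pp (real n + 1 - t))"
definition pd :: "nat \<Rightarrow> real \<Rightarrow> real" where
  "pd n t = - ((1 / bet \<mu>) ^ Suc n * snd (Y n pp (real n + 1 - t)))"
text \<open>Value at a vertex of height \<open>k\<close>; the companion \<open>PD k\<close> is the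
  derivative on each edge above it, so the edge below has derivative \<open>B * PD k\<close>
  there.\<close>

definition PS :: "nat \<Rightarrow> real" where "PS k = (1 / bet \<mu>) ^ k * fst (v k pp)"
definition PD :: "nat \<Rightarrow> real" where "PD k = (1 / bet \<mu>) ^ k * snd (v k pp)"

lemma ps_deriv:
  assumes t: "t \<in> {real n..real n + 1}"
  shows "(ps n has_real_derivative pd n t) (at t within {real n..real n + 1})"
    "(pd n has_real_derivative - P t * ps n t) (at t within {real n..real n + 1})"
proof -
  let ?g = "\<lambda>t. real n + 1 - t"
  have im: "?g ` {real n..real n + 1} = {0..1}" by (simp add: image_diff_atLeastAtMost)
  have x: "?g t \<in> {0..1}" using t by auto
  have m: "(?g has_real_derivative -1) (at t within {real n..real n + 1})" by (auto intro!: derivative_eq_intros)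
  note d = ode_solD[OF Y_sol x, of n pp]
  have 1: "((\<lambda>x. fst (Y n pp x)) has_real_derivative snd (Y n pp (?g t))) (at (?g t) within ?g ` {real n..real n + 1})"
    using d(1) unfolding im .
  have 2: "((\<lambda>x. snd (Y n pp x)) has_real_derivative - (P t * fst (Y n pp (?g t)))) (at (?g t) within ?g ` {real n..real n + 1})"
    using d(2) unfolding im by (simp add: pot_def)
  from DERIV_cmult[OF DERIV_image_chain[OF 1 m], of "(1 / bet \<mu>) ^ Suc n"]
  show "(ps n has_real_derivative pd n t) (at t within {real n..real n + 1})"
    by (simp add: ps_def[abs_def] pd_def o_def del: power_Suc)
  from DERIV_minus[OF DERIV_cmult[OF DERIV_image_chain[OF 2 m], of "(1 / bet \<mu>) ^ Suc n"]]
  show "(pd n has_real_derivative - P t * ps n t) (at t within {real n..real n + 1})"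
    by (simp add: ps_def pd_def[abs_def] o_def algebra_simps del: power_Suc)
qed

lemma ps_vertex: "ps n (real n) = PS n" "ps n (real n + 1) = PS (Suc n)"
  "pd n (real n) = PD n" "pd n (real n + 1) = B * PD (Suc n)"
  using bet_abs(4)[OF pp(3)] by (simp_all add: ps_def pd_def PS_def PD_def Y_0 Y_1[OF pp(1)] field_simps)

lemma PS_PD_nonzero: "PS k \<noteq> 0 \<or> PD k \<noteq> 0"
  using v_nonzero[OF pp(1), of k] bet_abs(4)[OF pp(3)] by (auto simp: PS_def PD_def prod_eq_iff)

lemma PS_eq_0_iff: "PS k = 0 \<longleftrightarrow> fst (v k pp) = 0"
  using bet_abs(4)[OF pp(3)] by (simp add: PS_def)

lemma ps_bound: "\<exists>M>0. \<forall>n. \<forall>t\<in>{real n..real n + 1}. \<bar>ps n t\<bar> \<le> M * r ^ n \<and> \<bar>pd n t\<bar> \<le> M * r ^ n"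
proof -
  obtain M where M: "M > 0" "\<And>n p x. p \<in> {0..s}\<times>J \<Longrightarrow> x \<in> {0..1} \<Longrightarrow> norm (Y n p x) \<le> M"
    using Y_bounded[OF s0] by blast
  have rn: "\<bar>(1 / bet \<mu>) ^ Suc n\<bar> \<le> r ^ n" for n
  proof -
    have "\<bar>(1 / bet \<mu>) ^ Suc n\<bar> = r ^ Suc n" unfolding power_abs r_def by simp
    also have "\<dots> \<le> r ^ n" using r(1,2) by (intro power_decreasing) auto
    finally show ?thesis .
  qed
  have "\<bar>ps n t\<bar> \<le> M * r ^ n \<and> \<bar>pd n t\<bar> \<le> M * r ^ n" if t: "t \<in> {real n..real n + 1}" for n t
  proof -
    have x: "real n + 1 - t \<in> {0..1}" using t by auto
    have "\<bar>fst (Y n pp (real n + 1 - t))\<bar> \<le> M" "\<bar>snd (Y n pp (real n + 1 - t))\<bar> \<le> M"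
      using M(2)[OF pp(2) x, of n] norm_fst_le[of "fst (Y n pp (real n + 1 - t))" "snd (Y n pp (real n + 1 - t))"]
        norm_snd_le[of "snd (Y n pp (real n + 1 - t))" "fst (Y n pp (real n + 1 - t))"] by auto
    then have "\<bar>(1 / bet \<mu>) ^ Suc n\<bar> * \<bar>fst (Y n pp (real n + 1 - t))\<bar> \<le> r ^ n * M"
      "\<bar>(1 / bet \<mu>) ^ Suc n\<bar> * \<bar>snd (Y n pp (real n + 1 - t))\<bar> \<le> r ^ n * M"
      using rn[of n] r(1) by (auto intro!: mult_mono simp del: power_Suc)
    then show ?thesis by (simp add: ps_def pd_def abs_mult mult.commute del: power_Suc)
  qed
  then show ?thesis using M(1) by blast
qed

definition Mb :: real where
  "Mb = (SOME M. M > 0 \<and> (\<forall>n. \<forall>t\<in>{real n..real n + 1}. \<bar>ps n t\<bar> \<le> M * r ^ n \<and> \<bar>pd n t\<bar> \<le> M * r ^ n))"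

lemma Mb: "Mb > 0" "t \<in> {real n..real n + 1} \<Longrightarrow> \<bar>ps n t\<bar> \<le> Mb * r ^ n" "t \<in> {real n..real n + 1} \<Longrightarrow> \<bar>pd n t\<bar> \<le> Mb * r ^ n"
  using someI_ex[OF ps_bound] unfolding Mb_def[symmetric] by blast+

lemma geometric_decay: "(\<lambda>n. real b ^ n * (K * (r ^ n)\<^sup>2)) \<longlonglongrightarrow> 0"
proof -
  have "(r ^ n)\<^sup>2 = (r\<^sup>2) ^ n" for n by (metis power_mult mult.commute)
  then have "(\<lambda>n. real b ^ n * (K * (r ^ n)\<^sup>2)) = (\<lambda>n. K * (B * r\<^sup>2) ^ n)"
    by (simp only: power_mult_distrib mult_ac)
  moreover have "(\<lambda>n. K * (B * r\<^sup>2) ^ n) \<longlonglongrightarrow> K * 0"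
    using r B2 by (intro tendsto_mult tendsto_const LIMSEQ_realpow_zero) auto
  ultimately show ?thesis by (simp only: mult_zero_right)
qed

section \<open>The Wronskian of an eigenfunction with the decaying solution\<close>

definition Wr :: "(tpoint \<Rightarrow> complex) \<Rightarrow> nat list \<Rightarrow> complex" where
  "Wr u w = u (w, real (length w) + 1) * of_real (B * PD (Suc (length w)))
     - edge_deriv u w (real (length w) + 1) * of_real (PS (Suc (length w)))"

lemma set_integral_eI_const: "(LINT t:eI w|lborel. (x :: real)) = x"
  by (simp add: set_lebesgue_integral_def eI_def)

context
  fixes u assumes u: "u \<in> eigenspace b V \<mu>"
begin

lemma uH: "u \<in> tree_H10 b" using u eigenspace_P by blast

lemma Wr_const:
  assumes w: "w \<in> words b" and t: "t \<in> cI w"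
  shows "u (edge_path w t) * of_real (pd (length w) t) - edge_deriv u w t * of_real (ps (length w) t) = Wr u w"
proof -
  let ?I = "(cI w)"
  let ?W = "\<lambda>t. u (edge_path w t) * of_real (pd (length w) t) - edge_deriv u w t * of_real (ps (length w) t)"
  have "(?W has_vector_derivative 0) (at t within ?I)" if t: "t \<in> ?I" for t
    using has_vector_derivative_diff[OF has_vector_derivative_mult[OF edge_deriv(1)[OF u w t] has_vector_derivative_of_real[OF ps_deriv(2)[OF t]]]
        has_vector_derivative_mult[OF edge_deriv(2)[OF u w t] has_vector_derivative_of_real[OF ps_deriv(1)[OF t]]]]
    by (simp add: algebra_simps)
  then obtain W where W: "\<And>t. t \<in> ?I \<Longrightarrow> ?W t = W"
    using has_vector_derivative_zero_constant[OF convex_real_interval(5), of "real (length w)" "real (length w) + 1" ?W] by blast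
  have "?W (real (length w) + 1) = Wr u w" by (simp add: Wr_def ps_vertex edge_path_end)
  then show ?thesis using W[OF t] W[of "real (length w) + 1"] by simp
qed

text \<open>At the vertex the value is shared by all branches, the derivatives of \<open>u\<close>
  add up by Kirchhoff's condition, and the derivative of the decaying solution below is
  \<open>b\<close> times the one above.\<close>

lemma Wr_branch:
  assumes w: "w \<in> words b"
  shows "Wr u w = (\<Sum>j<b. Wr u (w @ [j]))"
proof -
  let ?k = "real (length w) + 1"
  have "Wr u (w @ [j]) = u (w, ?k) * of_real (PD (Suc (length w))) - edge_deriv u (w @ [j]) ?k * of_real (PS (Suc (length w)))" if j: "j < b" for j
    using Wr_const[of "w @ [j]" ?k] ps_vertex(1,3)[of "Suc (length w)"] edge_path_snoc[of w j] w j by (simp add: words_snoc add.commute)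
  then have "(\<Sum>j<b. Wr u (w @ [j])) = of_real B * (u (w, ?k) * of_real (PD (Suc (length w)))) - (\<Sum>j<b. edge_deriv u (w @ [j]) ?k) * of_real (PS (Suc (length w)))"
    by (simp add: sum_subtractf sum_distrib_right)
  then show ?thesis unfolding eigenfunction_kirchhoff[OF u w, symmetric] by (simp add: Wr_def)
qed

lemma append_words: "w \<in> words b \<Longrightarrow> x \<in> words b \<Longrightarrow> w @ x \<in> words b"
  by (auto simp: words_def)

lemma Wr_descendants: "w \<in> words b \<Longrightarrow> Wr u w = (\<Sum>x\<in>level b n. Wr u (w @ x))"
proof (induction n)
  case 0
  then show ?case by (simp add: level_0)
next
  case (Suc n)
  have "Wr u (w @ x) = (\<Sum>j<b. Wr u (w @ x @ [j]))" if "x \<in> level b n" for x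
    using Wr_branch[of "w @ x"] append_words[OF Suc.prems, of x] that by (simp add: level_def)
  then show ?case using Suc by (simp add: sum_level_Suc)
qed

text \<open>Being constant on the edge, the Wronskian equals its mean over it, which the squares of
  the two functions and of their derivatives dominate.\<close>

lemma Wr_bound:
  assumes w: "w \<in> words b"
  shows "norm (Wr u w) \<le> (LINT t:eI w|lborel. (cmod (tree_deriv u (w, t)))\<^sup>2 + (cmod (u (w, t)))\<^sup>2) + 2 * Mb\<^sup>2 * (r ^ length w)\<^sup>2"
proof -
  let ?e = "\<lambda>t. (cmod (tree_deriv u (w, t)))\<^sup>2 + (cmod (u (w, t)))\<^sup>2"
  let ?c = "2 * Mb\<^sup>2 * (r ^ length w)\<^sup>2"
  have i: "set_integrable lborel (eI w) ?e" by (rule tree_H10_sections(3)[OF uH w])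
  have ic: "set_integrable lborel (eI w) (\<lambda>t. x)" for x :: real
    unfolding eI_def by (rule set_integrable_continuous_Ioo) auto
  have "norm (Wr u w) = (LINT t:eI w|lborel. norm (Wr u w))" by (simp only: set_integral_eI_const)
  also have "\<dots> \<le> (LINT t:eI w|lborel. ?e t + ?c)"
    unfolding set_lebesgue_integral_def
  proof (rule integral_mono_AE)
    show "integrable lborel (\<lambda>t. indicat_real (eI w) t *\<^sub>R norm (Wr u w))" using ic[of "norm (Wr u w)"] by (simp only: set_integrable_def)
    show "integrable lborel (\<lambda>t. indicat_real (eI w) t *\<^sub>R (?e t + ?c))"
      using set_integral_add(1)[OF i ic] by (simp only: set_integrable_def)
    show "AE t in lborel. indicat_real (eI w) t *\<^sub>R norm (Wr u w) \<le> indicat_real (eI w) t *\<^sub>R (?e t + ?c)"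
      using edge_deriv(3)[OF u w]
    proof eventually_elim
      case (elim t)
      show ?case
      proof (cases "t \<in> eI w")
        case True
        then have t: "t \<in> cI w" by (auto simp: eI_def)
        have td: "edge_deriv u w t = tree_deriv u (w, t)" using elim True by simp
        have W: "Wr u w = u (w, t) * of_real (pd (length w) t) - tree_deriv u (w, t) * of_real (ps (length w) t)"
          using Wr_const[OF w t] edge_path_eI[OF True] td by simp
        have "norm (Wr u w) \<le> cmod (u (w, t)) * \<bar>pd (length w) t\<bar> + cmod (tree_deriv u (w, t)) * \<bar>ps (length w) t\<bar>"
          unfolding W by (rule order_trans[OF norm_triangle_ineq4]) (simp add: norm_mult)
        also have "cmod (u (w, t)) * \<bar>pd (length w) t\<bar> \<le> (cmod (u (w, t)))\<^sup>2 + (pd (length w) t)\<^sup>2"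
          using norm_mult_le_squares[of "u (w, t)" "of_real (pd (length w) t)"] by (simp add: norm_mult)
        also have "cmod (tree_deriv u (w, t)) * \<bar>ps (length w) t\<bar> \<le> (cmod (tree_deriv u (w, t)))\<^sup>2 + (ps (length w) t)\<^sup>2"
          using norm_mult_le_squares[of "tree_deriv u (w, t)" "of_real (ps (length w) t)"] by (simp add: norm_mult)
        also have "(pd (length w) t)\<^sup>2 \<le> (Mb * r ^ length w)\<^sup>2" using Mb(3)[OF t] by (rule abs_le_square_iff[THEN iffD1, OF order_trans[OF _ abs_ge_self]])
        also have "(ps (length w) t)\<^sup>2 \<le> (Mb * r ^ length w)\<^sup>2" using Mb(2)[OF t] by (rule abs_le_square_iff[THEN iffD1, OF order_trans[OF _ abs_ge_self]])
        finally have "norm (Wr u w) \<le> ?e t + ?c" by (simp add: power_mult_distrib algebra_simps)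
        then show ?thesis using True by simp
      qed simp
    qed
  qed
  also have "\<dots> = (LINT t:eI w|lborel. ?e t) + ?c"
    by (subst set_integral_add(2)[OF i ic]) (simp only: set_integral_eI_const)
  finally show ?thesis .
qed

text \<open>The Wronskian equals its sum over the \<open>n\<close>-th generation of descendants. The
  bounds add up to the energy of \<open>u\<close> in one generation and a multiple of
  \<open>b^n r^(2n)\<close>, and both tend to 0.\<close>

lemma Wr_zero:
  assumes w: "w \<in> words b" shows "Wr u w = 0"
proof -
  let ?k = "length w"
  let ?E = "\<lambda>w. LINT t:eI w|lborel. (cmod (tree_deriv u (w, t)))\<^sup>2 + (cmod (u (w, t)))\<^sup>2"
  let ?c = "2 * Mb\<^sup>2"
  have E0: "?E v \<ge> 0" for v by (simp add: set_lebesgue_integral_def)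
  have "norm (Wr u w) \<le> (\<Sum>v\<in>level b (?k + n). ?E v) + real b ^ n * (?c * (r ^ n)\<^sup>2)" for n
  proof -
    have "norm (Wr u w) \<le> (\<Sum>x\<in>level b n. norm (Wr u (w @ x)))"
      unfolding Wr_descendants[OF w, of n] by (rule norm_sum)
    also have "\<dots> \<le> (\<Sum>x\<in>level b n. ?E (w @ x) + ?c * (r ^ n)\<^sup>2)"
    proof (rule sum_mono)
      fix x assume x: "x \<in> level b n"
      then have "norm (Wr u (w @ x)) \<le> ?E (w @ x) + ?c * (r ^ length (w @ x))\<^sup>2"
        by (intro Wr_bound append_words w) (auto simp: level_def)
      also have "r ^ length (w @ x) \<le> r ^ n" using r x by (intro power_decreasing) (auto simp: level_def)
      then have "?c * (r ^ length (w @ x))\<^sup>2 \<le> ?c * (r ^ n)\<^sup>2" using r by (intro mult_left_mono power_mono) auto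
      finally show "norm (Wr u (w @ x)) \<le> ?E (w @ x) + ?c * (r ^ n)\<^sup>2" by simp
    qed
    also have "\<dots> = (\<Sum>x\<in>level b n. ?E (w @ x)) + real b ^ n * (?c * (r ^ n)\<^sup>2)"
      by (simp add: sum.distrib card_level)
    also have "(\<Sum>x\<in>level b n. ?E (w @ x)) = (\<Sum>v\<in>(@) w ` level b n. ?E v)"
      by (subst sum.reindex) (auto intro: inj_onI)
    also have "\<dots> \<le> (\<Sum>v\<in>level b (?k + n). ?E v)"
      by (intro sum_mono2 finite_level E0) (use append_words[OF w] in \<open>auto simp: level_def\<close>)
    finally show ?thesis by simp
  qed
  moreover have "(\<lambda>n. (\<Sum>v\<in>level b (?k + n). ?E v) + real b ^ n * (?c * (r ^ n)\<^sup>2)) \<longlonglongrightarrow> 0 + 0"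
    using LIMSEQ_ignore_initial_segment[OF level_energy_tendsto_0[OF uH], of ?k]
    by (intro tendsto_add geometric_decay) (simp add: add.commute)
  ultimately have "norm (Wr u w) \<le> 0" by (intro LIMSEQ_le_const[of _ 0]) auto
  then show ?thesis by simp
qed

text \<open>Since the data of the decaying solution at the upper end do not vanish, a zero Wronskian
  makes the data of \<open>u\<close> a multiple of them, and uniqueness extends this to the
  edge.\<close>

lemma eigenfunction_on_edge:
  assumes w: "w \<in> words b"
  shows "\<exists>a. \<forall>t\<in>cI w.
    u (edge_path w t) = a * of_real (ps (length w) t) \<and> edge_deriv u w t = a * of_real (pd (length w) t)"
proof -
  let ?n = "length w"
  let ?I = "{real ?n..real ?n + 1}"
  let ?f = "u (w, real ?n + 1)" and ?d = "edge_deriv u w (real ?n + 1)"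
  have W: "?f * of_real (B * PD (Suc ?n)) = ?d * of_real (PS (Suc ?n))" using Wr_zero[OF w] by (simp add: Wr_def)
  obtain a where a: "?f = a * of_real (PS (Suc ?n))" "?d = a * of_real (B * PD (Suc ?n))"
  proof (cases "PS (Suc ?n) = 0")
    case False
    then show ?thesis using W by (intro that[of "?f / of_real (PS (Suc ?n))"]) (auto simp: field_simps)
  next
    case True
    then have "B * PD (Suc ?n) \<noteq> 0" using PS_PD_nonzero[of "Suc ?n"] B2 by auto
    then show ?thesis using W True by (intro that[of "?d / of_real (B * PD (Suc ?n))"]) (auto simp del: of_real_mult)
  qed
  define G where "G t = u (edge_path w t) - a * of_real (ps ?n t)" for t
  define G' where "G' t = edge_deriv u w t - a * of_real (pd ?n t)" for t
  have "G t = 0 \<and> G' t = 0" if t: "t \<in> ?I" for t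
  proof (rule complex_ode_zero[OF P_cont _ _ _ _ _ t])
    fix t assume t: "t \<in> ?I"
    show "(G has_vector_derivative G' t) (at t within ?I)"
      unfolding G_def[abs_def] G'_def
      by (intro has_vector_derivative_diff edge_deriv(1)[OF u w t] has_vector_derivative_mult_right has_vector_derivative_of_real ps_deriv(1)[OF t])
    have "(G' has_vector_derivative (- of_real (P t) * u (edge_path w t) - a * of_real (- P t * ps ?n t))) (at t within ?I)"
      unfolding G'_def[abs_def]
      by (intro has_vector_derivative_diff edge_deriv(2)[OF u w t] has_vector_derivative_mult_right has_vector_derivative_of_real ps_deriv(2)[OF t])
    then show "(G' has_vector_derivative - of_real (P t) * G t) (at t within ?I)"
      by (simp add: G_def algebra_simps)
  next
    show "G (real ?n + 1) = 0" "G' (real ?n + 1) = 0"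
      using a by (simp_all add: G_def G'_def ps_vertex edge_path_end)
  qed simp
  then show ?thesis by (intro exI[of _ a]) (simp add: G_def G'_def)
qed

end

text \<open>The vertex conditions for the multiples \<open>a w\<close>: the Dirichlet condition at
  the root, continuity, which matters where the solution does not vanish, and Kirchhoff's condition
  divided by the common derivative. The latter can be imposed at every vertex, as equal multiples
  satisfy it. The value 0 off \<open>words b\<close> makes the coefficients unique.\<close>

definition coeffs :: "(nat list \<Rightarrow> complex) set" where
  "coeffs = {a. (fst (v 0 pp) \<noteq> 0 \<longrightarrow> a [] = 0) \<and>
     (\<forall>w\<in>words b. fst (v (Suc (length w)) pp) \<noteq> 0 \<longrightarrow> (\<forall>j<b. a (w @ [j]) = a w)) \<and>
     (\<forall>w\<in>words b. (\<Sum>j<b. a (w @ [j])) = of_nat b * a w) \<and> (\<forall>w. w \<notin> words b \<longrightarrow> a w = 0)}"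

definition radial_fun :: "(nat list \<Rightarrow> complex) \<Rightarrow> tpoint \<Rightarrow> complex" where
  "radial_fun a = tree_fun b (\<lambda>w t. a w * of_real (ps (length w) t))"

lemma eigenfunction_coeffs:
  assumes u: "u \<in> eigenspace b V \<mu>"
  shows "\<exists>a\<in>coeffs. u = radial_fun a"
proof -
  have uH: "u \<in> tree_H10 b" using u eigenspace_P by blast
  define a where "a w = (if w \<in> words b then (SOME a. \<forall>t\<in>cI w.
    u (edge_path w t) = a * of_real (ps (length w) t) \<and> edge_deriv u w t = a * of_real (pd (length w) t)) else 0)" for w
  have a: "u (edge_path w t) = a w * of_real (ps (length w) t)" "edge_deriv u w t = a w * of_real (pd (length w) t)"
    if "w \<in> words b" "t \<in> cI w" for w t
  proof -
    have "a w = (SOME a. \<forall>t\<in>cI w.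
        u (edge_path w t) = a * of_real (ps (length w) t) \<and> edge_deriv u w t = a * of_real (pd (length w) t))"
      using that by (simp only: a_def if_True)
    from someI_ex[OF eigenfunction_on_edge[OF u that(1)], folded this] that(2)
    show "u (edge_path w t) = a w * of_real (ps (length w) t)" "edge_deriv u w t = a w * of_real (pd (length w) t)" by blast+
  qed
  have uv: "u (w, real (length w) + 1) = a w * of_real (PS (Suc (length w)))" if w: "w \<in> words b" for w
    using a(1)[OF w, of "real (length w) + 1"] by (simp add: edge_path_end ps_vertex)
  have uvj: "u (w, real (length w) + 1) = a (w @ [j]) * of_real (PS (Suc (length w)))" if w: "w \<in> words b" "j < b" for w j
    using a(1)[of "w @ [j]" "real (length w) + 1"] w edge_path_snoc[of w j] ps_vertex(1)[of "Suc (length w)"]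
    by (simp add: words_snoc add.commute)
  have K: "(\<Sum>j<b. a (w @ [j])) * of_real (PD (Suc (length w))) = of_nat b * a w * of_real (PD (Suc (length w)))" if w: "w \<in> words b" for w
  proof -
    have "edge_deriv u (w @ [j]) (real (length w) + 1) = a (w @ [j]) * of_real (PD (Suc (length w)))" if "j < b" for j
      using a(2)[of "w @ [j]" "real (length w) + 1"] w that ps_vertex(3)[of "Suc (length w)"] by (simp add: words_snoc add.commute)
    then have "(\<Sum>j<b. edge_deriv u (w @ [j]) (real (length w) + 1)) = (\<Sum>j<b. a (w @ [j])) * of_real (PD (Suc (length w)))"
      by (simp add: sum_distrib_right)
    then show ?thesis
      using eigenfunction_kirchhoff[OF u w] a(2)[OF w, of "real (length w) + 1"] by (auto simp: ps_vertex mult_ac)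
  qed
  have same: "a (w @ [j]) = a w" if "w \<in> words b" "j < b" "fst (v (Suc (length w)) pp) \<noteq> 0" for w j
    using uv[OF that(1)] uvj[OF that(1,2)] that(3) PS_eq_0_iff[of "Suc (length w)"] by simp
  have "a \<in> coeffs"
    unfolding coeffs_def
  proof (intro CollectI conjI impI ballI allI)
    assume "fst (v 0 pp) \<noteq> 0"
    moreover have "u (edge_path [] 0) = 0" using uH by (simp add: edge_path_def parent_vertex_def tree_H10_def)
    ultimately show "a [] = 0" using a(1)[OF words_Nil, of 0] ps_vertex(1)[of 0] PS_eq_0_iff[of 0] by simp
  next
    fix w assume w: "w \<in> words b"
    show "(\<Sum>j<b. a (w @ [j])) = of_nat b * a w"
    proof (cases "fst (v (Suc (length w)) pp) = 0")
      case True
      then have "PD (Suc (length w)) \<noteq> 0" using PS_PD_nonzero[of "Suc (length w)"] PS_eq_0_iff by auto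
      then have "complex_of_real (PD (Suc (length w))) \<noteq> 0" by simp
      with K[OF w] show ?thesis by (metis mult_right_cancel)
    next
      case False
      then show ?thesis using same[OF w] by simp
    qed
  next
    fix w j assume "w \<in> words b" "fst (v (Suc (length w)) pp) \<noteq> 0" "j < b"
    then show "a (w @ [j]) = a w" by (intro same)
  next
    fix w assume "w \<notin> words b"
    then show "a w = 0" by (simp add: a_def)
  qed
  moreover have "u = radial_fun a"
  proof
    fix x :: tpoint
    obtain w t where x: "x = (w, t)" by fastforce
    show "u x = radial_fun a x"
    proof (cases "x \<in> tree b")
      case False
      then show ?thesis using uH x by (simp add: radial_fun_def tree_fun_def tree_H10_def)
    next
      case True
      show ?thesis
      proof (cases "w = [] \<and> t = 0")
        case root: True
        have "u (edge_path [] 0) = a [] * of_real (ps 0 0)" using a(1)[OF words_Nil, of 0] by simp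
        then show ?thesis using root True x by (simp add: radial_fun_def tree_fun_def edge_path_def parent_vertex_def tree_root_def)
      next
        case False
        then have "w \<in> words b" "real (length w) < t" "t \<le> real (length w) + 1" using True x by (auto simp: mem_tree)
        then show ?thesis using a(1)[of w t] True x by (simp add: radial_fun_def tree_fun_def edge_path_def)
      qed
    qed
  qed
  ultimately show ?thesis by blast
qed

lemma finite_zero_levels: "finite {k. fst (v k pp) = 0}"
proof -
  obtain N where N: "\<forall>n\<ge>N. s * qbar n \<le> h0" using small_eventually[OF s0] by auto
  have "fst (v k pp) \<noteq> 0" if "k \<ge> N" for k by (rule no_zeros[OF pp(3), of s]) (use N that s0 in auto)
  then have "{k. fst (v k pp) = 0} \<subseteq> {..<N}" by (metis (mono_tags, lifting) lessThan_iff mem_Collect_eq not_less subsetI)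
  then show ?thesis by (rule finite_subset) simp
qed

text \<open>Above the last height at which the solution vanishes, the coefficients no longer change
  along a branch; so only finitely many values occur.\<close>

lemma coeffs_bounded:
  assumes a: "a \<in> coeffs"
  shows "\<exists>M. \<forall>w. norm (a w) \<le> M"
proof -
  obtain N where N: "\<And>k. fst (v k pp) = 0 \<Longrightarrow> k < N"
    using finite_zero_levels unfolding finite_nat_set_iff_bounded by blast
  have tk: "a w = a (take N w)" if "w \<in> words b" for w
    using that
  proof (induction w rule: rev_induct)
    case (snoc j w)
    show ?case
    proof (cases "length w < N")
      case False
      then have "fst (v (Suc (length w)) pp) \<noteq> 0" using N[of "Suc (length w)"] by auto
      then have "a (w @ [j]) = a w" using a snoc.prems by (auto simp: coeffs_def words_snoc)
      then show ?thesis using snoc False by (simp add: words_snoc)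
    qed simp
  qed simp
  have "bounded (a ` words_lt b (Suc N))" by (intro finite_imp_bounded finite_imageI finite_words_lt)
  then obtain M where M: "\<And>w. w \<in> words_lt b (Suc N) \<Longrightarrow> norm (a w) \<le> M" by (auto simp: bounded_iff)
  have "norm (a w) \<le> max M 0" for w
  proof (cases "w \<in> words b")
    case True
    then have "take N w \<in> words_lt b (Suc N)" by (auto simp: words_lt_def words_def dest: in_set_takeD)
    then show ?thesis using tk[OF True] M[of "take N w"] by simp
  next
    case False
    then show ?thesis using a by (simp add: coeffs_def)
  qed
  then show ?thesis by blast
qed

text \<open>Green's formula with both derivatives on the classical factor, since the test function
  has only a weak derivative.\<close>

lemma edge_green:
  assumes h: "\<phi> \<in> tree_H10 b" and w: "w \<in> words b" and n: "n = length w"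
  shows "(LINT t:eI w|lborel. of_real (pd n t) * cnj (tree_deriv \<phi> (w, t))) - (LINT t:eI w|lborel. of_real (P t * ps n t) * cnj (\<phi> (w, t)))
    = of_real (B * PD (Suc n)) * cnj (\<phi> (w, real n + 1)) - of_real (PD n) * cnj (\<phi> (parent_vertex w))"
proof -
  let ?I = "{real n..real n + 1}"
  let ?f = "\<lambda>t. \<phi> (edge_path w t)"
  have psc: "continuous_on ?I (ps n)" using ps_deriv(1) DERIV_continuous_on by blast
  have Pc: "continuous_on ?I (\<lambda>t. - P t * ps n t)" by (intro continuous_intros psc q_cont')
  obtain g g' where g: "\<And>x. (g has_real_derivative g' x) (at x)" "continuous_on UNIV g'"
    "\<And>x. x \<in> ?I \<Longrightarrow> g x = pd n x \<and> g' x = - P x * ps n x"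
    using extend_C1[OF less_add_one ps_deriv(2) Pc] by blast
  have g3: "cnj (?f x * of_real (g' x)) = - (of_real (P x * ps n x) * cnj (\<phi> (w, x)))" if x: "x \<in> eI w" for x
  proof -
    have "g' x = - (P x * ps n x)" using g(3)[of x] x by (simp add: eI_def n algebra_simps)
    then show ?thesis by (simp only: edge_path_eI[OF x] complex_cnj_mult complex_cnj_minus complex_cnj_complex_of_real of_real_minus mult_minus_right mult.commute)
  qed
  have "(LINT t:{real n<..<real n + 1}|lborel. tree_deriv \<phi> (w, t) * of_real (g t))
     = ?f (real n + 1) * of_real (g (real n + 1)) - ?f (real n) * of_real (g (real n)) - (LINT t:{real n<..<real n + 1}|lborel. ?f t * of_real (g' t))"
    unfolding n
    by (rule weak_integration_by_parts[OF tree_deriv_weak[OF h w] tree_H10_continuous[OF h w] _ g(1,2)]) (auto simp: edge_path_def)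
  then have "cnj (LINT t:eI w|lborel. tree_deriv \<phi> (w, t) * of_real (g t)) + cnj (LINT t:eI w|lborel. ?f t * of_real (g' t))
     = cnj (?f (real n + 1)) * of_real (g (real n + 1)) - cnj (?f (real n)) * of_real (g (real n))"
    by (simp add: eI_def n)
  moreover have "cnj (LINT t:eI w|lborel. tree_deriv \<phi> (w, t) * of_real (g t)) = (LINT t:eI w|lborel. of_real (pd n t) * cnj (tree_deriv \<phi> (w, t)))"
    unfolding set_lebesgue_integral_def Bochner_Integration.integral_cnj[symmetric]
    by (rule Bochner_Integration.integral_cong) (use g(3) in \<open>auto simp: indicator_def eI_def n mult.commute\<close>)
  moreover have "cnj (LINT t:eI w|lborel. ?f t * of_real (g' t)) = - (LINT t:eI w|lborel. of_real (P t * ps n t) * cnj (\<phi> (w, t)))"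
    unfolding set_lebesgue_integral_def Bochner_Integration.integral_cnj[symmetric] Bochner_Integration.integral_minus[symmetric]
    by (rule Bochner_Integration.integral_cong) (use g3 in \<open>auto simp: indicator_def simp del: complex_cnj_mult of_real_mult of_real_add\<close>)
  moreover have "?f (real n + 1) = \<phi> (w, real n + 1)" "?f (real n) = \<phi> (parent_vertex w)"
    by (simp_all add: edge_path_def n)
  ultimately show ?thesis using g(3)[of "real n"] g(3)[of "real n + 1"] by (simp add: ps_vertex mult.commute)
qed

text \<open>Bounded coefficients and \<open>B * r\<^sup>2 < 1\<close> give finite energy. Green's
  formula leaves terms at the ends of the edges; at inner vertices they cancel by the Kirchhoff part
  of \<open>coeffs\<close>, and the boundary term at great height tends to 0.\<close>

lemma radial_fun_eigenfunction:
  assumes a: "a \<in> coeffs"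
  shows "radial_fun a \<in> eigenspace b V \<mu>"
proof -
  obtain M where M: "\<And>w. norm (a w) \<le> M" using coeffs_bounded[OF a] by blast
  have M0: "0 \<le> M" using order_trans[OF norm_ge_zero M] .
  let ?\<eta> = "\<lambda>w t. a w * of_real (ps (length w) t)" and ?d = "\<lambda>w t. a w * of_real (pd (length w) t)"
  have ar: "a [] * of_real (PS 0) = 0" using a PS_eq_0_iff[of 0] by (auto simp: coeffs_def)
  have av: "a (w @ [j]) * of_real (PS (Suc (length w))) = a w * of_real (PS (Suc (length w)))" if "w \<in> words b" "j < b" for w j
    using a PS_eq_0_iff[of "Suc (length w)"] that by (auto simp: coeffs_def)
  have ak: "(\<Sum>j<b. a (w @ [j])) = of_real B * a w" if "w \<in> words b" for w
    using a that by (auto simp: coeffs_def)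
  have vc: "vertex_compatible b ?\<eta>"
    unfolding vertex_compatible_def
  proof (intro conjI allI impI)
    show "?\<eta> [] 0 = 0" using ar ps_vertex(1)[of 0] by simp
    fix w j assume "w \<in> words b" "j < b"
    then show "?\<eta> (w @ [j]) (real (length w) + 1) = ?\<eta> w (real (length w) + 1)"
      using av[of w j] ps_vertex(2)[of "length w"] ps_vertex(1)[of "Suc (length w)"] by (simp add: add.commute)
  qed
  have psc: "continuous_on {real n..real n + 1} (ps n)" "continuous_on {real n..real n + 1} (pd n)" for n
    by (rule DERIV_continuous_on, erule ps_deriv)+
  have \<eta>c: "continuous_on (cI w) (?\<eta> w)" "continuous_on (cI w) (?d w)" for w
    by (intro continuous_intros psc)+
  have der: "(?\<eta> w has_vector_derivative ?d w t) (at t)" if "t \<in> eI w - {}" for w t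
  proof -
    have t: "t \<in> cI w" "t \<in> {real (length w)<..<real (length w) + 1}" using that by (auto simp: eI_def)
    have "(ps (length w) has_real_derivative pd (length w) t) (at t)"
      using ps_deriv(1)[OF t(1)] t(2) by (simp add: at_within_Icc_at)
    then show ?thesis by (intro has_vector_derivative_mult_right has_vector_derivative_of_real)
  qed
  have dm: "set_borel_measurable lborel (eI w) (?d w)" for w
    using set_integrable_continuous_Ioo[OF \<eta>c(2)[of w]] by (auto simp: set_integrable_def set_borel_measurable_def eI_def)
  have bnd: "norm (?d w t) \<le> M * (Mb * r ^ length w)" "norm (?\<eta> w t) \<le> M * (Mb * r ^ length w)" if "t \<in> eI w" for w t
  proof -
    have t: "t \<in> cI w" using that by (auto simp: eI_def)
    show "norm (?d w t) \<le> M * (Mb * r ^ length w)" "norm (?\<eta> w t) \<le> M * (Mb * r ^ length w)"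
      unfolding norm_mult norm_of_real using M[of w] Mb(2,3)[OF t] M0 by (blast intro: mult_mono abs_ge_zero)+
  qed
  have E: "(LINT t:eI w|lborel. (cmod (?d w t))\<^sup>2 + (cmod (?\<eta> w t))\<^sup>2) \<le> 2 * (M * Mb)\<^sup>2 * (r ^ length w)\<^sup>2" for w
  proof -
    let ?c = "2 * (M * Mb)\<^sup>2 * (r ^ length w)\<^sup>2"
    have "(LINT t:eI w|lborel. (cmod (?d w t))\<^sup>2 + (cmod (?\<eta> w t))\<^sup>2) \<le> (LINT t:eI w|lborel. ?c)"
    proof (rule set_integral_mono)
      show "set_integrable lborel (eI w) (\<lambda>t. (cmod (?d w t))\<^sup>2 + (cmod (?\<eta> w t))\<^sup>2)"
        unfolding eI_def by (rule set_integrable_continuous_Ioo) (intro continuous_intros psc)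
      show "set_integrable lborel (eI w) (\<lambda>t. ?c)" unfolding eI_def by (rule set_integrable_continuous_Ioo) auto
      fix t assume t: "t \<in> eI w"
      have "(norm (?d w t))\<^sup>2 \<le> (M * (Mb * r ^ length w))\<^sup>2" "(norm (?\<eta> w t))\<^sup>2 \<le> (M * (Mb * r ^ length w))\<^sup>2"
        using bnd[OF t] by (auto intro!: power_mono simp del: norm_mult)
      then show "(cmod (?d w t))\<^sup>2 + (cmod (?\<eta> w t))\<^sup>2 \<le> ?c" by (simp add: power_mult_distrib mult_ac)
    qed
    then show ?thesis by (simp only: set_integral_eI_const)
  qed
  have K: "(\<Sum>w\<in>words_lt b N. (LINT t:eI w|lborel. (cmod (?d w t))\<^sup>2 + (cmod (?\<eta> w t))\<^sup>2)) \<le> 2 * (M * Mb)\<^sup>2 * (1 / (1 - B * r\<^sup>2))" for N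
  proof -
    have "(\<Sum>w\<in>words_lt b N. (LINT t:eI w|lborel. (cmod (?d w t))\<^sup>2 + (cmod (?\<eta> w t))\<^sup>2)) \<le> (\<Sum>w\<in>words_lt b N. 2 * (M * Mb)\<^sup>2 * (r ^ length w)\<^sup>2)"
      by (intro sum_mono E)
    also have "\<dots> = (\<Sum>n<N. \<Sum>w\<in>level b n. 2 * (M * Mb)\<^sup>2 * (r ^ n)\<^sup>2)"
      unfolding sum_words_lt by (intro sum.cong) (auto simp: level_def)
    also have "\<dots> = 2 * (M * Mb)\<^sup>2 * (\<Sum>n<N. (B * r\<^sup>2) ^ n)"
      by (simp add: card_level sum_distrib_left power_mult_distrib power_mult[symmetric] mult_ac)
    also have "\<dots> \<le> 2 * (M * Mb)\<^sup>2 * (\<Sum>n. (B * r\<^sup>2) ^ n)"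
      using r B2 by (intro mult_left_mono sum_le_suminf summable_geometric) auto
    also have "(\<Sum>n. (B * r\<^sup>2) ^ n) = 1 / (1 - B * r\<^sup>2)" using r B2 by (intro suminf_geometric) auto
    finally show ?thesis .
  qed
  have fin: "finite ({} :: real set)" by simp
  have uH: "radial_fun a \<in> tree_H10 b" unfolding radial_fun_def
    by (rule tree_fun_H10(1)[where d="?d" and F="\<lambda>_. {}" and M="\<lambda>w. M * (Mb * r ^ length w)", OF vc \<eta>c(1) fin der dm bnd(1) K])
  have uD: "AE t in lborel. t \<in> eI w \<longrightarrow> tree_deriv (radial_fun a) (w, t) = ?d w t" if "w \<in> words b" for w
    unfolding radial_fun_def
    by (rule tree_fun_H10(2)[where d="?d" and F="\<lambda>_. {}" and M="\<lambda>w. M * (Mb * r ^ length w)", OF vc \<eta>c(1) fin der dm bnd(1) K that])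
  show ?thesis
    unfolding eigenspace_P
  proof (intro conjI ballI uH)
    fix \<phi> assume h: "\<phi> \<in> tree_H10 b"
    let ?u = "radial_fun a"
    let ?F1 = "\<lambda>x. tree_deriv ?u x * cnj (tree_deriv \<phi> x)" and ?F2 = "\<lambda>x. of_real (P (height x)) * ?u x * cnj (\<phi> x)"
    have i: "integrable (tree_measure b) ?F1" "integrable (tree_measure b) ?F2"
      by (rule form_integrable[OF uH h])+
    define E where "E n = (\<Sum>w\<in>level b n. a w * of_real (B * PD (Suc n)) * cnj (\<phi> (w, real n + 1)))" for n
    have edge: "(LINT t:eI w|lborel. ?F1 (w, t) - ?F2 (w, t))
       = a w * of_real (B * PD (Suc (length w))) * cnj (\<phi> (w, real (length w) + 1)) - a w * of_real (PD (length w)) * cnj (\<phi> (parent_vertex w))"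
      if w: "w \<in> words b" for w
    proof -
      have s1: "set_integrable lborel (eI w) (\<lambda>t. ?F1 (w, t))" "set_integrable lborel (eI w) (\<lambda>t. ?F2 (w, t))"
        using tree_integral(1)[OF i(1) w] tree_integral(1)[OF i(2) w] .
      have m: "(\<lambda>t. indicat_real (eI w) t *\<^sub>R (a w * (of_real (pd (length w) t) * cnj (tree_deriv \<phi> (w, t))))) \<in> borel_measurable lborel"
      proof -
        have [measurable]: "(\<lambda>t. indicat_real (eI w) t *\<^sub>R ?d w t) \<in> borel_measurable lborel"
          "(\<lambda>t. indicat_real (eI w) t *\<^sub>R tree_deriv \<phi> (w, t)) \<in> borel_measurable lborel"
          using dm[of w] tree_H10_sections(2)[OF h w] by (simp_all add: set_borel_measurable_def)
        have "(\<lambda>t. (indicat_real (eI w) t *\<^sub>R ?d w t) * cnj (indicat_real (eI w) t *\<^sub>R tree_deriv \<phi> (w, t))) \<in> borel_measurable lborel"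
          by measurable
        moreover have "(\<lambda>t. (indicat_real (eI w) t *\<^sub>R ?d w t) * cnj (indicat_real (eI w) t *\<^sub>R tree_deriv \<phi> (w, t)))
           = (\<lambda>t. indicat_real (eI w) t *\<^sub>R (a w * (of_real (pd (length w) t) * cnj (tree_deriv \<phi> (w, t)))))"
          by (auto simp: indicator_def fun_eq_iff)
        ultimately show ?thesis by simp
      qed
      have "(LINT t:eI w|lborel. ?F1 (w, t)) = (LINT t:eI w|lborel. a w * (of_real (pd (length w) t) * cnj (tree_deriv \<phi> (w, t))))"
        unfolding set_lebesgue_integral_def
      proof (rule integral_cong_AE)
        show "(\<lambda>t. indicat_real (eI w) t *\<^sub>R ?F1 (w, t)) \<in> borel_measurable lborel"
          using s1(1) by (auto simp: set_integrable_def)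
        show "AE t in lborel. indicat_real (eI w) t *\<^sub>R ?F1 (w, t) = indicat_real (eI w) t *\<^sub>R (a w * (of_real (pd (length w) t) * cnj (tree_deriv \<phi> (w, t))))"
          using uD[OF w] by eventually_elim (auto simp: indicator_def)
      qed (rule m)
      moreover have "(LINT t:eI w|lborel. ?F2 (w, t)) = (LINT t:eI w|lborel. a w * (of_real (P t * ps (length w) t) * cnj (\<phi> (w, t))))"
        by (rule set_lebesgue_integral_cong)
          (auto simp: eI_borel height_eI[OF w] radial_fun_def tree_fun_eI[OF w] simp del: of_real_add of_real_mult, simp add: mult_ac)
      ultimately have "(LINT t:eI w|lborel. ?F1 (w, t) - ?F2 (w, t))
         = a w * ((LINT t:eI w|lborel. of_real (pd (length w) t) * cnj (tree_deriv \<phi> (w, t))) - (LINT t:eI w|lborel. of_real (P t * ps (length w) t) * cnj (\<phi> (w, t))))"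
        by (simp only: set_integral_diff(2)[OF s1] set_integral_mult_right right_diff_distrib)
      then show ?thesis unfolding edge_green[OF h w refl] by (simp add: algebra_simps)
    qed
    \<comment> \<open>\<open>words_lt b (Suc N)\<close> contains the edges of length up to
      \<open>N\<close>, and \<open>E N\<close> collects the upper ends of the last of them.\<close>
    have tel: "(\<Sum>w\<in>words_lt b (Suc N). (LINT t:eI w|lborel. ?F1 (w, t) - ?F2 (w, t))) = E N" for N
    proof (induction N)
      case 0
      have w0: "words_lt b (Suc 0) = {[]}" by (auto simp: words_lt_def words_Nil)
      have "\<phi> (parent_vertex []) = 0" using h by (simp add: parent_vertex_def tree_H10_def)
      have "(\<Sum>w\<in>words_lt b (Suc 0). (LINT t:eI w|lborel. ?F1 (w, t) - ?F2 (w, t))) = (LINT t:eI []|lborel. ?F1 ([], t) - ?F2 ([], t))"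
        unfolding w0 by simp
      also have "\<dots> = E 0" unfolding edge[OF words_Nil] using \<open>\<phi> (parent_vertex []) = 0\<close> by (simp add: E_def level_0)
      finally show ?case .
    next
      case (Suc N)
      have "(\<Sum>w\<in>level b (Suc N). a w * of_real (PD (Suc N)) * cnj (\<phi> (parent_vertex w)))
          = (\<Sum>w\<in>level b N. (\<Sum>j<b. a (w @ [j])) * of_real (PD (Suc N)) * cnj (\<phi> (w, real N + 1)))"
        unfolding sum_level_Suc
        by (intro sum.cong refl) (auto simp: level_def parent_vertex_def sum_distrib_right add.commute)
      also have "\<dots> = E N"
        unfolding E_def by (intro sum.cong refl) (auto simp: level_def ak mult_ac)
      finally have EN: "(\<Sum>w\<in>level b (Suc N). a w * of_real (PD (Suc N)) * cnj (\<phi> (parent_vertex w))) = E N" .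
      have "(\<Sum>w\<in>level b (Suc N). (LINT t:eI w|lborel. ?F1 (w, t) - ?F2 (w, t)))
          = (\<Sum>w\<in>level b (Suc N). a w * of_real (B * PD (Suc (Suc N))) * cnj (\<phi> (w, real (Suc N) + 1)) - a w * of_real (PD (Suc N)) * cnj (\<phi> (parent_vertex w)))"
      proof (rule sum.cong[OF refl])
        fix w assume "w \<in> level b (Suc N)"
        then have w: "w \<in> words b" and l: "length w = Suc N" by (auto simp: level_def)
        show "(LINT t:eI w|lborel. ?F1 (w, t) - ?F2 (w, t)) = a w * of_real (B * PD (Suc (Suc N))) * cnj (\<phi> (w, real (Suc N) + 1)) - a w * of_real (PD (Suc N)) * cnj (\<phi> (parent_vertex w))"
          by (rule edge[OF w, unfolded l])
      qed
      then have "(\<Sum>w\<in>level b (Suc N). (LINT t:eI w|lborel. ?F1 (w, t) - ?F2 (w, t))) = E (Suc N) - E N"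
        unfolding sum_subtractf EN E_def .
      then show ?case unfolding sum_words_lt_Suc[of _ b "Suc N"] Suc by simp
    qed
    have L: "E \<longlonglongrightarrow> (LINT x|tree_measure b. ?F1 x - ?F2 x)"
      using LIMSEQ_Suc[OF tree_integral(2)[OF Bochner_Integration.integrable_diff[OF i]]] unfolding tel .
    have "E \<longlonglongrightarrow> 0"
    proof (rule Lim_null_comparison[OF always_eventually])
      let ?e = "\<lambda>w. LINT t:eI w|lborel. (cmod (tree_deriv \<phi> (w, t)))\<^sup>2 + (cmod (\<phi> (w, t)))\<^sup>2"
      let ?c = "2 * (M * Mb)\<^sup>2"
      show "\<forall>n. norm (E n) \<le> (\<Sum>w\<in>level b n. ?e w) + real b ^ n * (?c * (r ^ n)\<^sup>2)"
      proof
        fix n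
        have "norm (a w * of_real (B * PD (Suc n)) * cnj (\<phi> (w, real n + 1))) \<le> ?e w + ?c * (r ^ n)\<^sup>2" if "w \<in> level b n" for w
        proof -
          have w: "w \<in> words b" "length w = n" using that by (auto simp: level_def)
          let ?K = "M * (Mb * r ^ n)"
          have K0: "0 \<le> ?K" using M0 Mb(1) r by auto
          have pdb: "\<bar>B * PD (Suc n)\<bar> \<le> Mb * r ^ n" using Mb(3)[of "real n + 1" n] ps_vertex(4)[of n] by simp
          have "norm (a w * of_real (B * PD (Suc n)) * cnj (\<phi> (w, real n + 1))) = (norm (a w) * \<bar>B * PD (Suc n)\<bar>) * norm (\<phi> (w, real n + 1))"
            by (simp add: norm_mult abs_mult)
          also have "\<dots> \<le> ?K * (LINT t:eI w|lborel. cmod (tree_deriv \<phi> (w, t)) + cmod (\<phi> (w, t)))"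
            using M[of w] pdb M0 K0 edge_end_value_bound[OF h w(1)] w(2) by (intro mult_mono) auto
          also have "\<dots> = (LINT t:eI w|lborel. ?K * (cmod (tree_deriv \<phi> (w, t)) + cmod (\<phi> (w, t))))"
            by (rule set_integral_mult_right[symmetric])
          also have "\<dots> \<le> (LINT t:eI w|lborel. ((cmod (tree_deriv \<phi> (w, t)))\<^sup>2 + (cmod (\<phi> (w, t)))\<^sup>2) + 2 * ?K\<^sup>2)"
          proof (rule set_integral_mono)
            have n1: "set_integrable lborel (eI w) (\<lambda>t. cmod (tree_deriv \<phi> (w, t)) + cmod (\<phi> (w, t)))"
              using tree_H10_sections(4,5)[OF h w(1)] by (intro set_integral_add set_integrable_norm)
            then show "set_integrable lborel (eI w) (\<lambda>t. ?K * (cmod (tree_deriv \<phi> (w, t)) + cmod (\<phi> (w, t))))"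
              by (intro set_integrable_mult_right)
            have "set_integrable lborel (eI w) (\<lambda>t. 2 * ?K\<^sup>2)" unfolding eI_def by (rule set_integrable_continuous_Ioo) auto
            then show "set_integrable lborel (eI w) (\<lambda>t. ((cmod (tree_deriv \<phi> (w, t)))\<^sup>2 + (cmod (\<phi> (w, t)))\<^sup>2) + 2 * ?K\<^sup>2)"
              by (intro set_integral_add(1)[OF tree_H10_sections(3)[OF h w(1)]])
            fix t assume "t \<in> eI w"
            have "?K * cmod (tree_deriv \<phi> (w, t)) \<le> ?K\<^sup>2 + (cmod (tree_deriv \<phi> (w, t)))\<^sup>2" "?K * cmod (\<phi> (w, t)) \<le> ?K\<^sup>2 + (cmod (\<phi> (w, t)))\<^sup>2"
              using norm_mult_le_squares[of "of_real ?K" "tree_deriv \<phi> (w, t)"] norm_mult_le_squares[of "of_real ?K" "\<phi> (w, t)"] K0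
              unfolding norm_mult complex_mod_cnj norm_of_real by (simp_all only: abs_of_nonneg)
            then show "?K * (cmod (tree_deriv \<phi> (w, t)) + cmod (\<phi> (w, t))) \<le> ((cmod (tree_deriv \<phi> (w, t)))\<^sup>2 + (cmod (\<phi> (w, t)))\<^sup>2) + 2 * ?K\<^sup>2"
              unfolding distrib_left by linarith
          qed
          also have "\<dots> = ?e w + 2 * ?K\<^sup>2"
          proof -
            have "set_integrable lborel (eI w) (\<lambda>t. 2 * ?K\<^sup>2)" unfolding eI_def by (rule set_integrable_continuous_Ioo) auto
            from set_integral_add(2)[OF tree_H10_sections(3)[OF h w(1)] this] show ?thesis by (simp only: set_integral_eI_const)
          qed
          also have "2 * ?K\<^sup>2 = ?c * (r ^ n)\<^sup>2" by (simp add: power_mult_distrib)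
          finally show ?thesis .
        qed
        then have "(\<Sum>w\<in>level b n. norm (a w * of_real (B * PD (Suc n)) * cnj (\<phi> (w, real n + 1)))) \<le> (\<Sum>w\<in>level b n. ?e w + ?c * (r ^ n)\<^sup>2)"
          by (rule sum_mono)
        then show "norm (E n) \<le> (\<Sum>w\<in>level b n. ?e w) + real b ^ n * (?c * (r ^ n)\<^sup>2)"
          unfolding E_def by (intro order_trans[OF norm_sum]) (simp add: sum.distrib card_level)
      qed
      have "(\<lambda>n. (\<Sum>w\<in>level b n. ?e w) + real b ^ n * (?c * (r ^ n)\<^sup>2)) \<longlonglongrightarrow> 0 + 0"
        by (intro tendsto_add level_energy_tendsto_0[OF h] geometric_decay)
      then show "(\<lambda>n. (\<Sum>w\<in>level b n. ?e w) + real b ^ n * (?c * (r ^ n)\<^sup>2)) \<longlonglongrightarrow> 0" by simp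
    qed
    with L show "(LINT x|tree_measure b. ?F1 x - ?F2 x) = 0" by (rule LIMSEQ_unique)
  qed
qed

end

section \<open>Multiplicities\<close>

text \<open>Biorthogonality gives independence. For spanning, subtracting the expansion with the
  coefficients \<open>L i f\<close> leaves an element that all functionals annihilate.\<close>

lemma cdim_dual_basis:
  fixes e :: "'i \<Rightarrow> 'a \<Rightarrow> complex" and L :: "'i \<Rightarrow> ('a \<Rightarrow> complex) \<Rightarrow> complex"
  assumes I: "finite I" and S: "module.subspace cscale S"
    and eS: "\<And>i. i \<in> I \<Longrightarrow> e i \<in> S"
    and Ladd: "\<And>i f g. L i (f + g) = L i f + L i g" and Lscale: "\<And>i c f. L i (cscale c f) = c * L i f"
    and dual: "\<And>i j. i \<in> I \<Longrightarrow> j \<in> I \<Longrightarrow> L i (e j) = (if i = j then 1 else 0)"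
    and sep: "\<And>f. f \<in> S \<Longrightarrow> (\<And>i. i \<in> I \<Longrightarrow> L i f = 0) \<Longrightarrow> f = 0"
  shows "cdim S = enat (card I)"
proof -
  interpret vector_space "cscale :: complex \<Rightarrow> ('a \<Rightarrow> complex) \<Rightarrow> 'a \<Rightarrow> complex" by (rule vector_space_cscale)
  have L0: "L i 0 = 0" for i using Lscale[of i 0 0] by (simp add: scale_zero_left)
  have Lsum: "L i (\<Sum>j\<in>A. cscale (a j) (h j)) = (\<Sum>j\<in>A. a j * L i (h j))" if "finite A" for i a h and A :: "'i set"
    using that by (induction A) (simp_all only: sum.empty sum.insert L0 Ladd Lscale not_False_eq_True)
  have Le: "L i (\<Sum>j\<in>I. cscale (a j) (e j)) = a i" if "i \<in> I" for i a
    using that I by (simp add: Lsum dual if_distrib[of "\<lambda>x. a _ * x"] cong: if_cong)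
  have inj: "inj_on e I"
  proof (rule inj_onI)
    fix i j assume "i \<in> I" "j \<in> I" "e i = e j"
    then show "i = j" using dual[of i i] dual[of i j] by (auto split: if_splits)
  qed
  have ind: "independent (e ` I)"
  proof (rule independent_if_scalars_zero[OF finite_imageI[OF I]])
    fix a x assume a: "(\<Sum>x\<in>e ` I. cscale (a x) x) = 0" and "x \<in> e ` I"
    then obtain i where i: "i \<in> I" "x = e i" by blast
    have "(\<Sum>j\<in>I. cscale (a (e j)) (e j)) = 0" using a by (simp add: sum.reindex[OF inj])
    then show "a x = 0" using Le[OF i(1), of "\<lambda>j. a (e j)"] L0 i(2) by simp
  qed
  have sp: "S \<subseteq> span (e ` I)"
  proof
    fix f assume f: "f \<in> S"
    let ?h = "\<Sum>j\<in>I. cscale (L j f) (e j)"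
    have hS: "?h \<in> S" by (intro subspace_sum[OF S] subspace_scale[OF S] eS)
    have "f - ?h = 0"
    proof (rule sep)
      show "f - ?h \<in> S" by (rule subspace_diff[OF S f hS])
      fix i assume i: "i \<in> I"
      have "f - ?h = f + cscale (-1) ?h" by (simp only: scale_minus_left scale_one diff_conv_add_uminus)
      then show "L i (f - ?h) = 0" using Le[OF i, of "\<lambda>j. L j f"] by (simp only: Ladd Lscale) simp
    qed
    moreover have "?h \<in> span (e ` I)" by (intro span_sum span_scale span_base) auto
    ultimately show "f \<in> span (e ` I)" by simp
  qed
  have "dim S = card (e ` I)" by (rule dim_unique[OF _ sp ind refl]) (use eS in blast)
  also have "\<dots> = card I" by (rule card_image[OF inj])
  finally show ?thesis unfolding cdim_def using sp finite_imageI[OF I] by auto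
qed

text \<open>A vertex of height \<open>k > 0\<close> is the upper end of one of
  \<open>b ^ (k - 1)\<close> edges and allows \<open>b - 1\<close> independent distributions of sum
  0 over its branches; the root allows the radial solution alone.\<close>

definition branch_multiplicity :: "nat \<Rightarrow> nat \<Rightarrow> nat" where
  "branch_multiplicity b k = (if k = 0 then 1 else b ^ (k - 1) * (b - 1))"

lemma sum_branch_multiplicity:
  assumes "b \<ge> 1" shows "(\<Sum>k\<le>n. branch_multiplicity b k) = b ^ n"
proof (induction n)
  case (Suc n)
  have "b ^ n + b ^ n * (b - 1) = b ^ n * Suc (b - 1)" by simp
  then show ?case using Suc assms by (simp add: branch_multiplicity_def mult.commute)
qed (simp add: branch_multiplicity_def)

context decaying_eigenfunction
begin

lemma ps_not_zero: "\<exists>t. real n < t \<and> t \<le> real n + 1 \<and> ps n t \<noteq> 0"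
proof (rule ccontr)
  assume "\<not> ?thesis"
  then have z: "ps n t = 0" if "real n < t" "t < real n + 1" for t using that by (meson less_imp_le)
  let ?t = "real n + 1 / 2"
  have "(ps n has_real_derivative pd n ?t) (at ?t)"
    using ps_deriv(1)[of ?t n] by (simp add: at_within_Icc_at)
  moreover have "(ps n has_real_derivative 0) (at ?t)"
    by (rule has_field_derivative_transform_within_open[of "\<lambda>_. 0" 0 ?t "{real n<..<real n + 1}"]) (auto simp: z)
  ultimately have "pd n ?t = 0" by (rule DERIV_unique)
  moreover have "ps n ?t = 0" by (rule z) auto
  ultimately have "Y n pp (1 / 2) = 0"
    using bet_abs(4)[OF pp(3)] by (simp add: ps_def pd_def prod_eq_iff)
  then show False using Y_nonzero[OF pp(1), of "1 / 2" n] by simp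
qed

section \<open>A basis of the eigenspace and its dual functionals\<close>

definition samp :: "nat \<Rightarrow> real" where "samp n = (SOME t. real n < t \<and> t \<le> real n + 1 \<and> ps n t \<noteq> 0)"

lemma samp: "real n < samp n" "samp n \<le> real n + 1" "ps n (samp n) \<noteq> 0"
  using someI_ex[OF ps_not_zero[of n]] by (simp_all add: samp_def)

text \<open>Recovers the multiple on the edge \<open>w\<close> from a single point at which the
  decaying solution does not vanish, and is therefore linear in \<open>u\<close>.\<close>

definition coeff :: "nat list \<Rightarrow> (tpoint \<Rightarrow> complex) \<Rightarrow> complex" where
  "coeff w u = u (w, samp (length w)) / of_real (ps (length w) (samp (length w)))"

lemma coeff_radial_fun: "w \<in> words b \<Longrightarrow> coeff w (radial_fun a) = a w"
  using samp[of "length w"] by (simp add: coeff_def radial_fun_def tree_fun_def mem_tree)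

lemma coeff_linear: "coeff w (f + g) = coeff w f + coeff w g" "coeff w (cscale x f) = x * coeff w f"
  by (simp_all add: coeff_def cscale_def add_divide_distrib)

lemma radial_fun_linear:
  "radial_fun (\<lambda>w. a w + a' w) = radial_fun a + radial_fun a'" "radial_fun (\<lambda>w. x * a w) = cscale x (radial_fun a)"
  "radial_fun (\<lambda>w. 0) = 0"
  by (auto simp: radial_fun_def tree_fun_def cscale_def fun_eq_iff algebra_simps)

lemma eigenspace_eq: "eigenspace b V \<mu> = radial_fun ` coeffs"
  using eigenfunction_coeffs radial_fun_eigenfunction by blast

lemma coeffs_linear:
  "a \<in> coeffs \<Longrightarrow> a' \<in> coeffs \<Longrightarrow> (\<lambda>w. a w + a' w) \<in> coeffs" "a \<in> coeffs \<Longrightarrow> (\<lambda>w. x * a w) \<in> coeffs" "(\<lambda>w. 0) \<in> coeffs"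
  by (simp_all add: coeffs_def sum.distrib algebra_simps sum_distrib_left[symmetric])

lemma eigenspace_subspace: "module.subspace cscale (eigenspace b V \<mu>)"
proof -
  interpret vector_space "cscale :: complex \<Rightarrow> (tpoint \<Rightarrow> complex) \<Rightarrow> tpoint \<Rightarrow> complex" by (rule vector_space_cscale)
  show ?thesis unfolding eigenspace_eq
  proof (rule subspaceI)
    show "0 \<in> radial_fun ` coeffs" using coeffs_linear(3) radial_fun_linear(3) by (metis image_eqI)
  next
    fix x y assume "x \<in> radial_fun ` coeffs" "y \<in> radial_fun ` coeffs"
    then obtain a a' where a: "x = radial_fun a" "a \<in> coeffs" "y = radial_fun a'" "a' \<in> coeffs" by blast
    show "x + y \<in> radial_fun ` coeffs" unfolding a(1,3) radial_fun_linear(1)[symmetric] by (intro imageI coeffs_linear a)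
  next
    fix x z assume "x \<in> radial_fun ` coeffs"
    then obtain a where a: "x = radial_fun a" "a \<in> coeffs" by blast
    show "cscale z x \<in> radial_fun ` coeffs" unfolding a(1) radial_fun_linear(2)[symmetric] by (intro imageI coeffs_linear a)
  qed
qed

text \<open>If the decaying solution vanishes at the vertices of height \<open>k + 1\<close>, then for every edge \<open>w\<close> of
  length \<open>k\<close> there are \<open>b - 1\<close> eigenfunctions that are supported above the upper end of \<open>w\<close> on the
  branches \<open>j\<close> and \<open>0\<close>, with opposite signs; \<open>None\<close> stands for the radial eigenfunction.\<close>

definition basis_index :: "(nat list \<times> nat) option set" where
  "basis_index = (if fst (v 0 pp) = 0 then {None} else {})
     \<union> Some ` ({w \<in> words b. fst (v (Suc (length w)) pp) = 0} \<times> {1..<b})"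

fun basis_coeffs :: "(nat list \<times> nat) option \<Rightarrow> nat list \<Rightarrow> complex" where
  "basis_coeffs None = (\<lambda>x. if x \<in> words b then 1 else 0)"
| "basis_coeffs (Some (w, j)) = (\<lambda>x. if x \<in> words b then of_bool (prefix (w @ [j]) x) - of_bool (prefix (w @ [0]) x) else 0)"

text \<open>The change of the multiple from \<open>w\<close> to its branch \<open>j\<close>. It
  annihilates every family that does not change at the upper end of \<open>w\<close>.\<close>

fun basis_functional :: "(nat list \<times> nat) option \<Rightarrow> (tpoint \<Rightarrow> complex) \<Rightarrow> complex" where
  "basis_functional None u = coeff [] u"
| "basis_functional (Some (w, j)) u = coeff (w @ [j]) u - coeff w u"

lemma not_prefix_snoc: "\<not> prefix (w @ [j]) w"
  by (auto dest: prefix_length_le)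

lemma basis_coeffs_mem:
  assumes i: "i \<in> basis_index"
  shows "basis_coeffs i \<in> coeffs"
proof (cases i)
  case None
  then have "fst (v 0 pp) = 0" using i by (auto simp: basis_index_def split: if_splits)
  then show ?thesis using None by (simp add: coeffs_def words_snoc)
next
  case (Some wj)
  obtain w j where wj: "wj = (w, j)" by fastforce
  have w: "w \<in> words b" "fst (v (Suc (length w)) pp) = 0" "1 \<le> j" "j < b"
    using i Some wj by (auto simp: basis_index_def split: if_splits)
  have ij: "of_bool (prefix (w @ [m]) (x @ [i'])) = (of_bool (prefix (w @ [m]) x) + of_bool (w = x \<and> m = i') :: complex)" for x m i'
    using not_prefix_snoc[of w m] by auto
  have "(\<Sum>i'<b. basis_coeffs i (x @ [i'])) = of_nat b * basis_coeffs i x" if x: "x \<in> words b" for x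
  proof -
    have "(\<Sum>i'<b. basis_coeffs i (x @ [i'])) = (\<Sum>i'<b. basis_coeffs i x + (of_bool (w = x \<and> j = i') - of_bool (w = x \<and> 0 = i')))"
      by (rule sum.cong) (use x in \<open>simp_all add: Some wj words_snoc ij del: prefix_snoc\<close>)
    also have "\<dots> = of_nat b * basis_coeffs i x + (\<Sum>i'<b. of_bool (w = x \<and> j = i') - of_bool (w = x \<and> 0 = i'))"
      by (simp add: sum.distrib)
    also have "(\<Sum>i'<b. of_bool (w = x \<and> j = i') - of_bool (w = x \<and> 0 = i') :: complex) = 0"
      using w(3,4) by (cases "w = x") (simp_all add: sum_subtractf of_bool_def)
    finally show ?thesis by simp
  qed
  moreover have "basis_coeffs i (x @ [i']) = basis_coeffs i x" if "x \<in> words b" "i' < b" "fst (v (Suc (length x)) pp) \<noteq> 0" for x i'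
    using that w(2) by (auto simp: Some wj words_snoc)
  ultimately show ?thesis by (auto simp: coeffs_def Some wj)
qed

text \<open>A prefix condition has the same value for \<open>w\<close> and for its branch
  \<open>m\<close>, unless the prefix is that branch itself; so only the diagonal terms survive the
  difference. The reference branch 0 is never an index.\<close>

lemma basis_dual:
  assumes i: "i \<in> basis_index" and j: "j \<in> basis_index"
  shows "basis_functional i (radial_fun (basis_coeffs j)) = (if i = j then 1 else 0)"
proof (cases i)
  case None
  then show ?thesis by (cases j) (auto simp: coeff_radial_fun words_Nil)
next
  case (Some wj)
  obtain w m where wj: "wj = (w, m)" by fastforce
  have w: "w \<in> words b" "1 \<le> m" "m < b" using i Some wj by (auto simp: basis_index_def split: if_splits)
  have ws: "w @ [m] \<in> words b" using w by (simp add: words_snoc)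
  show ?thesis
  proof (cases j)
    case None
    then show ?thesis using w ws by (simp add: Some wj coeff_radial_fun)
  next
    case (Some wj')
    obtain w' m' where wj': "wj' = (w', m')" by fastforce
    have "1 \<le> m'" using j Some wj' by (auto simp: basis_index_def split: if_splits)
    have ij: "of_bool (prefix (w' @ [x]) (w @ [m])) = (of_bool (prefix (w' @ [x]) w) + of_bool (w' = w \<and> x = m) :: complex)" for x
      using not_prefix_snoc[of w' x] by auto
    have "basis_functional i (radial_fun (basis_coeffs j)) = of_bool (w' = w \<and> m' = m) - of_bool (w' = w \<and> 0 = m)"
      using w(1) ws by (simp add: \<open>i = Some wj\<close> wj Some wj' coeff_radial_fun ij del: prefix_snoc)
    then show ?thesis using w(2) by (auto simp: \<open>i = Some wj\<close> wj Some wj')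
  qed
qed

text \<open>Induction along the word, with multiple 0 on \<open>w\<close>: where the solution does
  not vanish the branches inherit it; where it vanishes the functionals remove the branches
  \<open>m >= 1\<close>, and the sum condition removes branch 0.\<close>

lemma basis_separates:
  assumes u: "u \<in> eigenspace b V \<mu>" and z: "\<And>i. i \<in> basis_index \<Longrightarrow> basis_functional i u = 0"
  shows "u = 0"
proof -
  obtain a where a: "a \<in> coeffs" "u = radial_fun a" using u unfolding eigenspace_eq by blast
  have "w \<in> words b \<Longrightarrow> a w = 0" for w
  proof (induction w rule: rev_induct)
    case Nil
    show ?case
    proof (cases "fst (v 0 pp) = 0")
      case True
      then show ?thesis using z[of None] by (simp add: basis_index_def a(2) coeff_radial_fun words_Nil)
    next
      case False
      then show ?thesis using a(1) by (simp add: coeffs_def)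
    qed
  next
    case (snoc j w)
    then have w: "w \<in> words b" "j < b" "a w = 0" by (auto simp: words_snoc)
    show ?case
    proof (cases "fst (v (Suc (length w)) pp) = 0")
      case True
      have pos: "a (w @ [m]) = 0" if "1 \<le> m" "m < b" for m
        using z[of "Some (w, m)"] w True that by (simp add: basis_index_def a(2) coeff_radial_fun words_snoc)
      have "(\<Sum>m<b. a (w @ [m])) = 0" using a(1) w by (simp add: coeffs_def)
      also have "(\<Sum>m<b. a (w @ [m])) = a (w @ [0]) + (\<Sum>m\<in>{..<b} - {0}. a (w @ [m]))"
        using w(2) by (subst sum.remove[of _ 0]) auto
      also have "(\<Sum>m\<in>{..<b} - {0}. a (w @ [m])) = 0" by (rule sum.neutral) (auto intro: pos)
      finally have "a (w @ [0]) = 0" by simp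
      then show ?thesis using pos[of j] w(2) by (cases "j = 0") auto
    next
      case False
      then show ?thesis using a(1) w by (simp add: coeffs_def)
    qed
  qed
  moreover have "a w = 0" if "w \<notin> words b" for w using a(1) that by (simp add: coeffs_def)
  ultimately have "a = (\<lambda>w. 0)" by (intro ext) blast
  then show ?thesis using a(2) radial_fun_linear(3) by simp
qed

lemma card_basis_index:
  "finite basis_index" "card basis_index = (\<Sum>k | fst (v k pp) = 0. branch_multiplicity b k)"
proof -
  let ?Z = "{k. fst (v k pp) = 0}"
  let ?K = "{k. fst (v (Suc k) pp) = 0}"
  let ?W = "{w \<in> words b. fst (v (Suc (length w)) pp) = 0}"
  have ZK: "?Z = (if fst (v 0 pp) = 0 then {0} else {}) \<union> Suc ` ?K"
  proof (rule set_eqI)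
    fix k show "k \<in> ?Z \<longleftrightarrow> k \<in> (if fst (v 0 pp) = 0 then {0} else {}) \<union> Suc ` ?K"
      by (cases k) auto
  qed
  have "finite (Suc ` ?K)" by (rule finite_subset[OF _ finite_zero_levels]) auto
  then have K: "finite ?K" by (rule finite_imageD) simp
  have W: "?W = (\<Union>k\<in>?K. level b k)" by (auto simp: level_def)
  have fW: "finite ?W" unfolding W by (intro finite_UN_I K finite_level)
  have cW: "card ?W = (\<Sum>k\<in>?K. b ^ k)"
    unfolding W
  proof (subst card_UN_disjoint[OF K])
    show "\<forall>i\<in>?K. \<forall>j\<in>?K. i \<noteq> j \<longrightarrow> level b i \<inter> level b j = {}" by (auto simp: level_def)
  qed (simp_all add: finite_level card_level)
  show fin: "finite basis_index" unfolding basis_index_def using fW by auto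
  have "card basis_index = card (if fst (v 0 pp) = 0 then {None :: (nat list \<times> nat) option} else {}) + card (Some ` (?W \<times> {1..<b}))"
    unfolding basis_index_def by (rule card_Un_disjoint) (use fW in auto)
  also have "card (Some ` (?W \<times> {1..<b})) = card ?W * (b - 1)"
    by (subst card_image) (auto simp: card_cartesian_product)
  also have "\<dots> = (\<Sum>k\<in>?K. branch_multiplicity b (Suc k))"
    unfolding cW sum_distrib_right by (simp add: branch_multiplicity_def)
  also have "\<dots> = (\<Sum>k\<in>Suc ` ?K. branch_multiplicity b k)" by (subst sum.reindex) auto
  also have "card (if fst (v 0 pp) = 0 then {None :: (nat list \<times> nat) option} else {}) = (\<Sum>k\<in>(if fst (v 0 pp) = 0 then {0} else {}). branch_multiplicity b k)"
    by (simp add: branch_multiplicity_def)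
  also have "\<dots> + (\<Sum>k\<in>Suc ` ?K. branch_multiplicity b k) = (\<Sum>k\<in>?Z. branch_multiplicity b k)"
    unfolding ZK by (subst sum.union_disjoint) (use K in auto)
  finally show "card basis_index = (\<Sum>k | fst (v k pp) = 0. branch_multiplicity b k)" .
qed

lemma cdim_eigenspace:
  "cdim (eigenspace b V \<mu>) = enat (\<Sum>k | fst (v k pp) = 0. branch_multiplicity b k)"
proof -
  have "cdim (eigenspace b V \<mu>) = enat (card basis_index)"
  proof (rule cdim_dual_basis[where e = "\<lambda>i. radial_fun (basis_coeffs i)" and L = basis_functional])
    show "radial_fun (basis_coeffs i) \<in> eigenspace b V \<mu>" if "i \<in> basis_index" for i
      unfolding eigenspace_eq by (intro imageI basis_coeffs_mem that)
    show "basis_functional i (f + g) = basis_functional i f + basis_functional i g" for i f g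
      by (cases "(i, f)" rule: basis_functional.cases) (simp_all add: coeff_linear)
    show "basis_functional i (cscale x f) = x * basis_functional i f" for i f x
      by (cases "(i, f)" rule: basis_functional.cases) (simp_all add: coeff_linear algebra_simps)
  qed (use card_basis_index(1) eigenspace_subspace basis_dual basis_separates in auto)
  then show ?thesis by (simp only: card_basis_index(2))
qed

end

section \<open>Counting and its asymptotics\<close>

lemma sum_triangle_swap:
  "(\<Sum>k<T. \<Sum>n\<in>{k..<T}. f k n) = (\<Sum>n<T. \<Sum>k\<le>n. f k n)" for T :: nat and f :: "nat \<Rightarrow> nat \<Rightarrow> 'a :: comm_monoid_add"
proof (induction T)
  case (Suc T)
  have "(\<Sum>k<T. \<Sum>n\<in>{k..<Suc T}. f k n) = (\<Sum>k<T. (\<Sum>n\<in>{k..<T}. f k n) + f k T)"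
    by (intro sum.cong refl) (simp add: sum.op_ivl_Suc)
  then show ?case using Suc by (simp add: sum.distrib lessThan_Suc_atMost[symmetric] ac_simps)
qed simp

lemma cesaro_means:
  fixes x :: "nat \<Rightarrow> real"
  assumes x: "x \<longlonglongrightarrow> L"
  shows "(\<lambda>N. (\<Sum>n<N. x n) / real N) \<longlonglongrightarrow> L"
proof (rule LIMSEQ_I)
  fix e :: real assume e: "0 < e"
  obtain N0 where N0: "\<And>n. n \<ge> N0 \<Longrightarrow> \<bar>x n - L\<bar> < e / 2"
    using LIMSEQ_D[OF x, of "e / 2"] e by auto
  define M where "M = (\<Sum>n<N0. \<bar>x n - L\<bar>)"
  obtain N1 :: nat where N1: "M / (e / 2) < real N1" using reals_Archimedean2 by blast
  show "\<exists>no. \<forall>N\<ge>no. norm ((\<Sum>n<N. x n) / real N - L) < e"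
  proof (intro exI allI impI)
    fix N assume N: "N \<ge> Suc (max N0 N1)"
    then have N': "0 < real N" "N0 \<le> N" "real N1 < real N" by auto
    have "M < real N1 * (e / 2)" using N1 e by (simp add: field_simps)
    also have "\<dots> < real N * (e / 2)" using N'(3) e by (intro mult_strict_right_mono) auto
    finally have Mlt: "M < real N * (e / 2)" .
    have "\<bar>(\<Sum>n<N. x n) - real N * L\<bar> = \<bar>\<Sum>n<N. x n - L\<bar>" by (simp add: sum_subtractf)
    also have "\<dots> \<le> (\<Sum>n<N. \<bar>x n - L\<bar>)" by (rule sum_abs)
    also have "\<dots> = M + (\<Sum>n\<in>{N0..<N}. \<bar>x n - L\<bar>)"
      unfolding M_def using N' by (simp add: lessThan_atLeast0 sum.atLeastLessThan_concat)
    also have "(\<Sum>n\<in>{N0..<N}. \<bar>x n - L\<bar>) \<le> (\<Sum>n\<in>{N0..<N}. e / 2)" by (rule sum_mono, rule less_imp_le, rule N0) simp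
    also have "\<dots> \<le> real N * (e / 2)" using e by (simp add: mult_right_mono)
    also have "M < real N * (e / 2)" by (rule Mlt)
    finally have "\<bar>(\<Sum>n<N. x n) - real N * L\<bar> < e * real N" by simp
    moreover have "(\<Sum>n<N. x n) / real N - L = ((\<Sum>n<N. x n) - real N * L) / real N" using N' by (simp add: field_simps)
    ultimately show "norm ((\<Sum>n<N. x n) / real N - L) < e" using N' by (simp add: abs_divide pos_divide_less_eq)
  qed
qed

context window
begin

definition count :: "nat \<Rightarrow> real \<Rightarrow> real \<Rightarrow> nat" where
  "count T g \<mu> = (\<Sum>k<T. branch_multiplicity b k * card (zeros k g \<mu>))"

text \<open>A summand can differ from 0 only if \<open>\<alpha> * g\<close> is a zero for some
  height below \<open>T\<close>, since weak coupling excludes zeros from \<open>T\<close> on. Only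
  finitely many \<alpha> remain, and exchanging the sums over \<alpha> and \<open>k\<close> counts
  zeros with multiplicity.\<close>

lemma interior_count_eq:
  assumes \<mu>: "\<mu> \<in> J0" and g: "0 < g" "g * qbar T \<le> h0" and V: "\<And>t. t > 0 \<Longrightarrow> V t = - g * q t"
  shows "interior_count b V \<mu> = ereal (real (count T g \<mu>))"
proof -
  have mJ: "\<mu> \<in> J" using \<mu> by (simp add: J0_def)
  define F where "F \<alpha> = (\<Sum>k<T. branch_multiplicity b k * of_bool (fst (v k (\<alpha> * g, \<mu>)) = 0))" for \<alpha>
  have dim: "cdim (eigenspace b (\<lambda>t. \<alpha> * V t) \<mu>) = enat (F \<alpha>)" if \<alpha>: "\<alpha> \<in> {0<..<1}" for \<alpha>
  proof -
    interpret decaying_eigenfunction b q c C J sg "\<alpha> * g" \<mu> "\<lambda>t. \<alpha> * V t"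
      by unfold_locales (use \<mu> g V \<alpha> in auto)
    have "fst (v k (\<alpha> * g, \<mu>)) \<noteq> 0" if "T \<le> k" for k
    proof (rule no_zeros[OF mJ])
      show "g * qbar k \<le> h0" using qbar_antimono[OF that] g by (meson less_imp_le mult_left_mono order_trans)
      show "0 \<le> \<alpha> * g" "\<alpha> * g \<le> g" using \<alpha> g by (auto simp: mult_left_le_one_le)
    qed
    then have "{k. fst (v k (\<alpha> * g, \<mu>)) = 0} = {k \<in> {..<T}. fst (v k (\<alpha> * g, \<mu>)) = 0}"
      by (auto simp: not_le[symmetric])
    then have "(\<Sum>k | fst (v k (\<alpha> * g, \<mu>)) = 0. branch_multiplicity b k) = (\<Sum>k\<in>{k \<in> {..<T}. fst (v k (\<alpha> * g, \<mu>)) = 0}. branch_multiplicity b k)"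
      by (rule sum.cong) simp
    also have "\<dots> = (\<Sum>k<T. if fst (v k (\<alpha> * g, \<mu>)) = 0 then branch_multiplicity b k else 0)" by (rule sum.inter_filter) simp
    also have "\<dots> = F \<alpha>" unfolding F_def by (intro sum.cong) auto
    finally show ?thesis unfolding cdim_eigenspace by simp
  qed
  let ?A = "\<Union>k<T. (\<lambda>s. s / g) ` zeros k g \<mu>"
  have fin: "finite ?A" using zeros_card(1)[OF \<mu> g] by auto
  have A01: "?A \<subseteq> {0<..<1}" using g by (auto simp: zeros_def)
  have mem: "{\<alpha> \<in> ?A. fst (v k (\<alpha> * g, \<mu>)) = 0} = (\<lambda>s. s / g) ` zeros k g \<mu>" if "k < T" for k
    using that g by (force simp: zeros_def)
  have F0: "F \<alpha> = 0" if "\<alpha> \<in> {0<..<1} - ?A" for \<alpha>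
  proof -
    have "fst (v k (\<alpha> * g, \<mu>)) \<noteq> 0" if k: "k < T" for k
    proof
      assume "fst (v k (\<alpha> * g, \<mu>)) = 0"
      then have "\<alpha> * g \<in> zeros k g \<mu>" using \<open>\<alpha> \<in> {0<..<1} - ?A\<close> g by (auto simp: zeros_def)
      then have "\<alpha> * g / g \<in> ?A" using k by blast
      then show False using \<open>\<alpha> \<in> {0<..<1} - ?A\<close> g by simp
    qed
    then show ?thesis by (simp add: F_def)
  qed
  have "interior_count b V \<mu> = (\<Sum>\<^sub>\<infinity>\<alpha>\<in>?A. ereal (real (F \<alpha>)))"
    unfolding interior_count_def
  proof (rule infsum_cong_neutral)
    show "ereal_of_enat (cdim (eigenspace b (\<lambda>t. \<alpha> * V t) \<mu>)) = 0" if "\<alpha> \<in> {0<..<1} - ?A" for \<alpha>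
      using that dim[of \<alpha>] F0[OF that] by (simp add: zero_enat_def[symmetric])
    show "ereal_of_enat (cdim (eigenspace b (\<lambda>t. \<alpha> * V t) \<mu>)) = ereal (real (F \<alpha>))" if "\<alpha> \<in> {0<..<1} \<inter> ?A" for \<alpha>
      using that dim[of \<alpha>] by simp
    show "ereal (real (F \<alpha>)) = 0" if "\<alpha> \<in> ?A - {0<..<1}" for \<alpha>
      using that A01 by blast
  qed
  also have "\<dots> = ereal (real (\<Sum>\<alpha>\<in>?A. F \<alpha>))" using fin by simp
  also have "(\<Sum>\<alpha>\<in>?A. F \<alpha>) = (\<Sum>k<T. branch_multiplicity b k * (\<Sum>\<alpha>\<in>?A. of_bool (fst (v k (\<alpha> * g, \<mu>)) = 0)))"
    unfolding F_def sum_distrib_left by (rule sum.swap)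
  also have "\<dots> = count T g \<mu>"
    unfolding count_def
  proof (intro sum.cong refl arg_cong2[where f = times])
    fix k assume k: "k \<in> {..<T}"
    have "(\<Sum>\<alpha>\<in>?A. of_bool (fst (v k (\<alpha> * g, \<mu>)) = 0)) = card {\<alpha> \<in> ?A. fst (v k (\<alpha> * g, \<mu>)) = 0}"
      using fin by (simp add: of_bool_def sum.inter_filter[symmetric])
    also have "\<dots> = card (zeros k g \<mu>)"
      using mem[of k] k g by (simp add: card_image inj_on_def)
    finally show "(\<Sum>\<alpha>\<in>?A. of_bool (fst (v k (\<alpha> * g, \<mu>)) = 0)) = card (zeros k g \<mu>)" .
  qed
  finally show ?thesis .
qed

lemma count_mono:
  assumes "{\<mu>1..\<mu>2} \<subseteq> J0" "\<mu>1 \<le> \<mu>2" "0 < g" "g * qbar T \<le> h0"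
  shows "count T g \<mu>1 \<le> count T g \<mu>2"
  unfolding count_def by (intro sum_mono mult_left_mono zeros_mono[OF assms]) auto

definition level_sum :: "nat \<Rightarrow> real" where "level_sum T = (\<Sum>n<T. B ^ n * dq n)"

text \<open>The estimates for the separate heights are summed with their multiplicities. In the main
  term the sums are exchanged, so that the edges at height \<open>n\<close> receive the total
  multiplicity \<open>b^n\<close>; the errors sum to a multiple of \<open>b^T\<close> instead of
  \<open>T b^T\<close>.\<close>

lemma count_estimate:
  assumes \<mu>: "\<mu> \<in> J0" and g: "0 < g" "g * qbar T \<le> h0"
  shows "\<bar>pi * count T g \<mu> - sqrt g * level_sum T\<bar> \<le> (2 * pi + \<bar>K1\<bar>) * B ^ T"
proof -
  let ?m = "\<lambda>k. real (branch_multiplicity b k)"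
  have m: "(\<Sum>k\<le>n. ?m k) = B ^ n" for n
    using sum_branch_multiplicity[of b n] b2 by (simp flip: of_nat_sum of_nat_power)
  have geo: "(\<Sum>n<T. B ^ n) \<le> B ^ T"
  proof (induction T)
    case (Suc T)
    have "2 * B ^ T \<le> B * B ^ T" using B2 by (intro mult_right_mono) auto
    then show ?case using Suc by simp
  qed simp
  have m1: "(\<Sum>k<T. ?m k) \<le> B ^ T"
  proof (cases T)
    case (Suc n)
    have "B ^ n \<le> B * B ^ n" using B2 by (simp add: mult_le_cancel_right1)
    then show ?thesis using Suc m[of n] by (simp add: lessThan_Suc_atMost)
  qed simp
  \<comment> \<open>\<open>T - k\<close> is the number of \<open>n\<close> with
    \<open>k <= n < T\<close>, so the same exchange yields a geometric sum.\<close>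
  have m2: "(\<Sum>k<T. ?m k * real (T - k)) \<le> B ^ T"
  proof -
    have "(\<Sum>k<T. ?m k * real (T - k)) = (\<Sum>k<T. \<Sum>n\<in>{k..<T}. ?m k)" by (simp add: mult.commute)
    also have "\<dots> = (\<Sum>n<T. B ^ n)" unfolding sum_triangle_swap m ..
    finally show ?thesis using geo by simp
  qed
  have "level_sum T = (\<Sum>k<T. ?m k * (\<Sum>n\<in>{k..<T}. dq n))"
    unfolding level_sum_def sum_distrib_left sum_triangle_swap sum_distrib_right[symmetric] m ..
  then have "pi * count T g \<mu> - sqrt g * level_sum T = (\<Sum>k<T. ?m k * (pi * card (zeros k g \<mu>) - sqrt g * (\<Sum>n\<in>{k..<T}. dq n)))"
    by (simp add: count_def right_diff_distrib sum_subtractf sum_distrib_left mult_ac)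
  also have "\<bar>\<dots>\<bar> \<le> (\<Sum>k<T. \<bar>?m k * (pi * card (zeros k g \<mu>) - sqrt g * (\<Sum>n\<in>{k..<T}. dq n))\<bar>)" by (rule sum_abs)
  also have "\<dots> \<le> (\<Sum>k<T. ?m k * (2 * pi + \<bar>K1\<bar> * real (T - k)))"
  proof (rule sum_mono)
    fix k assume "k \<in> {..<T}"
    then have "\<bar>pi * card (zeros k g \<mu>) - sqrt g * (\<Sum>n\<in>{k..<T}. dq n)\<bar> \<le> 2 * pi + K1 * real (T - k)"
      by (intro zeros_card(2)[OF \<mu> g]) auto
    also have "\<dots> \<le> 2 * pi + \<bar>K1\<bar> * real (T - k)" by (intro add_left_mono mult_right_mono) auto
    finally show "\<bar>?m k * (pi * card (zeros k g \<mu>) - sqrt g * (\<Sum>n\<in>{k..<T}. dq n))\<bar> \<le> ?m k * (2 * pi + \<bar>K1\<bar> * real (T - k))"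
      by (simp add: abs_mult mult_left_mono)
  qed
  also have "\<dots> = 2 * pi * (\<Sum>k<T. ?m k) + \<bar>K1\<bar> * (\<Sum>k<T. ?m k * real (T - k))"
    by (simp add: distrib_left sum.distrib sum_distrib_left mult_ac)
  also have "\<dots> \<le> 2 * pi * B ^ T + \<bar>K1\<bar> * B ^ T" by (intro add_mono mult_left_mono m1 m2) auto
  finally show ?thesis by (simp add: distrib_right)
qed

text \<open>The first height of weak coupling. Its minimality makes \<open>b ^ depth g\<close>
  comparable with \<open>sqrt g\<close>, so that the error of the count is
  \<open>O(sqrt g)\<close>.\<close>

definition depth :: "real \<Rightarrow> nat" where "depth g = (LEAST T. g * qbar T \<le> h0)"

lemma depth: "0 \<le> g \<Longrightarrow> g * qbar (depth g) \<le> h0"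
  unfolding depth_def using small_eventually[of g] by (metis (mono_tags, lifting) LeastI order_refl)

text \<open>One generation below the depth the coupling is still strong, which gives
  \<open>b^(depth - 1) <= sqrt (g C / h0)\<close>; the summand 1 takes care of depth 0.\<close>

definition Kdepth :: real where "Kdepth = 1 + B * sqrt (C / h0)"

lemma Kdepth_ge: "1 \<le> Kdepth" using B2 C_pos h0_pos by (simp add: Kdepth_def)

lemma depth_bounds:
  assumes g: "1 \<le> g"
  shows "B ^ depth g \<le> Kdepth * sqrt g" "g * C / h0 \<le> (B ^ depth g)\<^sup>2"
proof -
  have qb: "qbar n = C / (B ^ n)\<^sup>2" for n
    by (simp add: qbar_def power_divide power_mult[symmetric] mult.commute)
  have Bn: "B ^ n > 0" for n using B2 by simp
  show "g * C / h0 \<le> (B ^ depth g)\<^sup>2"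
    using depth[of g] g h0_pos Bn[of "depth g"] by (simp add: qb field_simps)
  show "B ^ depth g \<le> Kdepth * sqrt g"
  proof (cases "depth g")
    case 0
    have "1 * 1 \<le> Kdepth * sqrt g" using Kdepth_ge g by (intro mult_mono) auto
    then show ?thesis using 0 by simp
  next
    case (Suc n)
    have "\<not> g * qbar n \<le> h0" using not_less_Least[of n "\<lambda>T. g * qbar T \<le> h0"] Suc by (simp add: depth_def)
    then have "(B ^ n)\<^sup>2 < (C / h0) * g" using h0_pos Bn[of n] by (simp add: qb field_simps)
    then have "B ^ n \<le> sqrt ((C / h0) * g)" by (intro real_le_rsqrt) simp
    then have "B * B ^ n \<le> B * (sqrt (C / h0) * sqrt g)" using B2 unfolding real_sqrt_mult[symmetric] by (intro mult_left_mono) auto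
    also have "\<dots> \<le> Kdepth * sqrt g" using g by (simp add: Kdepth_def distrib_right)
    finally show ?thesis using Suc by simp
  qed
qed

definition Kcount :: real where "Kcount = (2 * pi + \<bar>K1\<bar>) * Kdepth"

lemma count_estimate':
  assumes "\<mu> \<in> J0" "1 \<le> g"
  shows "\<bar>pi * count (depth g) g \<mu> - sqrt g * level_sum (depth g)\<bar> \<le> Kcount * sqrt g"
proof -
  have "(2 * pi + \<bar>K1\<bar>) * B ^ depth g \<le> (2 * pi + \<bar>K1\<bar>) * (Kdepth * sqrt g)"
    using depth_bounds(1)[OF assms(2)] by (intro mult_left_mono) (auto intro: add_nonneg_nonneg)
  then show ?thesis using count_estimate[OF assms(1) _ depth, of g] assms(2) by (simp add: Kcount_def mult_ac)
qed

text \<open>The logarithms of the two bounds say that \<open>depth g * ln B\<close> is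
  \<open>ln g / 2\<close> up to a bounded error.\<close>

lemma depth_asymp: "((\<lambda>g. real (depth g) / ln g) \<longlongrightarrow> 1 / (2 * ln B)) at_top"
proof -
  have lB: "ln B > 0" using B2 by simp
  have lim: "((\<lambda>g. (1 + a / ln g) / (2 * ln B)) \<longlongrightarrow> (1 + 0) / (2 * ln B)) at_top" for a
    using lB by (intro tendsto_intros tendsto_divide_0[OF tendsto_const] filterlim_at_top_imp_at_infinity ln_at_top) auto
  show ?thesis
  proof (rule tendsto_sandwich)
    show "((\<lambda>g. (1 + ln (C / h0) / ln g) / (2 * ln B)) \<longlongrightarrow> 1 / (2 * ln B)) at_top" using lim by simp
    show "((\<lambda>g. (1 + 2 * ln Kdepth / ln g) / (2 * ln B)) \<longlongrightarrow> 1 / (2 * ln B)) at_top" using lim by simp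
    show "eventually (\<lambda>g. (1 + ln (C / h0) / ln g) / (2 * ln B) \<le> real (depth g) / ln g) at_top"
      using eventually_gt_at_top[of 1]
    proof eventually_elim
      case (elim g)
      have "ln (g * (C / h0)) \<le> ln ((B ^ depth g)\<^sup>2)"
        using depth_bounds(2)[of g] elim C_pos h0_pos B2 by (subst ln_le_cancel_iff) auto
      also have "\<dots> = 2 * (real (depth g) * ln B)" using B2 by (simp add: ln_realpow)
      also have "ln (g * (C / h0)) = ln g + ln (C / h0)" using elim C_pos h0_pos by (intro ln_mult_pos) auto
      finally have "(ln g + ln (C / h0)) / (2 * ln B * ln g) \<le> 2 * (real (depth g) * ln B) / (2 * ln B * ln g)"
        using elim lB by (intro divide_right_mono) auto
      moreover have "(1 + ln (C / h0) / ln g) / (2 * ln B) = (ln g + ln (C / h0)) / (2 * ln B * ln g)"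
        using elim by (simp add: add_divide_distrib)
      ultimately show ?case using lB by simp
    qed
    show "eventually (\<lambda>g. real (depth g) / ln g \<le> (1 + 2 * ln Kdepth / ln g) / (2 * ln B)) at_top"
      using eventually_gt_at_top[of 1]
    proof eventually_elim
      case (elim g)
      have "real (depth g) * ln B = ln (B ^ depth g)" using B2 by (simp add: ln_realpow)
      also have "\<dots> \<le> ln (Kdepth * sqrt g)" using depth_bounds(1)[of g] elim Kdepth_ge B2 by (subst ln_le_cancel_iff) auto
      also have "\<dots> = ln Kdepth + ln (sqrt g)" using elim Kdepth_ge by (intro ln_mult_pos) auto
      also have "ln (sqrt g) = ln g / 2" using elim by (simp add: ln_sqrt)
      finally show ?case using elim lB by (simp add: field_simps)
    qed
  qed
qed

lemma depth_at_top: "filterlim depth at_top at_top"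
proof -
  have "filterlim (\<lambda>g. (real (depth g) / ln g) * ln g) at_top at_top"
    by (rule filterlim_tendsto_pos_mult_at_top[OF depth_asymp _ ln_at_top]) (use B2 in simp)
  then have "filterlim (\<lambda>g. real (depth g)) at_top at_top"
    by (rule filterlim_cong[THEN iffD1, OF refl refl, rotated]) (rule eventually_mono[OF eventually_gt_at_top[of 1]], simp)
  then show ?thesis
    unfolding filterlim_at_top
  proof (intro allI)
    fix Z :: nat
    assume "\<forall>Z. eventually (\<lambda>g. Z \<le> real (depth g)) at_top"
    then have "eventually (\<lambda>g. real Z \<le> real (depth g)) at_top" by blast
    then show "eventually (\<lambda>g. Z \<le> depth g) at_top" by simp
  qed
qed

lemma abs_sqrt_minus_1: "0 \<le> z \<Longrightarrow> \<bar>sqrt z - 1\<bar> \<le> \<bar>z - 1\<bar>" for z :: real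
proof -
  assume z: "0 \<le> z"
  have "\<bar>sqrt z - 1\<bar> * 1 \<le> \<bar>sqrt z - 1\<bar> * (sqrt z + 1)" using z by (intro mult_left_mono) auto
  also have "\<dots> = \<bar>(sqrt z - 1) * (sqrt z + 1)\<bar>" using z by (simp add: abs_mult)
  also have "(sqrt z - 1) * (sqrt z + 1) = z - 1" using z by (simp add: algebra_simps)
  finally show ?thesis by simp
qed

context
  assumes q_asymp: "((\<lambda>t. q t * B powr (2 * t)) \<longlongrightarrow> 1) at_top"
begin

text \<open>On the edge at height \<open>n\<close> the rescaled integrand
  \<open>b^n sqrt (q (n + 1 - x))\<close> converges to \<open>b^(x - 1)\<close> uniformly in
  \<open>x\<close>.\<close>

lemma dq_limit: "(\<lambda>n. B ^ n * dq n) \<longlonglongrightarrow> (1 - 1 / B) / ln B"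
proof (rule LIMSEQ_I)
  fix e :: real assume e: "0 < e"
  have lB: "ln B > 0" using B2 by simp
  have I: "((\<lambda>x. B powr (x - 1)) has_integral (B powr (1 - 1) / ln B - B powr (0 - 1) / ln B)) {0..1}"
  proof (rule fundamental_theorem_of_calculus)
    fix x :: real
    have "((\<lambda>x. exp ((x - 1) * ln B) / ln B) has_real_derivative exp ((x - 1) * ln B)) (at x within {0..1})"
      using lB by (auto intro!: derivative_eq_intros)
    then show "((\<lambda>x. B powr (x - 1) / ln B) has_vector_derivative B powr (x - 1)) (at x within {0..1})"
      using B2 by (simp add: powr_def has_real_derivative_iff_has_vector_derivative)
  qed simp
  then have L: "(1 - 1 / B) / ln B = integral {0..1} (\<lambda>x. B powr (x - 1))"
    using B2 by (simp add: integral_unique powr_minus_divide diff_divide_distrib)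
  have "eventually (\<lambda>t. dist (q t * B powr (2 * t)) 1 < e / 2) at_top"
    using q_asymp e by (intro tendstoD) auto
  then obtain T where T: "\<And>t. t \<ge> T \<Longrightarrow> \<bar>q t * B powr (2 * t) - 1\<bar> < e / 2"
    by (auto simp: eventually_at_top_linorder dist_real_def)
  obtain N :: nat where N: "T \<le> real N" using real_arch_simple by blast
  show "\<exists>no. \<forall>n\<ge>no. norm (B ^ n * dq n - (1 - 1 / B) / ln B) < e"
  proof (intro exI allI impI)
    fix n assume n: "n \<ge> N"
    let ?f = "\<lambda>x. B ^ n * sqrt (q (real n + 1 - x))" and ?h = "\<lambda>x. B powr (x - 1)"
    have fi: "?f integrable_on {0..1}"
      by (intro integrable_continuous_real continuous_intros continuous_on_compose2[OF q_cont]) auto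
    have hi: "?h integrable_on {0..1}" using I by blast
    have bd: "norm (?f x - ?h x) \<le> e / 2" if x: "x \<in> {0..1}" for x
    proof -
      let ?t = "real n + 1 - x"
      have t: "T \<le> ?t" "0 \<le> ?t" using x n N by auto
      have q0: "0 \<le> q ?t * B powr (2 * ?t)" using q_lower[OF t(2)] c_pos B2 by (meson mult_nonneg_nonneg order_trans powr_ge_zero less_imp_le)
      have "B ^ n = B powr (x - 1) * B powr ?t" using B2 by (simp add: powr_add[symmetric] powr_realpow)
      moreover have "sqrt (q ?t * B powr (2 * ?t)) = sqrt (q ?t) * B powr ?t"
        unfolding real_sqrt_mult by (intro arg_cong2[where f = times] refl real_sqrt_unique) (simp_all add: power2_eq_square powr_add[symmetric] algebra_simps)
      ultimately have "?f x - ?h x = ?h x * (sqrt (q ?t * B powr (2 * ?t)) - 1)" by (simp add: algebra_simps)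
      also have "norm \<dots> \<le> 1 * \<bar>q ?t * B powr (2 * ?t) - 1\<bar>"
        unfolding real_norm_def abs_mult
      proof (rule mult_mono)
        have "B powr (x - 1) \<le> B powr 0" using x B2 by (intro powr_mono) auto
        then show "\<bar>B powr (x - 1)\<bar> \<le> 1" using B2 by simp
      qed (use abs_sqrt_minus_1[OF q0] in auto)
      also have "\<dots> \<le> e / 2" using T[OF t(1)] by simp
      finally show ?thesis .
    qed
    have "norm (integral {0..1} (\<lambda>x. ?f x - ?h x)) \<le> integral {0..1} (\<lambda>x::real. e / 2)"
      by (rule integral_norm_bound_integral[OF integrable_diff[OF fi hi] _ bd]) auto
    moreover have "integral {0..1} (\<lambda>x. ?f x - ?h x) = B ^ n * dq n - (1 - 1 / B) / ln B"
      unfolding L dq_def integral_mult_right[symmetric] by (rule integral_diff[OF fi hi])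
    ultimately show "norm (B ^ n * dq n - (1 - 1 / B) / ln B) < e" using e by simp
  qed
qed

text \<open>The terms of \<open>level_sum\<close> converge, hence so do their means; the number of
  terms supplies the factor \<open>1 / (2 ln b)\<close> relative to \<open>ln g\<close>.\<close>

lemma level_sum_asymp: "((\<lambda>g. level_sum (depth g) / ln g) \<longlongrightarrow> (1 - 1 / B) / ln B * (1 / (2 * ln B))) at_top"
proof -
  have "((\<lambda>g. level_sum (depth g) / real (depth g)) \<longlongrightarrow> (1 - 1 / B) / ln B) at_top"
    using filterlim_compose[OF cesaro_means[OF dq_limit] depth_at_top] unfolding level_sum_def .
  from tendsto_mult[OF this depth_asymp] show ?thesis
    by (rule tendsto_cong[THEN iffD1, rotated]) (auto simp: level_sum_def intro!: always_eventually)
qed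

text \<open>Formulated for any function with this error bound, so that it applies to the counts
  inside a gap and to their one-sided limits at its ends.\<close>

lemma count_asymptotics:
  assumes x: "\<And>g. g \<ge> 1 \<Longrightarrow> \<bar>pi * x g - sqrt g * level_sum (depth g)\<bar> \<le> K * sqrt g"
  shows "((\<lambda>g. x g / (g powr (1 / 2) * ln g)) \<longlongrightarrow> (1 - 1 / B) / (2 * pi * (ln B)\<^sup>2)) at_top"
proof -
  let ?d = "\<lambda>g. pi * x g / (sqrt g * ln g) - level_sum (depth g) / ln g"
  have d: "(?d \<longlongrightarrow> 0) at_top"
  proof (rule Lim_null_comparison)
    show "eventually (\<lambda>g. norm (?d g) \<le> K / ln g) at_top"
      using eventually_gt_at_top[of 1]
    proof eventually_elim
      case (elim g)
      have pos: "0 < sqrt g * ln g" using elim by simp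
      have "?d g = (pi * x g - sqrt g * level_sum (depth g)) / (sqrt g * ln g)" using elim by (simp add: field_simps)
      then have "norm (?d g) = \<bar>pi * x g - sqrt g * level_sum (depth g)\<bar> / (sqrt g * ln g)" using pos by (simp add: abs_divide)
      also have "\<dots> \<le> K * sqrt g / (sqrt g * ln g)" using x[of g] elim pos by (intro divide_right_mono) auto
      also have "\<dots> = K / ln g" using elim by simp
      finally show ?case .
    qed
    show "((\<lambda>g. K / ln g) \<longlongrightarrow> 0) at_top"
      by (intro tendsto_divide_0[OF tendsto_const] filterlim_at_top_imp_at_infinity ln_at_top)
  qed
  have "((\<lambda>g. (?d g + level_sum (depth g) / ln g) / pi) \<longlongrightarrow> (0 + (1 - 1 / B) / ln B * (1 / (2 * ln B))) / pi) at_top"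
    by (intro tendsto_divide tendsto_add d level_sum_asymp tendsto_const) simp
  also have "(0 + (1 - 1 / B) / ln B * (1 / (2 * ln B))) / pi = (1 - 1 / B) / (2 * pi * (ln B)\<^sup>2)"
    by (simp add: power2_eq_square mult_ac)
  finally show ?thesis
    by (rule tendsto_cong[THEN iffD1, rotated])
      (rule eventually_mono[OF eventually_gt_at_top[of 1]], simp add: powr_half_sqrt)
qed

end

text \<open>The error bound does not depend on the level and hence survives the limit; no
  interchange with the limit in \<open>g\<close> is involved.\<close>

lemma limit_count:
  assumes g: "1 \<le> g" and V: "\<And>t. t > 0 \<Longrightarrow> V t = - g * q t"
    and F: "at \<mu> within G \<noteq> bot" and ev: "eventually (\<lambda>\<mu>'. \<mu>' \<in> J0) (at \<mu> within G)"
    and lim: "((\<lambda>\<mu>'. real (count (depth g) g \<mu>')) \<longlongrightarrow> x) (at \<mu> within G)"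
  shows "Lim (at \<mu> within G) (interior_count b V) = ereal x"
    "\<bar>pi * x - sqrt g * level_sum (depth g)\<bar> \<le> Kcount * sqrt g"
proof -
  have g': "0 < g" "g * qbar (depth g) \<le> h0" using g depth[of g] by auto
  have "((\<lambda>\<mu>'. ereal (real (count (depth g) g \<mu>'))) \<longlongrightarrow> ereal x) (at \<mu> within G)" by (intro tendsto_ereal lim)
  then have "(interior_count b V \<longlongrightarrow> ereal x) (at \<mu> within G)"
    by (rule tendsto_cong[THEN iffD1, rotated]) (use ev interior_count_eq[OF _ g' V] in \<open>auto elim!: eventually_mono\<close>)
  then show "Lim (at \<mu> within G) (interior_count b V) = ereal x" by (rule tendsto_Lim[OF F])
  show "\<bar>pi * x - sqrt g * level_sum (depth g)\<bar> \<le> Kcount * sqrt g"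
  proof (rule tendsto_upperbound[OF _ _ F])
    show "((\<lambda>\<mu>'. \<bar>pi * real (count (depth g) g \<mu>') - sqrt g * level_sum (depth g)\<bar>) \<longlongrightarrow> \<bar>pi * x - sqrt g * level_sum (depth g)\<bar>) (at \<mu> within G)"
      by (intro tendsto_intros lim)
    show "eventually (\<lambda>\<mu>'. \<bar>pi * real (count (depth g) g \<mu>') - sqrt g * level_sum (depth g)\<bar> \<le> Kcount * sqrt g) (at \<mu> within G)"
      using ev by eventually_elim (rule count_estimate'[OF _ g])
  qed
qed

lemma count_bounds:
  assumes "\<mu> \<in> J0" "1 \<le> g"
  shows "real (count (depth g) g \<mu>) \<le> (sqrt g * level_sum (depth g) + Kcount * sqrt g) / pi"
  using count_estimate'[OF assms] by (simp add: field_simps abs_le_iff)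

text \<open>For fixed \<open>g\<close> the count is monotone in the level and bounded by the uniform
  estimate.\<close>

lemma count_left_limit:
  assumes g: "1 \<le> g" and p: "p < m" "{p..<m} \<subseteq> J0"
  shows "\<exists>x. ((\<lambda>\<mu>. real (count (depth g) g \<mu>)) \<longlongrightarrow> x) (at_left m)"
proof -
  have g': "0 < g" "g * qbar (depth g) \<le> h0" using g depth[of g] by auto
  have "((\<lambda>\<mu>. real (count (depth g) g \<mu>)) \<longlongrightarrow> Sup ((\<lambda>\<mu>. real (count (depth g) g \<mu>)) ` ({..<m} \<inter> {p..}))) (at m within ({..<m} \<inter> {p..}))"
  proof (rule Lim_left_bound)
    fix x y assume "x \<in> {p..}" "y \<in> {p..}" "y < m" "x \<le> y"
    then show "real (count (depth g) g x) \<le> real (count (depth g) g y)"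
      using p(2) by (intro of_nat_mono count_mono g') auto
  next
    fix y assume "y \<in> {p..}" "y < m"
    then show "real (count (depth g) g y) \<le> (sqrt g * level_sum (depth g) + Kcount * sqrt g) / pi"
      using p(2) by (intro count_bounds g) auto
  qed
  moreover have "at m within ({..<m} \<inter> {p..}) = at_left m"
    by (rule at_within_nhd[of _ "{p<..}"]) (use p in auto)
  ultimately show ?thesis by auto
qed

lemma count_right_limit:
  assumes g: "1 \<le> g" and p: "m < p" "{m<..p} \<subseteq> J0"
  shows "\<exists>x. ((\<lambda>\<mu>. real (count (depth g) g \<mu>)) \<longlongrightarrow> x) (at_right m)"
proof -
  have g': "0 < g" "g * qbar (depth g) \<le> h0" using g depth[of g] by auto
  have "((\<lambda>\<mu>. real (count (depth g) g \<mu>)) \<longlongrightarrow> Inf ((\<lambda>\<mu>. real (count (depth g) g \<mu>)) ` ({m<..} \<inter> {..p}))) (at m within ({m<..} \<inter> {..p}))"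
  proof (rule Lim_right_bound)
    fix x y assume "x \<in> {..p}" "y \<in> {..p}" "m < x" "x \<le> y"
    then show "real (count (depth g) g x) \<le> real (count (depth g) g y)"
      using p(2) by (intro of_nat_mono count_mono g') auto
  next
    fix y show "0 \<le> real (count (depth g) g y)" by simp
  qed
  moreover have "at m within ({m<..} \<inter> {..p}) = at_right m"
    by (rule at_within_nhd[of _ "{..<p}"]) (use p in auto)
  ultimately show ?thesis by auto
qed

end

section \<open>The gaps\<close>

lemma ereal_quotient_limit:
  assumes N: "\<And>g. g \<ge> 1 \<Longrightarrow> N g = ereal (x g)"
    and lim: "((\<lambda>g. x g / (g powr (1 / 2) * ln g)) \<longlongrightarrow> L) at_top"
  shows "((\<lambda>g::real. N g / ereal (g powr (1 / 2) * ln g)) \<longlongrightarrow> ereal L) at_top"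
proof (rule tendsto_cong[THEN iffD1, OF _ tendsto_ereal[OF lim]])
  show "eventually (\<lambda>g. ereal (x g / (g powr (1 / 2) * ln g)) = N g / ereal (g powr (1 / 2) * ln g)) at_top"
    by (rule eventually_mono[OF eventually_gt_at_top[of 1]]) (simp add: N)
qed

context window
begin

lemma interior_count_asymptotics:
  assumes qa: "((\<lambda>t. q t * B powr (2 * t)) \<longlongrightarrow> 1) at_top" and \<mu>: "\<mu> \<in> J0"
    and V: "\<And>g t. t > 0 \<Longrightarrow> V g t = - g * q t"
  shows "((\<lambda>g. interior_count b (V g) \<mu> / ereal (g powr (1 / 2) * ln g)) \<longlongrightarrow> ereal ((1 - 1 / B) / (2 * pi * (ln B)\<^sup>2))) at_top"
proof (rule ereal_quotient_limit[OF _ count_asymptotics[OF qa count_estimate'[OF \<mu>]]])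
  fix g :: real assume g: "1 \<le> g"
  show "interior_count b (V g) \<mu> = ereal (real (count (depth g) g \<mu>))"
    by (rule interior_count_eq[OF \<mu>]) (use g depth[of g] V in auto)
qed

lemma limit_count_asymptotics:
  assumes qa: "((\<lambda>t. q t * B powr (2 * t)) \<longlongrightarrow> 1) at_top"
    and V: "\<And>g t. t > 0 \<Longrightarrow> V g t = - g * q t"
    and F: "at \<mu> within G \<noteq> bot" and ev: "eventually (\<lambda>\<mu>'. \<mu>' \<in> J0) (at \<mu> within G)"
    and ex: "\<And>g. 1 \<le> g \<Longrightarrow> \<exists>x. ((\<lambda>\<mu>'. real (count (depth g) g \<mu>')) \<longlongrightarrow> x) (at \<mu> within G)"
  shows "((\<lambda>g. Lim (at \<mu> within G) (interior_count b (V g)) / ereal (g powr (1 / 2) * ln g)) \<longlongrightarrow> ereal ((1 - 1 / B) / (2 * pi * (ln B)\<^sup>2))) at_top"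
proof -
  obtain x where x: "\<And>g. 1 \<le> g \<Longrightarrow> ((\<lambda>\<mu>'. real (count (depth g) g \<mu>')) \<longlongrightarrow> x g) (at \<mu> within G)"
    using ex by metis
  show ?thesis
  proof (rule ereal_quotient_limit)
    fix g :: real assume g: "1 \<le> g"
    show "Lim (at \<mu> within G) (interior_count b (V g)) = ereal (x g)" by (rule limit_count(1)[OF g V F ev x[OF g]])
  next
    show "((\<lambda>g. x g / (g powr (1 / 2) * ln g)) \<longlongrightarrow> (1 - 1 / B) / (2 * pi * (ln B)\<^sup>2)) at_top"
    proof (rule count_asymptotics[OF qa])
      fix g :: real assume g: "1 \<le> g"
      show "\<bar>pi * x g - sqrt g * level_sum (depth g)\<bar> \<le> Kcount * sqrt g" by (rule limit_count(2)[OF g V F ev x[OF g]])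
    qed
  qed
qed

end

section \<open>The free solutions in closed form and the gap conditions\<close>

lemma cosq_sinq_eqI:
  assumes S: "\<And>x. (S has_real_derivative S' x) (at x)" and S': "\<And>x. (S' has_real_derivative - \<mu> * S x) (at x)"
    and 0: "S 0 = 0" "S' 0 = 1"
  shows "sinq \<mu> = S 1" "cosq \<mu> = S' 1"
proof -
  have "flow (\<lambda>_. \<mu>) (0, 1) 1 = (S 1, S' 1)"
  proof (rule flow_unique[of _ "\<lambda>x. (S x, S' x)"])
    show "ode_sol (\<lambda>_. \<mu>) (\<lambda>_. 0) (\<lambda>x. (S x, S' x))"
      unfolding ode_sol_def using S S' by (auto intro: DERIV_subset)
  qed (use 0 in auto)
  then show "sinq \<mu> = S 1" "cosq \<mu> = S' 1" using flow_const_aux[of 1 \<mu>] by (simp_all add: sinq_def cosq_def)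
qed

lemma cosq_sinq_pos:
  assumes "0 < \<mu>" shows "cosq \<mu> = cos (sqrt \<mu>)" "sinq \<mu> = sin (sqrt \<mu>) / sqrt \<mu>"
proof -
  define k where "k = sqrt \<mu>"
  have k: "k \<noteq> 0" "\<mu> = k * k" using assms by (auto simp: k_def)
  have 1: "((\<lambda>x. sin (k * x) / k) has_real_derivative cos (k * x)) (at x)" for x
    using k(1) by (auto intro!: derivative_eq_intros)
  have 2: "((\<lambda>x. cos (k * x)) has_real_derivative - \<mu> * (sin (k * x) / k)) (at x)" for x
    using k(1) by (auto intro!: derivative_eq_intros simp: k(2))
  show "cosq \<mu> = cos (sqrt \<mu>)" "sinq \<mu> = sin (sqrt \<mu>) / sqrt \<mu>"
    using cosq_sinq_eqI[OF 1 2] by (simp_all add: k_def)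
qed

lemma cosq_sinq_nonpos:
  assumes "\<mu> \<le> 0" shows "1 \<le> cosq \<mu>" "0 < sinq \<mu>"
proof -
  have "1 \<le> cosq \<mu> \<and> 0 < sinq \<mu>"
  proof (cases "\<mu> = 0")
    case True
    have 1: "((\<lambda>x. x) has_real_derivative 1) (at x)" for x :: real by simp
    have 2: "((\<lambda>x. 1) has_real_derivative - 0 * x) (at x)" for x :: real by simp
    from cosq_sinq_eqI[OF 1 2] True show ?thesis by simp
  next
    case False
    define k where "k = sqrt (- \<mu>)"
    have k: "\<mu> = - (k * k)" "0 < k" using assms False by (auto simp: k_def)
    have 1: "((\<lambda>x. sinh (k * x) / k) has_real_derivative cosh (k * x)) (at x)" for x
      using k(2) by (auto intro!: derivative_eq_intros)
    have 2: "((\<lambda>x. cosh (k * x)) has_real_derivative - \<mu> * (sinh (k * x) / k)) (at x)" for x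
      using k(2) by (auto intro!: derivative_eq_intros simp: k(1))
    from cosq_sinq_eqI[OF 1 2] k(2) show ?thesis by (simp add: cosh_real_ge_1)
  qed
  then show "1 \<le> cosq \<mu>" "0 < sinq \<mu>" by auto
qed

text \<open>\<open>1 / gap_R b\<close> equals \<open>2 sqrt b / (1 + b)\<close>, so
  \<open>gap_theta b\<close> is the angle at which the trace of the free transfer matrix takes its
  critical value.\<close>

lemma gap_theta:
  assumes b: "b \<ge> 2"
  shows "0 < gap_theta b" "gap_theta b < pi / 2" "(1 + real b) * cos (gap_theta b) = 2 * sqrt (real b)" "2 * sqrt (real b) < 1 + real b"
proof -
  have sb: "sqrt (real b) > 0" "sqrt (real b) * sqrt (real b) = real b" using b by auto
  have R: "1 / gap_R b = 2 * sqrt (real b) / (1 + real b)"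
    using b sb by (simp add: gap_R_def powr_half_sqrt powr_minus field_simps)
  have "sqrt (real b) > 1" using b by simp
  then have "0 < (sqrt (real b) - 1)\<^sup>2" by simp
  then show lt: "2 * sqrt (real b) < 1 + real b" using sb(2) by (simp add: power2_eq_square algebra_simps)
  have R01: "0 < 1 / gap_R b" "1 / gap_R b < 1" unfolding R using lt sb(1) b by (simp_all add: divide_less_eq)
  then have R1: "- 1 \<le> 1 / gap_R b" "1 / gap_R b \<le> 1" by linarith+
  have c: "cos (gap_theta b) = 1 / gap_R b" unfolding gap_theta_def by (rule cos_arccos[OF R1])
  then show "(1 + real b) * cos (gap_theta b) = 2 * sqrt (real b)" unfolding R by simp
  have "arccos 1 < gap_theta b" "gap_theta b < arccos 0" unfolding gap_theta_def
    by (rule arccos_less_arccos[OF R1(1) R01(2) order_refl], rule arccos_less_arccos[OF _ R01(1) R1(2)]) simp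
  then show "0 < gap_theta b" "gap_theta b < pi / 2" by simp_all
qed

lemma closure_gap:
  assumes b: "b \<ge> 2"
  shows "closure (gap b l) = (if l = 0 then {..(gap_theta b)\<^sup>2} else {(pi * real l - gap_theta b)\<^sup>2..(pi * real l + gap_theta b)\<^sup>2})"
proof (cases "l = 0")
  case False
  have "pi * 1 \<le> pi * real l" using False by (intro mult_left_mono) auto
  then have "gap_theta b < pi * real l" using gap_theta(1,2)[OF b] by linarith
  then have "(pi * real l - gap_theta b)\<^sup>2 < (pi * real l + gap_theta b)\<^sup>2"
    using gap_theta(1)[OF b] by (intro power_strict_mono) auto
  then show ?thesis using False by (simp add: gap_def closure_greaterThanLessThan)
qed (simp add: gap_def closure_lessThan)

text \<open>For positive levels, \<open>d = sqrt \<nu> - pi l\<close> turns the closed gap into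
  \<open>|d| <= gap_theta b\<close> and gives \<open>cosq \<nu> = (-1)^l cos d\<close>, whence the
  sign. As \<open>|d| < pi / 2\<close>, the sine vanishes only at the excluded level
  \<open>d = 0\<close>. Nonpositive levels occur for \<open>l = 0\<close> alone, and there
  \<open>cosq\<close> is at least 1.\<close>

lemma gap_closure_window:
  assumes b: "b \<ge> 2" and \<nu>: "\<nu> \<in> closure (gap b l)" "l \<ge> 1 \<Longrightarrow> \<nu> \<noteq> (pi * real l)\<^sup>2"
  shows "sinq \<nu> \<noteq> 0" "2 * sqrt (real b) \<le> (1 + real b) * ((-1) ^ l * cosq \<nu>)"
    "\<nu> \<in> gap b l \<Longrightarrow> 2 * sqrt (real b) < (1 + real b) * ((-1) ^ l * cosq \<nu>)"
proof -
  note th = gap_theta[OF b]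
  let ?\<theta> = "gap_theta b" and ?B = "real b"
  have pl: "?\<theta> < pi * real l" if "l \<noteq> 0"
  proof -
    have "pi * 1 \<le> pi * real l" using that by (intro mult_left_mono) auto
    then show ?thesis using th by linarith
  qed
  have "sinq \<nu> \<noteq> 0 \<and> 2 * sqrt ?B \<le> (1 + ?B) * ((-1) ^ l * cosq \<nu>) \<and> (\<nu> \<in> gap b l \<longrightarrow> 2 * sqrt ?B < (1 + ?B) * ((-1) ^ l * cosq \<nu>))"
  proof (cases "\<nu> \<le> 0")
    case True
    have "l = 0"
    proof (rule ccontr)
      assume "l \<noteq> 0"
      then have "0 < pi * real l - ?\<theta>" "(pi * real l - ?\<theta>)\<^sup>2 \<le> \<nu>" using pl \<nu>(1) by (auto simp: closure_gap[OF b])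
      then show False using True zero_less_power[of "pi * real l - ?\<theta>" 2] by linarith
    qed
    moreover have "(1 + ?B) * 1 \<le> (1 + ?B) * cosq \<nu>" using cosq_sinq_nonpos[OF True] by (intro mult_left_mono) auto
    then have "2 * sqrt ?B < (1 + ?B) * cosq \<nu>" using th(4) by (metis less_le_trans mult_1_right)
    ultimately show ?thesis using cosq_sinq_nonpos(2)[OF True] by simp
  next
    case False
    define d where "d = sqrt \<nu> - pi * real l"
    have x: "0 < sqrt \<nu>" "(sqrt \<nu>)\<^sup>2 = \<nu>" using False by auto
    have d: "\<bar>d\<bar> \<le> ?\<theta> \<and> (\<nu> \<in> gap b l \<longrightarrow> \<bar>d\<bar> < ?\<theta>)"
    proof (cases "l = 0")
      case True
      have "sqrt \<nu> \<le> ?\<theta>" using \<nu>(1) True th(1) by (intro real_le_lsqrt) (auto simp: closure_gap[OF b])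
      moreover have "sqrt \<nu> < ?\<theta>" if "\<nu> \<in> gap b l"
        using that True th(1) False by (intro real_less_lsqrt) (auto simp: gap_def)
      ultimately show ?thesis using True x by (simp add: d_def)
    next
      case l: False
      have c: "(pi * real l - ?\<theta>)\<^sup>2 \<le> \<nu>" "\<nu> \<le> (pi * real l + ?\<theta>)\<^sup>2" using \<nu>(1) l by (auto simp: closure_gap[OF b])
      have "pi * real l - ?\<theta> \<le> sqrt \<nu>" using c(1) by (rule real_le_rsqrt)
      moreover have "sqrt \<nu> \<le> pi * real l + ?\<theta>" using c(2) pl[OF l] th(1) by (intro real_le_lsqrt) auto
      moreover have "pi * real l - ?\<theta> < sqrt \<nu>" "sqrt \<nu> < pi * real l + ?\<theta>" if "\<nu> \<in> gap b l"
      proof -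
        have c: "(pi * real l - ?\<theta>)\<^sup>2 < \<nu>" "\<nu> < (pi * real l + ?\<theta>)\<^sup>2" using that l by (auto simp: gap_def)
        show "pi * real l - ?\<theta> < sqrt \<nu>" using c(1) by (rule real_less_rsqrt)
        show "sqrt \<nu> < pi * real l + ?\<theta>" using c(2) pl[OF l] th(1) False by (intro real_less_lsqrt) auto
      qed
      ultimately show ?thesis by (auto simp: d_def)
    qed
    have d0: "d \<noteq> 0"
    proof
      assume "d = 0"
      then have s: "sqrt \<nu> = pi * real l" by (simp add: d_def)
      then have "l \<ge> 1" using x(1) by (cases l) auto
      then show False using \<nu>(2) x(2) s by simp
    qed
    have "cos (d + pi * real l) = cos d * (-1) ^ l" "sin (d + pi * real l) = sin d * (-1) ^ l"
      by (simp_all add: cos_add sin_add cos_npi2 sin_npi2 del: cos_npi_int)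
    then have cs: "(-1) ^ l * cosq \<nu> = cos d" "sinq \<nu> = sin d * (-1) ^ l / sqrt \<nu>"
      using cosq_sinq_pos[of \<nu>] False by (simp_all add: d_def power_mult_distrib[symmetric] mult.assoc[symmetric])
    have "0 < sin \<bar>d\<bar>" using d0 d th(2) by (intro sin_gt_zero) auto
    then have "sin d \<noteq> 0" by (cases "0 \<le> d") auto
    then have "sinq \<nu> \<noteq> 0" using cs(2) x(1) by simp
    moreover have "cos ?\<theta> \<le> cos \<bar>d\<bar>" using d th by (intro cos_monotone_0_pi_le) auto
    then have "(1 + ?B) * cos ?\<theta> \<le> (1 + ?B) * cos d" by (intro mult_left_mono) auto
    moreover have "(1 + ?B) * cos ?\<theta> < (1 + ?B) * cos d" if "\<nu> \<in> gap b l"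
    proof -
      have "cos ?\<theta> < cos \<bar>d\<bar>" using that d th by (intro cos_monotone_0_pi) auto
      then show ?thesis by (intro mult_strict_left_mono) auto
    qed
    ultimately show ?thesis unfolding cs(1) th(3) by blast
  qed
  then show "sinq \<nu> \<noteq> 0" "2 * sqrt ?B \<le> (1 + ?B) * ((-1) ^ l * cosq \<nu>)"
    "\<nu> \<in> gap b l \<Longrightarrow> 2 * sqrt ?B < (1 + ?B) * ((-1) ^ l * cosq \<nu>)" by auto
qed

lemma gap_window:
  assumes r: "radial b q c C" and J: "compact J" "J \<subseteq> closure (gap b l)" "l \<ge> 1 \<Longrightarrow> (pi * real l)\<^sup>2 \<notin> J"
  shows "window b q c C J ((-1) ^ l)" "J \<inter> gap b l \<subseteq> window.J0 b J ((-1) ^ l)"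
proof -
  interpret radial b q c C by (rule r)
  have w: "sinq \<nu> \<noteq> 0" "2 * sqrt B \<le> (1 + B) * ((-1) ^ l * cosq \<nu>)"
    "\<nu> \<in> gap b l \<Longrightarrow> 2 * sqrt B < (1 + B) * ((-1) ^ l * cosq \<nu>)" if "\<nu> \<in> J" for \<nu>
    using gap_closure_window[OF b2 subsetD[OF J(2) that]] J(3) that by blast+
  have s: "(-1) ^ l = (1 :: real) \<or> (-1) ^ l = (-1 :: real)" by (simp add: minus_one_power_iff)
  show win: "window b q c C J ((-1) ^ l)"
    by (intro window.intro window_axioms.intro radial_axioms J(1) s w)
  interpret window b q c C J "(-1) ^ l" by (rule win)
  show "J \<inter> gap b l \<subseteq> J0" unfolding J0_def using w(3) by blast
qed

text \<open>The bound on the derivative makes \<open>q\<close> Lipschitz, so it has a limit at 0;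
  for negative arguments that limit is repeated. The two-sided bound passes to 0 by closure.\<close>

lemma radial_extension:
  fixes q :: "real \<Rightarrow> real"
  assumes b: "b \<ge> 2" and C: "c > 0" "C > 0" and q1: "q C1_differentiable_on {0<..}"
    and bd: "\<And>t. t > 0 \<Longrightarrow> c * real b powr (- 2 * t) \<le> q t \<and> q t \<le> C * real b powr (- 2 * t)"
    and db: "\<And>t. t > 0 \<Longrightarrow> \<bar>deriv q t\<bar> \<le> C * real b powr (- 2 * t)"
  shows "\<exists>h. radial b h c C \<and> (\<forall>t>0. h t = q t)"
proof -
  have qd: "(q has_real_derivative deriv q t) (at t)" if "t > 0" for t
    using q1 that unfolding C1_differentiable_on_def
    by (metis DERIV_imp_deriv greaterThan_iff has_real_derivative_iff_has_vector_derivative)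
  have "C-lipschitz_on {0<..} q"
  proof (rule lipschitz_onI)
    fix s t :: real assume st: "s \<in> {0<..}" "t \<in> {0<..}"
    have "norm (q s - q t) \<le> C * norm (s - t)"
    proof (rule field_differentiable_bound[of "{0<..}" q "deriv q"])
      show "(q has_real_derivative deriv q z) (at z within {0<..})" if "z \<in> {0<..}" for z
        using qd[of z] that by (auto intro: DERIV_subset)
      show "norm (deriv q z) \<le> C" if "z \<in> {0<..}" for z
      proof -
        have "real b powr (- 2 * z) \<le> real b powr 0" using b that by (intro powr_mono) auto
        then have "C * real b powr (- 2 * z) \<le> C * 1" using C b by (intro mult_left_mono) auto
        then show ?thesis using db[of z] that by simp
      qed
    qed (use st in auto)
    then show "dist (q s) (q t) \<le> C * dist s t" by (simp add: dist_real_def)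
  qed (use C in simp)
  then have uc: "uniformly_continuous_on {0<..} q" by (rule lipschitz_on_uniformly_continuous)
  obtain g where g: "uniformly_continuous_on (closure {0<..}) g" "\<And>x. x \<in> {0<..} \<Longrightarrow> q x = g x"
    using uniformly_continuous_on_extension_on_closure[OF uc] by metis
  have gc: "continuous_on {0..} g" using uniformly_continuous_imp_continuous[OF g(1)] by simp
  define h where "h t = g (max 0 t)" for t
  have hq: "h t = q t" if "t > 0" for t using g(2)[of t] that by (simp add: h_def)
  have hc: "continuous_on UNIV h"
    unfolding h_def by (rule continuous_on_compose2[OF gc]) (auto intro!: continuous_intros)
  have hd: "(h has_real_derivative deriv q t) (at t)" if "t > 0" for t
    by (rule has_field_derivative_transform_within_open[OF qd[OF that], of "{0<..}"]) (use that hq in auto)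
  have lo: "c * real b powr (- 2 * t) \<le> h t" and up: "h t \<le> C * real b powr (- 2 * t)" if t: "t \<ge> 0" for t
  proof -
    have "0 \<le> h t - c * real b powr (- 2 * t)"
      by (rule continuous_ge_on_closure[of "{0<..}" "\<lambda>t. h t - c * real b powr (- 2 * t)"])
        (use t b bd hq in \<open>auto intro!: continuous_intros continuous_on_subset[OF hc]\<close>)
    then show "c * real b powr (- 2 * t) \<le> h t" by simp
    have "h t - C * real b powr (- 2 * t) \<le> 0"
      by (rule continuous_le_on_closure[of "{0<..}" "\<lambda>t. h t - C * real b powr (- 2 * t)"])
        (use t b bd hq in \<open>auto intro!: continuous_intros continuous_on_subset[OF hc]\<close>)
    then show "h t \<le> C * real b powr (- 2 * t)" by simp
  qed
  have "radial b h c C"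
    by unfold_locales (use b C hc lo up hd DERIV_imp_deriv[OF hd] db in auto)
  then show ?thesis using hq by blast
qed

theorem theorem9p3:
  fixes b l :: nat and \<kappa> c C \<mu> :: real and q Q :: "real \<Rightarrow> real"
  assumes "b \<ge> 2"
    and "\<kappa> = ln (real b)"
    and "Q = (\<lambda>t. exp (- 2 * \<kappa> * t))"
    and "q C1_differentiable_on {0<..}"
    and "q \<sim>[at_top] Q"
    and "c > 0" and "C > 0"
    and "\<And>t. t > 0 \<Longrightarrow> c * Q t \<le> q t \<and> q t \<le> C * Q t"
    and "\<And>t. t > 0 \<Longrightarrow> \<bar>deriv q t\<bar> \<le> C * Q t"
    and "\<mu> \<in> closure (gap b l)"
    and "l \<ge> 1 \<Longrightarrow> \<mu> \<noteq> (pi * real l)\<^sup>2"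
  shows "((\<lambda>g. counting_function b l (\<lambda>t. - g * q t) \<mu> / ereal (g powr (1/2) * ln g))
           \<longlongrightarrow> ereal ((1 - 1 / real b) / (2 * pi * \<kappa>\<^sup>2))) at_top"
proof -
  let ?\<theta> = "gap_theta b" and ?G = "gap b l"
  note th = gap_theta[OF assms(1)]
  have Q: "Q t = real b powr (- 2 * t)" for t
    using assms(1) by (simp add: assms(2,3) powr_def mult_ac)
  obtain h where r: "radial b h c C" and h: "\<And>t. t > 0 \<Longrightarrow> h t = q t"
    using radial_extension[OF assms(1,6,7,4) assms(8,9)[unfolded Q]] by blast
  have V: "- g * q t = - g * h t" if "t > 0" for g t using h[OF that] by simp
  have "((\<lambda>t. q t / Q t) \<longlongrightarrow> 1) at_top"
    using asymp_equivD[OF assms(5)] by (simp add: assms(3))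
  then have qa: "((\<lambda>t. h t * real b powr (2 * t)) \<longlongrightarrow> 1) at_top"
    by (rule tendsto_cong[THEN iffD1, rotated])
      (rule eventually_mono[OF eventually_gt_at_top[of 0]], simp add: h Q powr_minus divide_inverse)
  show ?thesis
  proof (cases "\<mu> \<in> ?G")
    case True
    \<comment> \<open>Inside the gap no limit in the level is taken, so the window may consist of
      the single level \<mu>.\<close>
    have J: "compact {\<mu>}" "{\<mu>} \<subseteq> closure ?G" "l \<ge> 1 \<Longrightarrow> (pi * real l)\<^sup>2 \<notin> {\<mu>}" using assms(10,11) by auto
    interpret window b h c C "{\<mu>}" "(-1) ^ l" by (rule gap_window(1)[OF r J])
    have "\<mu> \<in> J0" using gap_window(2)[OF r J] True by auto
    from interior_count_asymptotics[OF qa this, of "\<lambda>g t. - g * q t", OF V] show ?thesis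
      using True by (simp add: counting_function_def assms(2))
  next
    case out: False
    have G: "(if l = 0 then \<mu> = ?\<theta>\<^sup>2 else \<mu> = (pi * real l - ?\<theta>)\<^sup>2 \<or> \<mu> = (pi * real l + ?\<theta>)\<^sup>2)"
      using out assms(10) unfolding closure_gap[OF assms(1)] by (auto simp: gap_def split: if_splits)
    have pl: "?\<theta> < pi * real l" if "l \<noteq> 0"
    proof -
      have "pi * 1 \<le> pi * real l" using that by (intro mult_left_mono) auto
      then show ?thesis using th by linarith
    qed
    have mid: "(pi * real l - ?\<theta>)\<^sup>2 < (pi * real l)\<^sup>2" "(pi * real l)\<^sup>2 < (pi * real l + ?\<theta>)\<^sup>2" if "l \<noteq> 0"
      using pl[OF that] th by (intro power_strict_mono; simp)+
    show ?thesis
    proof (cases "l \<noteq> 0 \<and> \<mu> = (pi * real l - ?\<theta>)\<^sup>2")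
      case True
      \<comment> \<open>The window reaches from the lower end of the gap halfway to the excluded
        level \<open>(pi l)^2\<close>.\<close>
      define p where "p = (\<mu> + (pi * real l)\<^sup>2) / 2"
      have p: "\<mu> < p" "p < (pi * real l)\<^sup>2" using mid True by (auto simp: p_def)
      have sub: "{\<mu><..p} \<subseteq> ?G" "{\<mu>..p} \<subseteq> closure ?G" using True p mid unfolding closure_gap[OF assms(1)] by (auto simp: gap_def)
      have J: "compact {\<mu>..p}" "{\<mu>..p} \<subseteq> closure ?G" "l \<ge> 1 \<Longrightarrow> (pi * real l)\<^sup>2 \<notin> {\<mu>..p}" using sub p by auto
      interpret window b h c C "{\<mu>..p}" "(-1) ^ l" by (rule gap_window(1)[OF r J])
      have J0: "{\<mu><..p} \<subseteq> J0" using gap_window(2)[OF r J] sub by auto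
      have at: "at \<mu> within ?G = at_right \<mu>"
        by (rule at_within_nhd[of _ "{..<p}"]) (use True p mid in \<open>auto simp: gap_def\<close>)
      have "eventually (\<lambda>\<mu>'. \<mu>' \<in> J0) (at_right \<mu>)"
        unfolding eventually_at_right[OF p(1)] using p J0 by (intro exI[of _ p]) auto
      from limit_count_asymptotics[OF qa, of "\<lambda>g t. - g * q t" \<mu> "{\<mu><..}", OF V _ this count_right_limit[OF _ p(1) J0]]
      show ?thesis using out by (simp add: counting_function_def assms(2) at)
    next
      case False
      \<comment> \<open>For \<open>l >= 1\<close> the window has to stay above
        \<open>(pi l)^2\<close>; for \<open>l = 0\<close> any start below the end of the gap serves,
        for instance 0.\<close>
      define p where "p = (if l = 0 then 0 else ((pi * real l)\<^sup>2 + \<mu>) / 2)"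
      have m: "\<mu> = (pi * real l + ?\<theta>)\<^sup>2" using False G by (auto split: if_splits)
      have p: "p < \<mu>" "l \<noteq> 0 \<Longrightarrow> (pi * real l)\<^sup>2 < p" using mid th m by (auto simp: p_def)
      have sub: "{p..<\<mu>} \<subseteq> ?G" "{p..\<mu>} \<subseteq> closure ?G" using m p mid unfolding closure_gap[OF assms(1)] by (auto simp: gap_def)
      have J: "compact {p..\<mu>}" "{p..\<mu>} \<subseteq> closure ?G" "l \<ge> 1 \<Longrightarrow> (pi * real l)\<^sup>2 \<notin> {p..\<mu>}" using sub p by auto
      interpret window b h c C "{p..\<mu>}" "(-1) ^ l" by (rule gap_window(1)[OF r J])
      have J0: "{p..<\<mu>} \<subseteq> J0" using gap_window(2)[OF r J] sub by auto
      have at: "at \<mu> within ?G = at_left \<mu>"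
        by (rule at_within_nhd[of _ "{p<..}"]) (use m p mid in \<open>auto simp: gap_def\<close>)
      have "eventually (\<lambda>\<mu>'. \<mu>' \<in> J0) (at_left \<mu>)"
        unfolding eventually_at_left[OF p(1)] using p J0 by (intro exI[of _ p]) auto
      from limit_count_asymptotics[OF qa, of "\<lambda>g t. - g * q t" \<mu> "{..<\<mu>}", OF V _ this count_left_limit[OF _ p(1) J0]]
      show ?thesis using out by (simp add: counting_function_def assms(2) at)
    qed
  qed
qed

end
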